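(* Assume A1)–A5). Let each agent apply $$\hat u_i(t)=-(R+D^TP_iD)^{-1}\big[(B^TP_i+D^TP_iC)\hat x_i(t)+B^Ts_i(t)\big],\quad t\ge0,\ i=1,\dots,N,$$ and let $\hat x_i$ be the resulting closed-loop state. Then for any $N$, $$\max_{1\le i\le N}\mathbb{E}\int_0^\infty e^{-\rho t}\big(\|\hat x_i(t)\|^2+\|\hat u_i(t)\|^2\big)dt<\infty.$$
   Context: Model. For $i=1,\dots,N$, $dx_i(t)=[A(\theta_i)x_i(t)+Bu_i(t)]dt+[Cx_i(t)+Du_i(t)]dW_i(t)$ with $x_i\in\mathbb{R}^n$, $u_i\in\mathbb{R}^r$, $W_1,\dots,W_N$ mutually independent one-dimensional standard Brownian motions adapted to a filtration $\{\mathcal{F}_t\}$, deterministic matrices $A(\cdot),B,C,D$, and parameters $\theta_i\in\Theta$. Write $A_i=A(\theta_i)$, $A_\theta=A(\theta)$. The closed-loop state $\hat x_i$ starts from $\hat x_i(0)=x_i(0)$. The cost weights are symmetric matrices $Q,R$ and the discount is $\rho\ge0$. $C_{\rho/2}([0,\infty),\mathbb{R}^n)$: continuous $f$ with $\int_0^\infty e^{-\rho t}\|f(t)\|^2dt<\infty$. $F_N(\theta)=\frac1N\sum_{i=1}^N I_{[\theta_i\le\theta]}$ is the empirical distribution function of $\theta_1,\dots,\theta_N$. Assumptions. A1) $x_i(0)$, $i=1,\dots,N$, are mutually independent, $\mathbb{E}x_i(0)\equiv\bar x_0$, and $\max_{1\le i\le N}\mathbb{E}\|x_i(0)\|^2<c_0$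 for a constant $c_0$ independent of $N$; $\{x_i(0)\}$ and $\{W_i\}$ are independent. A2) $\Theta\subset\mathbb{R}^d$ is compact, $A(\theta)$ is continuous on $\Theta$, and $F_N$ converges weakly to a distribution function $F$: $\lim_{N\to\infty}\int_\Theta\psi\,dF_N=\int_\Theta\psi\,dF$ for every bounded continuous $\psi$ on $\Theta$. A3) For each $i$ the system is $\rho$-stabilizable: there is $K_i$ such that for every initial state the solution of $dx_i=(A_i+BK_i)x_idt+(C+DK_i)x_idW_i$ satisfies $\mathbb{E}\int_0^\infty e^{-\rho t}\|x_i\|^2dt<\infty$. A4) $R>0$, $Q\ge0$, and for each $i$, $[A_i-\frac\rho2I,C,\sqrt Q]$ is exactly detectable: for $dz_i=(A_i-\frac\rho2I)z_idt+Cz_idW_i$, $y_i=\sqrt Qz_i$, if $y_i(t)=0$ a.s. for $t\in[0,T]$ for all $T>0$, then $\lim_{t\to\infty}\mathbb{E}\|z_i(t)\|^2=0$. A5) There exists a solution $\bar x\in C_{\rho/2}([0,\infty),\mathbb{R}^n)$ to the consistency equations $$\rho s_\theta=\tfrac{ds_\theta}{dt}+\bar A_\theta^Ts_\theta-Q\bar x,\quad \tfrac{d\bar x_\theta}{dt}=\bar A_\theta\bar x_\theta-B(R+D^TP_\theta D)^{-1}B^Ts_\theta,\quad \bar x(t)=\int_\Theta\bar x_\theta(t)dF(\theta),$$ with $\bar x_\theta(0)=\bar x_0$ and $s_\theta(0)$ determined by $s_\theta\in C_{\rho/2}([0,\infty),\mathbb{R}^n)$. Here $P_\theta$ is the positive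 semidefinite solution of $\rho P_\theta=A_\theta^TP_\theta+P_\theta A_\theta+C^TP_\theta C+Q-(B^TP_\theta+D^TP_\theta C)^T(R+D^TP_\theta D)^{-1}(B^TP_\theta+D^TP_\theta C)$, $\bar A_\theta=A_\theta-B(R+D^TP_\theta D)^{-1}(B^TP_\theta+D^TP_\theta C)$, and $P_i=P_{\theta_i}$, $s_i=s_{\theta_i}$. *)

theory Defs
  imports "HOL-Probability.Probability"
begin

section \<open>Matrices and the Riccati equation\<close>

definition pos_semidef :: "real^'n^'n \<Rightarrow> bool" where
  "pos_semidef S \<longleftrightarrow> transpose S = S \<and> (\<forall>v. 0 \<le> v \<bullet> (S *v v))"

definition pos_def :: "real^'n^'n \<Rightarrow> bool" where
  "pos_def S \<longleftrightarrow> transpose S = S \<and> (\<forall>v. v \<noteq> 0 \<longrightarrow> 0 < v \<bullet> (S *v v))"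

text \<open>The unique positive semidefinite square root of a positive semidefinite matrix.\<close>

definition matrix_sqrt :: "real^'n^'n \<Rightarrow> real^'n^'n" where
  "matrix_sqrt S = (THE T. pos_semidef T \<and> T ** T = S)"

text \<open>In terms of a candidate \<open>P\<close> for the Riccati solution: \<open>R + D\<^sup>T P D\<close> and
  \<open>B\<^sup>T P + D\<^sup>T P C\<close>.\<close>

definition ctrl_weight :: "real^'r^'r \<Rightarrow> real^'r^'n \<Rightarrow> real^'n^'n \<Rightarrow> real^'r^'r" where
  "ctrl_weight R D P = R + transpose D ** P ** D"

definition cross_term :: "real^'r^'n \<Rightarrow> real^'n^'n \<Rightarrow> real^'r^'n \<Rightarrow> real^'n^'n \<Rightarrow> real^'n^'r" where
  "cross_term B C D P = transpose B ** P + transpose D ** P ** C"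

definition riccati_solution ::
  "real \<Rightarrow> real^'n^'n \<Rightarrow> real^'r^'n \<Rightarrow> real^'n^'n \<Rightarrow> real^'r^'n \<Rightarrow> real^'n^'n \<Rightarrow> real^'r^'r
    \<Rightarrow> real^'n^'n \<Rightarrow> bool" where
  "riccati_solution \<rho> A B C D Q R P \<longleftrightarrow>
     \<rho> *\<^sub>R P = transpose A ** P + P ** A + transpose C ** P ** C + Q
       - transpose (cross_term B C D P) ** matrix_inv (ctrl_weight R D P) ** cross_term B C D P"

definition closed_loop_drift ::
  "real^'n^'n \<Rightarrow> real^'r^'n \<Rightarrow> real^'n^'n \<Rightarrow> real^'r^'n \<Rightarrow> real^'r^'r \<Rightarrow> real^'n^'n \<Rightarrow> real^'n^'n" where
  "closed_loop_drift A B C D R P =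
     A - B ** matrix_inv (ctrl_weight R D P) ** cross_term B C D P"


section \<open>Brownian motion and Ito integrals\<close>

text \<open>Processes are indexed by real time, and only times \<open>t \<ge> 0\<close> matter. The members of a
  filtration are measures because this is how the library represents sigma-algebras; their
  measure values are irrelevant. Neither \<open>M\<close> nor the filtration is assumed to be complete.\<close>

definition stoch_basis :: "'a measure \<Rightarrow> (real \<Rightarrow> 'a measure) \<Rightarrow> bool" where
  "stoch_basis M F \<longleftrightarrow>
     prob_space M \<and> filtration (space M) F \<and> (\<forall>t. subalgebra M (F t))"

text \<open>Standard one-dimensional Brownian motion relative to the filtration \<open>F\<close>: it is adapted and its
  increments after time \<open>s\<close> are independent of \<open>F s\<close>.\<close>

definition brownian_motion ::
  "'a measure \<Rightarrow> (real \<Rightarrow> 'a measure) \<Rightarrow> (real \<Rightarrow> 'a \<Rightarrow> real) \<Rightarrow> bool" where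
  "brownian_motion M F W \<longleftrightarrow>
     (\<forall>t\<ge>0. W t \<in> borel_measurable (F t)) \<and>
     (AE \<omega> in M. W 0 \<omega> = 0) \<and>
     (AE \<omega> in M. continuous_on {0..} (\<lambda>t. W t \<omega>)) \<and>
     (\<forall>s t. 0 \<le> s \<and> s < t \<longrightarrow>
        distributed M lborel (\<lambda>\<omega>. W t \<omega> - W s \<omega>) (normal_density 0 (sqrt (t - s))) \<and>
        prob_space.indep_set M (sets (F s))
          (sets (vimage_algebra (space M) (\<lambda>\<omega>. W t \<omega> - W s \<omega>) borel)))"

definition progressive ::
  "(real \<Rightarrow> 'a measure) \<Rightarrow> (real \<Rightarrow> 'a \<Rightarrow> 'b::euclidean_space) \<Rightarrow> bool" where
  "progressive F X \<longleftrightarrow>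
     (\<forall>t\<ge>0. case_prod X \<in> borel_measurable (restrict_space borel {0..t} \<Otimes>\<^sub>M F t))"

text \<open>An elementary process on \<open>{0..t}\<close> is given by a partition \<open>\<tau> 0 \<le> \<dots> \<le> \<tau> k\<close> and bounded
  coefficients \<open>\<xi> j\<close> known at time \<open>\<tau> j\<close>.\<close>

definition elementary_data ::
  "'a measure \<Rightarrow> (real \<Rightarrow> 'a measure) \<Rightarrow> real \<Rightarrow> nat \<Rightarrow> (nat \<Rightarrow> real)
    \<Rightarrow> (nat \<Rightarrow> 'a \<Rightarrow> 'b::euclidean_space) \<Rightarrow> bool" where
  "elementary_data M F t k \<tau> \<xi> \<longleftrightarrow>
     \<tau> 0 = 0 \<and> \<tau> k = t \<and>
     (\<forall>j<k. \<tau> j \<le> \<tau> (Suc j) \<and> \<xi> j \<in> borel_measurable (F (\<tau> j)) \<and> bounded (\<xi> j ` space M))"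

definition elementary_process ::
  "nat \<Rightarrow> (nat \<Rightarrow> real) \<Rightarrow> (nat \<Rightarrow> 'a \<Rightarrow> 'b::euclidean_space) \<Rightarrow> real \<Rightarrow> 'a \<Rightarrow> 'b" where
  "elementary_process k \<tau> \<xi> s \<omega> = (\<Sum>j<k. indicator {\<tau> j<..\<tau> (Suc j)} s *\<^sub>R \<xi> j \<omega>)"

definition elementary_integral ::
  "(real \<Rightarrow> 'a \<Rightarrow> real) \<Rightarrow> nat \<Rightarrow> (nat \<Rightarrow> real) \<Rightarrow> (nat \<Rightarrow> 'a \<Rightarrow> 'b::euclidean_space) \<Rightarrow> 'a \<Rightarrow> 'b" where
  "elementary_integral W k \<tau> \<xi> \<omega> = (\<Sum>j<k. (W (\<tau> (Suc j)) \<omega> - W (\<tau> j) \<omega>) *\<^sub>R \<xi> j \<omega>)"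

text \<open>\<open>has_ito_integral M F W H t I\<close> says that \<open>I\<close> is (a version of) the Ito integral of \<open>H\<close> over
  \<open>{0..t}\<close>, in the general sense for progressive integrands with almost surely square integrable
  paths: some elementary processes tend to \<open>H\<close> in \<open>L\<^sup>2(0,t)\<close> in probability and their integrals tend
  to \<open>I\<close> in probability. No moment of \<open>H\<close> is assumed to be finite. All events below are measurable.\<close>

definition has_ito_integral ::
  "'a measure \<Rightarrow> (real \<Rightarrow> 'a measure) \<Rightarrow> (real \<Rightarrow> 'a \<Rightarrow> real)
    \<Rightarrow> (real \<Rightarrow> 'a \<Rightarrow> 'b::euclidean_space) \<Rightarrow> real \<Rightarrow> ('a \<Rightarrow> 'b) \<Rightarrow> bool" where
  "has_ito_integral M F W H t I \<longleftrightarrow>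
     progressive F H \<and> I \<in> borel_measurable M \<and>
     (\<exists>k \<tau> \<xi>.
        (\<forall>m::nat. elementary_data M F t (k m) (\<tau> m) (\<xi> m)) \<and>
        (\<forall>\<epsilon>>0. (\<lambda>m. measure M {\<omega> \<in> space M. ennreal \<epsilon> <
            (\<integral>\<^sup>+ s\<in>{0..t}. ennreal ((norm (elementary_process (k m) (\<tau> m) (\<xi> m) s \<omega> - H s \<omega>))\<^sup>2) \<partial>lborel)})
          \<longlonglongrightarrow> 0) \<and>
        (\<forall>\<epsilon>>0. (\<lambda>m. measure M {\<omega> \<in> space M.
            \<epsilon> < norm (elementary_integral W (k m) (\<tau> m) (\<xi> m) \<omega> - I \<omega>)})
          \<longlonglongrightarrow> 0))"

text \<open>\<open>X\<close> is a continuous process with \<open>dX = b dt + H dW\<close> on \<open>{0..}\<close>.\<close>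

definition has_ito_differential ::
  "'a measure \<Rightarrow> (real \<Rightarrow> 'a measure) \<Rightarrow> (real \<Rightarrow> 'a \<Rightarrow> real) \<Rightarrow> (real \<Rightarrow> 'a \<Rightarrow> 'b::euclidean_space)
    \<Rightarrow> (real \<Rightarrow> 'a \<Rightarrow> 'b) \<Rightarrow> (real \<Rightarrow> 'a \<Rightarrow> 'b) \<Rightarrow> bool" where
  "has_ito_differential M F W X b H \<longleftrightarrow>
     progressive F X \<and>
     (AE \<omega> in M. continuous_on {0..} (\<lambda>t. X t \<omega>)) \<and>
     (\<forall>t\<ge>0. \<exists>I. has_ito_integral M F W H t I \<and>
        (AE \<omega> in M. set_integrable lborel {0..t} (\<lambda>s. b s \<omega>) \<and>
           X t \<omega> = X 0 \<omega> + (LINT s:{0..t}|lborel. b s \<omega>) + I \<omega>))"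

definition linear_sde_solution ::
  "'a measure \<Rightarrow> (real \<Rightarrow> 'a measure) \<Rightarrow> (real \<Rightarrow> 'a \<Rightarrow> real) \<Rightarrow> real^'n^'n \<Rightarrow> real^'n^'n
    \<Rightarrow> (real \<Rightarrow> 'a \<Rightarrow> real^'n) \<Rightarrow> bool" where
  "linear_sde_solution M F W A C x \<longleftrightarrow>
     has_ito_differential M F W x (\<lambda>t \<omega>. A *v x t \<omega>) (\<lambda>t \<omega>. C *v x t \<omega>)"

definition controlled_sde_solution ::
  "'a measure \<Rightarrow> (real \<Rightarrow> 'a measure) \<Rightarrow> (real \<Rightarrow> 'a \<Rightarrow> real)
    \<Rightarrow> real^'n^'n \<Rightarrow> real^'r^'n \<Rightarrow> real^'n^'n \<Rightarrow> real^'r^'n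
    \<Rightarrow> (real \<Rightarrow> 'a \<Rightarrow> real^'n) \<Rightarrow> (real \<Rightarrow> 'a \<Rightarrow> real^'r) \<Rightarrow> bool" where
  "controlled_sde_solution M F W A B C D x u \<longleftrightarrow>
     has_ito_differential M F W x
       (\<lambda>t \<omega>. A *v x t \<omega> + B *v u t \<omega>) (\<lambda>t \<omega>. C *v x t \<omega> + D *v u t \<omega>)"


section \<open>Stabilizability and detectability\<close>

text \<open>The expectation of the integral of \<open>exp (- \<rho> t) * g t\<close> over \<open>{0..}\<close>, for nonnegative \<open>g\<close>; its
  value may be \<open>\<infinity>\<close>.\<close>

definition discounted_cost :: "'a measure \<Rightarrow> real \<Rightarrow> (real \<Rightarrow> 'a \<Rightarrow> real) \<Rightarrow> ennreal" where
  "discounted_cost M \<rho> g =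
     (\<integral>\<^sup>+ \<omega>. (\<integral>\<^sup>+ t\<in>{0..}. ennreal (exp (- \<rho> * t) * g t \<omega>) \<partial>lborel) \<partial>M)"

definition rho_stabilizable ::
  "'a measure \<Rightarrow> (real \<Rightarrow> 'a measure) \<Rightarrow> (real \<Rightarrow> 'a \<Rightarrow> real) \<Rightarrow> real
    \<Rightarrow> real^'n^'n \<Rightarrow> real^'r^'n \<Rightarrow> real^'n^'n \<Rightarrow> real^'r^'n \<Rightarrow> bool" where
  "rho_stabilizable M F W \<rho> A B C D \<longleftrightarrow>
     (\<exists>K :: real^'n^'r. \<forall>\<xi> x.
        linear_sde_solution M F W (A + B ** K) (C + D ** K) x \<and> (AE \<omega> in M. x 0 \<omega> = \<xi>) \<longrightarrow>
        discounted_cost M \<rho> (\<lambda>t \<omega>. (norm (x t \<omega>))\<^sup>2) < \<infinity>)"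

text \<open>Exact detectability of \<open>dz = A z dt + C z dW\<close>, \<open>y = H z\<close>, with deterministic initial states.\<close>

definition exactly_detectable ::
  "'a measure \<Rightarrow> (real \<Rightarrow> 'a measure) \<Rightarrow> (real \<Rightarrow> 'a \<Rightarrow> real)
    \<Rightarrow> real^'n^'n \<Rightarrow> real^'n^'n \<Rightarrow> real^'n^'m \<Rightarrow> bool" where
  "exactly_detectable M F W A C H \<longleftrightarrow>
     (\<forall>\<zeta> z. linear_sde_solution M F W A C z \<and> (AE \<omega> in M. z 0 \<omega> = \<zeta>) \<and>
        (\<forall>T>0. \<forall>t\<in>{0..T}. AE \<omega> in M. H *v z t \<omega> = 0) \<longrightarrow>
        ((\<lambda>t. \<integral>\<^sup>+ \<omega>. ennreal ((norm (z t \<omega>))\<^sup>2) \<partial>M) \<longlongrightarrow> 0) at_top)"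


section \<open>Distribution functions\<close>

text \<open>The order on \<open>real^'d\<close> is componentwise, so \<open>{..x}\<close> is the lower orthant with corner \<open>x\<close>.\<close>

definition has_df :: "(real^'d) measure \<Rightarrow> (real^'d \<Rightarrow> real) \<Rightarrow> bool" where
  "has_df \<mu> G \<longleftrightarrow> prob_space \<mu> \<and> sets \<mu> = sets borel \<and> (\<forall>x. measure \<mu> {..x} = G x)"

definition distribution_function :: "(real^'d \<Rightarrow> real) \<Rightarrow> bool" where
  "distribution_function G \<longleftrightarrow> (\<exists>\<mu>. has_df \<mu> G)"

text \<open>The Lebesgue-Stieltjes measure \<open>dG\<close>; it is unique because the lower orthants form an
  intersection-stable generator of the Borel sets.\<close>

definition df_measure :: "(real^'d \<Rightarrow> real) \<Rightarrow> (real^'d) measure" where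
  "df_measure G = (THE \<mu>. has_df \<mu> G)"

definition empirical_df :: "(nat \<Rightarrow> real^'d) \<Rightarrow> nat \<Rightarrow> real^'d \<Rightarrow> real" where
  "empirical_df \<theta> N x = (\<Sum>i=1..N. indicator {..x} (\<theta> i)) / real N"


section \<open>Consistency equations\<close>

text \<open>The space \<open>C\<^sub>\<rho>\<^sub>/\<^sub>2([0,\<infinity>), \<real>\<^sup>n)\<close>.\<close>

definition C_half_rho :: "real \<Rightarrow> (real \<Rightarrow> real^'n) set" where
  "C_half_rho \<rho> = {f. continuous_on {0..} f \<and>
     (\<integral>\<^sup>+ t\<in>{0..}. ennreal (exp (- \<rho> * t) * (norm (f t))\<^sup>2) \<partial>lborel) < \<infinity>}"

text \<open>No value of \<open>s \<theta> 0\<close> is prescribed: it is pinned down by \<open>s \<theta> \<in> C_half_rho \<rho>\<close>. Integrability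
  of \<open>\<theta> \<mapsto> x\<^sub>\<theta>(t)\<close> is explicit because the integral of a non-integrable function
  is \<open>0\<close> in the library.\<close>

definition consistency_solution ::
  "(real^'d) set \<Rightarrow> (real^'d \<Rightarrow> real) \<Rightarrow> real
    \<Rightarrow> (real^'d \<Rightarrow> real^'n^'n) \<Rightarrow> real^'r^'n \<Rightarrow> real^'n^'n \<Rightarrow> real^'r^'n \<Rightarrow> real^'n^'n \<Rightarrow> real^'r^'r
    \<Rightarrow> (real^'d \<Rightarrow> real^'n^'n) \<Rightarrow> real^'n
    \<Rightarrow> (real \<Rightarrow> real^'n) \<Rightarrow> (real^'d \<Rightarrow> real \<Rightarrow> real^'n) \<Rightarrow> (real^'d \<Rightarrow> real \<Rightarrow> real^'n) \<Rightarrow> bool" where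
  "consistency_solution \<Theta> F \<rho> A B C D Q R P x\<^sub>0 xbar x s \<longleftrightarrow>
     xbar \<in> C_half_rho \<rho> \<and>
     (\<forall>\<theta>\<in>\<Theta>.
        s \<theta> \<in> C_half_rho \<rho> \<and>
        x \<theta> 0 = x\<^sub>0 \<and>
        (\<forall>t\<ge>0.
           (\<exists>s'. (s \<theta> has_vector_derivative s') (at t within {0..}) \<and>
              \<rho> *\<^sub>R s \<theta> t
                = s' + transpose (closed_loop_drift (A \<theta>) B C D R (P \<theta>)) *v s \<theta> t - Q *v xbar t) \<and>
           (x \<theta> has_vector_derivative
              closed_loop_drift (A \<theta>) B C D R (P \<theta>) *v x \<theta> t
              - (B ** matrix_inv (ctrl_weight R D (P \<theta>)) ** transpose B) *v s \<theta> t)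
             (at t within {0..}))) \<and>
     (\<forall>t\<ge>0. set_integrable (df_measure F) \<Theta> (\<lambda>\<theta>. x \<theta> t) \<and>
        xbar t = (LINT \<theta>:\<Theta>|df_measure F. x \<theta> t))"

end

theory Submission
  imports Defs
begin

text \<open>Fix an agent, let \<open>P\<close> be its Riccati solution, \<open>K\<close> its feedback gain, \<open>G = A - \<rho>/2 + B K\<close> and
  \<open>H = C + D K\<close>. By duality in the cone of positive semidefinite matrices, either some
  \<open>S \<ge> 0\<close> satisfies \<open>G\<^sup>T S + S G + H\<^sup>T S H \<le> -I\<close>, or the adjoint operator has an
  eigenvector: \<open>G X + X G\<^sup>T + H X H\<^sup>T = a X\<close> with \<open>a \<ge> 0\<close> and \<open>0 \<noteq> X \<ge> 0\<close>.

  In the first case \<open>E (x \<bullet> S x)\<close> is a discounted Lyapunov function for the closed loop, which is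
  driven by the square integrable offset \<open>s\<close>; this bounds the cost. Ito's formula is avoided:
  the second moments of an Ito process are computed by approximating the stochastic integral.

  In the second case pairing with the Riccati equation gives \<open>Q X = 0\<close> and \<open>K X = 0\<close>, so \<open>X\<close> is also
  an eigenvector for the uncontrolled pair \<open>(A - \<rho>/2, C)\<close>. The uncontrolled equation is solved
  by an Euler scheme; solutions started from the columns of \<open>\<surd>X\<close> have zero output, yet the sum of
  their covariances dominates \<open>X\<close> at all times, which contradicts exact detectability.\<close>

section \<open>Symmetric matrices and square roots\<close>

text \<open>The matrix \<open>P\<close> is only positive semidefinite, so its own Lyapunov identity
  controls \<open>Q\<close> and \<open>K\<close> but not the state; hence a new \<open>S\<close> is
  sought, and its absence is turned into a mode that has to be excluded. Exact detectability speaks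
  about solutions for the given \<open>M\<close>, filtration and Brownian motion, so the
  contradiction needs genuine solutions there. They are defined as limits path by path, without
  modification on null sets, because the filtration is not completed. The other obstacle is that Ito
  integrals are given only through convergence in probability, and the closed-loop state has no
  finite second moment a priori after time 0. The estimates therefore start from the path energy
  truncated at a level \<open>n\<close>, for which the isometry survives as an inequality;
  \<open>n\<close> is removed by a Gronwall bound that does not depend on it. In place of Ito's
  formula for a squared norm, the stochastic integral is frozen at its terminal value, which leaves
  an ordinary chain rule in time; the error so made is orthogonal to the past. Only an upper bound
  results, and the Lyapunov argument needs no more.\<close>

lemma sym_inner:
  fixes S :: "real^'n^'n"
  assumes "transpose S = S"
  shows "(S *v u) \<bullet> v = u \<bullet> (S *v v)"
  by (metis assms dot_lmul_matrix matrix_transpose_mul transpose_matrix_vector vector_transpose_matrix)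

lemma symI_inner:
  fixes S :: "real^'n^'n"
  assumes "\<And>u v. (S *v u) \<bullet> v = u \<bullet> (S *v v)"
  shows "transpose S = S"
proof -
  have "transpose S *v v = S *v v" for v
  proof (rule vector_eq_ldot[THEN iffD1], intro allI)
    fix u
    show "u \<bullet> (transpose S *v v) = u \<bullet> (S *v v)"
      by (metis assms dot_lmul_matrix vector_transpose_matrix transpose_transpose transpose_matrix_vector)
  qed
  thus ?thesis by (simp add: matrix_eq)
qed

lemma transpose_inner:
  fixes S :: "real^'n^'m"
  shows "(S *v u) \<bullet> v = u \<bullet> (transpose S *v v)"
  by (metis dot_lmul_matrix inner_commute vector_transpose_matrix transpose_transpose)

text \<open>A maximiser of the quadratic form on the unit sphere of an invariant subspace is an
  eigenvector.\<close>

lemma symmetric_eigenvector_in_subspace: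
  fixes S :: "real^'n^'n"
  assumes sym: "transpose S = S" and V: "subspace V" and inv: "\<And>v. v \<in> V \<Longrightarrow> S *v v \<in> V"
    and ne: "V \<noteq> {0}"
  obtains v l where "v \<in> V" "norm v = 1" "S *v v = l *\<^sub>R v"
    "\<And>w'. w' \<in> V \<Longrightarrow> w' \<bullet> (S *v w') \<le> l * (norm w')\<^sup>2"
proof -
  let ?K = "V \<inter> sphere 0 1"
  obtain v0 where v0: "v0 \<in> V" "v0 \<noteq> 0" using ne V subspace_0 by blast
  have "v0 /\<^sub>R norm v0 \<in> ?K" using v0 V by (simp add: subspace_scale)
  hence K: "?K \<noteq> {}" by blast
  have cK: "compact ?K" using closed_subspace[OF V] by (metis compact_Int_closed compact_sphere inf_commute)
  have "continuous_on ?K (\<lambda>v. v \<bullet> (S *v v))"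
    by (intro continuous_intros matrix_vector_mult_linear_continuous_on)
  from continuous_attains_sup[OF cK K this] obtain v where
    v: "v \<in> ?K" and max: "\<And>w'. w' \<in> ?K \<Longrightarrow> w' \<bullet> (S *v w') \<le> v \<bullet> (S *v v)" by blast
  define l where "l = v \<bullet> (S *v v)"
  have nv: "norm v = 1" and vV: "v \<in> V" using v by auto
  have le: "w' \<bullet> (S *v w') \<le> l * (norm w')\<^sup>2" if "w' \<in> V" for w'
  proof (cases "w' = 0")
    case False
    have "w' /\<^sub>R norm w' \<in> ?K" using that False V by (simp add: subspace_scale)
    from max[OF this] have "(w' \<bullet> (S *v w')) / (norm w')\<^sup>2 \<le> l"
      by (simp add: l_def matrix_vector_mult_scaleR power2_eq_square divide_inverse mult_ac)
    thus ?thesis using False by (simp add: divide_le_eq)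
  qed simp
  define r where "r = S *v v - l *\<^sub>R v"
  have rV: "r \<in> V" unfolding r_def using V vV inv by (simp add: subspace_diff subspace_scale)
  have vr: "v \<bullet> r = 0" using nv by (simp add: r_def l_def inner_diff_right norm_eq_1)
  have Svr: "r \<bullet> (S *v v) = (norm r)\<^sup>2"
  proof -
    have "r \<bullet> (S *v v) = r \<bullet> (r + l *\<^sub>R v)" by (simp add: r_def)
    thus ?thesis using vr by (simp add: inner_add_right power2_norm_eq_inner inner_commute)
  qed
  have "r = 0"
  proof (rule ccontr)
    assume "r \<noteq> 0"
    \<comment> \<open>\<open>c\<close> dominates the second-order coefficient
      \<open>l * (norm r)\<^sup>2 - r \<bullet> (S *v r)\<close>, and its last summand keeps it
      positive. With \<open>e = |r|^2 / c\<close> the second-order loss is at most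
      \<open>e^2 * c = e * |r|^2\<close>, which is below the first-order gain
      \<open>2 * e * |r|^2\<close>.\<close>
    define c where "c = \<bar>r \<bullet> (S *v r)\<bar> + \<bar>l\<bar> * (norm r)\<^sup>2 + (norm r)\<^sup>2"
    have n0: "(norm r)\<^sup>2 > 0" using \<open>r \<noteq> 0\<close> by simp
    have c: "c > 0" unfolding c_def using n0 by (smt (verit) abs_ge_zero mult_nonneg_nonneg)
    define e where "e = (norm r)\<^sup>2 / c"
    have e: "e > 0" using c n0 by (simp add: e_def)
    have "v + e *\<^sub>R r \<in> V" using V vV rV by (simp add: subspace_add subspace_scale)
    from le[OF this]
    have "l + 2 * e * (norm r)\<^sup>2 + e\<^sup>2 * (r \<bullet> (S *v r)) \<le> l * (1 + e\<^sup>2 * (norm r)\<^sup>2)"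
    proof -
      have a: "(v + e *\<^sub>R r) \<bullet> (S *v (v + e *\<^sub>R r)) = l + 2 * e * (norm r)\<^sup>2 + e\<^sup>2 * (r \<bullet> (S *v r))"
        using Svr sym_inner[OF sym, of r v] sym_inner[OF sym, of v r]
        by (simp add: matrix_vector_right_distrib matrix_vector_mult_scaleR inner_add_left inner_add_right
            l_def power2_eq_square inner_commute algebra_simps)
      have b: "(norm (v + e *\<^sub>R r))\<^sup>2 = 1 + e\<^sup>2 * (norm r)\<^sup>2"
        using nv vr unfolding power2_norm_eq_inner by (simp add: inner_add_left inner_add_right inner_commute
            norm_eq_1 power2_eq_square)
      assume "(v + e *\<^sub>R r) \<bullet> (S *v (v + e *\<^sub>R r)) \<le> l * (norm (v + e *\<^sub>R r))\<^sup>2"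
      thus ?thesis unfolding a b .
    qed
    hence "2 * e * (norm r)\<^sup>2 \<le> e\<^sup>2 * (l * (norm r)\<^sup>2 - r \<bullet> (S *v r))" by (simp add: algebra_simps)
    also have "\<dots> \<le> e\<^sup>2 * c"
    proof (rule mult_left_mono)
      have "l * (norm r)\<^sup>2 \<le> \<bar>l\<bar> * (norm r)\<^sup>2" by (intro mult_right_mono) auto
      thus "l * (norm r)\<^sup>2 - r \<bullet> (S *v r) \<le> c" using n0 unfolding c_def by linarith
    qed simp
    finally have "2 * (norm r)\<^sup>2 \<le> e * c" using e by (simp add: power2_eq_square)
    thus False using c n0 by (simp add: e_def)
  qed
  hence "S *v v = l *\<^sub>R v" by (simp add: r_def)
  with that vV nv le show thesis by blast
qed

text \<open>Spectral theorem by induction on the dimension: one unit eigenvector is split off, and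
  its orthogonal complement inside \<open>V\<close> is again invariant because \<open>S\<close> is
  symmetric.\<close>

lemma symmetric_eigenbasis_subspace:
  fixes S :: "real^'n^'n"
  assumes sym: "transpose S = S" and V: "subspace V" and inv: "\<And>v. v \<in> V \<Longrightarrow> S *v v \<in> V"
  shows "\<exists>B. finite B \<and> pairwise orthogonal B \<and> (\<forall>b\<in>B. norm b = 1 \<and> (\<exists>l. S *v b = l *\<^sub>R b)) \<and> span B = V"
  using V inv
proof (induction "dim V" arbitrary: V rule: less_induct)
  case less
  show ?case
  proof (cases "V = {0}")
    case True
    show ?thesis by (rule exI[of _ "{}"]) (simp add: True)
  next
    case False
    from symmetric_eigenvector_in_subspace[OF sym less.prems False] obtain v l
      where v: "v \<in> V" "norm v = 1" "S *v v = l *\<^sub>R v" by metis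
    define U where "U = {w' \<in> V. v \<bullet> w' = 0}"
    have "U = V \<inter> {w'. v \<bullet> w' = 0}" by (auto simp: U_def)
    hence U: "subspace U" by (simp add: less.prems subspace_hyperplane subspace_inter)
    have "v \<notin> U" using v by (auto simp: U_def)
    hence "U \<subset> V" using v unfolding U_def by blast
    hence dimU: "dim U < dim V" using dim_psubset[of U V] U less.prems(1) by (simp add: span_eq_iff[THEN iffD2])
    have invU: "S *v w' \<in> U" if "w' \<in> U" for w'
      using that less.prems v sym_inner[OF sym, of v w'] by (auto simp: U_def)
    from less.hyps[OF dimU U invU] obtain B where B: "finite B" "pairwise orthogonal B"
      "\<forall>b\<in>B. norm b = 1 \<and> (\<exists>l. S *v b = l *\<^sub>R b)" "span B = U" by blast
    have BU: "B \<subseteq> U" using B(4) span_superset by blast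
    have "span (insert v B) = V"
    proof
      show "span (insert v B) \<subseteq> V"
        by (rule span_minimal) (use v BU less.prems in \<open>auto simp: U_def\<close>)
      show "V \<subseteq> span (insert v B)"
      proof
        fix w' assume w': "w' \<in> V"
        have "w' - (v \<bullet> w') *\<^sub>R v \<in> U" using w' v less.prems
          by (auto simp: U_def subspace_diff subspace_scale inner_diff_right norm_eq_1)
        hence "w' - (v \<bullet> w') *\<^sub>R v \<in> span (insert v B)" using B(4) span_mono[of B "insert v B"] by auto
        moreover have "(v \<bullet> w') *\<^sub>R v \<in> span (insert v B)" by (simp add: span_base span_scale)
        ultimately show "w' \<in> span (insert v B)" using span_add by force
      qed
    qed
    moreover have "pairwise orthogonal (insert v B)"
      using B(2) BU by (auto simp: pairwise_insert orthogonal_def U_def inner_commute)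
    ultimately show ?thesis using B v by (intro exI[of _ "insert v B"]) auto
  qed
qed

lemma symmetric_eigenbasis:
  fixes S :: "real^'n^'n"
  assumes "transpose S = S"
  obtains B l where "finite B" "pairwise orthogonal B" "\<And>b. b \<in> B \<Longrightarrow> norm b = 1"
    "\<And>b. b \<in> B \<Longrightarrow> S *v b = l b *\<^sub>R b" "span B = UNIV"
proof -
  from symmetric_eigenbasis_subspace[OF assms subspace_UNIV] obtain B where
    "finite B \<and> pairwise orthogonal B \<and> (\<forall>b\<in>B. norm b = 1 \<and> (\<exists>l. S *v b = l *\<^sub>R b)) \<and> span B = UNIV" by auto
  moreover then obtain l where "\<forall>b\<in>B. S *v b = l b *\<^sub>R b" by metis
  ultimately show thesis using that by blast
qed

text \<open>The root is the spectral sum of \<open>sqrt (l b)\<close> times the projection onto the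
  line of \<open>b\<close>; its square is compared with \<open>S\<close> on the eigenbasis
  only.\<close>

lemma psd_sqrt_exists:
  fixes S :: "real^'n^'n"
  assumes "pos_semidef S"
  shows "\<exists>T. pos_semidef T \<and> T ** T = S"
proof -
  have sym: "transpose S = S" using assms by (simp add: pos_semidef_def)
  obtain B l where B: "finite B" "pairwise orthogonal B" "\<And>b. b \<in> B \<Longrightarrow> norm b = 1"
    "\<And>b. b \<in> B \<Longrightarrow> S *v b = l b *\<^sub>R b" "span B = UNIV" using symmetric_eigenbasis[OF sym] by blast
  have l: "l b \<ge> 0" if "b \<in> B" for b
  proof -
    have "0 \<le> b \<bullet> (S *v b)" using assms by (simp add: pos_semidef_def)
    thus ?thesis using B(3,4)[OF that] by (simp add: norm_eq_1)
  qed
  define f where "f v = (\<Sum>b\<in>B. (sqrt (l b) * (b \<bullet> v)) *\<^sub>R b)" for v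
  have lin: "linear f"
    by (rule linearI) (simp_all add: f_def inner_add_right distrib_left scaleR_add_left sum.distrib
        scaleR_sum_right mult.left_commute)
  define T where "T = matrix f"
  have T: "T *v v = f v" for v unfolding T_def using lin by (simp add: matrix_works)
  have fb: "f b = sqrt (l b) *\<^sub>R b" if "b \<in> B" for b
  proof -
    have "f b = (\<Sum>c\<in>B. if c = b then sqrt (l b) *\<^sub>R b else 0)" unfolding f_def
      by (rule sum.cong) (use B(2,3) that in \<open>auto simp: pairwise_def orthogonal_def norm_eq_1\<close>)
    thus ?thesis using that B(1) by simp
  qed
  have "T ** T = S"
  proof -
    have eq: "(T ** T) *v b = S *v b" if "b \<in> B" for b
      using l B(4) that
      by (simp add: matrix_vector_mul_assoc[symmetric] T fb linear_cmul[OF lin] real_sqrt_mult_self)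
    have "(T ** T) *v v = S *v v" for v
      by (rule linear_eq_on[where B = B, OF matrix_vector_mul_linear matrix_vector_mul_linear]) (use B eq in auto)
    thus ?thesis by (simp add: matrix_eq)
  qed
  moreover have "pos_semidef T" unfolding pos_semidef_def
  proof (intro conjI allI symI_inner)
    show "(T *v u) \<bullet> v = u \<bullet> (T *v v)" for u v
      by (simp add: T f_def inner_sum_left inner_sum_right mult_ac inner_commute)
    show "0 \<le> v \<bullet> (T *v v)" for v
      using l by (auto simp: T f_def inner_sum_right inner_commute mult.assoc[symmetric] intro!: sum_nonneg)
         (metis mult.assoc mult_nonneg_nonneg real_sqrt_ge_zero zero_le_square)
  qed
  ultimately show ?thesis by blast
qed

lemma psd_sqrt_kernel:
  fixes T S :: "real^'n^'n"
  assumes "transpose T = T" "T ** T = S"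
  shows "v \<bullet> (S *v v) = (norm (T *v v))\<^sup>2" 
  using sym_inner[OF assms(1), of v "T *v v"]
  by (simp add: assms(2)[symmetric] power2_norm_eq_inner matrix_vector_mul_assoc)

text \<open>\<open>matrix_sqrt\<close> is a definite description, so uniqueness matters. An
  eigenvector \<open>b\<close> of \<open>S\<close> with eigenvalue \<open>l\<close> is one of every
  root \<open>V\<close>: \<open>(V + sqrt l) (V - sqrt l) b = 0\<close>, and
  \<open>V + sqrt l\<close> is positive definite if \<open>l > 0\<close>, while
  \<open>|V b|^2 = b . S b = 0\<close> if \<open>l = 0\<close>. Hence all roots agree on an
  eigenbasis.\<close>

lemma psd_sqrt_unique:
  fixes S T U :: "real^'n^'n"
  assumes S: "pos_semidef S" and T: "pos_semidef T" "T ** T = S" and U: "pos_semidef U" "U ** U = S"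
  shows "T = U"
proof -
  have sym: "transpose S = S" using S by (simp add: pos_semidef_def)
  obtain B l where B: "finite B" "pairwise orthogonal B" "\<And>b. b \<in> B \<Longrightarrow> norm b = 1"
    "\<And>b. b \<in> B \<Longrightarrow> S *v b = l b *\<^sub>R b" "span B = UNIV" using symmetric_eigenbasis[OF sym] by blast
  have root: "V *v b = sqrt (l b) *\<^sub>R b" if V: "pos_semidef V" "V ** V = S" and b: "b \<in> B" for V b
  proof -
    have lb: "l b = (norm (V *v b))\<^sup>2"
      using psd_sqrt_kernel[of V S b] V B(3,4)[OF b] by (simp add: pos_semidef_def norm_eq_1)
    define r where "r = V *v b - sqrt (l b) *\<^sub>R b"
    show ?thesis
    proof (cases "l b = 0")
      case True thus ?thesis using lb by simp
    next
      case False
      hence pos: "sqrt (l b) > 0" using lb by (simp add: less_le)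
      have "V *v r + sqrt (l b) *\<^sub>R r = S *v b - l b *\<^sub>R b"
        using lb by (simp add: r_def matrix_vector_mult_diff_distrib matrix_vector_mult_scaleR V(2)[symmetric]
            matrix_vector_mul_assoc scaleR_diff_right power2_eq_square)
      also have "\<dots> = 0" using B(4)[OF b] by simp
      finally have "r \<bullet> (V *v r) + sqrt (l b) * (r \<bullet> r) = 0"
        by (metis inner_add_right inner_scaleR_right inner_zero_right)
      moreover have "r \<bullet> (V *v r) \<ge> 0" using V by (simp add: pos_semidef_def)
      ultimately have "r \<bullet> r \<le> 0" using pos by (smt (verit) mult_pos_pos)
      hence "r = 0" by (metis inner_eq_zero_iff inner_ge_zero order_antisym)
      thus ?thesis by (simp add: r_def)
    qed
  qed
  have "T *v v = U *v v" for v
    by (rule linear_eq_on[where B = B, OF matrix_vector_mul_linear matrix_vector_mul_linear]) (use B T U root in auto)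
  thus ?thesis by (simp add: matrix_eq)
qed

lemma matrix_sqrt:
  fixes S :: "real^'n^'n"
  assumes "pos_semidef S"
  shows "pos_semidef (matrix_sqrt S)" "matrix_sqrt S ** matrix_sqrt S = S"
    "transpose (matrix_sqrt S) = matrix_sqrt S" "(norm (matrix_sqrt S *v v))\<^sup>2 = v \<bullet> (S *v v)"
proof -
  have "\<exists>!T. pos_semidef T \<and> T ** T = S"
    using psd_sqrt_exists[OF assms] psd_sqrt_unique[OF assms] by blast
  from theI'[OF this] show *: "pos_semidef (matrix_sqrt S)" "matrix_sqrt S ** matrix_sqrt S = S"
    by (auto simp: matrix_sqrt_def)
  thus "transpose (matrix_sqrt S) = matrix_sqrt S" by (simp add: pos_semidef_def)
  with * show "(norm (matrix_sqrt S *v v))\<^sup>2 = v \<bullet> (S *v v)" using psd_sqrt_kernel by metis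
qed

text \<open>The form equals \<open>|sqrt S v|^2\<close>, so its zeros lie in the kernel. This is how
  vanishing energies become vanishing vectors later on.\<close>

lemma psd_zero_iff:
  fixes S :: "real^'n^'n"
  assumes "pos_semidef S"
  shows "v \<bullet> (S *v v) = 0 \<longleftrightarrow> S *v v = 0"
  by (metis assms inner_zero_right matrix_sqrt(2,4) matrix_vector_mul_assoc matrix_vector_mult_0_right norm_eq_zero
      power2_eq_iff_nonneg norm_ge_zero zero_power2 order_refl)

section \<open>Lyapunov operators\<close>

definition outer :: "real^'m \<Rightarrow> real^'n \<Rightarrow> real^'n^'m" where
  "outer u v = (\<chi> i j. u $ i * v $ j)"

text \<open>The inner product of matrices is the trace form \<open>tr (X^T Y)\<close>, and
  \<open>X \<bullet> mat 1\<close> is the trace. All dualities below refer to it.\<close>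

lemma inner_matrix_def: "X \<bullet> Y = (\<Sum>i\<in>UNIV. \<Sum>j\<in>UNIV. X $ i $ j * Y $ i $ j)" for X Y :: "real^'n^'m"
  by (simp add: inner_vec_def)

lemma inner_outer: "X \<bullet> outer u v = u \<bullet> (X *v v)" for X :: "real^'n^'m"
  by (simp add: inner_matrix_def outer_def inner_vec_def matrix_vector_mult_def sum_distrib_left mult_ac)

lemma outer_mult_vec: "outer u v *v w' = (v \<bullet> w') *\<^sub>R u"
  by (simp add: vec_eq_iff outer_def inner_vec_def matrix_vector_mult_def sum_distrib_left mult_ac)

lemma inner_matrix_mult_left: "X \<bullet> (A ** B) = (transpose A ** X) \<bullet> B"
  for X :: "real^'n^'m" and A :: "real^'k^'m" and B :: "real^'n^'k"
proof -
  have "X \<bullet> (A ** B) = (\<Sum>i\<in>UNIV. \<Sum>j\<in>UNIV. \<Sum>k\<in>UNIV. A $ i $ k * X $ i $ j * B $ k $ j)"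
    by (simp add: inner_matrix_def matrix_matrix_mult_def sum_distrib_left mult_ac)
  also have "\<dots> = (\<Sum>i\<in>UNIV. \<Sum>k\<in>UNIV. \<Sum>j\<in>UNIV. A $ i $ k * X $ i $ j * B $ k $ j)"
    by (rule sum.cong[OF refl], rule sum.swap)
  also have "\<dots> = (\<Sum>k\<in>UNIV. \<Sum>i\<in>UNIV. \<Sum>j\<in>UNIV. A $ i $ k * X $ i $ j * B $ k $ j)"
    by (rule sum.swap)
  also have "\<dots> = (\<Sum>k\<in>UNIV. \<Sum>j\<in>UNIV. \<Sum>i\<in>UNIV. A $ i $ k * X $ i $ j * B $ k $ j)"
    by (rule sum.cong[OF refl], rule sum.swap)
  also have "\<dots> = (transpose A ** X) \<bullet> B"
    by (simp add: inner_matrix_def matrix_matrix_mult_def transpose_def sum_distrib_right)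
  finally show ?thesis .
qed

lemma inner_transpose: "transpose X \<bullet> transpose Y = X \<bullet> Y" for X Y :: "real^'n^'m"
  unfolding inner_matrix_def transpose_def by (simp, rule sum.swap)

lemma inner_matrix_mult_right: "X \<bullet> (A ** B) = (X ** transpose B) \<bullet> A"
  for X :: "real^'n^'m" and A :: "real^'k^'m" and B :: "real^'n^'k"
proof -
  have "X \<bullet> (A ** B) = transpose X \<bullet> (transpose B ** transpose A)"
    by (simp only: inner_transpose flip: matrix_transpose_mul)
  also have "\<dots> = (B ** transpose X) \<bullet> transpose A" by (simp only: inner_matrix_mult_left transpose_transpose)
  also have "\<dots> = transpose (B ** transpose X) \<bullet> transpose (transpose A)" by (rule inner_transpose[symmetric])
  finally show ?thesis by (simp only: matrix_transpose_mul transpose_transpose)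
qed

lemma sym_entry:
  fixes T :: "real^'n^'n"
  assumes "transpose T = T"
  shows "T $ k $ j = T $ j $ k"
  by (subst (1) assms[symmetric]) (simp add: transpose_def)

text \<open>\<open>T ** T\<close> is the sum of the rank-one matrices of the columns of
  \<open>T\<close>. With \<open>T\<close> a square root, pairing with a semidefinite matrix becomes
  a sum of values of a quadratic form.\<close>

lemma inner_square:
  fixes X T :: "real^'n^'n"
  assumes "transpose T = T"
  shows "X \<bullet> (T ** T) = (\<Sum>j\<in>UNIV. column j T \<bullet> (X *v column j T))"
proof -
  note sym_entry[OF assms]
  hence "(T ** T) = (\<Sum>j\<in>UNIV. outer (column j T) (column j T))"
    by (simp add: vec_eq_iff matrix_matrix_mult_def outer_def column_def sum_component)
  thus ?thesis by (simp add: inner_sum_right inner_outer)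
qed

lemma inner_psd_nonneg:
  fixes X Y :: "real^'n^'n"
  assumes "\<And>v. 0 \<le> v \<bullet> (X *v v)" "pos_semidef Y"
  shows "0 \<le> X \<bullet> Y"
  using inner_square[OF matrix_sqrt(3)[OF assms(2)], of X] matrix_sqrt(2)[OF assms(2)] assms(1)
  by (simp add: sum_nonneg)

lemma pos_semidef_outer: "pos_semidef (outer v v)"
  unfolding pos_semidef_def
proof (intro conjI allI)
  show "transpose (outer v v) = outer v v" by (simp add: outer_def transpose_def vec_eq_iff)
  show "0 \<le> w' \<bullet> (outer v v *v w')" for w' by (simp add: outer_mult_vec inner_commute[of w' v])
qed

lemma axis_quadratic: "axis a 1 \<bullet> (X *v axis b 1) = X $ a $ b" for X :: "real^'n^'n"
  by (simp add: matrix_vector_mult_basis inner_axis' column_def)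

lemma trace_psd_nonneg: "pos_semidef X \<Longrightarrow> 0 \<le> X \<bullet> mat 1" for X :: "real^'n^'n"
  using inner_psd_nonneg[of "mat 1" X] by (simp add: inner_commute)

lemma inner_mat_1: "X \<bullet> mat 1 = (\<Sum>i\<in>UNIV. axis i 1 \<bullet> (X *v axis i 1))" for X :: "real^'n^'n"
  by (simp add: axis_quadratic inner_matrix_def mat_def if_distrib cong: if_cong)

lemma psd_trace_zero:
  fixes X :: "real^'n^'n"
  assumes "pos_semidef X" "X \<bullet> mat 1 = 0"
  shows "X = 0"
proof -
  have "\<forall>i\<in>UNIV. axis i 1 \<bullet> (X *v axis i 1) = 0"
    using assms unfolding inner_mat_1 by (subst (asm) sum_nonneg_eq_0_iff) (auto simp: pos_semidef_def)
  hence "X *v axis i 1 = 0" for i using psd_zero_iff[OF assms(1)] by auto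
  thus ?thesis by (simp add: matrix_vector_mult_basis vec_eq_iff column_def)
qed

lemma closed_pos_semidef: "closed {X :: real^'n^'n. pos_semidef X}"
proof -
  have lin: "linear (\<lambda>X :: real^'n^'n. X *v v)" for v
    by (rule linearI) (simp_all add: matrix_vector_mult_add_rdistrib scaleR_matrix_vector_assoc)
  have c: "continuous_on UNIV (\<lambda>X :: real^'n^'n. X *v v)" for v
    using lin[of v] by (simp add: linear_continuous_on linear_conv_bounded_linear)
  have "{X :: real^'n^'n. pos_semidef X} =
    (\<Inter>u. \<Inter>v. {X. (X *v u) \<bullet> v = u \<bullet> (X *v v)}) \<inter> (\<Inter>v. {X. 0 \<le> v \<bullet> (X *v v)})"
    by (auto simp: pos_semidef_def symI_inner) (metis sym_inner)
  moreover have "closed {X :: real^'n^'n. (X *v u) \<bullet> v = u \<bullet> (X *v v)}" for u v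
    by (intro closed_Collect_eq continuous_intros c)
  moreover have "closed {X :: real^'n^'n. 0 \<le> v \<bullet> (X *v v)}" for v
    by (intro closed_Collect_le continuous_intros c)
  ultimately show ?thesis by (simp only:) (intro closed_Int closed_INT ballI)
qed

text \<open>Testing the form at \<open>e_i + e_j\<close> and \<open>e_i - e_j\<close> bounds
  \<open>2 * |X_ij|\<close> by \<open>X_ii + X_jj\<close>, and each diagonal entry is at most the
  trace. This makes the slice of trace one bounded.\<close>

lemma psd_entry_bound:
  fixes X :: "real^'n^'n"
  assumes "pos_semidef X"
  shows "\<bar>X $ i $ j\<bar> \<le> X \<bullet> mat 1"
proof -
  note ent = axis_quadratic[of _ X]
  have pos: "0 \<le> X $ a $ a" for a using assms ent[of a a] unfolding pos_semidef_def by metis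
  have le: "X $ a $ a \<le> X \<bullet> mat 1" for a
    unfolding inner_mat_1 ent by (rule member_le_sum) (auto simp: pos)
  have sym: "X $ j $ i = X $ i $ j" using assms by (simp add: pos_semidef_def sym_entry)
  have "0 \<le> (axis i 1 + axis j 1) \<bullet> (X *v (axis i 1 + axis j 1))"
    "0 \<le> (axis i 1 - axis j 1) \<bullet> (X *v (axis i 1 - axis j 1))"
    using assms by (auto simp: pos_semidef_def)
  hence "0 \<le> X $ i $ i + X $ j $ j + 2 * X $ i $ j" "0 \<le> X $ i $ i + X $ j $ j - 2 * X $ i $ j"
    by (simp_all add: matrix_vector_right_distrib matrix_vector_mult_diff_distrib inner_add_left inner_diff_left
        inner_add_right inner_diff_right ent sym)
  with le[of i] le[of j] show ?thesis by linarith
qed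

text \<open>For \<open>dx = G x dt + H x dW\<close> this is the generator of the second moment
  matrix \<open>E (x x^T)\<close>. With \<open>G\<close> and \<open>H\<close> transposed it is the
  adjoint, which acts on quadratic forms.\<close>

definition lyap :: "real^'n^'n \<Rightarrow> real^'n^'n \<Rightarrow> real^'n^'n \<Rightarrow> real^'n^'n" where
  "lyap G H X = G ** X + X ** transpose G + H ** X ** transpose H"

lemma matrix_matrix_mult_add_left: "(A + B) ** C = A ** C + B ** C" for A B :: "real^'n^'m" and C :: "real^'k^'n"
  by (simp add: matrix_matrix_mult_def vec_eq_iff sum.distrib distrib_right)

lemma linear_lyap: "linear (lyap G H)"
proof (rule linearI)
  have l: "(k *\<^sub>R A) ** B = k *\<^sub>R (A ** B)" and r: "A ** (k *\<^sub>R B) = k *\<^sub>R (A ** B)"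
    for k :: real and A B :: "real^'a^'a"
    by (simp_all add: matrix_matrix_mult_def vec_eq_iff sum_distrib_left mult.assoc mult.left_commute)
  show "lyap G H (X + Y) = lyap G H X + lyap G H Y" for X Y
    by (simp add: lyap_def matrix_add_ldistrib matrix_matrix_mult_add_left)
  show "lyap G H (k *\<^sub>R X) = k *\<^sub>R lyap G H X" for k X
    by (simp add: lyap_def l r scaleR_add_right)
qed

lemma lyap_adjoint: "lyap G H X \<bullet> S = X \<bullet> lyap (transpose G) (transpose H) S"
proof -
  have "lyap G H X \<bullet> S = S \<bullet> (G ** X) + S \<bullet> (X ** transpose G) + S \<bullet> ((H ** X) ** transpose H)"
    by (subst inner_commute) (simp only: lyap_def inner_add_right)
  also have "S \<bullet> (G ** X) = X \<bullet> (transpose G ** S)"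
    by (subst inner_matrix_mult_left) (rule inner_commute)
  also have "S \<bullet> (X ** transpose G) = X \<bullet> (S ** G)"
    by (subst inner_matrix_mult_right) (simp only: transpose_transpose inner_commute[of X])
  also have "S \<bullet> ((H ** X) ** transpose H) = (S ** H) \<bullet> (H ** X)"
    by (subst inner_matrix_mult_right) (simp only: transpose_transpose)
  also have "\<dots> = (transpose H ** (S ** H)) \<bullet> X" by (rule inner_matrix_mult_left)
  also have "\<dots> = X \<bullet> (transpose H ** S ** H)" unfolding matrix_mul_assoc by (rule inner_commute)
  finally show ?thesis by (simp add: lyap_def inner_add_right)
qed

text \<open>The right-hand side is the drift that Ito's formula would assign to
  \<open>x \<bullet> (S *v x)\<close> along \<open>dx = G x dt + H x dW\<close>.\<close>

lemma lyap_quadratic: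
  fixes S :: "real^'n^'n"
  assumes "transpose S = S"
  shows "v \<bullet> (lyap (transpose G) (transpose H) S *v v) = 2 * ((S *v v) \<bullet> (G *v v)) + (H *v v) \<bullet> (S *v (H *v v))"
proof -
  have "v \<bullet> (lyap (transpose G) (transpose H) S *v v) = v \<bullet> (transpose G *v (S *v v)) + v \<bullet> (S *v (G *v v))
      + v \<bullet> (transpose H *v (S *v (H *v v)))"
    by (simp only: lyap_def matrix_vector_mult_add_rdistrib inner_add_right matrix_vector_mul_assoc
        matrix_mul_assoc transpose_transpose)
  also have "\<dots> = (G *v v) \<bullet> (S *v v) + (S *v v) \<bullet> (G *v v) + (H *v v) \<bullet> (S *v (H *v v))"
    unfolding transpose_inner[symmetric] sym_inner[OF assms] ..
  finally show ?thesis by (simp add: inner_commute)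
qed

lemma transpose_lyap: "transpose (lyap G H X) = lyap G H (transpose X)"
proof -
  have add: "transpose (A + B) = transpose A + transpose B" for A B :: "real^'n^'n"
    by (simp add: transpose_def vec_eq_iff)
  show ?thesis by (simp add: lyap_def add matrix_transpose_mul matrix_mul_assoc add.commute)
qed

text \<open>A minimum principle. Suppose that the least eigenvalue of \<open>Y\<close> is
  \<open>- l < 0\<close>, with unit eigenvector \<open>v\<close>. The form of \<open>Y\<close> is
  everywhere at least \<open>- l * |.|^2\<close>, so the noise term at \<open>v\<close> is at least
  \<open>- l * |H^T v|^2\<close>, and the drift term is exactly
  \<open>- 2 * l * (G^T v . v)\<close>. The bound on \<open>c\<close> then makes the form of
  \<open>c Y - lyap G H Y\<close> negative at \<open>v\<close>.\<close>

lemma lyap_resolvent_positive: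
  fixes Y :: "real^'n^'n"
  assumes Y: "transpose Y = Y" and pos: "\<And>v. 0 \<le> v \<bullet> ((c *\<^sub>R Y - lyap G H Y) *v v)"
    and c: "\<And>v. norm v = 1 \<Longrightarrow> 2 * ((transpose G *v v) \<bullet> v) + (norm (transpose H *v v))\<^sup>2 < c"
  shows "pos_semidef Y"
proof -
  have symn: "transpose (- Y) = - Y" using Y by (simp add: transpose_def vec_eq_iff)
  obtain v l where v: "norm v = 1" "(- Y) *v v = l *\<^sub>R v" and
    max: "\<And>w'. w' \<bullet> ((- Y) *v w') \<le> l * (norm w')\<^sup>2"
  proof (rule symmetric_eigenvector_in_subspace[OF symn subspace_UNIV])
    show "UNIV \<noteq> {0 :: real^'n}" by (metis UNIV_I axis_eq_0_iff singletonD zero_neq_one)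
  qed auto
  have neg: "(- Y) *v w' = - (Y *v w')" for w' by (simp add: matrix_vector_mult_def vec_eq_iff sum_negf)
  have "l \<le> 0"
  proof (rule ccontr)
    assume "\<not> l \<le> 0"
    hence l: "l > 0" by simp
    have Yv: "Y *v v = - (l *\<^sub>R v)" using v(2) neg by (metis minus_minus)
    have q: "v \<bullet> (lyap G H Y *v v) = 2 * ((Y *v v) \<bullet> (transpose G *v v)) + (transpose H *v v) \<bullet> (Y *v (transpose H *v v))"
      using lyap_quadratic[OF Y, of v "transpose G" "transpose H"] by simp
    have "(transpose H *v v) \<bullet> (Y *v (transpose H *v v)) \<ge> - l * (norm (transpose H *v v))\<^sup>2"
      using max[of "transpose H *v v"] by (simp add: neg)
    with q have "v \<bullet> (lyap G H Y *v v) \<ge> - l * (2 * ((transpose G *v v) \<bullet> v) + (norm (transpose H *v v))\<^sup>2)"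
      by (simp add: Yv inner_commute algebra_simps)
    moreover have "v \<bullet> ((c *\<^sub>R Y - lyap G H Y) *v v) = - c * l - v \<bullet> (lyap G H Y *v v)"
      using v(1) by (simp add: matrix_vector_mult_diff_rdistrib inner_diff_right Yv norm_eq_1
          flip: scaleR_matrix_vector_assoc)
    ultimately have "0 \<le> l * (2 * ((transpose G *v v) \<bullet> v) + (norm (transpose H *v v))\<^sup>2 - c)"
      using pos[of v] by (simp add: algebra_simps)
    with l c[OF v(1)] show False by (simp add: zero_le_mult_iff)
  qed
  hence "0 \<le> w' \<bullet> (Y *v w')" for w'
    using max[of w'] by (simp add: neg) (smt (verit) mult_nonneg_nonneg zero_le_power2 mult_minus_left)
  with Y show ?thesis by (simp add: pos_semidef_def)
qed

text \<open>A Perron-Frobenius argument through Brouwer's theorem. The resolvent \<open>J\<close> of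
  \<open>lyap G H\<close> at \<open>c\<close> preserves the cone, so after normalising the trace it
  maps a compact convex set to itself. A fixed point satisfies \<open>J X = m X\<close>, that is,
  \<open>lyap G H X = (c - 1 / m) X\<close>.\<close>

lemma lyap_subharmonic_imp_eigen:
  fixes X0 :: "real^'n^'n"
  assumes X0: "pos_semidef X0" "X0 \<noteq> 0" "pos_semidef (lyap G H X0)"
  obtains X a where "pos_semidef X" "X \<noteq> 0" "a \<ge> 0" "lyap G H X = a *\<^sub>R X"
proof -
  obtain b where b: "b > 0" "\<And>Y. norm (lyap G H Y) \<le> b * norm Y"
    using linear_bounded_pos[OF linear_lyap] by metis
  obtain g where g: "\<And>v. norm (transpose G *v v) \<le> g * norm v"
    using linear_bounded[OF matrix_vector_mul_linear] by blast
  obtain h where h: "\<And>v. norm (transpose H *v v) \<le> h * norm v"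
    using linear_bounded[OF matrix_vector_mul_linear] by blast
  \<comment> \<open>Exceeding the operator bound \<open>b\<close> makes \<open>c - lyap G H\<close>
    injective; the terms in \<open>g\<close> and \<open>h\<close> supply the strict bound required
    by the minimum principle.\<close>
  define c where "c = b + 2 * \<bar>g\<bar> + h\<^sup>2 + 1"
  have cb: "c > b" unfolding c_def by (smt (verit) abs_ge_zero zero_le_power2)
  have cpos: "2 * ((transpose G *v v) \<bullet> v) + (norm (transpose H *v v))\<^sup>2 < c" if "norm v = 1" for v
  proof -
    have "(transpose G *v v) \<bullet> v \<le> \<bar>g\<bar>" using norm_cauchy_schwarz[of "transpose G *v v" v] g[of v] that by auto
    moreover have "(norm (transpose H *v v))\<^sup>2 \<le> h\<^sup>2" using h[of v] that by (intro power_mono) auto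
    ultimately show ?thesis unfolding c_def using b(1) by linarith
  qed
  define f where "f Y = c *\<^sub>R Y - lyap G H Y" for Y
  have linf: "linear f" unfolding f_def using linear_lyap[of G H]
    by (intro linear_compose_sub linear_compose_scale_right linear_ident)
  have "Y = 0" if "f Y = 0" for Y
  proof (rule ccontr)
    assume "Y \<noteq> 0"
    have "c * norm Y = norm (lyap G H Y)" using that cb b(1)
      by (simp add: f_def) (metis abs_of_pos norm_scaleR order_less_trans)
    also have "\<dots> \<le> b * norm Y" by (rule b)
    finally show False using cb \<open>Y \<noteq> 0\<close> by simp
  qed
  hence injf: "inj f" using linear_injective_0[OF linf] by simp
  from linear_injective_isomorphism[OF linf injf] obtain J where
    linJ: "linear J" and Jf: "\<And>Y. J (f Y) = Y" and fJ: "\<And>Y. f (J Y) = Y" by blast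
  have psdJ: "pos_semidef (J Y)" if "pos_semidef Y" for Y
  proof (rule lyap_resolvent_positive)
    have "f (transpose (J Y)) = transpose (f (J Y))"
      unfolding f_def using transpose_lyap[of G H "J Y"] by (simp add: transpose_def vec_eq_iff)
    also have "\<dots> = Y" using that by (simp add: fJ pos_semidef_def)
    finally show "transpose (J Y) = J Y" using injf fJ by (metis injD)
    show "0 \<le> v \<bullet> ((c *\<^sub>R J Y - lyap G H (J Y)) *v v)" for v
      using fJ[of Y] that by (simp add: f_def pos_semidef_def)
  qed (use cpos in auto)
  have comm: "lyap G H (J Y) = J (lyap G H Y)" for Y
  proof -
    have "f (lyap G H (J Y)) = lyap G H (f (J Y))"
      by (simp add: f_def linear_diff[OF linear_lyap] linear_cmul[OF linear_lyap])
    thus ?thesis using injf fJ by (metis injD)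
  qed
  \<comment> \<open>Semidefiniteness of \<open>lyap G H X\<close> is built into the set. It survives
    under \<open>J\<close>, which commutes with \<open>lyap G H\<close>, and the trace of the
    eigenvalue equation then yields a nonnegative eigenvalue. The set is nonempty thanks to
    \<open>X0\<close>.\<close>
  define K where "K = {X :: real^'n^'n. pos_semidef X} \<inter> {X. X \<bullet> mat 1 = 1} \<inter> lyap G H -` {X. pos_semidef X}"
  have contL: "continuous_on UNIV (lyap G H)"
    using linear_lyap[of G H] unfolding linear_conv_bounded_linear by (rule linear_continuous_on)
  have tr0: "X \<bullet> mat 1 > 0" if "pos_semidef X" "X \<noteq> 0" for X :: "real^'n^'n"
    using that trace_psd_nonneg psd_trace_zero by (metis less_eq_real_def)
  have psd_scale: "pos_semidef (t *\<^sub>R X)" if "pos_semidef X" "t \<ge> 0" for t and X :: "real^'n^'n"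
    using that by (auto simp: pos_semidef_def transpose_def vec_eq_iff simp flip: scaleR_matrix_vector_assoc)
  have psd_add: "pos_semidef (X + Y)" if "pos_semidef X" "pos_semidef Y" for X Y :: "real^'n^'n"
    using that by (auto simp: pos_semidef_def transpose_def vec_eq_iff matrix_vector_mult_add_rdistrib inner_add_right)
  have closedK: "closed K" unfolding K_def
    by (intro closed_Int closed_pos_semidef closed_vimage contL closed_Collect_eq continuous_intros)
  have "bounded K"
  proof (rule boundedI)
    fix X assume X: "X \<in> K"
    have "norm X \<le> (\<Sum>i\<in>UNIV. norm (X $ i))" by (simp add: norm_vec_def L2_set_le_sum)
    also have "\<dots> \<le> (\<Sum>i\<in>UNIV. \<Sum>j\<in>UNIV. \<bar>X $ i $ j\<bar>)" by (intro sum_mono norm_le_l1_cart)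
    also have "\<dots> \<le> (\<Sum>i\<in>(UNIV::'n set). \<Sum>j\<in>(UNIV::'n set). 1)"
      using psd_entry_bound[of X] X by (intro sum_mono) (auto simp: K_def)
    finally show "norm X \<le> (\<Sum>i\<in>(UNIV::'n set). \<Sum>j\<in>(UNIV::'n set). 1)" .
  qed
  hence compK: "compact K" using closedK compact_eq_bounded_closed by blast
  have convK: "convex K" unfolding convex_def K_def
    by (auto simp: linear_add[OF linear_lyap] linear_cmul[OF linear_lyap] inner_add_left intro!: psd_add psd_scale)
  have scaled_in: "(1 / (X \<bullet> mat 1)) *\<^sub>R X \<in> K" if "pos_semidef X" "X \<noteq> 0" "pos_semidef (lyap G H X)" for X
    using tr0[OF that(1,2)] that by (auto simp: K_def linear_cmul[OF linear_lyap] intro!: psd_scale)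
  have neK: "K \<noteq> {}" using scaled_in X0 by blast
  have K0: "X \<noteq> 0" if "X \<in> K" for X using that by (auto simp: K_def)
  have J0: "J X \<noteq> 0" if "X \<in> K" for X using K0[OF that] fJ linear_0[OF linf] by metis
  have JK: "pos_semidef (J X)" "pos_semidef (lyap G H (J X))" if "X \<in> K" for X
    using that psdJ by (auto simp: K_def comm)
  define F where "F X = (1 / (J X \<bullet> mat 1)) *\<^sub>R J X" for X
  have contJ: "continuous_on K J" using linJ by (simp add: linear_continuous_on linear_conv_bounded_linear)
  have "continuous_on K F" unfolding F_def
    by (intro continuous_intros contJ) (use tr0 J0 JK in force)
  moreover have "F \<in> K \<rightarrow> K" unfolding F_def using scaled_in J0 JK by blast
  ultimately obtain X where X: "X \<in> K" "F X = X" using brouwer[OF compK convK neK] by metis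
  define m where "m = J X \<bullet> mat 1"
  have m: "m > 0" unfolding m_def using tr0 J0 JK X by blast
  have "m *\<^sub>R X = (m * (1 / m)) *\<^sub>R J X" using X(2) by (metis F_def m_def scaleR_scaleR)
  hence "J X = m *\<^sub>R X" using m by simp
  hence "X = m *\<^sub>R (c *\<^sub>R X - lyap G H X)" using fJ[of X] by (simp add: f_def linear_cmul[OF linear_lyap] scaleR_diff_right mult.commute)
  hence "m *\<^sub>R lyap G H X = m *\<^sub>R ((c - 1 / m) *\<^sub>R X)" using m by (simp add: scaleR_diff_right scaleR_diff_left algebra_simps)
  hence eig: "lyap G H X = (c - 1 / m) *\<^sub>R X" using m by (simp only: scaleR_cancel_left) simp
  have "0 \<le> lyap G H X \<bullet> mat 1" using X(1) trace_psd_nonneg by (auto simp: K_def)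
  hence "c - 1 / m \<ge> 0" using X(1) eig by (auto simp: K_def)
  moreover have "pos_semidef X" using X(1) by (simp add: K_def)
  ultimately show thesis using that eig K0[OF X(1)] by blast
qed

text \<open>The first alternative says that \<open>- mat 1\<close> lies in the convex cone of all
  \<open>?L S + Y\<close> with \<open>S\<close> semidefinite and \<open>Y\<close> of nonnegative
  form. Otherwise a hyperplane separates the two weakly, which is enough and asks for no closedness
  of the cone. Its normal \<open>X\<close> is nonnegative on the cone: testing with \<open>Y\<close>
  shows that \<open>X\<close> is semidefinite, testing with \<open>?L (outer v v)\<close> that
  \<open>lyap G H X\<close> is.\<close>

lemma lyapunov_alternative:
  fixes G H :: "real^'n^'n"
  shows "(\<exists>S. pos_semidef S \<and> (\<forall>v. 2 * ((S *v v) \<bullet> (G *v v)) + (H *v v) \<bullet> (S *v (H *v v)) \<le> - (norm v)\<^sup>2)) \<or>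
    (\<exists>X a. pos_semidef X \<and> X \<noteq> 0 \<and> a \<ge> 0 \<and> lyap G H X = a *\<^sub>R X)"
proof (cases "\<exists>S. pos_semidef S \<and> (\<forall>v. 2 * ((S *v v) \<bullet> (G *v v)) + (H *v v) \<bullet> (S *v (H *v v)) \<le> - (norm v)\<^sup>2)")
  case False
  let ?L = "lyap (transpose G) (transpose H)"
  \<comment> \<open>Asymmetric matrices are included on purpose:
    \<open>outer u v - outer v u\<close> has zero form and lies in \<open>Q\<close> with both signs,
    which forces the normal \<open>X\<close> to be symmetric.\<close>
  define Q where "Q = {Y :: real^'n^'n. \<forall>v. 0 \<le> v \<bullet> (Y *v v)}"
  define C where "C = {?L S + Y | S Y. pos_semidef S \<and> Y \<in> Q}"
  have Qadd: "Y + Z \<in> Q" if "Y \<in> Q" "Z \<in> Q" for Y Z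
    using that by (auto simp: Q_def matrix_vector_mult_add_rdistrib inner_add_right)
  have Qscale: "t *\<^sub>R Y \<in> Q" if "Y \<in> Q" "t \<ge> 0" for Y t
    using that by (auto simp: Q_def simp flip: scaleR_matrix_vector_assoc)
  have Padd: "pos_semidef (X + Y)" if "pos_semidef X" "pos_semidef Y" for X Y :: "real^'n^'n"
    using that by (auto simp: pos_semidef_def transpose_def vec_eq_iff matrix_vector_mult_add_rdistrib inner_add_right)
  have Pscale: "pos_semidef (t *\<^sub>R X)" if "pos_semidef X" "t \<ge> 0" for t and X :: "real^'n^'n"
    using that by (auto simp: pos_semidef_def transpose_def vec_eq_iff simp flip: scaleR_matrix_vector_assoc)
  have P0: "pos_semidef (0 :: real^'n^'n)" by (auto simp: pos_semidef_def transpose_def vec_eq_iff)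
  have Q0: "0 \<in> Q" by (auto simp: Q_def)
  have Cadd: "x + y \<in> C" if "x \<in> C" "y \<in> C" for x y
  proof -
    from that obtain S Y S' Y' where "x = ?L S + Y" "y = ?L S' + Y'" "pos_semidef S" "pos_semidef S'" "Y \<in> Q" "Y' \<in> Q"
      by (auto simp: C_def)
    hence "x + y = ?L (S + S') + (Y + Y')" "pos_semidef (S + S')" "Y + Y' \<in> Q"
      using Padd Qadd by (auto simp: linear_add[OF linear_lyap])
    thus ?thesis unfolding C_def by blast
  qed
  have Cscale: "t *\<^sub>R x \<in> C" if "x \<in> C" "t \<ge> 0" for x t
  proof -
    from that obtain S Y where "x = ?L S + Y" "pos_semidef S" "Y \<in> Q" by (auto simp: C_def)
    hence "t *\<^sub>R x = ?L (t *\<^sub>R S) + t *\<^sub>R Y" "pos_semidef (t *\<^sub>R S)" "t *\<^sub>R Y \<in> Q"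
      using Pscale Qscale that(2) by (auto simp: linear_cmul[OF linear_lyap] scaleR_add_right)
    thus ?thesis unfolding C_def by blast
  qed
  have convC: "convex C" unfolding convex_def using Cadd Cscale by blast
  have LC: "?L S \<in> C" if "pos_semidef S" for S
  proof -
    have "?L S = ?L S + 0" by simp
    thus ?thesis unfolding C_def using that Q0 by blast
  qed
  have QC: "Y \<in> C" if "Y \<in> Q" for Y
  proof -
    have "Y = ?L 0 + Y" by (simp add: linear_0[OF linear_lyap])
    thus ?thesis unfolding C_def using that P0 by blast
  qed
  have "- mat 1 \<notin> C"
  proof
    assume "- mat 1 \<in> C"
    then obtain S Y where SY: "- mat 1 = ?L S + Y" "pos_semidef S" "Y \<in> Q" by (auto simp: C_def)
    have "2 * ((S *v v) \<bullet> (G *v v)) + (H *v v) \<bullet> (S *v (H *v v)) \<le> - (norm v)\<^sup>2" for v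
    proof -
      have "?L S = - mat 1 - Y" using SY(1) by (simp add: algebra_simps)
      hence "v \<bullet> (?L S *v v) = - (v \<bullet> v) - v \<bullet> (Y *v v)"
        using matrix_vector_mult_diff_rdistrib[of 0 "mat 1" v]
        by (simp add: matrix_vector_mult_diff_rdistrib inner_diff_right)
      moreover have "v \<bullet> (Y *v v) \<ge> 0" using SY(3) by (simp add: Q_def)
      ultimately show ?thesis using lyap_quadratic[of S v G H] SY(2) by (simp add: pos_semidef_def power2_norm_eq_inner)
    qed
    with False SY(2) show False by blast
  qed
  hence dis: "{- mat 1} \<inter> C = {}" by blast
  have neC: "C \<noteq> {}" using LC P0 by blast
  from separating_hyperplane_sets[OF convex_singleton convC _ neC dis] obtain X b where
    X: "X \<noteq> 0" and sep: "\<And>x. x \<in> C \<Longrightarrow> X \<bullet> x \<ge> b" by blast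
  have nonneg: "0 \<le> X \<bullet> x" if "x \<in> C" for x
  proof (rule ccontr)
    assume n: "\<not> 0 \<le> X \<bullet> x"
    \<comment> \<open>A negative value on a cone could be scaled to \<open>- (|b| + 1)\<close>,
      below the lower bound \<open>b\<close>.\<close>
    define t where "t = (\<bar>b\<bar> + 1) / (- (X \<bullet> x))"
    have "t \<ge> 0" using n unfolding t_def by (intro divide_nonneg_nonneg) auto
    from sep[OF Cscale[OF that this]] have "b \<le> t * (X \<bullet> x)" by simp
    also have "\<dots> = - (\<bar>b\<bar> + 1)" using n by (simp add: t_def)
    finally show False by linarith
  qed
  have "pos_semidef X" unfolding pos_semidef_def
  proof (intro conjI symI_inner allI)
    fix u v
    have "outer u v - outer v u \<in> Q" "outer v u - outer u v \<in> Q"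
      by (auto simp: Q_def matrix_vector_mult_diff_rdistrib outer_mult_vec inner_diff_right inner_commute)
    hence "0 \<le> X \<bullet> (outer u v - outer v u)" "0 \<le> X \<bullet> (outer v u - outer u v)" using QC nonneg by blast+
    thus "(X *v u) \<bullet> v = u \<bullet> (X *v v)" by (simp add: inner_diff_right inner_outer inner_commute)
  next
    fix v show "0 \<le> v \<bullet> (X *v v)"
      using nonneg[OF QC, of "outer v v"] pos_semidef_outer[of v] by (simp add: inner_outer Q_def pos_semidef_def)
  qed
  moreover have "pos_semidef (lyap G H X)" unfolding pos_semidef_def
  proof (intro conjI allI)
    show "transpose (lyap G H X) = lyap G H X"
      using \<open>pos_semidef X\<close> by (simp add: transpose_lyap pos_semidef_def)
    fix v
    have "v \<bullet> (lyap G H X *v v) = X \<bullet> ?L (outer v v)" by (metis inner_outer lyap_adjoint)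
    thus "0 \<le> v \<bullet> (lyap G H X *v v)" using nonneg[OF LC[OF pos_semidef_outer]] by simp
  qed
  ultimately show ?thesis using lyap_subharmonic_imp_eigen[OF _ X] by metis
qed blast

section \<open>Integrals of step processes\<close>

definition sq_integrable :: "'a measure \<Rightarrow> ('a \<Rightarrow> 'b::euclidean_space) \<Rightarrow> bool" where
  "sq_integrable M f \<longleftrightarrow> f \<in> borel_measurable M \<and> integrable M (\<lambda>w. (norm (f w))\<^sup>2)"

lemma sq_integrable_measurable: "sq_integrable M f \<Longrightarrow> f \<in> borel_measurable M"
  by (simp add: sq_integrable_def)

lemma sq_integrable_norm: "sq_integrable M f \<Longrightarrow> integrable M (\<lambda>w. (norm (f w))\<^sup>2)"
  by (simp add: sq_integrable_def)

lemma sq_integrable_bound: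
  assumes "f \<in> borel_measurable M" "integrable M g" "\<And>w. w \<in> space M \<Longrightarrow> (norm (f w))\<^sup>2 \<le> g w"
  shows "sq_integrable M f"
  unfolding sq_integrable_def
proof
  show "integrable M (\<lambda>w. (norm (f w))\<^sup>2)"
    by (rule Bochner_Integration.integrable_bound[OF assms(2)])
       (use assms(1,3) in \<open>auto intro!: AE_I2 order_trans[OF _ abs_ge_self]\<close>)
qed (rule assms)

lemma norm_add_sq_le: "(norm (x + y))\<^sup>2 \<le> 2 * (norm x)\<^sup>2 + 2 * (norm (y :: 'b::real_normed_vector))\<^sup>2"
proof -
  have "(norm (x + y))\<^sup>2 \<le> (norm x + norm y)\<^sup>2" by (intro power_mono norm_triangle_ineq) simp
  also have "\<dots> \<le> 2 * (norm x)\<^sup>2 + 2 * (norm y)\<^sup>2"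
    using sum_squares_bound[of "norm x" "norm y"] by (simp add: power2_sum)
  finally show ?thesis .
qed

lemma norm_add3_sq_le: "(norm (x + y + z))\<^sup>2 \<le> 3 * (norm x)\<^sup>2 + 3 * (norm y)\<^sup>2 + 3 * (norm (z :: 'b::real_normed_vector))\<^sup>2"
proof -
  have "norm (x + y + z) \<le> norm x + norm y + norm z"
    by (metis add_le_cancel_right norm_triangle_ineq norm_triangle_le)
  hence "(norm (x + y + z))\<^sup>2 \<le> (norm x + norm y + norm z)\<^sup>2" by (intro power_mono) simp_all
  also have "\<dots> \<le> 3 * (norm x)\<^sup>2 + 3 * (norm y)\<^sup>2 + 3 * (norm z)\<^sup>2"
    using sum_squares_bound[of "norm x" "norm y"] sum_squares_bound[of "norm x" "norm z"]
      sum_squares_bound[of "norm y" "norm z"] by (simp add: power2_eq_square algebra_simps)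
  finally show ?thesis .
qed

lemma sq_integrable_add:
  assumes "sq_integrable M f" "sq_integrable M g"
  shows "sq_integrable M (\<lambda>w. f w + g w)"
  using assms
  by (intro sq_integrable_bound[where g = "\<lambda>w. 2 * (norm (f w))\<^sup>2 + 2 * (norm (g w))\<^sup>2"] norm_add_sq_le)
     (auto simp: sq_integrable_def)

lemma sq_integrable_scaleR: "sq_integrable M f \<Longrightarrow> sq_integrable M (\<lambda>w. c *\<^sub>R f w)"
  by (auto simp: sq_integrable_def power_mult_distrib)

lemma sq_integrable_diff:
  assumes "sq_integrable M f" "sq_integrable M g"
  shows "sq_integrable M (\<lambda>w. f w - g w)"
  using sq_integrable_add[OF assms(1) sq_integrable_scaleR[OF assms(2), of "-1"]] by simp

lemma sq_integrable_zero: "sq_integrable M (\<lambda>_. 0)"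
  by (simp add: sq_integrable_def)

lemma sq_integrable_sum:
  "(\<And>i. i \<in> I \<Longrightarrow> sq_integrable M (f i)) \<Longrightarrow> sq_integrable M (\<lambda>w. \<Sum>i\<in>I. f i w)"
  by (induction I rule: infinite_finite_induct) (auto simp: sq_integrable_zero intro: sq_integrable_add)

lemma sq_integrable_linear:
  assumes "linear T" "sq_integrable M f"
  shows "sq_integrable M (\<lambda>w. T (f w))"
proof -
  obtain b where b: "\<And>x. norm (T x) \<le> b * norm x" "b > 0" using linear_bounded_pos[OF assms(1)] by metis
  have [measurable]: "f \<in> borel_measurable M" "T \<in> borel_measurable borel"
    using assms by (auto simp: sq_integrable_def linear_conv_bounded_linear
        intro!: borel_measurable_continuous_onI linear_continuous_on)
  show ?thesis
  proof (rule sq_integrable_bound)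
    show "(\<lambda>w. T (f w)) \<in> borel_measurable M" by measurable
    show "integrable M (\<lambda>w. b\<^sup>2 * (norm (f w))\<^sup>2)" using assms by (simp add: sq_integrable_def)
    show "(norm (T (f w)))\<^sup>2 \<le> b\<^sup>2 * (norm (f w))\<^sup>2" for w
      using b(1)[of "f w"] by (metis norm_ge_zero power_mono power_mult_distrib)
  qed
qed

lemma abs_inner_le_sq: "\<bar>x \<bullet> y\<bar> \<le> (norm x)\<^sup>2 + (norm y)\<^sup>2"
proof -
  have "\<bar>x \<bullet> y\<bar> \<le> norm x * norm y" by (rule Cauchy_Schwarz_ineq2)
  also have "\<dots> \<le> (norm x)\<^sup>2 + (norm y)\<^sup>2"
    using sum_squares_bound[of "norm x" "norm y"] mult_nonneg_nonneg[OF norm_ge_zero[of x] norm_ge_zero[of y]]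
    by linarith
  finally show ?thesis .
qed

lemma sq_integrable_inner:
  assumes "sq_integrable M f" "sq_integrable M g"
  shows "integrable M (\<lambda>w. f w \<bullet> g w)"
proof (rule Bochner_Integration.integrable_bound)
  show "integrable M (\<lambda>w. (norm (f w))\<^sup>2 + (norm (g w))\<^sup>2)" using assms by (auto simp: sq_integrable_def)
  show "AE w in M. norm (f w \<bullet> g w) \<le> norm ((norm (f w))\<^sup>2 + (norm (g w))\<^sup>2)"
    by (intro AE_I2) (use abs_inner_le_sq in \<open>auto intro: order_trans[OF _ abs_ge_self]\<close>)
qed (use assms in \<open>auto simp: sq_integrable_def\<close>)

lemma (in finite_measure) sq_integrable_bounded:
  assumes "f \<in> borel_measurable M" "bounded (f ` space M)"
  shows "sq_integrable M f"
proof -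
  obtain b where "\<And>w. w \<in> space M \<Longrightarrow> norm (f w) \<le> b" using assms(2) by (auto simp: bounded_iff)
  thus ?thesis using assms(1)
    by (intro sq_integrable_bound[where g = "\<lambda>_. b\<^sup>2"]) (auto intro: power_mono)
qed

section \<open>Brownian increments and integrals of step processes\<close>

locale brownian_basis = prob_space M for M :: "'a measure" +
  fixes F :: "real \<Rightarrow> 'a measure" and W :: "real \<Rightarrow> 'a \<Rightarrow> real"
  assumes basis: "stoch_basis M F" and bm: "brownian_motion M F W"
begin

lemma space_F: "space (F t) = space M"
  using basis by (auto simp: stoch_basis_def subalgebra_def)

lemma measurable_F_M: "f \<in> measurable (F t) N \<Longrightarrow> f \<in> measurable M N"
  using basis measurable_from_subalg unfolding stoch_basis_def by blast

lemma measurable_F_mono: "s \<le> t \<Longrightarrow> f \<in> measurable (F s) N \<Longrightarrow> f \<in> measurable (F t) N"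
  by (rule measurable_from_subalg[of "F t" "F s"])
     (use basis filtration.sets_F_mono[of "space M" F s t] space_F in \<open>auto simp: stoch_basis_def subalgebra_def\<close>)

lemma W_measurable: "0 \<le> t \<Longrightarrow> W t \<in> borel_measurable (F t)"
  using bm by (simp add: brownian_motion_def)

lemma W_measurable_M: "0 \<le> t \<Longrightarrow> W t \<in> borel_measurable M"
  by (rule measurable_F_M[OF W_measurable])

lemma W_increment_measurable:
  "0 \<le> s \<Longrightarrow> s \<le> t \<Longrightarrow> (\<lambda>w. W t w - W s w) \<in> borel_measurable (F t)"
  by (intro borel_measurable_diff) (rule W_measurable, simp, rule measurable_F_mono[of s], simp, rule W_measurable, simp)

lemma increment_indep:
  assumes st: "0 \<le> s" "s < t" and Y: "Y \<in> borel_measurable (F s)"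
  shows "indep_var borel (Y :: 'a \<Rightarrow> real) borel (\<lambda>w. W t w - W s w)"
  unfolding indep_var_eq
proof (intro conjI)
  let ?D = "\<lambda>w. W t w - W s w"
  show YM: "random_variable borel Y" using Y by (rule measurable_F_M)
  show DM: "random_variable borel ?D" using st W_measurable_M by auto
  have ind: "indep_set (sets (F s)) (sets (vimage_algebra (space M) ?D borel))"
    using bm st by (simp add: brownian_motion_def)
  have "sigma_sets (space M) {Y -` A \<inter> space M |A. A \<in> sets borel} \<subseteq> sets (F s)"
    unfolding space_F[of s, symmetric] using measurable_sets[OF Y]
    by (intro sets.sigma_sets_subset) auto
  thus "indep_set (sigma_sets (space M) {Y -` A \<inter> space M |A. A \<in> sets borel})
    (sigma_sets (space M) {?D -` A \<inter> space M |A. A \<in> sets borel})"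
    using ind unfolding indep_sets2_eq sets_vimage_algebra by blast
qed

lemma increment_moments:
  assumes st: "0 \<le> s" "s < t"
  shows "integrable M (\<lambda>w. W t w - W s w)" "(\<integral>w. (W t w - W s w) \<partial>M) = 0"
    "integrable M (\<lambda>w. (W t w - W s w)\<^sup>2)" "(\<integral>w. (W t w - W s w)\<^sup>2 \<partial>M) = t - s"
proof -
  let ?D = "\<lambda>w. W t w - W s w" and ?n = "normal_density 0 (sqrt (t - s))"
  have d: "distributed M lborel ?D ?n" using bm st by (simp add: brownian_motion_def)
  have p: "0 < sqrt (t - s)" using st by simp
  have n: "\<And>x. 0 \<le> ?n x" by simp
  show "integrable M ?D"
    using distributed_integrable[OF d, of "\<lambda>x. x"] integrable_normal_moment_nz_1[OF p, of 0] by simp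
  show "integral\<^sup>L M ?D = 0"
    using distributed_integral[OF d, of "\<lambda>x. x"] integral_normal_moment_nz_1[OF p, of 0] by simp
  show "integrable M (\<lambda>w. (?D w)\<^sup>2)"
    using distributed_integrable[OF d, of "\<lambda>x. x\<^sup>2"] integrable_normal_moment[OF p, of 0 2] by simp
  have "(LBINT x. ?n x * x\<^sup>2) = t - s"
    using integral_normal_moment_even[OF p, of 0 1] st by (simp add: power2_eq_square field_simps)
  thus "(\<integral>w. (?D w)\<^sup>2 \<partial>M) = t - s"
    using distributed_integral[OF d, of "\<lambda>x. x\<^sup>2"] by simp
qed

text \<open>Independence of the past factors each expectation into that of \<open>Y\<close> and a
  Gaussian moment, \<open>0\<close> or \<open>t - s\<close>. The empty interval is treated apart
  because \<open>brownian_motion\<close> speaks of \<open>s < t\<close> only.\<close>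

lemma times_increment:
  assumes st: "0 \<le> s" "s \<le> t" and Y: "Y \<in> borel_measurable (F s)" "integrable M (Y :: 'a \<Rightarrow> real)"
  shows "integrable M (\<lambda>w. Y w * (W t w - W s w))" "(\<integral>w. Y w * (W t w - W s w) \<partial>M) = 0"
    "integrable M (\<lambda>w. Y w * (W t w - W s w)\<^sup>2)"
    "(\<integral>w. Y w * (W t w - W s w)\<^sup>2 \<partial>M) = (t - s) * (\<integral>w. Y w \<partial>M)"
proof -
  have "integrable M (\<lambda>w. Y w * (W t w - W s w)) \<and> (\<integral>w. Y w * (W t w - W s w) \<partial>M) = 0 \<and>
    integrable M (\<lambda>w. Y w * (W t w - W s w)\<^sup>2) \<and>
    (\<integral>w. Y w * (W t w - W s w)\<^sup>2 \<partial>M) = (t - s) * (\<integral>w. Y w \<partial>M)"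
  proof (cases "s = t")
    case False
    with st have st': "s < t" by simp
    note mom = increment_moments[OF st(1) st']
    have ind: "indep_var borel Y borel (\<lambda>w. W t w - W s w)" by (rule increment_indep[OF st(1) st' Y(1)])
    have ind2: "indep_var borel Y borel (\<lambda>w. (W t w - W s w)\<^sup>2)"
      using indep_var_compose[OF ind, of "\<lambda>x. x" borel "\<lambda>x. x\<^sup>2" borel] by (simp add: comp_def)
    show ?thesis
      using indep_var_integrable[OF ind Y(2) mom(1)] indep_var_integrable[OF ind2 Y(2) mom(3)]
        indep_var_lebesgue_integral[OF ind Y(2) mom(1)] indep_var_lebesgue_integral[OF ind2 Y(2) mom(3)] mom(2,4)
      by simp
  qed simp
  thus "integrable M (\<lambda>w. Y w * (W t w - W s w))" "(\<integral>w. Y w * (W t w - W s w) \<partial>M) = 0"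
    "integrable M (\<lambda>w. Y w * (W t w - W s w)\<^sup>2)"
    "(\<integral>w. Y w * (W t w - W s w)\<^sup>2 \<partial>M) = (t - s) * (\<integral>w. Y w \<partial>M)" by auto
qed

lemma sq_integrable_increment:
  assumes st: "0 \<le> s" "s \<le> t" and X: "X \<in> borel_measurable (F s)" "sq_integrable M X"
  shows "sq_integrable M (\<lambda>w. (W t w - W s w) *\<^sub>R X w)"
    "(\<integral>w. (norm ((W t w - W s w) *\<^sub>R X w))\<^sup>2 \<partial>M) = (t - s) * (\<integral>w. (norm (X w))\<^sup>2 \<partial>M)"
proof -
  have [measurable]: "W t \<in> borel_measurable M" "W s \<in> borel_measurable M" "X \<in> borel_measurable M"
    using st W_measurable_M X by (auto simp: sq_integrable_def)
  have Y: "(\<lambda>w. (norm (X w))\<^sup>2) \<in> borel_measurable (F s)" "integrable M (\<lambda>w. (norm (X w))\<^sup>2)"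
    using X by (auto simp: sq_integrable_def)
  have eq: "(norm ((W t w - W s w) *\<^sub>R X w))\<^sup>2 = (norm (X w))\<^sup>2 * (W t w - W s w)\<^sup>2" for w
    by (simp add: power_mult_distrib mult.commute)
  show "sq_integrable M (\<lambda>w. (W t w - W s w) *\<^sub>R X w)"
    "(\<integral>w. (norm ((W t w - W s w) *\<^sub>R X w))\<^sup>2 \<partial>M) = (t - s) * (\<integral>w. (norm (X w))\<^sup>2 \<partial>M)"
    using times_increment[OF st Y] unfolding sq_integrable_def eq by auto
qed

lemma orthogonal_increment:
  assumes st: "0 \<le> s" "s \<le> t" and X: "X \<in> borel_measurable (F s)" "sq_integrable M X"
    and Y: "Y \<in> borel_measurable (F s)" "sq_integrable M Y"
  shows "(\<integral>w. Y w \<bullet> ((W t w - W s w) *\<^sub>R X w) \<partial>M) = 0"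
  using times_increment(2)[OF st, of "\<lambda>w. Y w \<bullet> X w"] X Y
  by (simp add: sq_integrable_inner mult.commute)

text \<open>Step integrands with square integrable coefficients; the coefficients of an elementary process
  are bounded instead.\<close>

definition step_data :: "nat \<Rightarrow> (nat \<Rightarrow> real) \<Rightarrow> (nat \<Rightarrow> 'a \<Rightarrow> 'b::euclidean_space) \<Rightarrow> bool" where
  "step_data k \<tau> \<xi> \<longleftrightarrow> 0 \<le> \<tau> 0 \<and>
     (\<forall>j<k. \<tau> j \<le> \<tau> (Suc j) \<and> \<xi> j \<in> borel_measurable (F (\<tau> j)) \<and> sq_integrable M (\<xi> j))"

lemma step_data_elementary: "elementary_data M F t k \<tau> \<xi> \<Longrightarrow> step_data k \<tau> \<xi>"
  unfolding elementary_data_def step_data_def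
  by (auto intro!: sq_integrable_bounded measurable_F_M)

lemma step_data_mono: "step_data k \<tau> \<xi> \<Longrightarrow> i \<le> j \<Longrightarrow> j \<le> k \<Longrightarrow> \<tau> i \<le> \<tau> j"
proof (induction j)
  case (Suc j)
  show ?case
  proof (cases "i = Suc j")
    case False
    hence "\<tau> i \<le> \<tau> j" using Suc by auto
    also have "\<tau> j \<le> \<tau> (Suc j)" using Suc.prems by (auto simp: step_data_def)
    finally show ?thesis .
  qed simp
qed simp

lemma step_data_nonneg: "step_data k \<tau> \<xi> \<Longrightarrow> j \<le> k \<Longrightarrow> 0 \<le> \<tau> j"
  using step_data_mono[of k \<tau> \<xi> 0 j] by (auto simp: step_data_def)

text \<open>The integral up to \<open>\<tau> k\<close> is known at time \<open>\<tau> k\<close>,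
  hence orthogonal to the next increment, and the second moments add up. Measurability is part of
  the induction for this reason.\<close>

lemma step_isometry:
  fixes \<xi> :: "nat \<Rightarrow> 'a \<Rightarrow> 'b::euclidean_space"
  assumes "step_data k \<tau> \<xi>"
  shows "elementary_integral W k \<tau> \<xi> \<in> borel_measurable (F (\<tau> k)) \<and>
    sq_integrable M (elementary_integral W k \<tau> \<xi>) \<and>
    (\<integral>w. (norm (elementary_integral W k \<tau> \<xi> w))\<^sup>2 \<partial>M)
      = (\<Sum>j<k. (\<tau> (Suc j) - \<tau> j) * (\<integral>w. (norm (\<xi> j w))\<^sup>2 \<partial>M))"
  using assms
proof (induction k)
  case 0
  have "elementary_integral W 0 \<tau> \<xi> = (\<lambda>_. 0)" by (simp add: elementary_integral_def fun_eq_iff)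
  thus ?case by (simp add: sq_integrable_zero)
next
  case (Suc k)
  let ?I = "elementary_integral W k \<tau> \<xi>" and ?D = "\<lambda>w. (W (\<tau> (Suc k)) w - W (\<tau> k) w) *\<^sub>R \<xi> k w"
  have sd: "step_data k \<tau> \<xi>" using Suc.prems by (auto simp: step_data_def)
  note IH = Suc.IH[OF sd]
  have t: "0 \<le> \<tau> k" "\<tau> k \<le> \<tau> (Suc k)" and X: "\<xi> k \<in> borel_measurable (F (\<tau> k))" "sq_integrable M (\<xi> k)"
    using Suc.prems step_data_nonneg[OF Suc.prems, of k] by (auto simp: step_data_def)
  have eq: "elementary_integral W (Suc k) \<tau> \<xi> = (\<lambda>w. ?I w + ?D w)"
    by (simp add: elementary_integral_def fun_eq_iff)
  note D = sq_integrable_increment[OF t X]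
  have orth: "(\<integral>w. ?I w \<bullet> ?D w \<partial>M) = 0" using orthogonal_increment[OF t X] IH by blast
  have "(norm (?I w + ?D w))\<^sup>2 = (norm (?I w))\<^sup>2 + 2 * (?I w \<bullet> ?D w) + (norm (?D w))\<^sup>2" for w
    unfolding power2_norm_eq_inner by (simp add: inner_add_left inner_add_right inner_commute)
  moreover have "integrable M (\<lambda>w. (norm (?I w))\<^sup>2)" "integrable M (\<lambda>w. (norm (?D w))\<^sup>2)"
    "integrable M (\<lambda>w. ?I w \<bullet> ?D w)"
    using IH D(1) by (auto simp only: sq_integrable_norm intro!: sq_integrable_inner)
  ultimately have "(\<integral>w. (norm (?I w + ?D w))\<^sup>2 \<partial>M)
      = (\<integral>w. (norm (?I w))\<^sup>2 \<partial>M) + (\<integral>w. (norm (?D w))\<^sup>2 \<partial>M)"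
    using orth by (simp only: Bochner_Integration.integral_add Bochner_Integration.integrable_add
        integral_mult_right_zero integrable_mult_right)
  moreover have "(\<lambda>w. ?I w + ?D w) \<in> borel_measurable (F (\<tau> (Suc k)))"
    using IH X t by (intro borel_measurable_add borel_measurable_scaleR W_increment_measurable)
       (auto intro: measurable_F_mono)
  ultimately show ?case using IH D by (simp add: eq sq_integrable_add)
qed

text \<open>Applied to partitions that start at some \<open>r\<close> instead of 0, where it says
  that the integral over later times is orthogonal to what is known at \<open>r\<close>;
  \<open>step_data\<close> therefore leaves \<open>\<tau> 0\<close> free.\<close>

lemma step_orthogonal:
  fixes \<xi> :: "nat \<Rightarrow> 'a \<Rightarrow> 'b::euclidean_space"
  assumes sd: "step_data k \<tau> \<xi>" and Y: "Y \<in> borel_measurable (F (\<tau> 0))" "sq_integrable M Y"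
  shows "(\<integral>w. Y w \<bullet> elementary_integral W k \<tau> \<xi> w \<partial>M) = 0"
proof -
  have *: "(\<integral>w. Y w \<bullet> ((W (\<tau> (Suc j)) w - W (\<tau> j) w) *\<^sub>R \<xi> j w) \<partial>M) = 0"
    "integrable M (\<lambda>w. Y w \<bullet> ((W (\<tau> (Suc j)) w - W (\<tau> j) w) *\<^sub>R \<xi> j w))" if j: "j < k" for j
  proof -
    have t: "0 \<le> \<tau> j" "\<tau> j \<le> \<tau> (Suc j)" and X: "\<xi> j \<in> borel_measurable (F (\<tau> j))" "sq_integrable M (\<xi> j)"
      using sd j step_data_nonneg[OF sd, of j] by (auto simp: step_data_def)
    have "\<tau> 0 \<le> \<tau> j" using step_data_mono[OF sd, of 0 j] j by simp
    hence "Y \<in> borel_measurable (F (\<tau> j))" using measurable_F_mono Y by blast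
    from orthogonal_increment[OF t X this Y(2)] sq_integrable_inner[OF Y(2) sq_integrable_increment(1)[OF t X]]
    show "(\<integral>w. Y w \<bullet> ((W (\<tau> (Suc j)) w - W (\<tau> j) w) *\<^sub>R \<xi> j w) \<partial>M) = 0"
     "integrable M (\<lambda>w. Y w \<bullet> ((W (\<tau> (Suc j)) w - W (\<tau> j) w) *\<^sub>R \<xi> j w))" by auto
  qed
  thus ?thesis unfolding elementary_integral_def inner_sum_right by (subst Bochner_Integration.integral_sum) auto
qed

text \<open>Switching the coefficients off as soon as an \<open>F (\<tau> j)\<close>-measurable condition fails is the discrete
  form of stopping.\<close>

lemma step_data_indicator:
  assumes sd: "step_data k \<tau> \<xi>" and A: "\<And>j. j < k \<Longrightarrow> Measurable.pred (F (\<tau> j)) (A j)"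
  shows "step_data k \<tau> (\<lambda>j w. if A j w then \<xi> j w else 0)"
  unfolding step_data_def
proof (intro conjI allI impI)
  fix j assume j: "j < k"
  have [measurable]: "\<xi> j \<in> borel_measurable (F (\<tau> j))" "Measurable.pred (F (\<tau> j)) (A j)"
    using sd A j by (auto simp: step_data_def)
  show m: "(\<lambda>w. if A j w then \<xi> j w else 0) \<in> borel_measurable (F (\<tau> j))" by measurable
  show "sq_integrable M (\<lambda>w. if A j w then \<xi> j w else 0)"
    by (rule sq_integrable_bound[OF measurable_F_M[OF m], of "\<lambda>w. (norm (\<xi> j w))\<^sup>2"])
       (use sd j in \<open>auto simp: step_data_def sq_integrable_def\<close>)
qed (use sd in \<open>auto simp: step_data_def\<close>)

text \<open>Kolmogorov's argument: the coefficients are switched off once a partial integral exceeds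
  \<open>c\<close>. On the event in question the stopped integral keeps that large value until the
  end, so Chebyshev's inequality at the final index and the isometry suffice.\<close>

lemma step_maximal_inequality:
  fixes \<xi> :: "nat \<Rightarrow> 'a \<Rightarrow> 'b::euclidean_space"
  assumes sd: "step_data k \<tau> \<xi>" and l: "c > 0"
  shows "measure M {w \<in> space M. \<exists>j\<le>k. c < norm (elementary_integral W j \<tau> \<xi> w)}
    \<le> (\<Sum>j<k. (\<tau> (Suc j) - \<tau> j) * (\<integral>w. (norm (\<xi> j w))\<^sup>2 \<partial>M)) / c\<^sup>2"
proof -
  \<comment> \<open>The condition includes index \<open>j\<close> itself: \<open>\<xi> j\<close>
    enters the integral only at index \<open>Suc j\<close>, so the stopped integral freezes at the
    first value above \<open>c\<close>, not at the one before.\<close>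
  define A where "A j w \<longleftrightarrow> (\<forall>i\<in>{..j}. norm (elementary_integral W i \<tau> \<xi> w) \<le> c)" for j w
  define \<eta> where "\<eta> j w = (if A j w then \<xi> j w else 0)" for j w
  have sdj: "step_data j \<tau> \<xi>" if "j \<le> k" for j using sd that by (auto simp: step_data_def)
  have meas: "elementary_integral W i \<tau> \<xi> \<in> borel_measurable (F (\<tau> j))" if "i \<le> j" "j \<le> k" for i j
    using step_isometry[OF sdj[of i]] step_data_mono[OF sd that] that measurable_F_mono by auto
  have pred: "Measurable.pred (F (\<tau> j)) (A j)" if "j < k" for j
    unfolding A_def using meas that
    by (intro pred_intros_finite) (auto intro!: borel_measurable_pred_less borel_measurable_norm)
  have sd': "step_data k \<tau> \<eta>" unfolding \<eta>_def using step_data_indicator[OF sd pred] by blast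
  have key: "c < norm (elementary_integral W k \<tau> \<eta> w)"
    if ex: "\<exists>j\<le>k. c < norm (elementary_integral W j \<tau> \<xi> w)" for w
  proof -
    define j where "j = (LEAST j. c < norm (elementary_integral W j \<tau> \<xi> w))"
    have j: "c < norm (elementary_integral W j \<tau> \<xi> w)" "j \<le> k"
      using LeastI_ex[of "\<lambda>j. c < norm (elementary_integral W j \<tau> \<xi> w)"] ex unfolding j_def
      by (auto intro: Least_le order_trans)
    have small: "norm (elementary_integral W i \<tau> \<xi> w) \<le> c" if "i < j" for i
      using not_less_Least[of i "\<lambda>j. c < norm (elementary_integral W j \<tau> \<xi> w)"] that unfolding j_def by auto
    have A: "A i w \<longleftrightarrow> i < j" for i
    proof
      assume "A i w"
      thus "i < j" unfolding A_def using j(1) by (meson atMost_iff linorder_not_le)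
    qed (auto simp: A_def small)
    have "elementary_integral W k \<tau> \<eta> w = (\<Sum>i<k. if i < j then (W (\<tau> (Suc i)) w - W (\<tau> i) w) *\<^sub>R \<xi> i w else 0)"
      unfolding elementary_integral_def \<eta>_def A by (intro sum.cong) auto
    also have "\<dots> = (\<Sum>i\<in>{..<k} \<inter> {i. i < j}. (W (\<tau> (Suc i)) w - W (\<tau> i) w) *\<^sub>R \<xi> i w)"
      by (simp add: sum.inter_restrict)
    also have "{..<k} \<inter> {i. i < j} = {..<j}" using j(2) by auto
    finally show ?thesis using j(1) by (simp add: elementary_integral_def)
  qed
  note iso = step_isometry[OF sd']
  have [measurable]: "elementary_integral W j \<tau> \<xi> \<in> borel_measurable M" if "j \<le> k" for j
    using step_isometry[OF sdj[OF that]] by (auto simp: sq_integrable_def)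
  have [measurable]: "elementary_integral W k \<tau> \<eta> \<in> borel_measurable M" using iso by (auto simp: sq_integrable_def)
  have "measure M {w \<in> space M. \<exists>j\<le>k. c < norm (elementary_integral W j \<tau> \<xi> w)}
      \<le> measure M {w \<in> space M. c\<^sup>2 \<le> (norm (elementary_integral W k \<tau> \<eta> w))\<^sup>2}"
  proof (rule finite_measure_mono)
    have "c\<^sup>2 \<le> (norm (elementary_integral W k \<tau> \<eta> w))\<^sup>2"
      if "\<exists>j\<le>k. c < norm (elementary_integral W j \<tau> \<xi> w)" for w
      using key[OF that] l by (intro power_mono) auto
    thus "{w \<in> space M. \<exists>j\<le>k. c < norm (elementary_integral W j \<tau> \<xi> w)}
      \<subseteq> {w \<in> space M. c\<^sup>2 \<le> (norm (elementary_integral W k \<tau> \<eta> w))\<^sup>2}" by blast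
  qed measurable
  also have "\<dots> \<le> (\<integral>w. (norm (elementary_integral W k \<tau> \<eta> w))\<^sup>2 \<partial>M) / c\<^sup>2"
    using iso l by (intro integral_Markov_inequality_measure[where A = "{}"]) (auto simp: sq_integrable_def)
  also have "\<dots> \<le> (\<Sum>j<k. (\<tau> (Suc j) - \<tau> j) * (\<integral>w. (norm (\<xi> j w))\<^sup>2 \<partial>M)) / c\<^sup>2"
  proof (rule divide_right_mono)
    have "(\<integral>w. (norm (\<eta> j w))\<^sup>2 \<partial>M) \<le> (\<integral>w. (norm (\<xi> j w))\<^sup>2 \<partial>M)" if "j < k" for j
      by (rule integral_mono) (use sd sd' that in \<open>auto simp: step_data_def sq_integrable_def \<eta>_def\<close>)
    thus "(\<integral>w. (norm (elementary_integral W k \<tau> \<eta> w))\<^sup>2 \<partial>M)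
        \<le> (\<Sum>j<k. (\<tau> (Suc j) - \<tau> j) * (\<integral>w. (norm (\<xi> j w))\<^sup>2 \<partial>M))"
      using iso sd by (auto intro!: sum_mono mult_left_mono simp: step_data_def)
  qed simp
  finally show ?thesis .
qed

end

section \<open>Ito integrals\<close>

lemma AE_tendsto_0_if_summable:
  fixes f :: "nat \<Rightarrow> 'a \<Rightarrow> ennreal"
  assumes [measurable]: "\<And>m. f m \<in> borel_measurable M"
    and le: "\<And>m. (\<integral>\<^sup>+ w. f m w \<partial>M) \<le> ennreal (c * r ^ m)" and c: "0 \<le> c" "0 \<le> r" "r < 1"
  shows "AE w in M. (\<lambda>m. f m w) \<longlonglongrightarrow> 0"
proof -
  \<comment> \<open>Summable expectations make the whole series finite almost surely, and the terms
    of a convergent series tend to 0.\<close>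
  have "(\<integral>\<^sup>+ w. (\<Sum>m. f m w) \<partial>M) = (\<Sum>m. \<integral>\<^sup>+ w. f m w \<partial>M)" by (rule nn_integral_suminf) measurable
  also have "\<dots> \<le> (\<Sum>m. ennreal (c * r ^ m))" by (intro suminf_le le) auto
  also have "\<dots> = ennreal (\<Sum>m. c * r ^ m)"
    using c by (intro suminf_ennreal2 summable_mult summable_geometric) auto
  also have "\<dots> < \<infinity>" by simp
  finally have "(\<integral>\<^sup>+ w. (\<Sum>m. f m w) \<partial>M) \<noteq> \<infinity>" by simp
  hence "AE w in M. (\<Sum>m. f m w) \<noteq> \<infinity>" by (intro nn_integral_PInf_AE) measurable
  thus ?thesis
  proof (rule AE_mp, intro AE_I2 impI)
    fix w assume fin: "(\<Sum>m. f m w) \<noteq> \<infinity>"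
    have "f m w \<noteq> top" for m
      using fin ennreal_suminf_lessD[of "\<lambda>m. f m w" top m] by (simp add: less_top)
    hence eq: "f m w = ennreal (enn2real (f m w))" for m by (simp add: less_top)
    hence "(\<Sum>m. ennreal (enn2real (f m w))) \<noteq> top" using fin by simp
    hence "summable (\<lambda>m. enn2real (f m w))" by (intro summable_suminf_not_top) auto
    hence "(\<lambda>m. enn2real (f m w)) \<longlonglongrightarrow> 0" by (rule summable_LIMSEQ_zero)
    hence "(\<lambda>m. ennreal (enn2real (f m w))) \<longlonglongrightarrow> ennreal 0" by (rule tendsto_ennrealI)
    thus "(\<lambda>m. f m w) \<longlonglongrightarrow> 0" using eq by simp
  qed
qed

lemma tendsto_0_if_min_tendsto_0:
  fixes f :: "nat \<Rightarrow> ennreal"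
  assumes "(\<lambda>m. min 1 (f m)) \<longlonglongrightarrow> 0"
  shows "f \<longlonglongrightarrow> 0"
proof -
  have "eventually (\<lambda>m. min 1 (f m) < 1) sequentially" using assms by (rule order_tendstoD) simp
  hence "eventually (\<lambda>m. min 1 (f m) = f m) sequentially"
    by eventually_elim (auto simp: min_def split: if_splits)
  from Lim_transform_eventually[OF assms this] show ?thesis .
qed

text \<open>Split at the threshold \<open>e / 2\<close>: below it the integrand is small, above it
  the integrand is at most \<open>c\<close> on an event of vanishing probability.\<close>

lemma (in prob_space) nn_integral_min_tendsto_0:
  fixes f :: "nat \<Rightarrow> 'a \<Rightarrow> ennreal"
  assumes [measurable]: "\<And>m. f m \<in> borel_measurable M"
    and conv: "\<And>\<epsilon>::real. \<epsilon> > 0 \<Longrightarrow> (\<lambda>m. measure M {w \<in> space M. ennreal \<epsilon> < f m w}) \<longlonglongrightarrow> 0"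
    and c: "0 \<le> c"
  shows "(\<lambda>m. \<integral>\<^sup>+ w. min (ennreal c) (f m w) \<partial>M) \<longlonglongrightarrow> 0"
proof (rule tendsto_0_if_min_tendsto_0, rule order_tendstoI)
  fix a :: ennreal assume "0 < a"
  then obtain e :: real where e: "e > 0" "ennreal e < a"
  proof (cases a)
    case (real r)
    with \<open>0 < a\<close> that[of "r / 2"] show thesis by (auto simp: ennreal_less_iff)
  next
    case top
    with that[of 1] show thesis by simp
  qed
  have le: "(\<integral>\<^sup>+ w. min (ennreal c) (f m w) \<partial>M) \<le> ennreal (e / 2 + c * measure M {w \<in> space M. ennreal (e/2) < f m w})" for m
  proof -
    have "(\<integral>\<^sup>+ w. min (ennreal c) (f m w) \<partial>M)
        \<le> (\<integral>\<^sup>+ w. ennreal (e/2) + ennreal c * indicator {w \<in> space M. ennreal (e/2) < f m w} w \<partial>M)"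
      by (intro nn_integral_mono) (auto simp: indicator_def min_def intro: add_increasing)
    also have "\<dots> = ennreal (e/2) + ennreal c * emeasure M {w \<in> space M. ennreal (e/2) < f m w}"
      by (subst nn_integral_add) (auto simp: nn_integral_cmult emeasure_space_1)
    also have "\<dots> = ennreal (e / 2 + c * measure M {w \<in> space M. ennreal (e/2) < f m w})"
      using e c by (simp add: emeasure_eq_measure ennreal_mult ennreal_plus)
    finally show ?thesis .
  qed
  have "(\<lambda>m. e / 2 + c * measure M {w \<in> space M. ennreal (e/2) < f m w}) \<longlonglongrightarrow> e / 2 + c * 0"
    using e by (intro tendsto_intros conv) simp
  hence "eventually (\<lambda>m. e / 2 + c * measure M {w \<in> space M. ennreal (e/2) < f m w} < e) sequentially"
    by (rule order_tendstoD) (use e in simp)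
  thus "eventually (\<lambda>m. min 1 (\<integral>\<^sup>+ w. min (ennreal c) (f m w) \<partial>M) < a) sequentially"
  proof eventually_elim
    case (elim m)
    have "(\<integral>\<^sup>+ w. min (ennreal c) (f m w) \<partial>M) \<le> ennreal e" using le[of m] elim
      by (meson ennreal_leI less_imp_le order_trans)
    thus ?case using e(2) by (meson min_le_iff_disj order_refl order_le_less_trans min.cobounded2)
  qed
qed simp

text \<open>An almost sure limit of a sequence bounded in \<open>L2\<close> is also its weak limit.
  Where \<open>|X| \<le> K * |Y|\<close> the product is dominated by \<open>K * |Y|^2\<close>;
  elsewhere it is at most \<open>|X|^2 / K\<close>, with integral at most
  \<open>c / K\<close>.\<close>

lemma (in prob_space) weak_convergence_inner:
  fixes X :: "nat \<Rightarrow> 'a \<Rightarrow> 'b::euclidean_space"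
  assumes X: "\<And>m. sq_integrable M (X m)" "\<And>m. (\<integral>w. (norm (X m w))\<^sup>2 \<partial>M) \<le> c"
    and lim: "AE w in M. (\<lambda>m. X m w) \<longlonglongrightarrow> 0" and Y: "sq_integrable M Y"
  shows "(\<lambda>m. \<integral>w. Y w \<bullet> X m w \<partial>M) \<longlonglongrightarrow> 0"
proof (rule LIMSEQ_I)
  have [measurable]: "X m \<in> borel_measurable M" "Y \<in> borel_measurable M" for m
    using X Y by (auto simp: sq_integrable_def)
  fix e :: real assume e: "e > 0"
  \<comment> \<open>Large enough for \<open>c / K \<le> e / 2\<close>; the summand 1 keeps
    \<open>K\<close> positive.\<close>
  define K where "K = 2 * (\<bar>c\<bar> + 1) / e"
  have K: "K > 0" using e by (simp add: K_def)
  have "c \<le> e / 2 * K" using e by (simp add: K_def)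
  hence cK: "c / K \<le> e / 2" using K by (simp add: pos_divide_le_eq)
  define g where "g m w = norm (Y w) * min (norm (X m w)) (K * norm (Y w))" for m w
  have [measurable]: "g m \<in> borel_measurable M" for m unfolding g_def by measurable
  have gle: "\<bar>g m w\<bar> \<le> K * (norm (Y w))\<^sup>2" and g0: "0 \<le> g m w" for m w
    using K by (auto simp: g_def power2_eq_square abs_mult intro!: mult_left_mono
      order_trans[OF mult_left_mono[OF min.cobounded2[of "norm (X m w)" "K * norm (Y w)"] norm_ge_zero]])
  have intY: "integrable M (\<lambda>w. K * (norm (Y w))\<^sup>2)" using Y by (simp add: sq_integrable_def)
  have "(\<lambda>m. \<integral>w. g m w \<partial>M) \<longlonglongrightarrow> (\<integral>w. 0 \<partial>M)"
  proof (rule integral_dominated_convergence[where w = "\<lambda>w. K * (norm (Y w))\<^sup>2"])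
    show "AE w in M. (\<lambda>m. g m w) \<longlonglongrightarrow> 0" using lim
    proof eventually_elim
      case (elim w)
      have "(\<lambda>m. norm (Y w) * min (norm (X m w)) (K * norm (Y w))) \<longlonglongrightarrow> norm (Y w) * min 0 (K * norm (Y w))"
        using tendsto_norm_zero[OF elim] by (intro tendsto_intros) 
      thus ?case using K by (simp add: g_def min_def)
    qed
  qed (use gle intY in \<open>auto\<close>)
  hence "eventually (\<lambda>m. (\<integral>w. g m w \<partial>M) < e / 2) sequentially"
    by (rule order_tendstoD) (use e in simp)
  then obtain m0 where m0: "\<And>m. m \<ge> m0 \<Longrightarrow> (\<integral>w. g m w \<partial>M) < e / 2" by (auto simp: eventually_sequentially)
  have "norm (\<integral>w. Y w \<bullet> X m w \<partial>M) < e" if "m \<ge> m0" for m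
  proof -
    have intg: "integrable M (g m)"
      by (rule Bochner_Integration.integrable_bound[OF intY]) (use gle in \<open>auto intro: order_trans[OF _ abs_ge_self]\<close>)
    have pt: "\<bar>Y w \<bullet> X m w\<bar> \<le> g m w + (norm (X m w))\<^sup>2 / K" for w
    proof -
      have "norm (Y w) * norm (X m w) \<le> g m w + (norm (X m w))\<^sup>2 / K"
      proof (cases "norm (X m w) \<le> K * norm (Y w)")
        case True thus ?thesis using K by (simp add: g_def)
      next
        case False
        hence "norm (Y w) \<le> norm (X m w) / K" using K by (simp add: pos_le_divide_eq mult.commute)
        hence "norm (Y w) * norm (X m w) \<le> norm (X m w) / K * norm (X m w)" by (intro mult_right_mono) auto
        thus ?thesis using g0[of m w] by (simp add: power2_eq_square)
      qed
      thus ?thesis using Cauchy_Schwarz_ineq2[of "Y w" "X m w"] by linarith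
    qed
    have "norm (\<integral>w. Y w \<bullet> X m w \<partial>M) \<le> (\<integral>w. \<bar>Y w \<bullet> X m w\<bar> \<partial>M)"
      using integral_norm_bound[of M "\<lambda>w. Y w \<bullet> X m w"] by simp
    also have "\<dots> \<le> (\<integral>w. g m w + (norm (X m w))\<^sup>2 / K \<partial>M)"
      using intg X(1)[of m] Y pt by (intro integral_mono Bochner_Integration.integrable_abs sq_integrable_inner Bochner_Integration.integrable_add)
        (auto simp: sq_integrable_def)
    also have "\<dots> = (\<integral>w. g m w \<partial>M) + (\<integral>w. (norm (X m w))\<^sup>2 \<partial>M) / K"
      using intg X(1)[of m] by (subst Bochner_Integration.integral_add) (auto simp: sq_integrable_def)
    also have "\<dots> \<le> (\<integral>w. g m w \<partial>M) + c / K" using X(2)[of m] K by (simp add: divide_right_mono)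
    also have "\<dots> < e" using m0[OF that] cK by linarith
    finally show ?thesis .
  qed
  thus "\<exists>no. \<forall>n\<ge>no. norm ((\<integral>w. Y w \<bullet> X n w \<partial>M) - 0) < e" by auto
qed

section \<open>Elementary processes and the energy of a path\<close>

lemma partition_mono:
  fixes \<tau> :: "nat \<Rightarrow> real"
  assumes mono: "\<And>i. i < k \<Longrightarrow> \<tau> i \<le> \<tau> (Suc i)" and "a \<le> b" "b \<le> k"
  shows "\<tau> a \<le> \<tau> b"
  using assms(2,3)
proof (induction b)
  case (Suc b)
  thus ?case using mono[of b] by (cases "a = Suc b") auto
qed simp

lemma elementary_process_eq:
  assumes mono: "\<And>i. i < k \<Longrightarrow> \<tau> i \<le> \<tau> (Suc i)" and j: "j < k" "\<tau> j < s" "s \<le> \<tau> (Suc j)"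
  shows "elementary_process k \<tau> \<xi> s w = \<xi> j w"
proof -
  note m = partition_mono[of k \<tau>, OF mono]
  have "indicat_real {\<tau> i<..\<tau> (Suc i)} s = (if i = j then 1 else 0)" if "i < k" for i
  proof (cases i j rule: linorder_cases)
    case less
    hence "\<tau> (Suc i) \<le> \<tau> j" using j by (intro m) auto
    thus ?thesis using j less by (auto simp: indicator_def)
  next
    case greater
    hence "\<tau> (Suc j) \<le> \<tau> i" using that by (intro m) auto
    thus ?thesis using j greater by (auto simp: indicator_def)
  qed (use j in auto)
  hence "elementary_process k \<tau> \<xi> s w = (\<Sum>i<k. (if i = j then 1 else 0) *\<^sub>R \<xi> i w)"
    unfolding elementary_process_def by (intro sum.cong) auto
  also have "\<dots> = \<xi> j w" using j by (simp add: if_distrib[of "\<lambda>c. c *\<^sub>R _"] cong: if_cong)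
  finally show ?thesis .
qed

lemma norm_elementary_process:
  assumes mono: "\<And>i. i < k \<Longrightarrow> \<tau> i \<le> \<tau> (Suc i)"
  shows "(norm (elementary_process k \<tau> \<xi> s w))\<^sup>2 = (\<Sum>j<k. indicator {\<tau> j<..\<tau> (Suc j)} s * (norm (\<xi> j w))\<^sup>2)"
proof (cases "\<exists>j<k. \<tau> j < s \<and> s \<le> \<tau> (Suc j)")
  case True
  then obtain j where j: "j < k" "\<tau> j < s" "s \<le> \<tau> (Suc j)" by blast
  show ?thesis
    using elementary_process_eq[OF mono j, of \<xi> w]
      elementary_process_eq[OF mono j, of "\<lambda>j _. (norm (\<xi> j w))\<^sup>2" undefined]
    by (simp add: elementary_process_def)
next
  case False
  hence "indicat_real {\<tau> j<..\<tau> (Suc j)} s = 0" if "j < k" for j using that by (auto simp: indicator_def)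
  thus ?thesis by (simp add: elementary_process_def)
qed

definition step_energy :: "nat \<Rightarrow> (nat \<Rightarrow> real) \<Rightarrow> (nat \<Rightarrow> 'a \<Rightarrow> 'b::euclidean_space) \<Rightarrow> 'a \<Rightarrow> real" where
  "step_energy k \<tau> \<xi> w = (\<Sum>j<k. (\<tau> (Suc j) - \<tau> j) * (norm (\<xi> j w))\<^sup>2)"

text \<open>The squared \<open>L2\<close> norm of one path. It is extended-valued, as nothing
  prevents single paths of an integrand from having infinite energy.\<close>

definition energy :: "real \<Rightarrow> (real \<Rightarrow> 'a \<Rightarrow> 'b::euclidean_space) \<Rightarrow> 'a \<Rightarrow> ennreal" where
  "energy t H w = (\<integral>\<^sup>+ s\<in>{0..t}. ennreal ((norm (H s w))\<^sup>2) \<partial>lborel)"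

lemma energy_elementary:
  assumes "elementary_data M F t k \<tau> \<xi>"
  shows "energy t (elementary_process k \<tau> \<xi>) w = ennreal (step_energy k \<tau> \<xi> w)"
proof -
  have mono: "\<And>i. i < k \<Longrightarrow> \<tau> i \<le> \<tau> (Suc i)" and t: "\<tau> 0 = 0" "\<tau> k = t"
    using assms by (auto simp: elementary_data_def)
  note m = partition_mono[of k \<tau>, OF mono]
  have sub: "ennreal (indicator {\<tau> j<..\<tau> (Suc j)} s * c) * indicator {0..t} s = ennreal c * indicator {\<tau> j<..\<tau> (Suc j)} s"
    if "j < k" for j s c
    using m[of 0 j] m[of "Suc j" k] t that by (auto simp: indicator_def)
  have pt: "ennreal ((norm (elementary_process k \<tau> \<xi> s w))\<^sup>2) * indicator {0..t} s
      = (\<Sum>j<k. ennreal ((norm (\<xi> j w))\<^sup>2) * indicator {\<tau> j<..\<tau> (Suc j)} s)" for s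
  proof -
    have "ennreal ((norm (elementary_process k \<tau> \<xi> s w))\<^sup>2)
      = (\<Sum>j<k. ennreal (indicator {\<tau> j<..\<tau> (Suc j)} s * (norm (\<xi> j w))\<^sup>2))"
      by (subst norm_elementary_process) (auto simp: mono intro!: sum_ennreal[symmetric])
    thus ?thesis by (simp only: sum_distrib_right) (intro sum.cong refl sub, simp)
  qed
  have "energy t (elementary_process k \<tau> \<xi>) w
      = (\<integral>\<^sup>+ s. (\<Sum>j<k. ennreal ((norm (\<xi> j w))\<^sup>2) * indicator {\<tau> j<..\<tau> (Suc j)} s) \<partial>lborel)"
    unfolding energy_def pt ..
  also have "\<dots> = (\<Sum>j<k. ennreal ((norm (\<xi> j w))\<^sup>2) * ennreal (\<tau> (Suc j) - \<tau> j))"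
    by (subst nn_integral_sum) (auto simp: nn_integral_cmult mono intro!: sum.cong)
  also have "\<dots> = ennreal (step_energy k \<tau> \<xi> w)"
    unfolding step_energy_def by (subst sum_ennreal[symmetric]) (auto simp: mono ennreal_mult mult.commute intro!: sum.cong)
  finally show ?thesis .
qed

lemma energy_mono: "r \<le> t \<Longrightarrow> energy r H w \<le> energy t H w"
  unfolding energy_def by (intro nn_integral_mono mult_left_mono) (auto simp: indicator_def)

text \<open>Young's inequality with a free parameter: the factor of \<open>y\<close> may be taken as
  close to 1 as desired, so that approximating an integrand does not spoil the constant 1 in the
  localised isometry.\<close>

lemma norm_sq_eps_le:
  fixes x y :: "'b::real_inner"
  assumes "e > 0"
  shows "(norm x)\<^sup>2 \<le> (1 + e) * (norm y)\<^sup>2 + (1 + 1 / e) * (norm (x - y))\<^sup>2"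
proof -
  define z where "z = x - y"
  have "0 \<le> (norm (sqrt e *\<^sub>R y - (1 / sqrt e) *\<^sub>R z))\<^sup>2" by simp
  also have "\<dots> = e * (norm y)\<^sup>2 - 2 * (y \<bullet> z) + (1 / e) * (norm z)\<^sup>2"
    using assms unfolding power2_norm_eq_inner
    by (simp add: inner_diff_left inner_diff_right inner_commute power_divide field_simps)
  finally have "2 * (y \<bullet> z) \<le> e * (norm y)\<^sup>2 + (1 / e) * (norm z)\<^sup>2" by simp
  moreover have "(norm x)\<^sup>2 = (norm y)\<^sup>2 + 2 * (y \<bullet> z) + (norm z)\<^sup>2"
    unfolding power2_norm_eq_inner z_def by (simp add: inner_diff_left inner_diff_right inner_commute)
  ultimately show ?thesis by (simp add: z_def algebra_simps)
qed

lemma energy_eps_le: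
  fixes G H :: "real \<Rightarrow> 'a \<Rightarrow> 'b::euclidean_space"
  assumes e: "e > 0"
    and [measurable]: "(\<lambda>s. indicator {0..t} s *\<^sub>R H s w) \<in> borel_measurable lborel"
      "(\<lambda>s. indicator {0..t} s *\<^sub>R G s w) \<in> borel_measurable lborel"
  shows "energy t G w \<le> ennreal (1 + e) * energy t H w + ennreal (1 + 1 / e) * energy t (\<lambda>s w. G s w - H s w) w"
proof -
  define h g where "h s = indicat_real {0..t} s *\<^sub>R H s w" and "g s = indicat_real {0..t} s *\<^sub>R G s w" for s
  have [measurable]: "h \<in> borel_measurable lborel" "g \<in> borel_measurable lborel"
    using assms(2,3) by (simp_all add: h_def[abs_def] g_def[abs_def])
  have eq: "energy t G w = (\<integral>\<^sup>+ s. ennreal ((norm (g s))\<^sup>2) \<partial>lborel)"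
    "energy t H w = (\<integral>\<^sup>+ s. ennreal ((norm (h s))\<^sup>2) \<partial>lborel)"
    "energy t (\<lambda>s w. G s w - H s w) w = (\<integral>\<^sup>+ s. ennreal ((norm (g s - h s))\<^sup>2) \<partial>lborel)"
    unfolding energy_def by (intro nn_integral_cong; auto simp: g_def h_def indicator_def)+
  have "ennreal ((norm (g s))\<^sup>2) \<le> ennreal (1 + e) * ennreal ((norm (h s))\<^sup>2) + ennreal (1 + 1 / e) * ennreal ((norm (g s - h s))\<^sup>2)" for s
    using ennreal_leI[OF norm_sq_eps_le[OF e, of "g s" "h s"]] e by (simp add: ennreal_plus ennreal_mult)
  hence "energy t G w \<le> (\<integral>\<^sup>+ s. ennreal (1 + e) * ennreal ((norm (h s))\<^sup>2) + ennreal (1 + 1 / e) * ennreal ((norm (g s - h s))\<^sup>2) \<partial>lborel)"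
    unfolding eq by (intro nn_integral_mono)
  also have "\<dots> = ennreal (1 + e) * energy t H w + ennreal (1 + 1 / e) * energy t (\<lambda>s w. G s w - H s w) w"
    unfolding eq by (subst nn_integral_add) (auto simp: nn_integral_cmult)
  finally show ?thesis .
qed

section \<open>Joint measurability, and stopping by energy\<close>

context brownian_basis
begin

text \<open>Progressivity concerns the restricted product only. Multiplying by the indicator gives a
  function that is measurable on all of \<open>M \<Otimes>\<^sub>M lborel\<close>, where Fubini's
  theorem applies.\<close>

lemma progressive_joint:
  assumes "progressive F H" "0 \<le> t"
  shows "(\<lambda>x. indicator {0..t} (snd x) *\<^sub>R H (snd x) (fst x)) \<in> borel_measurable (M \<Otimes>\<^sub>M lborel)"
proof -
  let ?\<Omega> = "space M \<times> {0..t}"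
  let ?R = "restrict_space (M \<Otimes>\<^sub>M lborel) ?\<Omega>"
  have \<Omega>: "?\<Omega> \<inter> space (M \<Otimes>\<^sub>M lborel) \<in> sets (M \<Otimes>\<^sub>M lborel)" by (auto simp: space_pair_measure)
  have H: "case_prod H \<in> borel_measurable (restrict_space borel {0..t} \<Otimes>\<^sub>M F t)"
    using assms by (simp add: progressive_def)
  have "(\<lambda>x. x) \<in> measurable M (F t)"
    by (rule measurable_F_M[of _ t]) simp
  from measurable_compose[OF measurable_fst this]
  have f: "fst \<in> measurable (M \<Otimes>\<^sub>M lborel) (F t)" .
  have "(\<lambda>x. (snd x, fst x)) \<in> measurable ?R (restrict_space borel {0..t} \<Otimes>\<^sub>M F t)"
    by (intro measurable_Pair measurable_restrict_space2 measurable_restrict_space1 f)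
       (auto simp: space_restrict_space)
  hence "(\<lambda>x. case_prod H (snd x, fst x)) \<in> borel_measurable ?R" using H by (rule measurable_compose)
  hence "(\<lambda>x. H (snd x) (fst x)) \<in> borel_measurable ?R" by simp
  hence "(\<lambda>x. indicator ?\<Omega> x *\<^sub>R H (snd x) (fst x)) \<in> borel_measurable (M \<Otimes>\<^sub>M lborel)"
    by (subst (asm) borel_measurable_restrict_space_iff[OF \<Omega>])
  thus ?thesis
    by (rule measurable_cong[THEN iffD1, rotated]) (auto simp: indicator_def space_pair_measure)
qed

end

lemma nonneg_sum_stopped:
  fixes a :: "nat \<Rightarrow> real"
  assumes "\<And>j. j < k \<Longrightarrow> 0 \<le> a j" "0 \<le> n"
  shows "(\<Sum>j<k. if (\<Sum>i<Suc j. a i) \<le> n then a j else 0) \<le> n"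
  using assms(1)
proof (induction k)
  case (Suc k)
  show ?case
  proof (cases "(\<Sum>i<Suc k. a i) \<le> n")
    case True
    have "(\<Sum>j<Suc k. if (\<Sum>i<Suc j. a i) \<le> n then a j else 0) \<le> (\<Sum>j<Suc k. a j)"
      by (intro sum_mono) (use Suc.prems in auto)
    thus ?thesis using True by linarith
  next
    case False
    thus ?thesis using Suc by simp
  qed
qed (use assms in simp)

context brownian_basis
begin

lemma elementary_process_measurable_s:
  "(\<lambda>s. indicator {0..t} s *\<^sub>R elementary_process k \<tau> \<xi> s w) \<in> borel_measurable lborel"
  unfolding elementary_process_def by measurable

lemma elementary_process_joint:
  assumes "elementary_data M F t k \<tau> \<xi>" "0 \<le> t"
  shows "(\<lambda>x. indicator {0..t} (snd x) *\<^sub>R elementary_process k \<tau> \<xi> (snd x) (fst x)) \<in> borel_measurable (M \<Otimes>\<^sub>M lborel)"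
proof -
  have "(\<lambda>x. \<xi> j (fst x)) \<in> borel_measurable (M \<Otimes>\<^sub>M lborel)" if "j < k" for j
    by (rule measurable_compose[OF measurable_fst measurable_F_M[of _ "\<tau> j"]])
       (use assms that in \<open>auto simp: elementary_data_def\<close>)
  moreover have "(\<lambda>x. indicat_real {a<..b} (snd x)) \<in> borel_measurable (M \<Otimes>\<^sub>M lborel)"
    "(\<lambda>x. indicat_real {a..b} (snd x)) \<in> borel_measurable (M \<Otimes>\<^sub>M lborel)" for a b :: real
    by measurable
  ultimately show ?thesis unfolding elementary_process_def
    by (intro borel_measurable_scaleR borel_measurable_sum) auto
qed

lemma energy_measurable:
  assumes "(\<lambda>x. indicator {0..t} (snd x) *\<^sub>R H (snd x) (fst x)) \<in> borel_measurable (M \<Otimes>\<^sub>M lborel)"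
  shows "energy t H \<in> borel_measurable M"
proof -
  have eq: "energy t H = (\<lambda>w. \<integral>\<^sup>+ s. ennreal ((norm (indicator {0..t} s *\<^sub>R H s w))\<^sup>2) \<partial>lborel)"
    unfolding energy_def fun_eq_iff by (intro allI nn_integral_cong) (auto simp: indicator_def)
  have "(\<lambda>x. ennreal ((norm (indicator {0..t} (snd x) *\<^sub>R H (snd x) (fst x)))\<^sup>2)) \<in> borel_measurable (M \<Otimes>\<^sub>M lborel)"
    using assms by measurable
  thus ?thesis unfolding eq by (intro lborel.borel_measurable_nn_integral) (simp add: case_prod_beta)
qed

lemma energy_diff_measurable:
  assumes "(\<lambda>x. indicator {0..t} (snd x) *\<^sub>R H (snd x) (fst x)) \<in> borel_measurable (M \<Otimes>\<^sub>M lborel)"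
    "(\<lambda>x. indicator {0..t} (snd x) *\<^sub>R G (snd x) (fst x)) \<in> borel_measurable (M \<Otimes>\<^sub>M lborel)"
  shows "energy t (\<lambda>s w. G s w - H s w) \<in> borel_measurable M"
  by (rule energy_measurable) (use assms in \<open>simp add: scaleR_diff_right\<close>)

lemma progressive_path_measurable:
  assumes "progressive F H" "0 \<le> t" "w \<in> space M"
  shows "(\<lambda>s. indicator {0..t} s *\<^sub>R H s w) \<in> borel_measurable lborel"
  using measurable_compose[OF measurable_Pair1'[OF assms(3)] progressive_joint[OF assms(1,2)]] by simp

lemma progressive_adapted:
  assumes "progressive F H" "0 \<le> t"
  shows "H t \<in> borel_measurable (F t)"
proof -
  have "(\<lambda>w. (t, w)) \<in> measurable (F t) (restrict_space borel {0..t} \<Otimes>\<^sub>M F t)"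
    by (rule measurable_Pair1') (use assms in \<open>simp add: space_restrict_space\<close>)
  moreover have "case_prod H \<in> borel_measurable (restrict_space borel {0..t} \<Otimes>\<^sub>M F t)"
    using assms by (simp add: progressive_def)
  ultimately have "(\<lambda>w. case_prod H (t, w)) \<in> borel_measurable (F t)" by (rule measurable_compose)
  thus ?thesis by simp
qed

text \<open>The energy up to the end of cell \<open>j\<close> is already known at its start
  \<open>\<tau> j\<close>, since cell lengths are deterministic and \<open>\<xi> j\<close> is known
  then. The decision is thus adapted although it looks at \<open>Suc j\<close>, and the retained
  energy never overshoots \<open>n\<close>.\<close>

definition stopped :: "real \<Rightarrow> (nat \<Rightarrow> real) \<Rightarrow> (nat \<Rightarrow> 'a \<Rightarrow> 'b::euclidean_space) \<Rightarrow> nat \<Rightarrow> 'a \<Rightarrow> 'b" where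
  "stopped n \<tau> \<xi> j w = (if step_energy (Suc j) \<tau> \<xi> w \<le> n then \<xi> j w else 0)"

lemma stopped_elementary:
  assumes ed: "elementary_data M F t k \<tau> \<xi>"
  shows "elementary_data M F t k \<tau> (stopped n \<tau> \<xi>)"
  unfolding elementary_data_def
proof (intro conjI allI impI)
  have mono: "\<And>i. i < k \<Longrightarrow> \<tau> i \<le> \<tau> (Suc i)" using ed by (auto simp: elementary_data_def)
  note m = partition_mono[of k \<tau>, OF mono]
  fix j assume j: "j < k"
  have [measurable]: "\<xi> i \<in> borel_measurable (F (\<tau> j))" if "i \<le> j" for i
    by (rule measurable_F_mono[of "\<tau> i"]) (use ed j that m[of i j] in \<open>auto simp: elementary_data_def\<close>)
  have [measurable]: "step_energy (Suc j) \<tau> \<xi> \<in> borel_measurable (F (\<tau> j))"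
    unfolding step_energy_def[abs_def] by measurable
  show "stopped n \<tau> \<xi> j \<in> borel_measurable (F (\<tau> j))" unfolding stopped_def[abs_def] by measurable
  have "bounded (\<xi> j ` space M)" using ed j by (auto simp: elementary_data_def)
  then obtain b where "\<forall>w\<in>space M. norm (\<xi> j w) \<le> b" by (auto simp: bounded_iff)
  hence "\<forall>w\<in>space M. norm (stopped n \<tau> \<xi> j w) \<le> \<bar>b\<bar>" by (auto simp: stopped_def)
  thus "bounded (stopped n \<tau> \<xi> j ` space M)" by (auto simp: bounded_iff)
qed (use ed in \<open>auto simp: elementary_data_def\<close>)

lemma step_energy_mono:
  assumes "\<And>i. i < k \<Longrightarrow> \<tau> i \<le> \<tau> (Suc i)" "j \<le> k"
  shows "step_energy j \<tau> \<xi> w \<le> step_energy k \<tau> \<xi> w"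
  unfolding step_energy_def by (intro sum_mono2) (use assms in auto)

lemma step_energy_nonneg:
  assumes "elementary_data M F t k \<tau> \<xi>"
  shows "0 \<le> step_energy k \<tau> \<xi> w"
  unfolding step_energy_def by (intro sum_nonneg) (use assms in \<open>auto simp: elementary_data_def\<close>)

lemma stopped_eq:
  assumes "elementary_data M F t k \<tau> \<xi>" "step_energy k \<tau> \<xi> w \<le> n" "j < k"
  shows "stopped n \<tau> \<xi> j w = \<xi> j w"
proof -
  have "step_energy (Suc j) \<tau> \<xi> w \<le> step_energy k \<tau> \<xi> w"
    by (rule step_energy_mono) (use assms in \<open>auto simp: elementary_data_def\<close>)
  thus ?thesis using assms(2) by (simp add: stopped_def)
qed

lemma stopped_energy_le:
  assumes "elementary_data M F t k \<tau> \<xi>" "0 \<le> n"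
  shows "step_energy k \<tau> (stopped n \<tau> \<xi>) w \<le> n" "step_energy k \<tau> (stopped n \<tau> \<xi>) w \<le> step_energy k \<tau> \<xi> w"
proof -
  have mono: "\<And>i. i < k \<Longrightarrow> \<tau> i \<le> \<tau> (Suc i)" using assms by (auto simp: elementary_data_def)
  have "step_energy k \<tau> (stopped n \<tau> \<xi>) w = (\<Sum>j<k. if (\<Sum>i<Suc j. (\<tau> (Suc i) - \<tau> i) * (norm (\<xi> i w))\<^sup>2) \<le> n
     then (\<tau> (Suc j) - \<tau> j) * (norm (\<xi> j w))\<^sup>2 else 0)"
    unfolding step_energy_def stopped_def by (intro sum.cong) auto
  also have "\<dots> \<le> n" by (rule nonneg_sum_stopped) (use mono assms in auto)
  finally show "step_energy k \<tau> (stopped n \<tau> \<xi>) w \<le> n" .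
  show "step_energy k \<tau> (stopped n \<tau> \<xi>) w \<le> step_energy k \<tau> \<xi> w"
    unfolding step_energy_def stopped_def by (intro sum_mono) (use mono in auto)
qed

lemma elementary_isometry_nn:
  assumes "step_data k \<tau> \<xi>"
  shows "(\<integral>\<^sup>+ w. ennreal ((norm (elementary_integral W k \<tau> \<xi> w))\<^sup>2) \<partial>M) = (\<integral>\<^sup>+ w. ennreal (step_energy k \<tau> \<xi> w) \<partial>M)"
proof -
  note iso = step_isometry[OF assms]
  have int: "integrable M (\<lambda>w. (\<tau> (Suc j) - \<tau> j) * (norm (\<xi> j w))\<^sup>2)" if "j < k" for j
    using assms that by (auto simp: step_data_def sq_integrable_def)
  hence inte: "integrable M (step_energy k \<tau> \<xi>)" unfolding step_energy_def[abs_def] by auto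
  have "(\<integral>\<^sup>+ w. ennreal ((norm (elementary_integral W k \<tau> \<xi> w))\<^sup>2) \<partial>M)
      = ennreal (\<integral>w. (norm (elementary_integral W k \<tau> \<xi> w))\<^sup>2 \<partial>M)"
    using iso by (intro nn_integral_eq_integral) (auto simp: sq_integrable_def)
  also have "\<dots> = ennreal (\<integral>w. step_energy k \<tau> \<xi> w \<partial>M)"
    using iso int unfolding step_energy_def by (subst Bochner_Integration.integral_sum) auto
  also have "\<dots> = (\<integral>\<^sup>+ w. ennreal (step_energy k \<tau> \<xi> w) \<partial>M)"
    using assms by (intro nn_integral_eq_integral[symmetric] inte)
      (auto simp: step_energy_def step_data_def intro!: sum_nonneg)
  finally show ?thesis .
qed

text \<open>The stopped energy is at most \<open>n\<close> and at most the full energy, so its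
  second moment is finite whatever the coefficients are.\<close>

lemma stopped_isometry:
  assumes "elementary_data M F t k \<tau> \<xi>" "0 \<le> n"
  shows "(\<integral>\<^sup>+ w. ennreal ((norm (elementary_integral W k \<tau> (stopped n \<tau> \<xi>) w))\<^sup>2) \<partial>M)
    \<le> (\<integral>\<^sup>+ w. min (ennreal n) (ennreal (step_energy k \<tau> \<xi> w)) \<partial>M)"
  unfolding elementary_isometry_nn[OF step_data_elementary[OF stopped_elementary[OF assms(1)]]]
  by (intro nn_integral_mono) (use stopped_energy_le[OF assms] in \<open>auto intro!: ennreal_leI\<close>)

lemma elementary_integral_measurable:
  "elementary_data M F t k \<tau> \<xi> \<Longrightarrow> elementary_integral W k \<tau> \<xi> \<in> borel_measurable M"
  using step_isometry[OF step_data_elementary] by (auto simp: sq_integrable_def)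

text \<open>Passing to a subsequence turns the convergence in probability of the definition into almost sure
  convergence at a geometric rate.\<close>

lemma ito_approximation:
  fixes H :: "real \<Rightarrow> 'a \<Rightarrow> 'b::euclidean_space"
  assumes ito: "has_ito_integral M F W H t I" and t: "0 \<le> t"
  obtains k \<tau> \<xi> where "\<And>m::nat. elementary_data M F t (k m) (\<tau> m) (\<xi> m)"
    "\<And>m. (\<integral>\<^sup>+ w. min (ennreal (real m)) (energy t (\<lambda>s w. elementary_process (k m) (\<tau> m) (\<xi> m) s w - H s w) w) \<partial>M) \<le> ennreal ((1/2) ^ m)"
    "AE w in M. (\<lambda>m. energy t (\<lambda>s w. elementary_process (k m) (\<tau> m) (\<xi> m) s w - H s w) w) \<longlonglongrightarrow> 0"
    "AE w in M. (\<lambda>m. elementary_integral W (k m) (\<tau> m) (\<xi> m) w) \<longlonglongrightarrow> I w"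
proof -
  from ito obtain k \<tau> \<xi> where prog: "progressive F H" and I[measurable]: "I \<in> borel_measurable M"
    and ed: "\<And>m::nat. elementary_data M F t (k m) (\<tau> m) (\<xi> m)"
    and c1: "\<And>\<epsilon>. \<epsilon> > 0 \<Longrightarrow> (\<lambda>m. measure M {w \<in> space M. ennreal \<epsilon> <
            (\<integral>\<^sup>+ s\<in>{0..t}. ennreal ((norm (elementary_process (k m) (\<tau> m) (\<xi> m) s w - H s w))\<^sup>2) \<partial>lborel)}) \<longlonglongrightarrow> 0"
    and c2: "\<And>\<epsilon>. \<epsilon> > 0 \<Longrightarrow> (\<lambda>m. measure M {w \<in> space M. \<epsilon> < norm (elementary_integral W (k m) (\<tau> m) (\<xi> m) w - I w)}) \<longlonglongrightarrow> 0"
    unfolding has_ito_integral_def by blast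
  define D where "D m = energy t (\<lambda>s w. elementary_process (k m) (\<tau> m) (\<xi> m) s w - H s w)" for m
  define E where "E m w = ennreal (norm (elementary_integral W (k m) (\<tau> m) (\<xi> m) w - I w))" for m w
  have [measurable]: "D m \<in> borel_measurable M" for m unfolding D_def
    by (rule energy_diff_measurable[OF progressive_joint[OF prog t] elementary_process_joint[OF ed t]])
  have [measurable]: "elementary_integral W (k m) (\<tau> m) (\<xi> m) \<in> borel_measurable M" for m
    by (rule elementary_integral_measurable[OF ed])
  have [measurable]: "E m \<in> borel_measurable M" for m unfolding E_def by measurable
  have c1': "(\<lambda>m. measure M {w \<in> space M. ennreal \<epsilon> < D m w}) \<longlonglongrightarrow> 0" if "\<epsilon> > 0" for \<epsilon>
    using c1[OF that] unfolding D_def energy_def .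
  have D0: "(\<lambda>m. \<integral>\<^sup>+ w. min (ennreal c) (D m w) \<partial>M) \<longlonglongrightarrow> 0" if "0 \<le> c" for c
    by (rule nn_integral_min_tendsto_0[OF _ c1' that]) measurable
  have E0: "(\<lambda>m. \<integral>\<^sup>+ w. min (ennreal 1) (E m w) \<partial>M) \<longlonglongrightarrow> 0"
  proof (rule nn_integral_min_tendsto_0)
    fix \<epsilon> :: real assume e: "\<epsilon> > 0"
    have "ennreal \<epsilon> < E m w \<longleftrightarrow> \<epsilon> < norm (elementary_integral W (k m) (\<tau> m) (\<xi> m) w - I w)" for m w
      unfolding E_def using e by (simp add: ennreal_less_iff)
    thus "(\<lambda>m. measure M {w \<in> space M. ennreal \<epsilon> < E m w}) \<longlonglongrightarrow> 0" using c2[OF e] by simp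
  qed auto
  have "\<exists>m. (\<integral>\<^sup>+ w. min (ennreal (real j)) (D m w) \<partial>M) \<le> ennreal ((1/2) ^ j) \<and>
      (\<integral>\<^sup>+ w. min (ennreal 1) (E m w) \<partial>M) \<le> ennreal ((1/2) ^ j)" for j
  proof -
    have p: "(0::ennreal) < ennreal ((1/2) ^ j)" by simp
    have "eventually (\<lambda>m. (\<integral>\<^sup>+ w. min (ennreal (real j)) (D m w) \<partial>M) < ennreal ((1/2) ^ j) \<and>
      (\<integral>\<^sup>+ w. min (ennreal 1) (E m w) \<partial>M) < ennreal ((1/2) ^ j)) sequentially"
      using order_tendstoD(2)[OF D0[of "real j"] p] order_tendstoD(2)[OF E0 p] by (simp add: eventually_conj)
    thus ?thesis unfolding eventually_sequentially by (meson less_imp_le order_refl)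
  qed
  then obtain r where r: "\<And>j. (\<integral>\<^sup>+ w. min (ennreal (real j)) (D (r j) w) \<partial>M) \<le> ennreal ((1/2) ^ j)"
    "\<And>j. (\<integral>\<^sup>+ w. min (ennreal 1) (E (r j) w) \<partial>M) \<le> ennreal ((1/2) ^ j)" by metis
  have "AE w in M. (\<lambda>j. min 1 (E (r j) w)) \<longlonglongrightarrow> 0"
    by (rule AE_tendsto_0_if_summable[of _ _ 1 "1/2"]) (use r in auto)
  hence AE2: "AE w in M. (\<lambda>j. elementary_integral W (k (r j)) (\<tau> (r j)) (\<xi> (r j)) w) \<longlonglongrightarrow> I w"
  proof eventually_elim
    case (elim w)
    hence "(\<lambda>j. E (r j) w) \<longlonglongrightarrow> ennreal 0" using tendsto_0_if_min_tendsto_0 by simp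
    hence "(\<lambda>j. norm (elementary_integral W (k (r j)) (\<tau> (r j)) (\<xi> (r j)) w - I w)) \<longlonglongrightarrow> 0"
      unfolding E_def by (subst (asm) tendsto_ennreal_iff) auto
    thus ?case using LIM_zero_iff tendsto_norm_zero_iff by blast
  qed
  have "AE w in M. (\<lambda>j. min (ennreal (real j)) (D (r j) w)) \<longlonglongrightarrow> 0"
    by (rule AE_tendsto_0_if_summable[of _ _ 1 "1/2"]) (use r in auto)
  hence AE1: "AE w in M. (\<lambda>j. D (r j) w) \<longlonglongrightarrow> 0"
  proof eventually_elim
    case (elim w)
    have "(\<lambda>j. min 1 (D (r j) w)) \<longlonglongrightarrow> 0"
    proof (rule tendsto_sandwich[OF _ _ tendsto_const elim])
      show "\<forall>\<^sub>F j in sequentially. min 1 (D (r j) w) \<le> min (ennreal (real j)) (D (r j) w)"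
        unfolding eventually_sequentially
        by (intro exI[of _ 1] allI impI min.mono order_refl) (metis ennreal_1 ennreal_leI of_nat_1 of_nat_le_iff)
    qed auto
    thus ?case by (rule tendsto_0_if_min_tendsto_0)
  qed
  show thesis
    by (rule that[of "\<lambda>j. k (r j)" "\<lambda>j. \<tau> (r j)" "\<lambda>j. \<xi> (r j)"]) (use ed r(1) AE1 AE2 in \<open>auto simp: D_def\<close>)
qed

text \<open>A substitute for the isometry when no moment is finite. On
  \<open>energy t H w < n\<close> the approximating energies are eventually below \<open>n\<close>,
  so stopping has no effect and the stopped integrals still converge to \<open>I\<close>; Fatou's
  lemma and the isometry for stopped steps give the bound up to a factor \<open>1 + e\<close>, which
  is removed at the end.\<close>

lemma ito_localized_energy:
  fixes H :: "real \<Rightarrow> 'a \<Rightarrow> 'b::euclidean_space"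
  assumes ito: "has_ito_integral M F W H t I" and t: "0 \<le> t" and n: "0 \<le> n"
  shows "(\<integral>\<^sup>+ w. (if energy t H w < ennreal n then ennreal ((norm (I w))\<^sup>2) else 0) \<partial>M)
    \<le> (\<integral>\<^sup>+ w. min (ennreal n) (energy t H w) \<partial>M)"
proof -
  obtain k \<tau> \<xi> where ed: "\<And>m::nat. elementary_data M F t (k m) (\<tau> m) (\<xi> m)"
    and D: "\<And>m. (\<integral>\<^sup>+ w. min (ennreal (real m)) (energy t (\<lambda>s w. elementary_process (k m) (\<tau> m) (\<xi> m) s w - H s w) w) \<partial>M) \<le> ennreal ((1/2) ^ m)"
    and D0: "AE w in M. (\<lambda>m. energy t (\<lambda>s w. elementary_process (k m) (\<tau> m) (\<xi> m) s w - H s w) w) \<longlonglongrightarrow> 0"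
    and I0: "AE w in M. (\<lambda>m. elementary_integral W (k m) (\<tau> m) (\<xi> m) w) \<longlonglongrightarrow> I w"
    by (rule ito_approximation[OF ito t]) (rule that)
  have prog: "progressive F H" and [measurable]: "I \<in> borel_measurable M" using ito by (auto simp: has_ito_integral_def)
  define d where "d m = energy t (\<lambda>s w. elementary_process (k m) (\<tau> m) (\<xi> m) s w - H s w)" for m
  define q where "q = energy t H"
  define J where "J m = elementary_integral W (k m) (\<tau> m) (stopped n (\<tau> m) (\<xi> m))" for m
  have [measurable]: "q \<in> borel_measurable M" unfolding q_def by (rule energy_measurable[OF progressive_joint[OF prog t]])
  have [measurable]: "d m \<in> borel_measurable M" for m unfolding d_def
    by (rule energy_diff_measurable[OF progressive_joint[OF prog t] elementary_process_joint[OF ed t]])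
  have [measurable]: "J m \<in> borel_measurable M" for m unfolding J_def
    by (rule elementary_integral_measurable[OF stopped_elementary[OF ed]])
  have eps: "ennreal (step_energy (k m) (\<tau> m) (\<xi> m) w) \<le> ennreal (1 + e) * q w + ennreal (1 + 1 / e) * d m w"
    if "e > 0" "w \<in> space M" for e m w
    using energy_eps_le[where G = "elementary_process (k m) (\<tau> m) (\<xi> m)" and H = H, OF that(1)
        progressive_path_measurable[OF prog t that(2)]
        elementary_process_measurable_s[of t "k m" "\<tau> m" "\<xi> m" w]]
    unfolding d_def q_def energy_elementary[OF ed, symmetric] .
  have fatou: "AE w in M. (if q w < ennreal n then ennreal ((norm (I w))\<^sup>2) else 0) \<le> liminf (\<lambda>m. ennreal ((norm (J m w))\<^sup>2))"
    using D0 I0 AE_space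
  proof eventually_elim
    case (elim w)
    show ?case
    proof (cases "q w < ennreal n")
      case True
      then obtain x where x: "q w = ennreal x" "0 \<le> x" "x < n"
        by (cases "q w") (auto simp: ennreal_less_iff)
      \<comment> \<open>The slack is spent on keeping \<open>(1 + e) * x\<close> strictly below
        \<open>n\<close>: \<open>e * x\<close> is at most half of the gap
        \<open>n - x\<close>.\<close>
      define e where "e = (n - x) / (2 * (x + 1))"
      have e: "e > 0" using x by (simp add: e_def)
      have "e * x \<le> e * (x + 1)" using e by simp
      also have "\<dots> = (n - x) / 2" using x by (simp add: e_def field_simps)
      finally have ex: "(1 + e) * x < n" using x by (simp add: algebra_simps)
      have "(\<lambda>m. ennreal (1 + e) * q w + ennreal (1 + 1 / e) * d m w) \<longlonglongrightarrow> ennreal (1 + e) * q w + ennreal (1 + 1 / e) * 0"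
        using elim(1) unfolding d_def by (intro tendsto_add tendsto_const ennreal_tendsto_cmult) auto
      moreover have "ennreal (1 + e) * q w + ennreal (1 + 1 / e) * 0 < ennreal n"
      proof -
        have "ennreal (1 + e) * q w = ennreal ((1 + e) * x)"
          unfolding x(1) using e x by (intro ennreal_mult[symmetric]) auto
        moreover have "0 \<le> (1 + e) * x" using e x by simp
        ultimately show ?thesis using ex by (simp add: ennreal_less_iff del: ennreal_plus)
      qed
      ultimately have "eventually (\<lambda>m. ennreal (1 + e) * q w + ennreal (1 + 1 / e) * d m w < ennreal n) sequentially"
        by (rule order_tendstoD)
      hence "eventually (\<lambda>m. elementary_integral W (k m) (\<tau> m) (\<xi> m) w = J m w) sequentially"
      proof eventually_elim
        case (elim m)
        hence "ennreal (step_energy (k m) (\<tau> m) (\<xi> m) w) < ennreal n"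
          using eps[OF e, of w m] \<open>w \<in> space M\<close> by (meson order_le_less_trans)
        hence "step_energy (k m) (\<tau> m) (\<xi> m) w \<le> n"
          using step_energy_nonneg[OF ed, of m w] by (simp add: ennreal_less_iff)
        thus ?case unfolding J_def elementary_integral_def
          by (intro sum.cong) (auto simp: stopped_eq[OF ed])
      qed
      with elim(2) have "(\<lambda>m. J m w) \<longlonglongrightarrow> I w" by (rule Lim_transform_eventually)
      hence "(\<lambda>m. ennreal ((norm (J m w))\<^sup>2)) \<longlonglongrightarrow> ennreal ((norm (I w))\<^sup>2)" by (intro tendsto_intros)
      hence "liminf (\<lambda>m. ennreal ((norm (J m w))\<^sup>2)) = ennreal ((norm (I w))\<^sup>2)"
        by (intro lim_imp_Liminf) auto
      thus ?thesis using True by simp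
    qed simp
  qed
  let ?R = "\<integral>\<^sup>+ w. min (ennreal n) (q w) \<partial>M"
  have Rfin: "?R < top"
  proof -
    have "?R \<le> (\<integral>\<^sup>+ w. ennreal n \<partial>M)" by (intro nn_integral_mono) auto
    also have "\<dots> < top" by (simp add: emeasure_space_1)
    finally show ?thesis .
  qed
  have bound: "(\<integral>\<^sup>+ w. (if q w < ennreal n then ennreal ((norm (I w))\<^sup>2) else 0) \<partial>M) \<le> ennreal (1 + e) * ?R" if e: "e > 0" for e
  proof -
    have "(\<integral>\<^sup>+ w. (if q w < ennreal n then ennreal ((norm (I w))\<^sup>2) else 0) \<partial>M)
       \<le> (\<integral>\<^sup>+ w. liminf (\<lambda>m. ennreal ((norm (J m w))\<^sup>2)) \<partial>M)" using fatou by (rule nn_integral_mono_AE)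
    also have "\<dots> \<le> liminf (\<lambda>m. \<integral>\<^sup>+ w. ennreal ((norm (J m w))\<^sup>2) \<partial>M)" by (intro nn_integral_liminf) measurable
    also have "\<dots> \<le> liminf (\<lambda>m. ennreal (1 + e) * ?R + ennreal (1 + 1 / e) * ennreal ((1/2) ^ m))"
    proof (rule Liminf_mono)
      obtain n0 where n0: "n \<le> real n0" using real_arch_simple by blast
      have "(\<integral>\<^sup>+ w. ennreal ((norm (J m w))\<^sup>2) \<partial>M) \<le> ennreal (1 + e) * ?R + ennreal (1 + 1 / e) * ennreal ((1/2) ^ m)"
        if "m \<ge> n0" for m
      proof -
        \<comment> \<open>Truncation passes inside the sum because both factors are at least 1. The
          error term may be cut at \<open>m\<close> rather than \<open>n\<close> since
          \<open>n \<le> m\<close>, and for that cut the geometric rate is available.\<close>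
        have mn: "min (ennreal n) (a * x + b * y) \<le> a * min (ennreal n) x + b * min (ennreal (real m)) y"
          if "a \<ge> 1" "b \<ge> 1" for a b x y :: ennreal
        proof -
          have nm: "ennreal n \<le> ennreal (real m)" using n0 \<open>m \<ge> n0\<close> by (intro ennreal_leI) linarith
          show ?thesis
          proof (cases "x \<le> ennreal n \<and> y \<le> ennreal (real m)")
            case True
            hence "min (ennreal n) x = x" "min (ennreal (real m)) y = y" by (auto intro: min_absorb2)
            thus ?thesis by simp
          next
            case False
            hence "ennreal n \<le> a * min (ennreal n) x \<or> ennreal n \<le> b * min (ennreal (real m)) y"
            proof (cases "x \<le> ennreal n")
              case False
              hence "ennreal n = 1 * min (ennreal n) x" by (simp add: min_absorb1)
              also have "\<dots> \<le> a * min (ennreal n) x" using that by (intro mult_right_mono) auto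
              finally show ?thesis by simp
            next
              case True
              with False have "ennreal n \<le> 1 * min (ennreal (real m)) y" using nm by (auto simp: min_def)
              also have "\<dots> \<le> b * min (ennreal (real m)) y" using that by (intro mult_right_mono) auto
              finally show ?thesis by simp
            qed
            thus ?thesis by (meson add_increasing add_increasing2 min.coboundedI1 zero_le)
          qed
        qed
        have "(\<integral>\<^sup>+ w. ennreal ((norm (J m w))\<^sup>2) \<partial>M) \<le> (\<integral>\<^sup>+ w. min (ennreal n) (ennreal (step_energy (k m) (\<tau> m) (\<xi> m) w)) \<partial>M)"
          unfolding J_def by (rule stopped_isometry[OF ed n])
        also have "\<dots> \<le> (\<integral>\<^sup>+ w. ennreal (1 + e) * min (ennreal n) (q w) + ennreal (1 + 1 / e) * min (ennreal (real m)) (d m w) \<partial>M)"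
        proof (rule nn_integral_mono)
          fix w assume w': "w \<in> space M"
          have "min (ennreal n) (ennreal (step_energy (k m) (\<tau> m) (\<xi> m) w))
            \<le> min (ennreal n) (ennreal (1 + e) * q w + ennreal (1 + 1 / e) * d m w)"
            using eps[OF e w'] by (intro min.mono) auto
          also have "\<dots> \<le> ennreal (1 + e) * min (ennreal n) (q w) + ennreal (1 + 1 / e) * min (ennreal (real m)) (d m w)"
            by (rule mn) (use e in \<open>auto simp flip: ennreal_1 intro!: ennreal_leI\<close>)
          finally show "min (ennreal n) (ennreal (step_energy (k m) (\<tau> m) (\<xi> m) w)) \<le> \<dots>" .
        qed
        also have "\<dots> = ennreal (1 + e) * ?R + ennreal (1 + 1 / e) * (\<integral>\<^sup>+ w. min (ennreal (real m)) (d m w) \<partial>M)"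
          by (subst nn_integral_add) (auto simp: nn_integral_cmult)
        also have "\<dots> \<le> ennreal (1 + e) * ?R + ennreal (1 + 1 / e) * ennreal ((1/2) ^ m)"
          using D[of m] unfolding d_def by (intro add_left_mono mult_left_mono) auto
        finally show ?thesis .
      qed
      thus "\<forall>\<^sub>F m in sequentially. (\<integral>\<^sup>+ w. ennreal ((norm (J m w))\<^sup>2) \<partial>M) \<le> ennreal (1 + e) * ?R + ennreal (1 + 1 / e) * ennreal ((1/2) ^ m)"
        unfolding eventually_sequentially by blast
    qed
    also have "\<dots> = ennreal (1 + e) * ?R + ennreal (1 + 1 / e) * ennreal 0"
      by (intro lim_imp_Liminf tendsto_add tendsto_const ennreal_tendsto_cmult tendsto_ennrealI LIMSEQ_realpow_zero) auto
    finally show ?thesis by simp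
  qed
  have "(\<integral>\<^sup>+ w. (if q w < ennreal n then ennreal ((norm (I w))\<^sup>2) else 0) \<partial>M) \<le> ?R"
  proof (rule ennreal_le_epsilon)
    fix e :: real assume e: "e > 0"
    obtain x where x: "?R = ennreal x" "x \<ge> 0" using Rfin by (cases "?R") auto
    \<comment> \<open>The truncated expectation is a finite number \<open>x\<close>, so the factor
      \<open>1 + e'\<close> costs at most \<open>e' * x \<le> e\<close>.\<close>
    define e' where "e' = e / (x + 1)"
    have e': "e' > 0" "e' * x \<le> e" using e x by (auto simp: e'_def field_simps)
    have "ennreal (1 + e') * ?R \<le> ?R + ennreal e"
      using e' x e unfolding x by (simp add: ennreal_mult[symmetric] ennreal_plus[symmetric] distrib_right del: ennreal_plus)
    with bound[OF e'(1)] show "(\<integral>\<^sup>+ w. (if q w < ennreal n then ennreal ((norm (I w))\<^sup>2) else 0) \<partial>M) \<le> ?R + ennreal e"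
      by (rule order_trans)
  qed
  thus ?thesis by (simp add: q_def)
qed

end

section \<open>Common refinements of partitions\<close>

lemma partition_strict_mono:
  fixes \<sigma> :: "nat \<Rightarrow> real"
  assumes "\<And>i. i < K \<Longrightarrow> \<sigma> i < \<sigma> (Suc i)" "a < b" "b \<le> K"
  shows "\<sigma> a < \<sigma> b"
  using assms(2,3)
proof (induction b)
  case (Suc b)
  thus ?case using assms(1)[of b] by (cases "a = b") auto
qed simp

lemma partition_cover:
  fixes \<sigma> :: "nat \<Rightarrow> real"
  assumes "\<sigma> 0 < s" "s \<le> \<sigma> K"
  shows "\<exists>i<K. \<sigma> i < s \<and> s \<le> \<sigma> (Suc i)"
  using assms(2)
proof (induction K)
  case 0 thus ?case using assms(1) by simp
next
  case (Suc K)
  show ?case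
  proof (cases "s \<le> \<sigma> K")
    case True thus ?thesis using Suc.IH by (meson less_SucI)
  next
    case False thus ?thesis using Suc.prems by (intro exI[of _ K]) auto
  qed
qed

text \<open>The cells of elementary processes are open on the left and closed on the right, so the
  value on a fine cell is read off at its right endpoint \<open>\<sigma> (Suc i)\<close>. Within a
  coarse cell the fine increments telescope.\<close>

lemma refined_sum:
  fixes \<sigma> \<tau> :: "nat \<Rightarrow> real" and w' :: "real \<Rightarrow> real"
  assumes \<sigma>: "\<And>i. i < K \<Longrightarrow> \<sigma> i < \<sigma> (Suc i)" and \<tau>: "\<And>j. j < k \<Longrightarrow> \<tau> j \<le> \<tau> (Suc j)"
    and sub: "\<And>j. j \<le> k \<Longrightarrow> \<exists>a\<le>K. \<tau> j = \<sigma> a"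
  shows "(\<Sum>i<K. (w' (\<sigma> (Suc i)) - w' (\<sigma> i)) *\<^sub>R elementary_process k \<tau> \<xi> (\<sigma> (Suc i)) w)
    = (\<Sum>j<k. (w' (\<tau> (Suc j)) - w' (\<tau> j)) *\<^sub>R \<xi> j w)"
proof -
  have less: "\<sigma> a < \<sigma> b \<longleftrightarrow> a < b" if "a \<le> K" "b \<le> K" for a b
    using partition_strict_mono[of K \<sigma>, OF \<sigma>] that by (metis linorder_neqE_nat order_less_asym order_less_irrefl)
  have inner: "(\<Sum>i<K. (w' (\<sigma> (Suc i)) - w' (\<sigma> i)) * indicator {\<tau> j<..\<tau> (Suc j)} (\<sigma> (Suc i))) = w' (\<tau> (Suc j)) - w' (\<tau> j)"
    if j: "j < k" for j
  proof -
    obtain a b where a: "a \<le> K" "\<tau> j = \<sigma> a" and b: "b \<le> K" "\<tau> (Suc j) = \<sigma> b" using sub j by (meson Suc_leI less_imp_le)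
    have ab: "a \<le> b" using \<tau>[OF j] less[OF b(1) a(1)] a(2) b(2) by (cases "b < a") auto
    have "(\<Sum>i<K. (w' (\<sigma> (Suc i)) - w' (\<sigma> i)) * indicator {\<tau> j<..\<tau> (Suc j)} (\<sigma> (Suc i)))
        = (\<Sum>i<K. if i \<in> {a..<b} then w' (\<sigma> (Suc i)) - w' (\<sigma> i) else 0)"
    proof (intro sum.cong refl)
      fix i assume "i \<in> {..<K}"
      hence i: "Suc i \<le> K" by simp
      have "\<sigma> (Suc i) \<in> {\<tau> j<..\<tau> (Suc j)} \<longleftrightarrow> i \<in> {a..<b}"
        using less[OF a(1) i] less[OF b(1) i] unfolding a b by auto
      thus "(w' (\<sigma> (Suc i)) - w' (\<sigma> i)) * indicator {\<tau> j<..\<tau> (Suc j)} (\<sigma> (Suc i))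
        = (if i \<in> {a..<b} then w' (\<sigma> (Suc i)) - w' (\<sigma> i) else 0)" by (simp add: indicator_def)
    qed
    also have "\<dots> = (\<Sum>i\<in>{..<K} \<inter> {a..<b}. w' (\<sigma> (Suc i)) - w' (\<sigma> i))" by (simp only: sum.inter_restrict finite_lessThan)
    also have "{..<K} \<inter> {a..<b} = {a..<b}" using b by auto
    also have "(\<Sum>i\<in>{a..<b}. w' (\<sigma> (Suc i)) - w' (\<sigma> i)) = w' (\<sigma> b) - w' (\<sigma> a)" using ab by (rule sum_Suc_diff')
    finally show ?thesis by (simp add: a b)
  qed
  have "(\<Sum>i<K. (w' (\<sigma> (Suc i)) - w' (\<sigma> i)) *\<^sub>R elementary_process k \<tau> \<xi> (\<sigma> (Suc i)) w)
      = (\<Sum>i<K. \<Sum>j<k. ((w' (\<sigma> (Suc i)) - w' (\<sigma> i)) * indicator {\<tau> j<..\<tau> (Suc j)} (\<sigma> (Suc i))) *\<^sub>R \<xi> j w)"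
    by (simp only: elementary_process_def scaleR_sum_right scaleR_scaleR)
  also have "\<dots> = (\<Sum>j<k. (\<Sum>i<K. (w' (\<sigma> (Suc i)) - w' (\<sigma> i)) * indicator {\<tau> j<..\<tau> (Suc j)} (\<sigma> (Suc i))) *\<^sub>R \<xi> j w)"
    by (subst sum.swap) (simp only: scaleR_sum_left)
  also have "\<dots> = (\<Sum>j<k. (w' (\<tau> (Suc j)) - w' (\<tau> j)) *\<^sub>R \<xi> j w)" by (intro sum.cong refl) (simp only: inner lessThan_iff)
  finally show ?thesis .
qed

lemma refined_process:
  fixes \<sigma> \<tau> :: "nat \<Rightarrow> real"
  assumes \<sigma>: "\<And>i. i < K \<Longrightarrow> \<sigma> i < \<sigma> (Suc i)"
    and sub: "\<And>j. j \<le> k \<Longrightarrow> \<exists>a\<le>K. \<tau> j = \<sigma> a" and i: "i < K" "\<sigma> i < s" "s \<le> \<sigma> (Suc i)"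
  shows "elementary_process k \<tau> \<xi> s w = elementary_process k \<tau> \<xi> (\<sigma> (Suc i)) w"
  unfolding elementary_process_def
proof (intro sum.cong refl)
  fix j assume "j \<in> {..<k}"
  hence j: "j \<le> k" "Suc j \<le> k" by auto
  have less: "\<sigma> a < \<sigma> b \<longleftrightarrow> a < b" if "a \<le> K" "b \<le> K" for a b
    using partition_strict_mono[of K \<sigma>, OF \<sigma>] that by (metis linorder_neqE_nat order_less_asym order_less_irrefl)
  have cmp: "\<sigma> a < s \<longleftrightarrow> \<sigma> a < \<sigma> (Suc i)" if "a \<le> K" for a
  proof
    assume "\<sigma> a < \<sigma> (Suc i)"
    hence "a \<le> i" using less[OF that, of "Suc i"] i by simp
    hence "\<sigma> a \<le> \<sigma> i" using less[of i a] that i by (meson leD leI less_imp_le)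
    thus "\<sigma> a < s" using i by simp
  qed (use i in simp)
  obtain a b where "a \<le> K" "\<tau> j = \<sigma> a" "b \<le> K" "\<tau> (Suc j) = \<sigma> b" using sub j by meson
  hence "s \<in> {\<tau> j<..\<tau> (Suc j)} \<longleftrightarrow> \<sigma> (Suc i) \<in> {\<tau> j<..\<tau> (Suc j)}" using cmp by (auto simp: not_less[symmetric])
  thus "indicat_real {\<tau> j<..\<tau> (Suc j)} s *\<^sub>R \<xi> j w = indicator {\<tau> j<..\<tau> (Suc j)} (\<sigma> (Suc i)) *\<^sub>R \<xi> j w"
    by (simp add: indicator_def)
qed

lemma common_partition:
  fixes T :: "real set"
  assumes T: "finite T" "0 \<in> T" "r \<in> T" "T \<subseteq> {0..r}"
  obtains K \<sigma> where "\<sigma> 0 = 0" "\<sigma> K = r" "\<And>i. i < K \<Longrightarrow> \<sigma> i < \<sigma> (Suc i)" "\<And>x. x \<in> T \<Longrightarrow> \<exists>a\<le>K. x = \<sigma> a"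
    "\<And>a. a \<le> K \<Longrightarrow> \<sigma> a \<in> T"
proof -
  define xs where "xs = sorted_list_of_set T"
  have set: "set xs = T" using T by (simp add: xs_def)
  have sorted: "sorted_wrt (<) xs" by (simp add: xs_def)
  define K where "K = length xs - 1"
  have ne: "xs \<noteq> []" using set T by auto
  have K: "a \<le> K \<longleftrightarrow> a < length xs" for a using ne by (cases xs) (auto simp: K_def)
  have strict: "xs ! a < xs ! b" if "a < b" "b \<le> K" for a b
    using sorted_wrt_nth_less[OF sorted that(1)] that K by auto
  have idx: "\<exists>a\<le>K. x = xs ! a" if "x \<in> T" for x using that set K by (metis in_set_conv_nth)
  have mem: "xs ! a \<in> T" if "a \<le> K" for a using that set K nth_mem by blast
  have "xs ! 0 = 0"
  proof -
    obtain a where a: "a \<le> K" "0 = xs ! a" using idx T by blast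
    have "0 \<le> xs ! 0" using mem[of 0] T(4) by auto
    thus ?thesis using strict[of 0 a] a by (cases "a = 0") auto
  qed
  moreover have "xs ! K = r"
  proof -
    obtain a where a: "a \<le> K" "r = xs ! a" using idx T by blast
    have "xs ! K \<le> r" using mem[of K] T(4) by auto
    thus ?thesis using strict[of a K] a by (cases "a = K") auto
  qed
  ultimately show thesis using that[of "\<lambda>i. xs ! i" K] strict idx mem by auto
qed

section \<open>Energy bound, consistency in time and orthogonality of Ito integrals\<close>

context brownian_basis
begin

text \<open>The localised bound with \<open>n\<close> tending to infinity, by monotone convergence
  on paths of finite energy. Of the isometry only this direction is established, and upper bounds on
  moments ask for no other.\<close>

lemma ito_energy:
  assumes ito: "has_ito_integral M F W H t I" and t: "0 \<le> t"
  shows "(\<integral>\<^sup>+ w. ennreal ((norm (I w))\<^sup>2) \<partial>M) \<le> (\<integral>\<^sup>+ w. energy t H w \<partial>M)"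
proof (cases "(\<integral>\<^sup>+ w. energy t H w \<partial>M) = \<infinity>")
  case False
  have prog: "progressive F H" and [measurable]: "I \<in> borel_measurable M" using ito by (auto simp: has_ito_integral_def)
  have [measurable]: "energy t H \<in> borel_measurable M" by (rule energy_measurable[OF progressive_joint[OF prog t]])
  define f where "f n w = (if energy t H w < ennreal (real n) then ennreal ((norm (I w))\<^sup>2) else 0)" for n w
  have [measurable]: "f n \<in> borel_measurable M" for n unfolding f_def by measurable
  have "AE w in M. energy t H w \<noteq> \<infinity>" using False by (intro nn_integral_PInf_AE) auto
  hence "AE w in M. ennreal ((norm (I w))\<^sup>2) = (SUP n. f n w)"
  proof eventually_elim
    case (elim w)
    then obtain x where x: "energy t H w = ennreal x" "0 \<le> x" by (cases "energy t H w") auto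
    obtain n where "x < real n" using reals_Archimedean2 by blast
    hence "f n w = ennreal ((norm (I w))\<^sup>2)" using x by (simp add: f_def ennreal_less_iff)
    hence "ennreal ((norm (I w))\<^sup>2) \<le> (SUP n. f n w)" by (metis SUP_upper UNIV_I)
    moreover have "(SUP n. f n w) \<le> ennreal ((norm (I w))\<^sup>2)" by (rule SUP_least) (simp add: f_def)
    ultimately show ?case by (rule antisym)
  qed
  hence "(\<integral>\<^sup>+ w. ennreal ((norm (I w))\<^sup>2) \<partial>M) = (\<integral>\<^sup>+ w. (SUP n. f n w) \<partial>M)" by (rule nn_integral_cong_AE)
  also have "\<dots> = (SUP n. \<integral>\<^sup>+ w. f n w \<partial>M)"
  proof (rule nn_integral_monotone_convergence_SUP)
    show "incseq f" unfolding incseq_def le_fun_def f_def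
      by (auto intro: order.strict_trans2 ennreal_leI)
  qed measurable
  also have "\<dots> \<le> (\<integral>\<^sup>+ w. energy t H w \<partial>M)"
  proof (rule SUP_least)
    fix n
    have "(\<integral>\<^sup>+ w. f n w \<partial>M) \<le> (\<integral>\<^sup>+ w. min (ennreal (real n)) (energy t H w) \<partial>M)"
      unfolding f_def by (rule ito_localized_energy[OF ito t]) simp
    also have "\<dots> \<le> (\<integral>\<^sup>+ w. energy t H w \<partial>M)" by (intro nn_integral_mono) simp
    finally show "(\<integral>\<^sup>+ w. f n w \<partial>M) \<le> (\<integral>\<^sup>+ w. energy t H w \<partial>M)" .
  qed
  finally show ?thesis .
qed simp

lemma sq_integrableI_nn:
  assumes "f \<in> borel_measurable M" "(\<integral>\<^sup>+ w. ennreal ((norm (f w))\<^sup>2) \<partial>M) < \<infinity>"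
  shows "sq_integrable M f"
  using assms by (auto simp: sq_integrable_def intro!: integrableI_bounded)

lemma ito_sq_integrable:
  assumes ito: "has_ito_integral M F W H t I" and t: "0 \<le> t" and fin: "(\<integral>\<^sup>+ w. energy t H w \<partial>M) < \<infinity>"
  shows "sq_integrable M I"
  by (rule sq_integrableI_nn) (use ito ito_energy[OF ito t] fin in \<open>auto simp: has_ito_integral_def\<close>)

text \<open>Both processes are rewritten on a common refinement. A fine cell lies in one coarse
  cell, whose coefficient is known at the coarse left endpoint, hence no later than the fine one;
  this is why the difference is again adapted.\<close>

lemma elementary_diff:
  fixes \<xi> \<xi>' :: "nat \<Rightarrow> 'a \<Rightarrow> 'b::euclidean_space"
  assumes ed: "elementary_data M F r k \<tau> \<xi>" and ed': "elementary_data M F r k' \<tau>' \<xi>'"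
  shows "\<exists>K \<sigma> \<zeta>. elementary_data M F r K \<sigma> \<zeta> \<and>
    (\<forall>w. elementary_integral W K \<sigma> \<zeta> w = elementary_integral W k \<tau> \<xi> w - elementary_integral W k' \<tau>' \<xi>' w) \<and>
    (\<forall>w. \<forall>s\<in>{0..r}. elementary_process K \<sigma> \<zeta> s w = elementary_process k \<tau> \<xi> s w - elementary_process k' \<tau>' \<xi>' s w)"
proof -
  have t: "\<tau> 0 = 0" "\<tau> k = r" "\<And>j. j < k \<Longrightarrow> \<tau> j \<le> \<tau> (Suc j)" using ed by (auto simp: elementary_data_def)
  have t': "\<tau>' 0 = 0" "\<tau>' k' = r" "\<And>j. j < k' \<Longrightarrow> \<tau>' j \<le> \<tau>' (Suc j)" using ed' by (auto simp: elementary_data_def)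
  note mono = partition_mono[of k \<tau>, OF t(3)] and mono' = partition_mono[of k' \<tau>', OF t'(3)]
  define T where "T = \<tau> ` {..k} \<union> \<tau>' ` {..k'}"
  have "finite T" by (simp add: T_def)
  moreover have "0 \<in> T" unfolding T_def using t(1) by (metis UnI1 atMost_iff image_eqI zero_le)
  moreover have "r \<in> T" unfolding T_def using t(2) by (metis UnI1 atMost_iff image_eqI order_refl)
  moreover have "T \<subseteq> {0..r}" using mono[of 0] mono[of _ k] mono'[of 0] mono'[of _ k'] t t' by (auto simp: T_def)
  ultimately obtain K \<sigma> where \<sigma>: "\<sigma> 0 = 0" "\<sigma> K = r" "\<And>i. i < K \<Longrightarrow> \<sigma> i < \<sigma> (Suc i)"
    and inT: "\<And>x. x \<in> T \<Longrightarrow> \<exists>a\<le>K. x = \<sigma> a" by (rule common_partition) blast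
  have sub: "\<exists>a\<le>K. \<tau> j = \<sigma> a" if "j \<le> k" for j using inT that by (auto simp: T_def)
  have sub': "\<exists>a\<le>K. \<tau>' j = \<sigma> a" if "j \<le> k'" for j using inT that by (auto simp: T_def)
  define \<zeta> where "\<zeta> i w = elementary_process k \<tau> \<xi> (\<sigma> (Suc i)) w - elementary_process k' \<tau>' \<xi>' (\<sigma> (Suc i)) w" for i w
  have key: "(\<lambda>w. elementary_process k \<tau> \<xi> (\<sigma> (Suc i)) w) \<in> borel_measurable (F (\<sigma> i)) \<and>
      (\<exists>b. \<forall>w\<in>space M. norm (elementary_process k \<tau> \<xi> (\<sigma> (Suc i)) w) \<le> b)"
    if ed: "elementary_data M F r k \<tau> \<xi>" and sub: "\<And>j. j \<le> k \<Longrightarrow> \<exists>a\<le>K. \<tau> j = \<sigma> a" and i: "i < K"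
    for k \<tau> and \<xi> :: "nat \<Rightarrow> 'a \<Rightarrow> 'b" and i
  proof -
    have t: "\<tau> 0 = 0" "\<tau> k = r" "\<And>j. j < k \<Longrightarrow> \<tau> j \<le> \<tau> (Suc j)" using ed by (auto simp: elementary_data_def)
    have "\<tau> 0 < \<sigma> (Suc i)" using partition_strict_mono[of K \<sigma> 0 "Suc i"] \<sigma> i t(1) by auto
    moreover have "\<sigma> (Suc i) \<le> \<tau> k" using partition_strict_mono[of K \<sigma> "Suc i" K] \<sigma> i t(2) by (cases "Suc i = K") auto
    ultimately obtain j where j: "j < k" "\<tau> j < \<sigma> (Suc i)" "\<sigma> (Suc i) \<le> \<tau> (Suc j)" using partition_cover by blast
    have eq: "elementary_process k \<tau> \<xi> (\<sigma> (Suc i)) w = \<xi> j w" for w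
      by (rule elementary_process_eq) (use t j in auto)
    obtain a where a: "a \<le> K" "\<tau> j = \<sigma> a" using sub[of j] j by auto
    have "a \<le> i" using a j i partition_strict_mono[of K \<sigma> "Suc i" a] \<sigma>(3) by (metis not_less_eq_eq order_less_asym order_less_irrefl le_neq_implies_less Suc_leI)
    hence "\<tau> j \<le> \<sigma> i" using a partition_strict_mono[of K \<sigma> a i] \<sigma>(3) i by (cases "a = i") auto
    hence "\<xi> j \<in> borel_measurable (F (\<sigma> i))"
      using ed j by (intro measurable_F_mono[of "\<tau> j" "\<sigma> i"]) (auto simp: elementary_data_def)
    moreover have "\<exists>b. \<forall>w\<in>space M. norm (\<xi> j w) \<le> b" using ed j by (auto simp: elementary_data_def bounded_iff)
    ultimately show ?thesis by (simp add: eq)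
  qed
  have "elementary_data M F r K \<sigma> \<zeta>" unfolding elementary_data_def
  proof (intro conjI allI impI)
    fix i assume i: "i < K"
    note k1 = key[OF ed sub i] and k2 = key[OF ed' sub' i]
    show "\<zeta> i \<in> borel_measurable (F (\<sigma> i))" unfolding \<zeta>_def using k1 k2 by (intro borel_measurable_diff) auto
    from k1 k2 obtain b b' where b: "\<forall>w\<in>space M. norm (elementary_process k \<tau> \<xi> (\<sigma> (Suc i)) w) \<le> b"
      "\<forall>w\<in>space M. norm (elementary_process k' \<tau>' \<xi>' (\<sigma> (Suc i)) w) \<le> b'" by blast
    have "norm (\<zeta> i w) \<le> b + b'" if "w \<in> space M" for w
      unfolding \<zeta>_def using b that norm_triangle_ineq4 by (meson add_mono order_trans)
    thus "bounded (\<zeta> i ` space M)" unfolding bounded_iff by blast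
    show "\<sigma> i \<le> \<sigma> (Suc i)" using \<sigma>(3)[OF i] by simp
  qed (use \<sigma> in auto)
  moreover have "elementary_integral W K \<sigma> \<zeta> w = elementary_integral W k \<tau> \<xi> w - elementary_integral W k' \<tau>' \<xi>' w" for w
    unfolding elementary_integral_def \<zeta>_def scaleR_diff_right sum_subtractf
    using refined_sum[of K \<sigma> k \<tau> "\<lambda>t. W t w" \<xi> w, OF \<sigma>(3) t(3) sub]
      refined_sum[of K \<sigma> k' \<tau>' "\<lambda>t. W t w" \<xi>' w, OF \<sigma>(3) t'(3) sub'] by simp
  moreover have "elementary_process K \<sigma> \<zeta> s w = elementary_process k \<tau> \<xi> s w - elementary_process k' \<tau>' \<xi>' s w"
    if s: "s \<in> {0..r}" for s w
  proof (cases "s = 0")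
    case True
    have "elementary_process k \<tau> \<xi> 0 w = 0"
      unfolding elementary_process_def using mono[of 0] t by (intro sum.neutral) (auto simp: indicator_def dest: less_imp_le leD)
    moreover have "elementary_process k' \<tau>' \<xi>' 0 w = 0"
      unfolding elementary_process_def using mono'[of 0] t' by (intro sum.neutral) (auto simp: indicator_def dest: less_imp_le leD)
    moreover have "elementary_process K \<sigma> \<zeta> 0 w = 0"
      unfolding elementary_process_def using partition_strict_mono[of K \<sigma> 0, OF \<sigma>(3)] \<sigma>(1)
      by (intro sum.neutral) (auto simp: indicator_def, metis less_imp_le not_gr_zero order_less_asym order_less_irrefl)
    ultimately show ?thesis using True by simp
  next
    case False
    then obtain i where i: "i < K" "\<sigma> i < s" "s \<le> \<sigma> (Suc i)" using partition_cover[of \<sigma> s K] \<sigma> s by auto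
    have "elementary_process K \<sigma> \<zeta> s w = \<zeta> i w" by (rule elementary_process_eq) (use \<sigma>(3) i in \<open>auto intro: less_imp_le\<close>)
    thus ?thesis unfolding \<zeta>_def
      using refined_process[of K \<sigma> k \<tau> i s \<xi> w, OF \<sigma>(3) sub i] refined_process[of K \<sigma> k' \<tau>' i s \<xi>' w, OF \<sigma>(3) sub' i] by simp
  qed
  ultimately show ?thesis by blast
qed

text \<open>Meant for the times \<open>min r (\<tau> j)\<close>. A cell that starts at
  \<open>r\<close> or later collapses to a point, and its coefficient is set to 0 because it need
  not be known at time \<open>r\<close>.\<close>

definition restricted :: "real \<Rightarrow> (nat \<Rightarrow> real) \<Rightarrow> (nat \<Rightarrow> 'a \<Rightarrow> 'b::euclidean_space) \<Rightarrow> nat \<Rightarrow> 'a \<Rightarrow> 'b" where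
  "restricted r \<tau> \<xi> j w = (if \<tau> j < r then \<xi> j w else 0)"

lemma restricted_elementary:
  assumes ed: "elementary_data M F t k \<tau> \<xi>" and r: "0 \<le> r" "r \<le> t"
  shows "elementary_data M F r k (\<lambda>j. min r (\<tau> j)) (restricted r \<tau> \<xi>)"
  unfolding elementary_data_def
proof (intro conjI allI impI)
  fix j assume j: "j < k"
  show "restricted r \<tau> \<xi> j \<in> borel_measurable (F (min r (\<tau> j)))"
    using ed j by (cases "\<tau> j < r") (auto simp: restricted_def[abs_def] elementary_data_def min_absorb2)
  show "min r (\<tau> j) \<le> min r (\<tau> (Suc j))" using ed j by (intro min.mono) (auto simp: elementary_data_def)
  obtain b where "\<forall>w\<in>space M. norm (\<xi> j w) \<le> b" using ed j by (auto simp: elementary_data_def bounded_iff)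
  hence "\<forall>w\<in>space M. norm (restricted r \<tau> \<xi> j w) \<le> \<bar>b\<bar>" by (auto simp: restricted_def)
  thus "bounded (restricted r \<tau> \<xi> j ` space M)" by (auto simp: bounded_iff)
qed (use ed r in \<open>auto simp: elementary_data_def\<close>)

lemma restricted_process:
  assumes "s \<le> r"
  shows "elementary_process k (\<lambda>j. min r (\<tau> j)) (restricted r \<tau> \<xi>) s w = elementary_process k \<tau> \<xi> s w"
  unfolding elementary_process_def restricted_def using assms by (intro sum.cong refl) (auto simp: indicator_def)

lemma restricted_integral:
  assumes "elementary_data M F t k \<tau> \<xi>"
  shows "elementary_integral W k \<tau> \<xi> w = elementary_integral W k (\<lambda>j. min r (\<tau> j)) (restricted r \<tau> \<xi>) w
    + elementary_integral W k (\<lambda>j. max r (\<tau> j)) \<xi> w"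
  unfolding elementary_integral_def sum.distrib[symmetric]
proof (intro sum.cong refl)
  fix j assume "j \<in> {..<k}"
  hence le: "\<tau> j \<le> \<tau> (Suc j)" using assms by (auto simp: elementary_data_def)
  show "(W (\<tau> (Suc j)) w - W (\<tau> j) w) *\<^sub>R \<xi> j w =
    (W (min r (\<tau> (Suc j))) w - W (min r (\<tau> j)) w) *\<^sub>R restricted r \<tau> \<xi> j w +
    (W (max r (\<tau> (Suc j))) w - W (max r (\<tau> j)) w) *\<^sub>R \<xi> j w"
    using le by (auto simp: restricted_def min_def max_def scaleR_add_left[symmetric] split: if_splits)
qed

text \<open>The definition of the integral picks an approximating sequence for each end time
  separately; this links the sequence for \<open>t\<close> with any version \<open>J\<close> at
  \<open>r\<close>. The difference of two approximating sequences is elementary with energy tending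
  to 0, so its integral tends to 0 as well.\<close>

lemma ito_restricted_limit:
  fixes H :: "real \<Rightarrow> 'a \<Rightarrow> 'b::euclidean_space"
  assumes ed: "\<And>m::nat. elementary_data M F t (k m) (\<tau> m) (\<xi> m)"
    and D: "\<And>m. (\<integral>\<^sup>+ w. min (ennreal (real m)) (energy t (\<lambda>s w. elementary_process (k m) (\<tau> m) (\<xi> m) s w - H s w) w) \<partial>M) \<le> ennreal ((1/2) ^ m)"
    and J: "has_ito_integral M F W H r J" and r: "0 \<le> r" "r \<le> t"
  shows "AE w in M. (\<lambda>m. elementary_integral W (k m) (\<lambda>j. min r (\<tau> m j)) (restricted r (\<tau> m) (\<xi> m)) w) \<longlonglongrightarrow> J w"
proof -
  have prog: "progressive F H" using J by (auto simp: has_ito_integral_def)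
  obtain k' \<tau>' \<xi>' where ed': "\<And>m::nat. elementary_data M F r (k' m) (\<tau>' m) (\<xi>' m)"
    and D': "\<And>m. (\<integral>\<^sup>+ w. min (ennreal (real m)) (energy r (\<lambda>s w. elementary_process (k' m) (\<tau>' m) (\<xi>' m) s w - H s w) w) \<partial>M) \<le> ennreal ((1/2) ^ m)"
    and J0: "AE w in M. (\<lambda>m. elementary_integral W (k' m) (\<tau>' m) (\<xi>' m) w) \<longlonglongrightarrow> J w"
    by (rule ito_approximation[OF J r(1)]) (rule that)
  define e where "e m = elementary_integral W (k m) (\<lambda>j. min r (\<tau> m j)) (restricted r (\<tau> m) (\<xi> m))" for m
  define e' where "e' m = elementary_integral W (k' m) (\<tau>' m) (\<xi>' m)" for m
  define p where "p m = elementary_process (k m) (\<tau> m) (\<xi> m)" for m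
  define p' where "p' m = elementary_process (k' m) (\<tau>' m) (\<xi>' m)" for m
  have "\<forall>m. \<exists>K \<sigma> \<zeta>. elementary_data M F r K \<sigma> \<zeta> \<and>
    (\<forall>w. elementary_integral W K \<sigma> \<zeta> w = e m w - e' m w) \<and>
    (\<forall>w. \<forall>s\<in>{0..r}. elementary_process K \<sigma> \<zeta> s w = p m s w - p' m s w)"
  proof
    fix m
    from elementary_diff[OF restricted_elementary[OF ed r] ed', of m m]
    show "\<exists>K \<sigma> \<zeta>. elementary_data M F r K \<sigma> \<zeta> \<and>
      (\<forall>w. elementary_integral W K \<sigma> \<zeta> w = e m w - e' m w) \<and>
      (\<forall>w. \<forall>s\<in>{0..r}. elementary_process K \<sigma> \<zeta> s w = p m s w - p' m s w)"
      by (simp add: e_def e'_def p_def p'_def restricted_process)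
  qed
  then obtain K \<sigma> \<zeta> where edz: "\<And>m. elementary_data M F r (K m) (\<sigma> m) (\<zeta> m)"
    and intz: "\<And>m w. elementary_integral W (K m) (\<sigma> m) (\<zeta> m) w = e m w - e' m w"
    and prz: "\<And>m w s. s \<in> {0..r} \<Longrightarrow> elementary_process (K m) (\<sigma> m) (\<zeta> m) s w = p m s w - p' m s w" by metis
  define d where "d m = energy t (\<lambda>s w. p m s w - H s w)" for m
  define d' where "d' m = energy r (\<lambda>s w. p' m s w - H s w)" for m
  have t: "0 \<le> t" using r by simp
  have [measurable]: "d m \<in> borel_measurable M" for m unfolding d_def p_def
    by (rule energy_diff_measurable[OF progressive_joint[OF prog t] elementary_process_joint[OF ed t]])
  have [measurable]: "d' m \<in> borel_measurable M" for m unfolding d'_def p'_def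
    by (rule energy_diff_measurable[OF progressive_joint[OF prog r(1)] elementary_process_joint[OF ed' r(1)]])
  have E: "ennreal (step_energy (K m) (\<sigma> m) (\<zeta> m) w) \<le> 2 * d m w + 2 * d' m w" if w': "w \<in> space M" for m w
  proof -
    have meas: "(\<lambda>s. indicator {0..r} s *\<^sub>R H s w) \<in> borel_measurable lborel"
      "(\<lambda>s. indicator {0..r} s *\<^sub>R p m s w) \<in> borel_measurable lborel"
      "(\<lambda>s. indicator {0..r} s *\<^sub>R p' m s w) \<in> borel_measurable lborel"
      unfolding p_def p'_def using progressive_path_measurable[OF prog r(1) w'] elementary_process_measurable_s by auto
    have "ennreal (step_energy (K m) (\<sigma> m) (\<zeta> m) w) = energy r (\<lambda>s w. p m s w - p' m s w) w"
      unfolding energy_elementary[OF edz, symmetric] energy_def by (intro nn_integral_cong) (auto simp: prz indicator_def)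
    also have "\<dots> \<le> ennreal (1 + 1) * energy r (\<lambda>s w. p m s w - H s w) w
       + ennreal (1 + 1 / 1) * energy r (\<lambda>s w. (p m s w - p' m s w) - (p m s w - H s w)) w"
      by (rule energy_eps_le) (use meas in \<open>auto simp: scaleR_diff_right\<close>)
    also have "energy r (\<lambda>s w. (p m s w - p' m s w) - (p m s w - H s w)) w = d' m w"
      unfolding d'_def energy_def by (simp add: norm_minus_commute)
    also have "energy r (\<lambda>s w. p m s w - H s w) w \<le> d m w" unfolding d_def by (rule energy_mono[OF r(2)])
    finally show ?thesis by (simp add: mult_left_mono add_mono)
  qed
  have minE: "(\<integral>\<^sup>+ w. min (ennreal 1) (ennreal (step_energy (K m) (\<sigma> m) (\<zeta> m) w)) \<partial>M) \<le> ennreal (4 * (1/2) ^ m)" for m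
  proof (cases "m = 0")
    case True
    have "(\<integral>\<^sup>+ w. min (ennreal 1) (ennreal (step_energy (K m) (\<sigma> m) (\<zeta> m) w)) \<partial>M) \<le> (\<integral>\<^sup>+ w. 1 \<partial>M)"
      by (intro nn_integral_mono) simp
    also have "\<dots> \<le> ennreal (4 * (1/2) ^ m)" using True by (simp add: emeasure_space_1)
    finally show ?thesis .
  next
    case False
    have m1: "min 1 x \<le> min (ennreal (real m)) x" for x
      using False by (intro min.mono) (auto simp flip: ennreal_1 intro!: ennreal_leI)
    have mm: "min 1 (2 * x + 2 * y) \<le> 2 * min 1 x + 2 * min 1 y" for x y :: ennreal
    proof (cases "x \<le> 1 \<and> y \<le> 1")
      case True thus ?thesis by (simp add: min_absorb2)
    next
      case False
      hence "1 \<le> min 1 x + min 1 y" by (auto simp: not_le min_absorb1 intro: add_increasing add_increasing2)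
      also have "\<dots> \<le> 2 * min 1 x + 2 * min 1 y" by (metis add_mono_thms_linordered_semiring(1) le_iff_add mult_2)
      finally show ?thesis by (meson min.coboundedI1)
    qed
    have "(\<integral>\<^sup>+ w. min (ennreal 1) (ennreal (step_energy (K m) (\<sigma> m) (\<zeta> m) w)) \<partial>M)
       \<le> (\<integral>\<^sup>+ w. 2 * min (ennreal (real m)) (d m w) + 2 * min (ennreal (real m)) (d' m w) \<partial>M)"
    proof (rule nn_integral_mono)
      fix w assume w': "w \<in> space M"
      have "min (ennreal 1) (ennreal (step_energy (K m) (\<sigma> m) (\<zeta> m) w)) \<le> min 1 (2 * d m w + 2 * d' m w)"
        using E[OF w'] by (intro min.mono) auto
      also have "\<dots> \<le> 2 * min 1 (d m w) + 2 * min 1 (d' m w)" by (rule mm)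
      also have "\<dots> \<le> 2 * min (ennreal (real m)) (d m w) + 2 * min (ennreal (real m)) (d' m w)"
        by (intro add_mono mult_left_mono m1) auto
      finally show "min (ennreal 1) (ennreal (step_energy (K m) (\<sigma> m) (\<zeta> m) w)) \<le> \<dots>" .
    qed
    also have "\<dots> = 2 * (\<integral>\<^sup>+ w. min (ennreal (real m)) (d m w) \<partial>M) + 2 * (\<integral>\<^sup>+ w. min (ennreal (real m)) (d' m w) \<partial>M)"
      by (subst nn_integral_add) (auto simp: nn_integral_cmult)
    also have "\<dots> \<le> 2 * ennreal ((1/2) ^ m) + 2 * ennreal ((1/2) ^ m)"
      using D[of m] D'[of m] unfolding d_def d'_def p_def p'_def by (intro add_mono mult_left_mono) auto
    also have "\<dots> = ennreal (4 * (1/2) ^ m)"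
      by (simp add: ennreal_mult' flip: distrib_right)
    finally show ?thesis .
  qed
  \<comment> \<open>Stopping at energy 1 makes the isometry applicable to the difference. Since the
    energies tend to 0 almost surely, stopping is eventually without effect on almost every
    path.\<close>
  define V where "V m = elementary_integral W (K m) (\<sigma> m) (stopped 1 (\<sigma> m) (\<zeta> m))" for m
  have [measurable]: "V m \<in> borel_measurable M" for m unfolding V_def
    by (rule elementary_integral_measurable[OF stopped_elementary[OF edz]])
  have [measurable]: "(\<lambda>w. ennreal (step_energy (K m) (\<sigma> m) (\<zeta> m) w)) \<in> borel_measurable M" for m
    unfolding energy_elementary[OF edz, symmetric]
    by (rule energy_measurable[OF elementary_process_joint[OF edz r(1)]])
  have "(\<integral>\<^sup>+ w. ennreal ((norm (V m w))\<^sup>2) \<partial>M) \<le> ennreal (4 * (1/2) ^ m)" for m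
    unfolding V_def by (rule order_trans[OF stopped_isometry[OF edz] minE]) simp
  hence V0: "AE w in M. (\<lambda>m. ennreal ((norm (V m w))\<^sup>2)) \<longlonglongrightarrow> 0"
    by (intro AE_tendsto_0_if_summable[of _ _ 4 "1/2"]) auto
  have S0: "AE w in M. (\<lambda>m. min 1 (ennreal (step_energy (K m) (\<sigma> m) (\<zeta> m) w))) \<longlonglongrightarrow> 0"
    by (rule AE_tendsto_0_if_summable[of _ _ 4 "1/2"]) (use minE in auto)
  show ?thesis using V0 S0 J0
  proof eventually_elim
    case (elim w)
    have "(\<lambda>m. ennreal (step_energy (K m) (\<sigma> m) (\<zeta> m) w)) \<longlonglongrightarrow> 0" using elim(2) by (rule tendsto_0_if_min_tendsto_0)
    hence "eventually (\<lambda>m. ennreal (step_energy (K m) (\<sigma> m) (\<zeta> m) w) < 1) sequentially" by (rule order_tendstoD) simp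
    hence ev: "eventually (\<lambda>m. V m w = e m w - e' m w) sequentially"
    proof eventually_elim
      case (elim m)
      hence "step_energy (K m) (\<sigma> m) (\<zeta> m) w \<le> 1"
        using step_energy_nonneg[OF edz, of m w] by (simp add: ennreal_less_iff flip: ennreal_1)
      hence "V m w = elementary_integral W (K m) (\<sigma> m) (\<zeta> m) w"
        unfolding V_def elementary_integral_def by (intro sum.cong) (auto simp: stopped_eq[OF edz])
      thus ?case by (simp add: intz)
    qed
    have "(\<lambda>m. (norm (V m w))\<^sup>2) \<longlonglongrightarrow> 0"
      using elim(1) unfolding ennreal_0[symmetric] by (subst (asm) tendsto_ennreal_iff) auto
    hence "(\<lambda>m. V m w) \<longlonglongrightarrow> 0" by (simp add: tendsto_norm_zero_iff)
    hence "(\<lambda>m. e m w - e' m w) \<longlonglongrightarrow> 0" using ev by (rule Lim_transform_eventually)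
    hence "(\<lambda>m. (e m w - e' m w) + e' m w) \<longlonglongrightarrow> 0 + J w" using elim(3) unfolding e'_def by (intro tendsto_add)
    thus ?case by (simp add: e_def)
  qed
qed

text \<open>The increment after \<open>r\<close> is the almost sure limit of step integrals over the
  times \<open>max r (\<tau> j)\<close>, each orthogonal to \<open>Y\<close>. These are bounded in
  \<open>L2\<close>, so the orthogonality passes to the limit weakly, without \<open>L2\<close>
  convergence.\<close>

lemma ito_orthogonal:
  fixes H :: "real \<Rightarrow> 'a \<Rightarrow> 'b::euclidean_space"
  assumes I: "has_ito_integral M F W H t I" and J: "has_ito_integral M F W H r J" and r: "0 \<le> r" "r \<le> t"
    and fin: "(\<integral>\<^sup>+ w. energy t H w \<partial>M) < \<infinity>" and Y: "Y \<in> borel_measurable (F r)" "sq_integrable M Y"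
  shows "(\<integral>w. Y w \<bullet> (I w - J w) \<partial>M) = 0"
proof -
  have t: "0 \<le> t" using r by simp
  have prog: "progressive F H" using J by (auto simp: has_ito_integral_def)
  obtain k \<tau> \<xi> where ed: "\<And>m::nat. elementary_data M F t (k m) (\<tau> m) (\<xi> m)"
    and D: "\<And>m. (\<integral>\<^sup>+ w. min (ennreal (real m)) (energy t (\<lambda>s w. elementary_process (k m) (\<tau> m) (\<xi> m) s w - H s w) w) \<partial>M) \<le> ennreal ((1/2) ^ m)"
    and D0: "AE w in M. (\<lambda>m. energy t (\<lambda>s w. elementary_process (k m) (\<tau> m) (\<xi> m) s w - H s w) w) \<longlonglongrightarrow> 0"
    and I0: "AE w in M. (\<lambda>m. elementary_integral W (k m) (\<tau> m) (\<xi> m) w) \<longlonglongrightarrow> I w"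
    by (rule ito_approximation[OF I t]) (rule that)
  define d where "d m = energy t (\<lambda>s w. elementary_process (k m) (\<tau> m) (\<xi> m) s w - H s w)" for m
  define q where "q = energy t H"
  have [measurable]: "q \<in> borel_measurable M" unfolding q_def by (rule energy_measurable[OF progressive_joint[OF prog t]])
  have [measurable]: "d m \<in> borel_measurable M" for m unfolding d_def
    by (rule energy_diff_measurable[OF progressive_joint[OF prog t] elementary_process_joint[OF ed t]])
  have eps: "ennreal (step_energy (k m) (\<tau> m) (\<xi> m) w) \<le> 2 * q w + 2 * d m w" if "w \<in> space M" for m w
    using energy_eps_le[where G = "elementary_process (k m) (\<tau> m) (\<xi> m)" and H = H and e = 1, OF _
        progressive_path_measurable[OF prog t that]
        elementary_process_measurable_s[of t "k m" "\<tau> m" "\<xi> m" w]]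
    unfolding d_def q_def energy_elementary[OF ed, symmetric] by simp
  \<comment> \<open>The stopping level grows with \<open>m\<close>, matching the truncation in
    \<open>D\<close>, which yields the \<open>L2\<close> bound; a path of finite energy eventually
    falls below the level and is left unchanged.\<close>
  define \<eta> where "\<eta> m = stopped (real m) (\<tau> m) (\<xi> m)" for m
  have ed\<eta>: "elementary_data M F t (k m) (\<tau> m) (\<eta> m)" for m unfolding \<eta>_def by (rule stopped_elementary[OF ed])
  have sd: "step_data (k m) (\<lambda>j. max r (\<tau> m j)) (\<eta> m)" for m
    unfolding step_data_def
  proof (intro conjI allI impI)
    fix j assume j: "j < k m"
    show "max r (\<tau> m j) \<le> max r (\<tau> m (Suc j))" using ed[of m] j by (intro max.mono) (auto simp: elementary_data_def)
    show "\<eta> m j \<in> borel_measurable (F (max r (\<tau> m j)))"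
      by (rule measurable_F_mono[of "\<tau> m j"]) (use ed\<eta>[of m] j in \<open>auto simp: elementary_data_def\<close>)
    show "sq_integrable M (\<eta> m j)" using step_data_elementary[OF ed\<eta>[of m]] j by (auto simp: step_data_def)
  qed (use r in simp)
  define Z where "Z m = elementary_integral W (k m) (\<lambda>j. max r (\<tau> m j)) (\<eta> m)" for m
  have Zsq: "sq_integrable M (Z m)" for m using step_isometry[OF sd] by (simp add: Z_def)
  have \<tau>0: "max r (\<tau> m 0) = r" for m using ed[of m] r by (simp add: elementary_data_def)
  have orth: "(\<integral>w. Y w \<bullet> Z m w \<partial>M) = 0" for m
    unfolding Z_def by (rule step_orthogonal[OF sd]) (use Y \<tau>0 in auto)
  obtain c where c: "(\<integral>\<^sup>+ w. q w \<partial>M) = ennreal c" "0 \<le> c" using fin unfolding q_def by (cases "\<integral>\<^sup>+ w. energy t H w \<partial>M") auto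
  have Zb: "(\<integral>w. (norm (Z m w))\<^sup>2 \<partial>M) \<le> 2 * c + 2" for m
  proof -
    have "ennreal (\<integral>w. (norm (Z m w))\<^sup>2 \<partial>M) = (\<integral>\<^sup>+ w. ennreal ((norm (Z m w))\<^sup>2) \<partial>M)"
      by (rule nn_integral_eq_integral[symmetric]) (use Zsq in \<open>auto simp: sq_integrable_def\<close>)
    also have "\<dots> = (\<integral>\<^sup>+ w. ennreal (step_energy (k m) (\<lambda>j. max r (\<tau> m j)) (\<eta> m) w) \<partial>M)"
      unfolding Z_def by (rule elementary_isometry_nn[OF sd])
    also have "\<dots> \<le> (\<integral>\<^sup>+ w. 2 * q w + 2 * min (ennreal (real m)) (d m w) \<partial>M)"
    proof (rule nn_integral_mono)
      fix w assume w': "w \<in> space M"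
      have "step_energy (k m) (\<lambda>j. max r (\<tau> m j)) (\<eta> m) w \<le> step_energy (k m) (\<tau> m) (\<eta> m) w"
        unfolding step_energy_def
      proof (intro sum_mono mult_right_mono)
        fix j assume "j \<in> {..<k m}"
        hence "\<tau> m j \<le> \<tau> m (Suc j)" using ed[of m] by (auto simp: elementary_data_def)
        thus "max r (\<tau> m (Suc j)) - max r (\<tau> m j) \<le> \<tau> m (Suc j) - \<tau> m j" by linarith
      qed simp
      also have "\<dots> \<le> min (real m) (step_energy (k m) (\<tau> m) (\<xi> m) w)"
        unfolding \<eta>_def using stopped_energy_le[OF ed, of "real m" m w] by simp
      finally have "ennreal (step_energy (k m) (\<lambda>j. max r (\<tau> m j)) (\<eta> m) w)
          \<le> min (ennreal (real m)) (ennreal (step_energy (k m) (\<tau> m) (\<xi> m) w))"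
        by (auto intro: ennreal_leI)
      also have "\<dots> \<le> min (ennreal (real m)) (2 * q w + 2 * d m w)" using eps[OF w'] by (intro min.mono) auto
      also have "\<dots> \<le> 2 * q w + 2 * min (ennreal (real m)) (d m w)"
      proof (cases "d m w \<le> ennreal (real m)")
        case True thus ?thesis by (simp add: min_absorb2)
      next
        case False
        hence "min (ennreal (real m)) (2 * q w + 2 * d m w) \<le> 1 * min (ennreal (real m)) (d m w)" by (simp add: min_absorb1)
        also have "\<dots> \<le> 2 * min (ennreal (real m)) (d m w)" by (intro mult_right_mono) auto
        also have "\<dots> \<le> 2 * q w + 2 * min (ennreal (real m)) (d m w)" by (simp add: add_increasing)
        finally show ?thesis .
      qed
      finally show "ennreal (step_energy (k m) (\<lambda>j. max r (\<tau> m j)) (\<eta> m) w) \<le> 2 * q w + 2 * min (ennreal (real m)) (d m w)" .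
    qed
    also have "\<dots> = 2 * (\<integral>\<^sup>+ w. q w \<partial>M) + 2 * (\<integral>\<^sup>+ w. min (ennreal (real m)) (d m w) \<partial>M)"
      by (subst nn_integral_add) (auto simp: nn_integral_cmult)
    also have "\<dots> \<le> 2 * ennreal c + 2 * ennreal ((1/2) ^ m)"
      using D[of m] c unfolding d_def by (intro add_mono mult_left_mono) auto
    also have "\<dots> \<le> 2 * ennreal c + 2 * ennreal 1"
      by (intro add_left_mono mult_left_mono ennreal_leI power_le_one) auto
    also have "\<dots> = ennreal (2 * c + 2)" using c by (simp add: ennreal_mult ennreal_plus)
    finally show ?thesis using c by (subst (asm) ennreal_le_iff) auto
  qed
  have finr: "(\<integral>\<^sup>+ w. energy r H w \<partial>M) < \<infinity>"
    using nn_integral_mono[of M "energy r H" "energy t H"] energy_mono[OF r(2), of H] fin by (meson order_le_less_trans)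
  have IJ: "sq_integrable M (\<lambda>w. I w - J w)"
    by (intro sq_integrable_diff ito_sq_integrable[OF I t fin] ito_sq_integrable[OF J r(1) finr])
  have "AE w in M. q w \<noteq> \<infinity>" using c(1) by (intro nn_integral_PInf_AE) auto
  hence lim: "AE w in M. (\<lambda>m. Z m w - (I w - J w)) \<longlonglongrightarrow> 0"
    using D0 I0 ito_restricted_limit[OF ed D J r] AE_space
  proof eventually_elim
    case (elim w)
    then obtain x where x: "q w = ennreal x" "0 \<le> x" by (cases "q w") auto
    have "eventually (\<lambda>m. d m w < ennreal 1) sequentially" using elim(2) unfolding d_def by (rule order_tendstoD) simp
    moreover have "eventually (\<lambda>m. 2 * x + 2 \<le> real m) sequentially"
      using filterlim_real_sequentially by (simp add: filterlim_at_top)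
    ultimately have "eventually (\<lambda>m. elementary_integral W (k m) (\<tau> m) (\<xi> m) w -
       elementary_integral W (k m) (\<lambda>j. min r (\<tau> m j)) (restricted r (\<tau> m) (\<xi> m)) w = Z m w) sequentially"
    proof eventually_elim
      case (elim m)
      have "ennreal (step_energy (k m) (\<tau> m) (\<xi> m) w) \<le> 2 * q w + 2 * d m w" using eps \<open>w \<in> space M\<close> by blast
      also have "\<dots> \<le> 2 * ennreal x + 2 * ennreal 1" unfolding x(1) using elim(1) by (intro add_mono mult_left_mono) auto
      also have "\<dots> = ennreal (2 * x + 2)" using x by (simp add: ennreal_mult ennreal_plus)
      finally have "step_energy (k m) (\<tau> m) (\<xi> m) w \<le> real m"
        using elim(2) x by (subst (asm) ennreal_le_iff) auto
      hence "Z m w = elementary_integral W (k m) (\<lambda>j. max r (\<tau> m j)) (\<xi> m) w"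
        unfolding Z_def \<eta>_def elementary_integral_def by (intro sum.cong) (auto simp: stopped_eq[OF ed])
      thus ?case using restricted_integral[OF ed, of m w r] by simp
    qed
    with tendsto_diff[OF elim(3,4)] have "(\<lambda>m. Z m w) \<longlonglongrightarrow> I w - J w" by (rule Lim_transform_eventually)
    thus ?case by (rule LIM_zero)
  qed
  have "(\<lambda>m. \<integral>w. Y w \<bullet> (Z m w - (I w - J w)) \<partial>M) \<longlonglongrightarrow> 0"
  proof (rule weak_convergence_inner[OF _ _ lim Y(2)])
    show s: "sq_integrable M (\<lambda>w. Z m w - (I w - J w))" for m by (intro sq_integrable_diff Zsq IJ)
    fix m
    have "(\<integral>w. (norm (Z m w - (I w - J w)))\<^sup>2 \<partial>M) \<le> (\<integral>w. 2 * (norm (Z m w))\<^sup>2 + 2 * (norm (I w - J w))\<^sup>2 \<partial>M)"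
      using norm_add_sq_le[of "Z m _" "- (I _ - J _)"]
      by (intro integral_mono sq_integrable_norm[OF s] Bochner_Integration.integrable_add integrable_mult_right sq_integrable_norm[OF Zsq] sq_integrable_norm[OF IJ]) 
         (metis diff_conv_add_uminus norm_minus_cancel)
    also have "\<dots> = 2 * (\<integral>w. (norm (Z m w))\<^sup>2 \<partial>M) + 2 * (\<integral>w. (norm (I w - J w))\<^sup>2 \<partial>M)"
      using sq_integrable_norm[OF Zsq] sq_integrable_norm[OF IJ] by simp
    also have "\<dots> \<le> 2 * (2 * c + 2) + 2 * (\<integral>w. (norm (I w - J w))\<^sup>2 \<partial>M)" using Zb[of m] by simp
    finally show "(\<integral>w. (norm (Z m w - (I w - J w)))\<^sup>2 \<partial>M) \<le> 2 * (2 * c + 2) + 2 * (\<integral>w. (norm (I w - J w))\<^sup>2 \<partial>M)" .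
  qed
  moreover have "(\<integral>w. Y w \<bullet> (Z m w - (I w - J w)) \<partial>M) = - (\<integral>w. Y w \<bullet> (I w - J w) \<partial>M)" for m
    using sq_integrable_inner[OF Y(2) Zsq[of m]] sq_integrable_inner[OF Y(2) IJ] orth[of m]
    by (subst inner_diff_right) simp
  ultimately show ?thesis using LIMSEQ_unique[OF tendsto_const] by fastforce
qed

end

section \<open>Second moments of Ito processes\<close>

text \<open>In the supremum norm with weight \<open>exp (- 2 * k * t)\<close> the integral operator
  contracts by one half, so the weighted supremum \<open>m\<close> satisfies
  \<open>m \<le> a * T + m / 2\<close>. The bound \<open>n\<close> serves only to make
  \<open>m\<close> finite and does not enter the result, so truncation levels can later tend to
  infinity.\<close>

lemma gronwall_nn_integral:
  fixes G :: "real \<Rightarrow> ennreal"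
  assumes bd: "\<And>t. t \<in> {0..T} \<Longrightarrow> G t \<le> ennreal n"
    and a: "0 \<le> a" and k: "0 < k" and T: "0 \<le> T"
    and le: "\<And>t. t \<in> {0..T} \<Longrightarrow> G t \<le> (\<integral>\<^sup>+ s\<in>{0..t}. (ennreal a + ennreal k * G s) \<partial>lborel)"
    and t: "t \<in> {0..T}"
  shows "G t \<le> ennreal (2 * a * T * exp (2 * k * T))"
proof -
  define g where "g t = enn2real (G t)" for t
  have G: "G t = ennreal (g t)" if "t \<in> {0..T}" for t
    using bd[OF that] unfolding g_def by (metis ennreal_enn2real ennreal_less_top order_le_less_trans)
  have g0: "0 \<le> g t" for t by (simp add: g_def)
  have gn: "g t \<le> \<bar>n\<bar>" if "t \<in> {0..T}" for t
    using bd[OF that] G[OF that] by (metis abs_ge_self abs_ge_zero ennreal_le_iff ennreal_leI order_trans)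
  define m where "m = (SUP t\<in>{0..T}. exp (- 2 * k * t) * g t)"
  have bdd: "bdd_above ((\<lambda>t. exp (- 2 * k * t) * g t) ` {0..T})"
  proof (rule bdd_aboveI2)
    fix t assume t: "t \<in> {0..T}"
    have "exp (- 2 * k * t) * g t \<le> 1 * \<bar>n\<bar>" by (rule mult_mono) (use t k g0 gn in auto)
    thus "exp (- 2 * k * t) * g t \<le> \<bar>n\<bar>" by simp
  qed
  have up: "exp (- 2 * k * s) * g s \<le> m" if "s \<in> {0..T}" for s
    unfolding m_def by (rule cSUP_upper[OF that bdd])
  have m0: "0 \<le> m" using up[of 0] g0[of 0] T by (auto intro: order_trans)
  have gm: "g s \<le> m * exp (2 * k * s)" if "s \<in> {0..T}" for s
    using up[OF that] by (simp add: exp_minus field_simps)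
  have step: "exp (- 2 * k * t) * g t \<le> a * T + m / 2" if t: "t \<in> {0..T}" for t
  proof -
    have d: "DERIV (\<lambda>s. a * s + m / 2 * exp (2 * k * s)) s :> a + k * (m * exp (2 * k * s))" for s
      by (auto intro!: derivative_eq_intros)
    have d': "DERIV (\<lambda>s. a * s + m * exp (2 * k * s) / 2) s :> a + k * (m * exp (2 * k * s))" for s
      using d by simp
    have "ennreal (g t) \<le> (\<integral>\<^sup>+ s\<in>{0..t}. (ennreal a + ennreal k * G s) \<partial>lborel)" using le[OF t] G[OF t] by simp
    also have "\<dots> \<le> (\<integral>\<^sup>+ s. ennreal (a + k * (m * exp (2 * k * s))) * indicator {0..t} s \<partial>lborel)"
    proof (rule nn_integral_mono)
      fix s
      show "(ennreal a + ennreal k * G s) * indicator {0..t} s \<le> ennreal (a + k * (m * exp (2 * k * s))) * indicator {0..t} s"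
      proof (cases "s \<in> {0..t}")
        case True
        hence s: "s \<in> {0..T}" using t by auto
        have "ennreal a + ennreal k * G s = ennreal (a + k * g s)"
          unfolding G[OF s] using a k g0 by (simp add: ennreal_mult ennreal_plus)
        also have "\<dots> \<le> ennreal (a + k * (m * exp (2 * k * s)))"
          using gm[OF s] k by (intro ennreal_leI add_left_mono mult_left_mono) auto
        finally show ?thesis using True by simp
      qed simp
    qed
    also have "\<dots> = ennreal ((a * t + m / 2 * exp (2 * k * t)) - (a * 0 + m / 2 * exp (2 * k * 0)))"
      by (rule nn_integral_FTC_Icc) (use a k m0 t in \<open>auto intro!: d'\<close>)
    also have "\<dots> \<le> ennreal (a * T + m / 2 * exp (2 * k * t))"
    proof (rule ennreal_leI)
      have "a * t \<le> a * T" using a t by (intro mult_left_mono) auto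
      thus "(a * t + m / 2 * exp (2 * k * t)) - (a * 0 + m / 2 * exp (2 * k * 0)) \<le> a * T + m / 2 * exp (2 * k * t)"
        using m0 by simp
    qed
    finally have "g t \<le> a * T + m / 2 * exp (2 * k * t)" using a m0 T by (subst (asm) ennreal_le_iff) auto
    hence "exp (- 2 * k * t) * g t \<le> exp (- 2 * k * t) * (a * T + m / 2 * exp (2 * k * t))"
      by (rule mult_left_mono) simp
    also have "\<dots> = exp (- 2 * k * t) * (a * T) + m / 2 * (exp (- 2 * k * t) * exp (2 * k * t))"
      by (simp only: distrib_left mult.left_commute)
    also have "exp (- 2 * k * t) * exp (2 * k * t) = 1" by (simp flip: exp_add)
    also have "exp (- 2 * k * t) * (a * T) \<le> 1 * (a * T)" by (rule mult_right_mono) (use a T k t in auto)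
    finally show ?thesis by simp
  qed
  have "m \<le> a * T + m / 2" unfolding m_def[symmetric]
    by (subst m_def, rule cSUP_least) (use T step in auto)
  hence m: "m \<le> 2 * a * T" by simp
  have "g t \<le> m * exp (2 * k * t)" by (rule gm[OF t])
  also have "\<dots> \<le> 2 * a * T * exp (2 * k * T)" using m m0 a k t T by (intro mult_mono) auto
  finally show ?thesis unfolding G[OF t] by (rule ennreal_leI)
qed

text \<open>Stopping at the first time \<open>\<sigma>\<close> at which the running integral reaches
  \<open>n\<close>. Boundedness of \<open>\<phi>\<close> makes \<open>\<Phi>\<close> continuous, so
  the level is attained at \<open>\<sigma>\<close>, and the part of the integral before
  \<open>\<sigma>\<close> already accounts for it.\<close>

lemma truncated_integral_le:
  fixes \<phi> :: "real \<Rightarrow> ennreal" and n :: ennreal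
  assumes bd: "\<And>s. s \<in> {0..t} \<Longrightarrow> \<phi> s \<le> ennreal \<kappa>" and [measurable]: "\<phi> \<in> borel_measurable lborel"
    and t: "0 \<le> t" and \<kappa>: "0 \<le> \<kappa>" and \<Phi>: "\<And>s. \<Phi> s = (\<integral>\<^sup>+ r\<in>{0..s}. \<phi> r \<partial>lborel)"
  shows "min n (\<Phi> t) \<le> (\<integral>\<^sup>+ s\<in>{0..t}. (if \<Phi> s < n then \<phi> s else 0) \<partial>lborel)"
proof (cases "\<Phi> t < n")
  case True
  have "\<Phi> s < n" if "s \<in> {0..t}" for s
  proof -
    have "\<Phi> s \<le> \<Phi> t" unfolding \<Phi> by (intro nn_integral_mono mult_left_mono) (use that in \<open>auto simp: indicator_def\<close>)
    thus ?thesis using True by simp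
  qed
  hence "(\<integral>\<^sup>+ s\<in>{0..t}. (if \<Phi> s < n then \<phi> s else 0) \<partial>lborel) = \<Phi> t"
    unfolding \<Phi>[of t] by (intro nn_integral_cong) (auto simp: indicator_def)
  thus ?thesis by simp
next
  case False
  define A where "A = {s \<in> {0..t}. n \<le> \<Phi> s}"
  define \<sigma> where "\<sigma> = Inf A"
  have tA: "t \<in> A" using False t by (simp add: A_def)
  have bA: "bdd_below A" by (auto simp: A_def intro: bdd_belowI[of _ 0])
  have \<sigma>: "0 \<le> \<sigma>" "\<sigma> \<le> t" unfolding \<sigma>_def using tA bA by (auto intro: cInf_greatest cInf_lower simp: A_def)
  have n\<sigma>: "n \<le> \<Phi> \<sigma>"
  proof (rule ennreal_le_epsilon)
    fix e :: real assume e: "0 < e"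
    \<comment> \<open>Between \<open>\<sigma>\<close> and a nearby point \<open>u\<close> of
      \<open>A\<close> the integral grows by at most
      \<open>\<kappa> * (u - \<sigma>) \<le> e\<close>; adding 1 avoids division by zero.\<close>
    have "\<sigma> < \<sigma> + e / (\<kappa> + 1)" using e \<kappa> by simp
    then obtain u where u: "u \<in> A" "u < \<sigma> + e / (\<kappa> + 1)" using cInf_lessD[of A "\<sigma> + e / (\<kappa> + 1)"] tA unfolding \<sigma>_def by blast
    have \<sigma>u: "\<sigma> \<le> u" unfolding \<sigma>_def by (rule cInf_lower[OF u(1) bA])
    have ut: "u \<in> {0..t}" using u by (simp add: A_def)
    have "n \<le> \<Phi> u" using u by (simp add: A_def)
    also have "\<Phi> u \<le> (\<integral>\<^sup>+ r. \<phi> r * indicator {0..\<sigma>} r + ennreal \<kappa> * indicator {\<sigma>..u} r \<partial>lborel)"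
      unfolding \<Phi> by (rule nn_integral_mono) (use bd ut \<sigma>u in \<open>auto simp: indicator_def\<close>)
    also have "\<dots> = \<Phi> \<sigma> + ennreal \<kappa> * ennreal (u - \<sigma>)"
      unfolding \<Phi> using \<sigma>u by (subst nn_integral_add) (auto simp: nn_integral_cmult)
    also have "ennreal \<kappa> * ennreal (u - \<sigma>) \<le> ennreal e"
    proof -
      have "\<kappa> * (u - \<sigma>) \<le> (\<kappa> + 1) * (e / (\<kappa> + 1))" using u \<sigma>u \<kappa> e by (intro mult_mono) auto
      also have "\<dots> = e" using \<kappa> by simp
      finally show ?thesis using \<kappa> \<sigma>u by (simp add: ennreal_mult[symmetric] ennreal_leI)
    qed
    finally show "n \<le> \<Phi> \<sigma> + ennreal e" by (simp add: add_left_mono)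
  qed
  have below: "\<Phi> s < n" if "0 \<le> s" "s < \<sigma>" for s
  proof (rule ccontr)
    assume "\<not> \<Phi> s < n"
    hence "s \<in> A" using that \<sigma> by (simp add: A_def)
    hence "\<sigma> \<le> s" unfolding \<sigma>_def by (rule cInf_lower[OF _ bA])
    thus False using that by simp
  qed
  have "\<Phi> \<sigma> = (\<integral>\<^sup>+ r. \<phi> r * indicator {0..<\<sigma>} r \<partial>lborel)"
    unfolding \<Phi> by (intro nn_integral_cong_AE) (use AE_lborel_singleton[of \<sigma>] in \<open>eventually_elim, auto simp: indicator_def\<close>)
  also have "\<dots> \<le> (\<integral>\<^sup>+ s\<in>{0..t}. (if \<Phi> s < n then \<phi> s else 0) \<partial>lborel)"
    by (rule nn_integral_mono) (use below \<sigma> in \<open>auto simp: indicator_def\<close>)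
  finally have "\<Phi> \<sigma> \<le> (\<integral>\<^sup>+ s\<in>{0..t}. (if \<Phi> s < n then \<phi> s else 0) \<partial>lborel)" .
  with n\<sigma> have "n \<le> (\<integral>\<^sup>+ s\<in>{0..t}. (if \<Phi> s < n then \<phi> s else 0) \<partial>lborel)" by (rule order_trans)
  thus ?thesis by (rule min.coboundedI1)
qed

lemma drift_bound:
  fixes b :: "real \<Rightarrow> 'b::euclidean_space"
  assumes int: "set_integrable lborel {0..t} b" and t: "0 \<le> t"
  shows "ennreal ((norm (LINT s:{0..t}|lborel. b s))\<^sup>2) \<le> ennreal t * (\<integral>\<^sup>+ s\<in>{0..t}. ennreal ((norm (b s))\<^sup>2) \<partial>lborel)"
proof -
  define f where "f s = indicator {0..t} s *\<^sub>R b s" for s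
  have i: "integrable lborel f" using int by (simp add: set_integrable_def f_def[abs_def])
  have [measurable]: "f \<in> borel_measurable lborel" using i by auto
  have "ennreal (norm (LINT s:{0..t}|lborel. b s)) \<le> (\<integral>\<^sup>+ s. ennreal (norm (f s)) \<partial>lborel)"
    unfolding set_lebesgue_integral_def f_def[symmetric] by (rule integral_norm_bound_ennreal[OF i])
  also have "\<dots> = (\<integral>\<^sup>+ s. ennreal (norm (f s)) * indicator {0..t} s \<partial>lborel)"
    by (intro nn_integral_cong) (auto simp: f_def indicator_def)
  finally have le: "ennreal (norm (LINT s:{0..t}|lborel. b s)) \<le> (\<integral>\<^sup>+ s. ennreal (norm (f s)) * indicator {0..t} s \<partial>lborel)" .
  have "ennreal ((norm (LINT s:{0..t}|lborel. b s))\<^sup>2) = (ennreal (norm (LINT s:{0..t}|lborel. b s)))\<^sup>2" by (simp add: ennreal_power)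
  also have "\<dots> \<le> (\<integral>\<^sup>+ s. ennreal (norm (f s)) * indicator {0..t} s \<partial>lborel)\<^sup>2" using le by (rule power_mono) simp
  also have "\<dots> \<le> (\<integral>\<^sup>+ s. (ennreal (norm (f s)))\<^sup>2 \<partial>lborel) * (\<integral>\<^sup>+ s. (indicator {0..t} s)\<^sup>2 \<partial>lborel)"
    by (rule Cauchy_Schwarz_nn_integral) measurable
  also have "(\<integral>\<^sup>+ s. (indicator {0..t} s :: ennreal)\<^sup>2 \<partial>lborel) = (\<integral>\<^sup>+ s. indicator {0..t} s \<partial>lborel)"
    by (intro nn_integral_cong) (auto simp: indicator_def)
  also have "\<dots> = ennreal t" using t by simp
  also have "(\<integral>\<^sup>+ s. (ennreal (norm (f s)))\<^sup>2 \<partial>lborel) = (\<integral>\<^sup>+ s\<in>{0..t}. ennreal ((norm (b s))\<^sup>2) \<partial>lborel)"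
    by (intro nn_integral_cong) (auto simp: f_def indicator_def ennreal_power)
  finally show ?thesis by (simp add: mult.commute)
qed

context brownian_basis
begin

text \<open>The accumulated growth \<open>\<Phi>\<close> dominates the energies of both
  \<open>b\<close> and \<open>H\<close>. Truncating at \<open>\<Phi> < n\<close> makes all
  expectations finite; the localised isometry bounds the truncated integrand by \<open>G\<close>,
  pathwise stopping bounds \<open>G\<close> by its time integral, and Gronwall's inequality closes
  the loop uniformly in \<open>n\<close>.\<close>

lemma second_moment_bound:
  fixes X :: "real \<Rightarrow> 'a \<Rightarrow> 'b::euclidean_space"
  assumes diff: "has_ito_differential M F W X b H" and T: "0 \<le> T" and c: "1 \<le> c"
    and bc: "\<And>t w. t \<in> {0..T} \<Longrightarrow> (norm (b t w))\<^sup>2 \<le> c * (1 + (norm (X t w))\<^sup>2)"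
    and Hc: "\<And>t w. t \<in> {0..T} \<Longrightarrow> (norm (H t w))\<^sup>2 \<le> c * (1 + (norm (X t w))\<^sup>2)"
    and X0: "(\<integral>\<^sup>+ w. ennreal ((norm (X 0 w))\<^sup>2) \<partial>M) < \<infinity>"
  shows "\<exists>C. \<forall>t\<in>{0..T}. (\<integral>\<^sup>+ w. ennreal ((norm (X t w))\<^sup>2) \<partial>M) \<le> ennreal C"
proof -
  interpret P: pair_sigma_finite M lborel ..
  have prog: "progressive F X" and cont: "AE w in M. continuous_on {0..} (\<lambda>t. X t w)"
    and ito: "\<And>t. 0 \<le> t \<Longrightarrow> \<exists>I. has_ito_integral M F W H t I \<and>
        (AE w in M. set_integrable lborel {0..t} (\<lambda>s. b s w) \<and> X t w = X 0 w + (LINT s:{0..t}|lborel. b s w) + I w)"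
    using diff by (auto simp: has_ito_differential_def)
  define xx where "xx w s = indicator {0..T} s *\<^sub>R X s w" for w s
  have [measurable]: "case_prod xx \<in> borel_measurable (M \<Otimes>\<^sub>M lborel)"
    using progressive_joint[OF prog T] by (simp add: xx_def case_prod_beta')
  define \<phi> where "\<phi> w s = ennreal (c * (1 + (norm (xx w s))\<^sup>2))" for w s
  have [measurable]: "case_prod \<phi> \<in> borel_measurable (M \<Otimes>\<^sub>M lborel)" unfolding \<phi>_def by measurable
  have \<phi>X: "\<phi> w s = ennreal (c * (1 + (norm (X s w))\<^sup>2))" if "s \<in> {0..T}" for s w using that by (simp add: \<phi>_def xx_def)
  define \<Phi> where "\<Phi> w s = (\<integral>\<^sup>+ r. (if 0 \<le> r \<and> r \<le> s then \<phi> w r else 0) \<partial>lborel)" for w s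
  have \<Phi>: "\<Phi> w s = (\<integral>\<^sup>+ r\<in>{0..s}. \<phi> w r \<partial>lborel)" for w s
    unfolding \<Phi>_def by (intro nn_integral_cong) (auto simp: indicator_def)
  have [measurable]: "case_prod \<Phi> \<in> borel_measurable (M \<Otimes>\<^sub>M lborel)"
    unfolding \<Phi>_def by measurable
  have X0m: "X 0 \<in> borel_measurable M" using measurable_F_M[OF progressive_adapted[OF prog order_refl]] .
  obtain e0 where e0: "(\<integral>\<^sup>+ w. ennreal ((norm (X 0 w))\<^sup>2) \<partial>M) = ennreal e0" "0 \<le> e0"
    using X0 by (cases "\<integral>\<^sup>+ w. ennreal ((norm (X 0 w))\<^sup>2) \<partial>M") auto
  \<comment> \<open>The factor 3 comes from squaring a sum of three terms; in \<open>k\<close>, the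
    drift contributes \<open>T\<close> through Cauchy-Schwarz and the stochastic integral
    contributes 1.\<close>
  define a where "a = c + 3 * c * e0"
  define k where "k = 3 * c * (T + 1)"
  have a: "0 \<le> a" and k: "0 < k" using c e0 T by (auto simp: a_def k_def)
  \<comment> \<open>\<open>G\<close> truncates the integral of \<open>\<phi>\<close>,
    \<open>h\<close> switches off the integrand. They bound each other:
    \<open>h \<le> a + k * G\<close> by the equation, and \<open>G\<close> is at most the time
    integral of \<open>h\<close> by stopping each path.\<close>
  define G where "G n t = (\<integral>\<^sup>+ w. min (ennreal (real n)) (\<Phi> w t) \<partial>M)" for n t
  define h where "h n t = (\<integral>\<^sup>+ w. (if \<Phi> w t < ennreal (real n) then \<phi> w t else 0) \<partial>M)" for n t
  have le\<Phi>: "(\<integral>\<^sup>+ s\<in>{0..t}. ennreal (f s) \<partial>lborel) \<le> \<Phi> w t"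
    if "t \<in> {0..T}" "\<And>s. s \<in> {0..T} \<Longrightarrow> f s \<le> c * (1 + (norm (X s w))\<^sup>2)" for f t w
    unfolding \<Phi>
  proof (rule nn_integral_mono)
    fix s
    show "ennreal (f s) * indicator {0..t} s \<le> \<phi> w s * indicator {0..t} s"
      using that by (cases "s \<in> {0..t}") (auto simp: \<phi>X intro!: ennreal_leI)
  qed
  have h: "h n t \<le> ennreal a + ennreal k * G n t" if t: "t \<in> {0..T}" for n t
  proof -
    obtain I where I: "has_ito_integral M F W H t I" and eq: "AE w in M. set_integrable lborel {0..t} (\<lambda>s. b s w) \<and>
       X t w = X 0 w + (LINT s:{0..t}|lborel. b s w) + I w" using ito[of t] t by auto
    have progH: "progressive F H" and [measurable]: "I \<in> borel_measurable M" using I by (auto simp: has_ito_integral_def)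
    have [measurable]: "energy t H \<in> borel_measurable M" using t by (intro energy_measurable progressive_joint[OF progH]) auto
    have [measurable]: "X 0 \<in> borel_measurable M" by (rule X0m)
    have "AE w in M. (if \<Phi> w t < ennreal (real n) then \<phi> w t else 0) \<le>
      ennreal c + ennreal (3 * c) * (ennreal ((norm (X 0 w))\<^sup>2) + (ennreal T * min (ennreal (real n)) (\<Phi> w t)
       + (if energy t H w < ennreal (real n) then ennreal ((norm (I w))\<^sup>2) else 0)))"
      using eq
    proof eventually_elim
      case (elim w)
      let ?B = "LINT s:{0..t}|lborel. b s w"
      show ?case
      proof (cases "\<Phi> w t < ennreal (real n)")
        case True
        have eH: "energy t H w \<le> \<Phi> w t" unfolding energy_def
          by (rule le\<Phi>[OF t Hc])
        have "ennreal ((norm ?B)\<^sup>2) \<le> ennreal t * (\<integral>\<^sup>+ s\<in>{0..t}. ennreal ((norm (b s w))\<^sup>2) \<partial>lborel)"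
          using elim t by (intro drift_bound) auto
        also have "\<dots> \<le> ennreal T * \<Phi> w t" 
          by (intro mult_mono le\<Phi>[OF t bc]) (use t in \<open>auto intro!: ennreal_leI\<close>)
        also have "\<Phi> w t = min (ennreal (real n)) (\<Phi> w t)" using True by (simp add: min_absorb2)
        finally have B: "ennreal ((norm ?B)\<^sup>2) \<le> ennreal T * min (ennreal (real n)) (\<Phi> w t)" .
        have "c * (1 + (norm (X t w))\<^sup>2) \<le> c + 3 * c * ((norm (X 0 w))\<^sup>2 + ((norm ?B)\<^sup>2 + (norm (I w))\<^sup>2))"
          using mult_left_mono[OF norm_add3_sq_le[of "X 0 w" ?B "I w"], of c] c elim by (simp add: algebra_simps)
        hence "\<phi> w t \<le> ennreal (c + 3 * c * ((norm (X 0 w))\<^sup>2 + ((norm ?B)\<^sup>2 + (norm (I w))\<^sup>2)))"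
          unfolding \<phi>X[OF t] by (rule ennreal_leI)
        also have "\<dots> = ennreal c + ennreal (3 * c) * (ennreal ((norm (X 0 w))\<^sup>2) + (ennreal ((norm ?B)\<^sup>2) + ennreal ((norm (I w))\<^sup>2)))"
          using c by (simp add: ennreal_plus ennreal_mult)
        also have "\<dots> \<le> ennreal c + ennreal (3 * c) * (ennreal ((norm (X 0 w))\<^sup>2) + (ennreal T * min (ennreal (real n)) (\<Phi> w t)
          + (if energy t H w < ennreal (real n) then ennreal ((norm (I w))\<^sup>2) else 0)))"
          using B order_le_less_trans[OF eH True] by (intro add_left_mono mult_left_mono add_mono) auto
        finally show ?thesis using True by simp
      qed simp
    qed
    hence "h n t \<le> (\<integral>\<^sup>+ w. ennreal c + ennreal (3 * c) * (ennreal ((norm (X 0 w))\<^sup>2) + (ennreal T * min (ennreal (real n)) (\<Phi> w t)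
       + (if energy t H w < ennreal (real n) then ennreal ((norm (I w))\<^sup>2) else 0))) \<partial>M)"
      unfolding h_def by (rule nn_integral_mono_AE)
    also have "\<dots> = ennreal c + ennreal (3 * c) * ((\<integral>\<^sup>+ w. ennreal ((norm (X 0 w))\<^sup>2) \<partial>M) + (ennreal T * G n t
       + (\<integral>\<^sup>+ w. (if energy t H w < ennreal (real n) then ennreal ((norm (I w))\<^sup>2) else 0) \<partial>M)))"
      unfolding G_def by (simp add: nn_integral_add nn_integral_cmult emeasure_space_1)
    also have "(\<integral>\<^sup>+ w. (if energy t H w < ennreal (real n) then ennreal ((norm (I w))\<^sup>2) else 0) \<partial>M) \<le> G n t"
    proof -
      have "(\<integral>\<^sup>+ w. (if energy t H w < ennreal (real n) then ennreal ((norm (I w))\<^sup>2) else 0) \<partial>M)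
          \<le> (\<integral>\<^sup>+ w. min (ennreal (real n)) (energy t H w) \<partial>M)" using t by (intro ito_localized_energy[OF I]) auto
      also have "\<dots> \<le> G n t" unfolding G_def energy_def
        by (intro nn_integral_mono min.mono order_refl le\<Phi>[OF t Hc])
      finally show ?thesis .
    qed
    also have "ennreal c + ennreal (3 * c) * ((\<integral>\<^sup>+ w. ennreal ((norm (X 0 w))\<^sup>2) \<partial>M) + (ennreal T * G n t + G n t))
       = ennreal a + ennreal k * G n t"
    proof -
      have "ennreal (3 * c) * ennreal e0 = ennreal (3 * c * e0)" using c e0 by (intro ennreal_mult[symmetric]) auto
      moreover have "ennreal T * G n t + G n t = ennreal (T + 1) * G n t" using T by (simp add: ennreal_plus distrib_right)
      moreover have "ennreal (3 * c) * (ennreal (T + 1) * G n t) = ennreal k * G n t"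
        unfolding k_def using c T by (subst mult.assoc[symmetric], subst ennreal_mult[symmetric]) auto
      moreover have "ennreal c + ennreal (3 * c * e0) = ennreal a" unfolding a_def using c e0 by (intro ennreal_plus[symmetric]) auto
      ultimately show ?thesis unfolding e0(1) by (simp only: distrib_left add.assoc[symmetric])
    qed
    finally show ?thesis by (simp add: add_left_mono mult_left_mono)
  qed
  have G: "G n t \<le> (\<integral>\<^sup>+ s\<in>{0..t}. h n s \<partial>lborel)" if t: "t \<in> {0..T}" for n t
  proof -
    have "AE w in M. min (ennreal (real n)) (\<Phi> w t)
       \<le> (\<integral>\<^sup>+ s\<in>{0..t}. (if \<Phi> w s < ennreal (real n) then \<phi> w s else 0) \<partial>lborel)"
      using cont AE_space
    proof eventually_elim
      case (elim w)
      have "continuous_on {0..T} (\<lambda>s. c * (1 + (norm (X s w))\<^sup>2))"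
        by (intro continuous_intros continuous_on_subset[OF elim(1)]) auto
      hence "compact ((\<lambda>s. c * (1 + (norm (X s w))\<^sup>2)) ` {0..T})" by (rule compact_continuous_image) simp
      from compact_imp_bounded[OF this] obtain \<kappa> where "\<forall>s\<in>{0..T}. \<bar>c * (1 + (norm (X s w))\<^sup>2)\<bar> \<le> \<kappa>"
        by (auto simp: bounded_real)
      hence \<kappa>: "c * (1 + (norm (X s w))\<^sup>2) \<le> \<kappa>" if "s \<in> {0..T}" for s using that by (meson abs_le_D1)
      show ?case
      proof (rule truncated_integral_le[where \<kappa> = "\<bar>\<kappa>\<bar>"])
        show "\<phi> w s \<le> ennreal \<bar>\<kappa>\<bar>" if "s \<in> {0..t}" for s
          using \<kappa>[of s] that t by (subst \<phi>X) (auto intro!: ennreal_leI order_trans[OF _ abs_ge_self])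
        show "\<phi> w \<in> borel_measurable lborel" using elim(2) by measurable
      qed (use t \<Phi> in auto)
    qed
    hence "G n t \<le> (\<integral>\<^sup>+ w. (\<integral>\<^sup>+ s\<in>{0..t}. (if \<Phi> w s < ennreal (real n) then \<phi> w s else 0) \<partial>lborel) \<partial>M)"
      unfolding G_def by (rule nn_integral_mono_AE)
    also have "\<dots> = (\<integral>\<^sup>+ s. (\<integral>\<^sup>+ w. (if \<Phi> w s < ennreal (real n) then \<phi> w s else 0) * indicator {0..t} s \<partial>M) \<partial>lborel)"
      by (rule P.Fubini'[symmetric]) measurable
    also have "\<dots> = (\<integral>\<^sup>+ s\<in>{0..t}. h n s \<partial>lborel)"
      unfolding h_def by (intro nn_integral_cong nn_integral_multc) measurable
    finally show ?thesis .
  qed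
  define C where "C = 2 * a * T * exp (2 * k * T)"
  have GC: "G n t \<le> ennreal C" if t: "t \<in> {0..T}" for n t
    unfolding C_def
  proof (rule gronwall_nn_integral[OF _ a k T _ t])
    show "G n s \<le> ennreal (real n)" for s
    proof -
      have "G n s \<le> (\<integral>\<^sup>+ w. ennreal (real n) \<partial>M)" unfolding G_def by (intro nn_integral_mono) simp
      thus ?thesis by (simp add: emeasure_space_1)
    qed
    show "G n s \<le> (\<integral>\<^sup>+ r\<in>{0..s}. (ennreal a + ennreal k * G n r) \<partial>lborel)" if "s \<in> {0..T}" for s
      using G[OF that, of n] by (rule order_trans) (use that h in \<open>auto intro!: nn_integral_mono simp: indicator_def\<close>)
  qed
  have C0: "0 \<le> C" using a T by (simp add: C_def)
  have "(\<integral>\<^sup>+ w. ennreal ((norm (X t w))\<^sup>2) \<partial>M) \<le> ennreal (a + k * C)" if t: "t \<in> {0..T}" for t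
  proof -
    \<comment> \<open>A continuous path has finite \<open>\<Phi>\<close>, so the events
      \<open>\<Phi> < n\<close> exhaust the space up to a null set and the bound uniform in
      \<open>n\<close> reaches the full moment.\<close>
    have "AE w in M. ennreal ((norm (X t w))\<^sup>2) \<le> (SUP n. if \<Phi> w t < ennreal (real n) then \<phi> w t else 0)"
      using cont
    proof eventually_elim
      case (elim w)
      have "continuous_on {0..T} (\<lambda>s. c * (1 + (norm (X s w))\<^sup>2))"
        by (intro continuous_intros continuous_on_subset[OF elim]) auto
      hence "compact ((\<lambda>s. c * (1 + (norm (X s w))\<^sup>2)) ` {0..T})" by (rule compact_continuous_image) simp
      from compact_imp_bounded[OF this] obtain \<kappa> where "\<forall>s\<in>{0..T}. \<bar>c * (1 + (norm (X s w))\<^sup>2)\<bar> \<le> \<kappa>"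
        by (auto simp: bounded_real)
      hence \<kappa>: "c * (1 + (norm (X s w))\<^sup>2) \<le> \<kappa>" if "s \<in> {0..T}" for s using that by (meson abs_le_D1)
      have "\<Phi> w t \<le> (\<integral>\<^sup>+ s. ennreal \<bar>\<kappa>\<bar> * indicator {0..t} s \<partial>lborel)" unfolding \<Phi>
      proof (rule nn_integral_mono)
        fix s
        show "\<phi> w s * indicator {0..t} s \<le> ennreal \<bar>\<kappa>\<bar> * indicator {0..t} s"
          using \<kappa>[of s] t by (cases "s \<in> {0..t}") (auto simp: \<phi>X intro!: ennreal_leI order_trans[OF _ abs_ge_self])
      qed
      also have "\<dots> = ennreal (\<bar>\<kappa>\<bar> * t)" using t by (simp add: nn_integral_cmult ennreal_mult)
      finally have le: "\<Phi> w t \<le> ennreal (\<bar>\<kappa>\<bar> * t)" .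
      obtain n where n: "\<bar>\<kappa>\<bar> * t < real n" using reals_Archimedean2 by blast
      hence "\<Phi> w t < ennreal (real n)" using le t by (auto intro!: order_le_less_trans[OF le] simp: ennreal_less_iff)
      moreover have "ennreal ((norm (X t w))\<^sup>2) \<le> \<phi> w t"
      proof -
        have "1 * (norm (X t w))\<^sup>2 \<le> c * (1 + (norm (X t w))\<^sup>2)" by (rule mult_mono) (use c in auto)
        thus ?thesis unfolding \<phi>X[OF t] by (intro ennreal_leI) simp
      qed
      ultimately have "ennreal ((norm (X t w))\<^sup>2) \<le> (if \<Phi> w t < ennreal (real n) then \<phi> w t else 0)" by simp
      thus ?case by (rule SUP_upper2[OF UNIV_I])
    qed
    hence "(\<integral>\<^sup>+ w. ennreal ((norm (X t w))\<^sup>2) \<partial>M) \<le> (\<integral>\<^sup>+ w. (SUP n. if \<Phi> w t < ennreal (real n) then \<phi> w t else 0) \<partial>M)"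
      by (rule nn_integral_mono_AE)
    also have "\<dots> = (SUP n. h n t)" unfolding h_def
    proof (rule nn_integral_monotone_convergence_SUP)
      show "incseq (\<lambda>n w. if \<Phi> w t < ennreal (real n) then \<phi> w t else 0)" unfolding incseq_def le_fun_def
        by (auto intro: order.strict_trans2 ennreal_leI)
    qed measurable
    also have "\<dots> \<le> ennreal (a + k * C)"
    proof (rule SUP_least)
      fix n
      have "h n t \<le> ennreal a + ennreal k * ennreal C" using h[OF t, of n] GC[OF t, of n] by (meson add_left_mono mult_left_mono order_trans zero_le)
      thus "h n t \<le> ennreal (a + k * C)" using a k C0 by (simp add: ennreal_plus ennreal_mult)
    qed
    finally show ?thesis .
  qed
  thus ?thesis by blast
qed

lemma ito_linear:
  fixes H :: "real \<Rightarrow> 'a \<Rightarrow> 'b::euclidean_space" and L :: "'b \<Rightarrow> 'c::euclidean_space"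
  assumes ito: "has_ito_integral M F W H t I" and t: "0 \<le> t" and L: "linear L"
  shows "has_ito_integral M F W (\<lambda>s w. L (H s w)) t (\<lambda>w. L (I w))"
proof -
  obtain c where c: "c > 0" "\<And>x. norm (L x) \<le> c * norm x" using linear_bounded_pos[OF L] by metis
  have [measurable]: "L \<in> borel_measurable borel"
    using L by (auto simp: linear_conv_bounded_linear intro!: borel_measurable_continuous_onI linear_continuous_on)
  from ito obtain k \<tau> \<xi> where prog: "progressive F H" and I[measurable]: "I \<in> borel_measurable M"
    and ed: "\<And>m::nat. elementary_data M F t (k m) (\<tau> m) (\<xi> m)"
    and c1: "\<And>\<epsilon>. \<epsilon> > 0 \<Longrightarrow> (\<lambda>m. measure M {w \<in> space M. ennreal \<epsilon> <
            (\<integral>\<^sup>+ s\<in>{0..t}. ennreal ((norm (elementary_process (k m) (\<tau> m) (\<xi> m) s w - H s w))\<^sup>2) \<partial>lborel)}) \<longlonglongrightarrow> 0"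
    and c2: "\<And>\<epsilon>. \<epsilon> > 0 \<Longrightarrow> (\<lambda>m. measure M {w \<in> space M. \<epsilon> < norm (elementary_integral W (k m) (\<tau> m) (\<xi> m) w - I w)}) \<longlonglongrightarrow> 0"
    unfolding has_ito_integral_def by blast
  define \<eta> where "\<eta> m j w = L (\<xi> m j w)" for m j w
  have proc: "elementary_process (k m) (\<tau> m) (\<eta> m) s w = L (elementary_process (k m) (\<tau> m) (\<xi> m) s w)" for m s w
    by (simp only: elementary_process_def \<eta>_def linear_sum[OF L] linear_cmul[OF L] o_def)
  have int: "elementary_integral W (k m) (\<tau> m) (\<eta> m) w = L (elementary_integral W (k m) (\<tau> m) (\<xi> m) w)" for m w
    by (simp only: elementary_integral_def \<eta>_def linear_sum[OF L] linear_cmul[OF L] o_def)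
  have prog': "progressive F (\<lambda>s w. L (H s w))" unfolding progressive_def
  proof (intro allI impI)
    fix u :: real assume "0 \<le> u"
    hence "case_prod H \<in> borel_measurable (restrict_space borel {0..u} \<Otimes>\<^sub>M F u)" using prog by (simp add: progressive_def)
    from measurable_compose[OF this \<open>L \<in> borel_measurable borel\<close>]
    show "case_prod (\<lambda>s w. L (H s w)) \<in> borel_measurable (restrict_space borel {0..u} \<Otimes>\<^sub>M F u)"
      by (simp add: case_prod_beta')
  qed
  have ed': "elementary_data M F t (k m) (\<tau> m) (\<eta> m)" for m
    unfolding elementary_data_def
  proof (intro conjI allI impI)
    fix j assume j: "j < k m"
    show "\<eta> m j \<in> borel_measurable (F (\<tau> m j))" unfolding \<eta>_def
      by (rule measurable_compose[of "\<xi> m j" _ borel L]) (use ed[of m] j in \<open>auto simp: elementary_data_def\<close>)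
    obtain B where B: "\<forall>w\<in>space M. norm (\<xi> m j w) \<le> B" using ed[of m] j by (auto simp: elementary_data_def bounded_iff)
    have "norm (\<eta> m j w) \<le> c * B" if "w \<in> space M" for w
      unfolding \<eta>_def using c(2)[of "\<xi> m j w"] B that c(1) by (meson mult_left_mono less_imp_le order_trans)
    thus "bounded (\<eta> m j ` space M)" by (auto simp: bounded_iff)
  qed (use ed[of m] in \<open>auto simp: elementary_data_def\<close>)
  have d1: "(\<lambda>m. measure M {w \<in> space M. ennreal \<epsilon> <
            (\<integral>\<^sup>+ s\<in>{0..t}. ennreal ((norm (elementary_process (k m) (\<tau> m) (\<eta> m) s w - L (H s w)))\<^sup>2) \<partial>lborel)}) \<longlonglongrightarrow> 0"
    if e: "\<epsilon> > 0" for \<epsilon>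
  proof (rule tendsto_sandwich[OF _ _ tendsto_const c1[of "\<epsilon> / c\<^sup>2"]])
    show "\<epsilon> / c\<^sup>2 > 0" using e c by simp
    have "measure M {w \<in> space M. ennreal \<epsilon> <
            (\<integral>\<^sup>+ s\<in>{0..t}. ennreal ((norm (elementary_process (k m) (\<tau> m) (\<eta> m) s w - L (H s w)))\<^sup>2) \<partial>lborel)}
       \<le> measure M {w \<in> space M. ennreal (\<epsilon> / c\<^sup>2) < energy t (\<lambda>s w. elementary_process (k m) (\<tau> m) (\<xi> m) s w - H s w) w}" for m
    proof (rule finite_measure_mono, safe)
      have [measurable]: "energy t (\<lambda>s w. elementary_process (k m) (\<tau> m) (\<xi> m) s w - H s w) \<in> borel_measurable M"
        by (rule energy_diff_measurable[OF progressive_joint[OF prog t] elementary_process_joint[OF ed t]])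
      show "{w \<in> space M. ennreal (\<epsilon> / c\<^sup>2) < energy t (\<lambda>s w. elementary_process (k m) (\<tau> m) (\<xi> m) s w - H s w) w} \<in> events"
        by measurable
      fix w assume w': "w \<in> space M" and lt: "ennreal \<epsilon> <
            (\<integral>\<^sup>+ s\<in>{0..t}. ennreal ((norm (elementary_process (k m) (\<tau> m) (\<eta> m) s w - L (H s w)))\<^sup>2) \<partial>lborel)"
      define g where "g s = elementary_process (k m) (\<tau> m) (\<xi> m) s w - H s w" for s
      have gm: "(\<lambda>s. indicator {0..t} s *\<^sub>R g s) \<in> borel_measurable lborel"
        using borel_measurable_diff[OF elementary_process_measurable_s[of t "k m" "\<tau> m" "\<xi> m" w] progressive_path_measurable[OF prog t w']]
        by (simp add: g_def scaleR_diff_right)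
      have "ennreal \<epsilon> < (\<integral>\<^sup>+ s. ennreal ((norm (L (g s)))\<^sup>2) * indicator {0..t} s \<partial>lborel)"
        using lt by (simp add: proc g_def linear_diff[OF L])
      also have "\<dots> \<le> (\<integral>\<^sup>+ s. ennreal (c\<^sup>2) * ennreal ((norm (indicat_real {0..t} s *\<^sub>R g s))\<^sup>2) \<partial>lborel)"
      proof (rule nn_integral_mono)
        fix s
        have "(norm (L (g s)))\<^sup>2 \<le> (c * norm (g s))\<^sup>2" using c(2)[of "g s"] by (intro power_mono) auto
        thus "ennreal ((norm (L (g s)))\<^sup>2) * indicator {0..t} s \<le> ennreal (c\<^sup>2) * ennreal ((norm (indicat_real {0..t} s *\<^sub>R g s))\<^sup>2)"
          by (auto simp: indicator_def power_mult_distrib simp flip: ennreal_mult intro!: ennreal_leI)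
      qed
      also have "\<dots> = ennreal (c\<^sup>2) * (\<integral>\<^sup>+ s. ennreal ((norm (indicat_real {0..t} s *\<^sub>R g s))\<^sup>2) \<partial>lborel)"
        by (rule nn_integral_cmult, rule measurable_compose[OF gm]) measurable
      also have "(\<integral>\<^sup>+ s. ennreal ((norm (indicat_real {0..t} s *\<^sub>R g s))\<^sup>2) \<partial>lborel) =
          energy t (\<lambda>s w. elementary_process (k m) (\<tau> m) (\<xi> m) s w - H s w) w"
        unfolding energy_def g_def by (intro nn_integral_cong) (auto simp: indicator_def)
      finally have "ennreal \<epsilon> < ennreal (c\<^sup>2) * energy t (\<lambda>s w. elementary_process (k m) (\<tau> m) (\<xi> m) s w - H s w) w" .
      moreover have "ennreal \<epsilon> = ennreal (c\<^sup>2) * ennreal (\<epsilon> / c\<^sup>2)" using c e by (subst ennreal_mult[symmetric]) auto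
      ultimately show "ennreal (\<epsilon> / c\<^sup>2) < energy t (\<lambda>s w. elementary_process (k m) (\<tau> m) (\<xi> m) s w - H s w) w"
        by (metis mult_left_mono not_le zero_le)
    qed
    thus "\<forall>\<^sub>F m in sequentially. measure M {w \<in> space M. ennreal \<epsilon> <
            (\<integral>\<^sup>+ s\<in>{0..t}. ennreal ((norm (elementary_process (k m) (\<tau> m) (\<eta> m) s w - L (H s w)))\<^sup>2) \<partial>lborel)}
       \<le> measure M {w \<in> space M. ennreal (\<epsilon> / c\<^sup>2) <
            (\<integral>\<^sup>+ s\<in>{0..t}. ennreal ((norm (elementary_process (k m) (\<tau> m) (\<xi> m) s w - H s w))\<^sup>2) \<partial>lborel)}"
      unfolding energy_def by (rule always_eventually[OF allI])
  qed auto
  have d2: "(\<lambda>m. measure M {w \<in> space M. \<epsilon> < norm (elementary_integral W (k m) (\<tau> m) (\<eta> m) w - L (I w))}) \<longlonglongrightarrow> 0"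
    if e: "\<epsilon> > 0" for \<epsilon>
  proof (rule tendsto_sandwich[OF _ _ tendsto_const c2[of "\<epsilon> / c"]])
    show "\<epsilon> / c > 0" using e c by simp
    have "measure M {w \<in> space M. \<epsilon> < norm (elementary_integral W (k m) (\<tau> m) (\<eta> m) w - L (I w))}
      \<le> measure M {w \<in> space M. \<epsilon> / c < norm (elementary_integral W (k m) (\<tau> m) (\<xi> m) w - I w)}" for m
    proof (rule finite_measure_mono, safe)
      have [measurable]: "elementary_integral W (k m) (\<tau> m) (\<xi> m) \<in> borel_measurable M" by (rule elementary_integral_measurable[OF ed])
      show "{w \<in> space M. \<epsilon> / c < norm (elementary_integral W (k m) (\<tau> m) (\<xi> m) w - I w)} \<in> events" by measurable
      fix w assume "\<epsilon> < norm (elementary_integral W (k m) (\<tau> m) (\<eta> m) w - L (I w))"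
      also have "\<dots> \<le> c * norm (elementary_integral W (k m) (\<tau> m) (\<xi> m) w - I w)"
        unfolding int linear_diff[OF L, symmetric] by (rule c(2))
      finally show "\<epsilon> / c < norm (elementary_integral W (k m) (\<tau> m) (\<xi> m) w - I w)"
        using c(1) by (simp add: pos_divide_less_eq mult.commute)
    qed
    thus "\<forall>\<^sub>F m in sequentially. measure M {w \<in> space M. \<epsilon> < norm (elementary_integral W (k m) (\<tau> m) (\<eta> m) w - L (I w))}
      \<le> measure M {w \<in> space M. \<epsilon> / c < norm (elementary_integral W (k m) (\<tau> m) (\<xi> m) w - I w)}"
      by (rule always_eventually[OF allI])
  qed auto
  show ?thesis unfolding has_ito_integral_def
    by (intro conjI exI[of _ k] exI[of _ \<tau>] exI[of _ \<eta>] allI impI prog' ed' d1 d2) measurable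
qed

lemma progressive_linear:
  assumes "progressive F X" "linear L"
  shows "progressive F (\<lambda>t w. L (X t w))"
proof -
  have [measurable]: "L \<in> borel_measurable borel"
    using assms(2) by (auto simp: linear_conv_bounded_linear intro!: borel_measurable_continuous_onI linear_continuous_on)
  show ?thesis using assms(1) unfolding progressive_def
    by (auto simp: case_prod_beta' intro!: measurable_compose[OF _ \<open>L \<in> borel_measurable borel\<close>])
qed

text \<open>Serves to write \<open>x \<bullet> (S *v x)\<close> as the squared norm of the Ito
  process \<open>sqrt S x\<close>, so that only squared norms have to be differentiated.\<close>

lemma ito_differential_linear:
  fixes X :: "real \<Rightarrow> 'a \<Rightarrow> 'b::euclidean_space" and L :: "'b \<Rightarrow> 'c::euclidean_space"
  assumes diff: "has_ito_differential M F W X b H" and L: "linear L"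
  shows "has_ito_differential M F W (\<lambda>t w. L (X t w)) (\<lambda>t w. L (b t w)) (\<lambda>t w. L (H t w))"
  unfolding has_ito_differential_def
proof (intro conjI allI impI)
  have bl: "bounded_linear L" using L by (simp add: linear_conv_bounded_linear)
  have prog: "progressive F X" and cont: "AE w in M. continuous_on {0..} (\<lambda>t. X t w)"
    using diff by (auto simp: has_ito_differential_def)
  show "progressive F (\<lambda>t w. L (X t w))" by (rule progressive_linear[OF prog L])
  show "AE w in M. continuous_on {0..} (\<lambda>t. L (X t w))" using cont
    by eventually_elim (rule bounded_linear.continuous_on[OF bl])
  fix t :: real assume t: "0 \<le> t"
  then obtain I where I: "has_ito_integral M F W H t I" and eq: "AE w in M. set_integrable lborel {0..t} (\<lambda>s. b s w) \<and>
       X t w = X 0 w + (LINT s:{0..t}|lborel. b s w) + I w" using diff unfolding has_ito_differential_def by blast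
  have "AE w in M. set_integrable lborel {0..t} (\<lambda>s. L (b s w)) \<and>
       L (X t w) = L (X 0 w) + (LINT s:{0..t}|lborel. L (b s w)) + L (I w)" using eq
  proof eventually_elim
    case (elim w)
    have i: "integrable lborel (\<lambda>s. indicator {0..t} s *\<^sub>R b s w)" using elim by (simp add: set_integrable_def)
    have "(LINT s:{0..t}|lborel. L (b s w)) = L (LINT s:{0..t}|lborel. b s w)"
      using integral_bounded_linear[OF bl i] by (simp add: set_lebesgue_integral_def linear_cmul[OF L])
    moreover have "set_integrable lborel {0..t} (\<lambda>s. L (b s w))"
      using integrable_bounded_linear[OF bl i] by (simp add: set_integrable_def linear_cmul[OF L])
    ultimately show ?case using elim by (simp add: linear_add[OF L])
  qed
  thus "\<exists>I. has_ito_integral M F W (\<lambda>t w. L (H t w)) t I \<and> (AE w in M. set_integrable lborel {0..t} (\<lambda>s. L (b s w)) \<and>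
       L (X t w) = L (X 0 w) + (LINT s:{0..t}|lborel. L (b s w)) + I w)"
    using ito_linear[OF I t L] by blast
qed

end

text \<open>An ordinary chain rule along the drift. The constant \<open>y\<close> will be the
  initial state plus the stochastic integral at the terminal time, which depends on the future but
  not on the integration variable.\<close>

lemma norm_sq_FTC:
  fixes b :: "real \<Rightarrow> 'b::euclidean_space"
  assumes cont: "continuous_on {0..t} b" and t: "0 \<le> t"
  shows "(LINT r:{0..t}|lborel. 2 * (b r \<bullet> (y + (LINT s:{0..r}|lborel. b s))))
    = (norm (y + (LINT s:{0..t}|lborel. b s)))\<^sup>2 - (norm y)\<^sup>2"
proof -
  define Bi where "Bi r = integral {0..r} b" for r
  have B: "(LINT s:{0..r}|lborel. b s) = Bi r" if "r \<in> {0..t}" for r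
    unfolding Bi_def by (rule set_borel_integral_eq_integral(2))
      (use borel_integrable_compact[of "{0..r}" b] continuous_on_subset[OF cont, of "{0..r}"] that in \<open>auto simp: set_integrable_def\<close>)
  have dB: "(Bi has_vector_derivative b r) (at r within {0..t})" if "r \<in> {0..t}" for r
    unfolding Bi_def by (rule integral_has_vector_derivative[OF cont that])
  have cB: "continuous_on {0..t} Bi"
    by (rule continuous_on_vector_derivative[OF dB])
  define f where "f r = 2 * (b r \<bullet> (y + Bi r))" for r
  have cf: "continuous_on {0..t} f" unfolding f_def by (intro continuous_intros cont cB)
  have d: "((\<lambda>r. (norm (y + Bi r))\<^sup>2) has_vector_derivative f r) (at r within {0..t})" if "r \<in> {0..t}" for r
    unfolding power2_norm_eq_inner f_def has_vector_derivative_def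
    by (auto intro!: derivative_eq_intros dB[OF that, unfolded has_vector_derivative_def] simp: inner_commute algebra_simps)
  have "(f has_integral ((norm (y + Bi t))\<^sup>2 - (norm (y + Bi 0))\<^sup>2)) {0..t}"
    by (rule fundamental_theorem_of_calculus[OF t d])
  hence "integral {0..t} f = (norm (y + Bi t))\<^sup>2 - (norm y)\<^sup>2" by (simp add: integral_unique Bi_def)
  moreover have "(LINT r:{0..t}|lborel. f r) = integral {0..t} f"
    by (rule set_borel_integral_eq_integral(2)) (use borel_integrable_compact[of "{0..t}" f] cf in \<open>auto simp: set_integrable_def\<close>)
  moreover have "(LINT r:{0..t}|lborel. 2 * (b r \<bullet> (y + (LINT s:{0..r}|lborel. b s)))) = (LINT r:{0..t}|lborel. f r)"
    by (rule set_lebesgue_integral_cong) (auto simp: f_def B)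
  ultimately show ?thesis using B[of t] t by simp
qed

context brownian_basis
begin

lemma sq_integrable_nn_integral:
  "sq_integrable M f \<Longrightarrow> (\<integral>\<^sup>+ w. ennreal ((norm (f w))\<^sup>2) \<partial>M) = ennreal (\<integral>w. (norm (f w))\<^sup>2 \<partial>M)"
  by (rule nn_integral_eq_integral) (auto simp: sq_integrable_def)

text \<open>With the noise frozen at its terminal value, \<open>|X t|^2\<close> differs from
  \<open>|X 0 + It t|^2\<close> by a time integral of \<open>2 * (b r \<bullet> Z r)\<close>. In
  expectation \<open>Z r\<close> may be replaced by \<open>X r\<close>, the difference
  \<open>It t - It r\<close> being orthogonal to \<open>b r\<close>. Likewise \<open>X 0\<close> is
  orthogonal to \<open>It t\<close>, and the energy bound for \<open>It t\<close> is the only place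
  where equality is lost.\<close>

lemma moment_inequality:
  fixes X :: "real \<Rightarrow> 'a \<Rightarrow> 'b::euclidean_space"
  assumes diff: "has_ito_differential M F W X b H" and T: "0 \<le> T" and c: "1 \<le> c"
    and bc: "\<And>t w. t \<in> {0..T} \<Longrightarrow> (norm (b t w))\<^sup>2 \<le> c * (1 + (norm (X t w))\<^sup>2)"
    and Hc: "\<And>t w. t \<in> {0..T} \<Longrightarrow> (norm (H t w))\<^sup>2 \<le> c * (1 + (norm (X t w))\<^sup>2)"
    and X0: "(\<integral>\<^sup>+ w. ennreal ((norm (X 0 w))\<^sup>2) \<partial>M) < \<infinity>"
    and progb: "progressive F b" and contb: "AE w in M. continuous_on {0..} (\<lambda>t. b t w)"
    and t: "t \<in> {0..T}"
  shows "(\<integral>w. (norm (X t w))\<^sup>2 \<partial>M) \<le> (\<integral>w. (norm (X 0 w))\<^sup>2 \<partial>M)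
    + (LINT s:{0..t}|lborel. (\<integral>w. 2 * (b s w \<bullet> X s w) + (norm (H s w))\<^sup>2 \<partial>M))"
proof -
  interpret P: pair_sigma_finite M lborel ..
  have prog: "progressive F X" and cont: "AE w in M. continuous_on {0..} (\<lambda>t. X t w)"
    and ito: "\<forall>t\<in>{0..}. \<exists>I. has_ito_integral M F W H t I \<and>
        (AE w in M. set_integrable lborel {0..t} (\<lambda>s. b s w) \<and> X t w = X 0 w + (LINT s:{0..t}|lborel. b s w) + I w)"
    using diff by (auto simp: has_ito_differential_def)
  from bchoice[OF ito] obtain It where It: "\<And>s. 0 \<le> s \<Longrightarrow> has_ito_integral M F W H s (It s)"
    and eq: "\<And>s. 0 \<le> s \<Longrightarrow> AE w in M. set_integrable lborel {0..s} (\<lambda>s. b s w) \<and> X s w = X 0 w + (LINT r:{0..s}|lborel. b r w) + It s w"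
    by auto
  have progH: "progressive F H" using It[of 0] by (simp add: has_ito_integral_def)
  from second_moment_bound[OF diff T c bc Hc X0] obtain C' where
    C': "\<And>s. s \<in> {0..T} \<Longrightarrow> (\<integral>\<^sup>+ w. ennreal ((norm (X s w))\<^sup>2) \<partial>M) \<le> ennreal C'" by blast
  define C where "C = \<bar>C'\<bar>"
  have C0: "0 \<le> C" by (simp add: C_def)
  have C: "(\<integral>\<^sup>+ w. ennreal ((norm (X s w))\<^sup>2) \<partial>M) \<le> ennreal C" if "s \<in> {0..T}" for s
    using C'[OF that] by (rule order_trans) (simp add: C_def ennreal_leI)
  have Xm: "X s \<in> borel_measurable M" "b s \<in> borel_measurable M" "H s \<in> borel_measurable M" if "0 \<le> s" for s
    using measurable_F_M[OF progressive_adapted[OF prog that]] measurable_F_M[OF progressive_adapted[OF progb that]]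
      measurable_F_M[OF progressive_adapted[OF progH that]] by auto
  have Xsq: "sq_integrable M (X s)" if "s \<in> {0..T}" for s
    using that by (intro sq_integrableI_nn order_le_less_trans[OF C]) (auto simp: Xm)
  have bsq: "sq_integrable M (b s)" and Hsq: "sq_integrable M (H s)" if "s \<in> {0..T}" for s
    by (rule sq_integrable_bound[where g = "\<lambda>w. c * (1 + (norm (X s w))\<^sup>2)"];
        use that Xm bc Hc Xsq[OF that] in \<open>auto simp: sq_integrable_norm\<close>)+
  define K where "K = c * (1 + C)"
  have K0: "0 \<le> K" using c C0 by (simp add: K_def)
  have Kb: "(\<integral>\<^sup>+ w. ennreal ((norm (Y w))\<^sup>2) \<partial>M) \<le> ennreal K"
    if "s \<in> {0..T}" "\<And>w. (norm (Y w))\<^sup>2 \<le> c * (1 + (norm (X s w))\<^sup>2)" for s and Y :: "'a \<Rightarrow> 'b"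
  proof -
    have "(\<integral>\<^sup>+ w. ennreal ((norm (Y w))\<^sup>2) \<partial>M) \<le> (\<integral>\<^sup>+ w. ennreal c * (1 + ennreal ((norm (X s w))\<^sup>2)) \<partial>M)"
    proof (rule nn_integral_mono)
      fix w
      have "ennreal ((norm (Y w))\<^sup>2) \<le> ennreal (c * (1 + (norm (X s w))\<^sup>2))" by (rule ennreal_leI[OF that(2)])
      also have "\<dots> = ennreal c * (1 + ennreal ((norm (X s w))\<^sup>2))" using c by (simp add: ennreal_mult ennreal_plus)
      finally show "ennreal ((norm (Y w))\<^sup>2) \<le> ennreal c * (1 + ennreal ((norm (X s w))\<^sup>2))" .
    qed
    also have "\<dots> = ennreal c * (1 + (\<integral>\<^sup>+ w. ennreal ((norm (X s w))\<^sup>2) \<partial>M))"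
      using that Xm[of s] by (simp add: nn_integral_cmult nn_integral_add emeasure_space_1)
    also have "\<dots> \<le> ennreal c * (1 + ennreal C)" using C[OF that(1)] by (intro mult_left_mono add_left_mono) auto
    also have "\<dots> = ennreal K" unfolding K_def using c C0 by (simp add: ennreal_mult ennreal_plus)
    finally show ?thesis .
  qed
  define hh where "hh w s = indicator {0..T} s *\<^sub>R H s w" for w s
  have hhm[measurable]: "case_prod hh \<in> borel_measurable (M \<Otimes>\<^sub>M lborel)"
    using progressive_joint[OF progH T] by (simp add: hh_def case_prod_beta')
  define bb where "bb w s = indicator {0..T} s *\<^sub>R b s w" for w s
  have bbm[measurable]: "case_prod bb \<in> borel_measurable (M \<Otimes>\<^sub>M lborel)"
    using progressive_joint[OF progb T] by (simp add: bb_def case_prod_beta')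
  define xx where "xx w s = indicator {0..T} s *\<^sub>R X s w" for w s
  have xxm[measurable]: "case_prod xx \<in> borel_measurable (M \<Otimes>\<^sub>M lborel)"
    using progressive_joint[OF prog T] by (simp add: xx_def case_prod_beta')
  have energyH: "(\<integral>\<^sup>+ w. energy s H w \<partial>M) = (\<integral>\<^sup>+ r\<in>{0..s}. (\<integral>\<^sup>+ w. ennreal ((norm (H r w))\<^sup>2) \<partial>M) \<partial>lborel)" if s: "s \<in> {0..T}" for s
  proof -
    have "(\<integral>\<^sup>+ w. energy s H w \<partial>M) = (\<integral>\<^sup>+ w. (\<integral>\<^sup>+ r. ennreal ((norm (hh w r))\<^sup>2) * indicator {0..s} r \<partial>lborel) \<partial>M)"
      unfolding energy_def by (intro nn_integral_cong) (use s in \<open>auto simp: hh_def indicator_def\<close>)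
    also have "\<dots> = (\<integral>\<^sup>+ r. (\<integral>\<^sup>+ w. ennreal ((norm (hh w r))\<^sup>2) * indicator {0..s} r \<partial>M) \<partial>lborel)"
      by (rule P.Fubini'[symmetric]) measurable
    also have "\<dots> = (\<integral>\<^sup>+ r\<in>{0..s}. (\<integral>\<^sup>+ w. ennreal ((norm (H r w))\<^sup>2) \<partial>M) \<partial>lborel)"
      by (intro nn_integral_cong) (use s in \<open>auto simp: hh_def indicator_def\<close>)
    finally show ?thesis .
  qed
  have fin: "(\<integral>\<^sup>+ w. energy s H w \<partial>M) \<le> ennreal (K * T)" if s: "s \<in> {0..T}" for s
  proof -
    have "(\<integral>\<^sup>+ w. energy s H w \<partial>M) \<le> (\<integral>\<^sup>+ r. ennreal K * indicator {0..T} r \<partial>lborel)"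
      unfolding energyH[OF s]
    proof (rule nn_integral_mono)
      fix r
      show "(\<integral>\<^sup>+ w. ennreal ((norm (H r w))\<^sup>2) \<partial>M) * indicator {0..s} r \<le> ennreal K * indicator {0..T} r"
        using s Kb[of r "H r"] Hc[of r] by (cases "r \<in> {0..s}") auto
    qed
    also have "\<dots> = ennreal (K * T)" using T K0 by (simp add: nn_integral_cmult ennreal_mult)
    finally show ?thesis .
  qed
  have fin': "(\<integral>\<^sup>+ w. energy s H w \<partial>M) < \<infinity>" if "s \<in> {0..T}" for s
    using fin[OF that] by (rule order_le_less_trans) simp
  have Isq: "sq_integrable M (It s)" if "s \<in> {0..T}" for s
    using ito_sq_integrable[OF It _ fin'[OF that]] that by auto
  have Ib: "(\<integral>\<^sup>+ w. ennreal ((norm (It s w))\<^sup>2) \<partial>M) \<le> ennreal (K * T)" if "s \<in> {0..T}" for s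
    using order_trans[OF ito_energy[OF It] fin[OF that]] that by auto
  note [measurable] = sq_integrable_measurable[OF Isq[OF t]] Xm(1)[OF order_refl]
  define Bi where "Bi w s = (\<integral>r. (if 0 \<le> r \<and> r \<le> s then bb w r else 0) \<partial>lborel)" for w s
  have [measurable]: "case_prod Bi \<in> borel_measurable (M \<Otimes>\<^sub>M lborel)" unfolding Bi_def by measurable
  have Bi: "Bi w s = (LINT r:{0..s}|lborel. b r w)" if "s \<in> {0..T}" for w s
    unfolding Bi_def set_lebesgue_integral_def
    by (intro Bochner_Integration.integral_cong) (use that in \<open>auto simp: bb_def indicator_def\<close>)
  \<comment> \<open>The state at time \<open>r\<close>, but with the stochastic integral over the
    whole interval up to \<open>t\<close>; at \<open>r = t\<close> it is \<open>X t\<close>, at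
    \<open>r = 0\<close> it is \<open>X 0 + It t\<close>, up to null sets.\<close>
  define Z where "Z w r = X 0 w + Bi w r + It t w" for w r
  have [measurable]: "case_prod Z \<in> borel_measurable (M \<Otimes>\<^sub>M lborel)" unfolding Z_def by measurable
  have Zeq: "AE w in M. Z w r = X r w + (It t w - It r w)" if r: "r \<in> {0..T}" for r
    using eq[of r] r by (auto simp: Z_def Bi[OF r])
  have Zsq: "sq_integrable M (\<lambda>w. Z w r)" if r: "r \<in> {0..T}" for r
  proof -
    have "sq_integrable M (\<lambda>w. X r w + (It t w - It r w))"
      by (intro sq_integrable_add sq_integrable_diff Xsq Isq r t)
    moreover have "(\<lambda>w. Z w r) \<in> borel_measurable M" by measurable
    ultimately show ?thesis unfolding sq_integrable_def
      using Zeq[OF r] by (auto intro: integrable_cong_AE_imp)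
  qed
  have Zb: "(\<integral>\<^sup>+ w. ennreal ((norm (Z w r))\<^sup>2) \<partial>M) \<le> ennreal (3 * C + 6 * (K * T))" if r: "r \<in> {0..T}" for r
  proof -
    note [measurable] = sq_integrable_measurable[OF Isq[OF r]] sq_integrable_measurable[OF Xsq[OF r]]
    have "AE w in M. ennreal ((norm (Z w r))\<^sup>2) \<le> 3 * ennreal ((norm (X r w))\<^sup>2) + 3 * ennreal ((norm (It t w))\<^sup>2) + 3 * ennreal ((norm (It r w))\<^sup>2)"
      using Zeq[OF r]
    proof eventually_elim
      case (elim w)
      have "(norm (Z w r))\<^sup>2 \<le> 3 * (norm (X r w))\<^sup>2 + 3 * (norm (It t w))\<^sup>2 + 3 * (norm (It r w))\<^sup>2"
      proof -
        have "Z w r = X r w + It t w + (- It r w)" using elim by simp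
        thus ?thesis using norm_add3_sq_le[of "X r w" "It t w" "- It r w"] by simp
      qed
      thus ?case by (auto dest!: ennreal_leI simp: ennreal_mult ennreal_plus)
    qed
    hence "(\<integral>\<^sup>+ w. ennreal ((norm (Z w r))\<^sup>2) \<partial>M) \<le> (\<integral>\<^sup>+ w. 3 * ennreal ((norm (X r w))\<^sup>2) + 3 * ennreal ((norm (It t w))\<^sup>2) + 3 * ennreal ((norm (It r w))\<^sup>2) \<partial>M)"
      by (rule nn_integral_mono_AE)
    also have "\<dots> = 3 * (\<integral>\<^sup>+ w. ennreal ((norm (X r w))\<^sup>2) \<partial>M) + 3 * (\<integral>\<^sup>+ w. ennreal ((norm (It t w))\<^sup>2) \<partial>M) + 3 * (\<integral>\<^sup>+ w. ennreal ((norm (It r w))\<^sup>2) \<partial>M)"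
      by (simp add: nn_integral_add nn_integral_cmult)
    also have "\<dots> \<le> 3 * ennreal C + 3 * ennreal (K * T) + 3 * ennreal (K * T)"
      by (intro add_mono mult_left_mono C Ib r t) auto
    also have "\<dots> = ennreal (3 * C + 6 * (K * T))"
    proof -
      have "3 * ennreal C = ennreal (3 * C)" "3 * ennreal (K * T) = ennreal (3 * (K * T))"
        using C0 K0 T by (simp_all add: ennreal_mult)
      hence "3 * ennreal C + 3 * ennreal (K * T) + 3 * ennreal (K * T) = ennreal (3 * C + 3 * (K * T) + 3 * (K * T))"
        using C0 K0 T by (simp only: ennreal_plus mult_nonneg_nonneg add_nonneg_nonneg zero_le_numeral)
      thus ?thesis by (simp add: algebra_simps)
    qed
    finally show ?thesis .
  qed
  define f where "f w r = indicat_real {0..t} r * (2 * (bb w r \<bullet> Z w r))" for w r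
  have fm[measurable]: "case_prod f \<in> borel_measurable (M \<Otimes>\<^sub>M lborel)" unfolding f_def by measurable
  have intf: "integrable (M \<Otimes>\<^sub>M lborel) (case_prod f)"
  proof (rule integrableI_bounded[OF fm])
    define k where "k = 2 * K + 2 * (3 * C + 6 * (K * T))"
    have k0: "0 \<le> k" using K0 C0 T by (simp add: k_def)
    have "(\<integral>\<^sup>+ x. ennreal (norm (case_prod f x)) \<partial>(M \<Otimes>\<^sub>M lborel)) = (\<integral>\<^sup>+ r. (\<integral>\<^sup>+ w. ennreal (norm (f w r)) \<partial>M) \<partial>lborel)"
      by (subst P.nn_integral_snd[symmetric]) (auto simp: case_prod_beta')
    also have "\<dots> \<le> (\<integral>\<^sup>+ r. ennreal k * indicator {0..T} r \<partial>lborel)"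
    proof (rule nn_integral_mono)
      fix r
      show "(\<integral>\<^sup>+ w. ennreal (norm (f w r)) \<partial>M) \<le> ennreal k * indicator {0..T} r"
      proof (cases "r \<in> {0..t}")
        case True
        hence r: "r \<in> {0..T}" using t by auto
        note [measurable] = sq_integrable_measurable[OF bsq[OF r]]
        have "(\<integral>\<^sup>+ w. ennreal (norm (f w r)) \<partial>M) \<le> (\<integral>\<^sup>+ w. 2 * ennreal ((norm (b r w))\<^sup>2) + 2 * ennreal ((norm (Z w r))\<^sup>2) \<partial>M)"
        proof (rule nn_integral_mono)
          fix w
          have "norm (f w r) \<le> 2 * (norm (b r w))\<^sup>2 + 2 * (norm (Z w r))\<^sup>2"
            using abs_inner_le_sq[of "b r w" "Z w r"] True r by (simp add: f_def bb_def abs_mult)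
          thus "ennreal (norm (f w r)) \<le> 2 * ennreal ((norm (b r w))\<^sup>2) + 2 * ennreal ((norm (Z w r))\<^sup>2)"
            by (auto dest!: ennreal_leI simp: ennreal_mult ennreal_plus)
        qed
        also have "\<dots> = 2 * (\<integral>\<^sup>+ w. ennreal ((norm (b r w))\<^sup>2) \<partial>M) + 2 * (\<integral>\<^sup>+ w. ennreal ((norm (Z w r))\<^sup>2) \<partial>M)"
          by (simp add: nn_integral_add nn_integral_cmult)
        also have "\<dots> \<le> 2 * ennreal K + 2 * ennreal (3 * C + 6 * (K * T))"
          using Kb[OF r, of "b r"] bc[OF r] Zb[OF r] by (intro add_mono mult_left_mono) auto
        also have "\<dots> = ennreal 2 * ennreal K + ennreal 2 * ennreal (3 * C + 6 * (K * T))" by simp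
        also have "\<dots> = ennreal k" unfolding k_def
          using K0 C0 T by (subst (1 2) ennreal_mult[symmetric]) (auto intro!: ennreal_plus[symmetric])
        finally show ?thesis using r by simp
      qed (simp add: f_def)
    qed
    also have "\<dots> < \<infinity>" using T by (simp add: nn_integral_cmult ennreal_mult_less_top)
    finally show "(\<integral>\<^sup>+ x. ennreal (norm (case_prod f x)) \<partial>(M \<Otimes>\<^sub>M lborel)) < \<infinity>" .
  qed
  \<comment> \<open>Here the anticipating \<open>Z r\<close> becomes \<open>X r\<close>: the surplus
    noise lies after \<open>r\<close>, while \<open>b r\<close> is known at
    \<open>r\<close>.\<close>
  have Ef: "(\<integral>w. f w r \<partial>M) = indicator {0..t} r * (2 * (\<integral>w. b r w \<bullet> X r w \<partial>M))" for r
  proof (cases "r \<in> {0..t}")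
    case True
    hence r: "r \<in> {0..T}" using t by auto
    have "(\<integral>w. f w r \<partial>M) = 2 * (\<integral>w. b r w \<bullet> Z w r \<partial>M)" using True r by (simp add: f_def bb_def)
    also have "(\<integral>w. b r w \<bullet> Z w r \<partial>M) = (\<integral>w. b r w \<bullet> X r w + b r w \<bullet> (It t w - It r w) \<partial>M)"
    proof (rule integral_cong_AE)
      show "AE w in M. b r w \<bullet> Z w r = b r w \<bullet> X r w + b r w \<bullet> (It t w - It r w)"
        using Zeq[OF r] by eventually_elim (simp add: inner_add_right)
    qed (use sq_integrable_measurable[OF bsq[OF r]] sq_integrable_measurable[OF Zsq[OF r]]
        sq_integrable_measurable[OF Isq[OF r]] sq_integrable_measurable[OF Xsq[OF r]] in auto)
    also have "\<dots> = (\<integral>w. b r w \<bullet> X r w \<partial>M) + (\<integral>w. b r w \<bullet> (It t w - It r w) \<partial>M)"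
      by (intro Bochner_Integration.integral_add sq_integrable_inner bsq Xsq sq_integrable_diff Isq r t)
    also have "(\<integral>w. b r w \<bullet> (It t w - It r w) \<partial>M) = 0"
      using True t r by (intro ito_orthogonal[OF It It] fin' progressive_adapted[OF progb] bsq) auto
    finally show ?thesis using True by simp
  qed (simp add: f_def)
  have t0: "0 \<le> t" using t by simp
  have path: "AE w in M. (norm (X t w))\<^sup>2 = (norm (X 0 w + It t w))\<^sup>2 + (\<integral>r. f w r \<partial>lborel)"
    using contb eq[OF t0]
  proof eventually_elim
    case (elim w)
    hence cb: "continuous_on {0..t} (\<lambda>s. b s w)" and e: "X t w = X 0 w + (LINT r:{0..t}|lborel. b r w) + It t w"
      by (auto intro: continuous_on_subset)
    define g where "g r = 2 * (b r w \<bullet> ((X 0 w + It t w) + (LINT s:{0..r}|lborel. b s w)))" for r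
    have "f w r = indicator {0..t} r *\<^sub>R g r" for r
      using t by (cases "r \<in> {0..t}") (auto simp: f_def bb_def Z_def Bi g_def algebra_simps)
    hence "(\<integral>r. f w r \<partial>lborel) = (LINT r:{0..t}|lborel. g r)" by (simp add: set_lebesgue_integral_def)
    also have "\<dots> = (LINT r:{0..t}|lborel. 2 * (b r w \<bullet> ((X 0 w + It t w) + (LINT s:{0..r}|lborel. b s w))))"
      by (simp only: g_def)
    also have "\<dots> = (norm ((X 0 w + It t w) + (LINT r:{0..t}|lborel. b r w)))\<^sup>2 - (norm (X 0 w + It t w))\<^sup>2"
      by (rule norm_sq_FTC[OF cb]) (use t in auto)
    finally show ?case using e by (simp add: algebra_simps)
  qed
  have T0: "0 \<in> {0..T}" using T by simp
  \<comment> \<open>The integral over \<open>{0..0}\<close> is pinned down by the equation at time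
    0, where the drift integrates over a null set; orthogonality of increments with
    \<open>r = 0\<close> then applies.\<close>
  have orth0: "(\<integral>w. X 0 w \<bullet> It t w \<partial>M) = 0"
  proof -
    have "AE w in M. It 0 w = 0" using eq[OF order_refl]
    proof eventually_elim
      case (elim w)
      have "(LINT r:{0..0::real}|lborel. b r w) = 0"
        unfolding set_lebesgue_integral_def
        by (subst integral_cong_AE[where g = "\<lambda>_. 0"])
          (use elim AE_lborel_singleton[of "0::real"] in \<open>auto simp: set_integrable_def elim!: eventually_mono\<close>)
      with elim show "It 0 w = 0" by simp
    qed
    hence "(\<integral>w. X 0 w \<bullet> It t w \<partial>M) = (\<integral>w. X 0 w \<bullet> (It t w - It 0 w) \<partial>M)"
      using sq_integrable_measurable[OF Isq[OF T0]] by (intro integral_cong_AE) auto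
    also have "\<dots> = 0" using t T0 by (intro ito_orthogonal[OF It It] fin' progressive_adapted[OF prog] Xsq) auto
    finally show ?thesis .
  qed
  have sq0: "sq_integrable M (\<lambda>w. X 0 w + It t w)" by (intro sq_integrable_add Xsq Isq T0 t)
  have "(\<integral>w. (norm (X t w))\<^sup>2 \<partial>M) = (\<integral>w. (norm (X 0 w + It t w))\<^sup>2 + (\<integral>r. f w r \<partial>lborel) \<partial>M)"
    by (rule integral_cong_AE) (use path sq_integrable_measurable[OF Xsq[OF t]] in auto)
  also have "\<dots> = (\<integral>w. (norm (X 0 w + It t w))\<^sup>2 \<partial>M) + (\<integral>w. (\<integral>r. f w r \<partial>lborel) \<partial>M)"
    using sq_integrable_norm[OF sq0] P.integrable_fst[OF intf] by (intro Bochner_Integration.integral_add) auto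
  also have "(\<integral>w. (\<integral>r. f w r \<partial>lborel) \<partial>M) = (\<integral>r. (\<integral>w. f w r \<partial>M) \<partial>lborel)"
    by (rule P.Fubini_integral[OF intf, symmetric])
  also have "(\<integral>w. (norm (X 0 w + It t w))\<^sup>2 \<partial>M) = (\<integral>w. (norm (X 0 w))\<^sup>2 \<partial>M) + (\<integral>w. (norm (It t w))\<^sup>2 \<partial>M)"
  proof -
    have "(norm (X 0 w + It t w))\<^sup>2 = (norm (X 0 w))\<^sup>2 + 2 * (X 0 w \<bullet> It t w) + (norm (It t w))\<^sup>2" for w
      unfolding power2_norm_eq_inner by (simp add: inner_add_left inner_add_right inner_commute)
    thus ?thesis using orth0 sq_integrable_norm[OF Xsq[OF T0]] sq_integrable_norm[OF Isq[OF t]] sq_integrable_inner[OF Xsq[OF T0] Isq[OF t]]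
      by simp
  qed
  finally have main: "(\<integral>w. (norm (X t w))\<^sup>2 \<partial>M) = (\<integral>w. (norm (X 0 w))\<^sup>2 \<partial>M) + (\<integral>w. (norm (It t w))\<^sup>2 \<partial>M)
      + (\<integral>r. (\<integral>w. f w r \<partial>M) \<partial>lborel)" .
  have G: "(\<integral>w. (norm (It t w))\<^sup>2 \<partial>M) \<le> (\<integral>r. indicator {0..t} r * (\<integral>w. (norm (H r w))\<^sup>2 \<partial>M) \<partial>lborel)
     \<and> integrable lborel (\<lambda>r. indicator {0..t} r * (\<integral>w. (norm (H r w))\<^sup>2 \<partial>M))"
  proof -
    define g where "g r = indicat_real {0..t} r * (\<integral>w. (norm (H r w))\<^sup>2 \<partial>M)" for r
    have geq: "g = (\<lambda>r. indicator {0..t} r * (\<integral>w. (norm (hh w r))\<^sup>2 \<partial>M))"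
      using t by (auto simp: g_def hh_def indicator_def fun_eq_iff)
    have "(\<lambda>x. hh (snd x) (fst x)) \<in> borel_measurable (lborel \<Otimes>\<^sub>M M)"
      using measurable_compose[OF measurable_pair_swap' hhm] by (simp add: case_prod_beta')
    hence "(\<lambda>r. \<integral>w. (norm (hh w r))\<^sup>2 \<partial>M) \<in> borel_measurable lborel"
      by (intro borel_measurable_lebesgue_integral) (simp add: case_prod_beta')
    hence gm[measurable]: "g \<in> borel_measurable lborel" unfolding geq by measurable
    have g0: "0 \<le> g r" for r by (simp add: g_def)
    have "(\<integral>\<^sup>+ r. ennreal (g r) \<partial>lborel) = (\<integral>\<^sup>+ w. energy t H w \<partial>M)"
      unfolding energyH[OF t]
    proof (rule nn_integral_cong)
      fix r
      show "ennreal (g r) = (\<integral>\<^sup>+ w. ennreal ((norm (H r w))\<^sup>2) \<partial>M) * indicator {0..t} r"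
        using sq_integrable_nn_integral[OF Hsq, of r] t by (cases "r \<in> {0..t}") (auto simp: g_def)
    qed
    hence ge: "(\<integral>\<^sup>+ r. ennreal (g r) \<partial>lborel) = (\<integral>\<^sup>+ w. energy t H w \<partial>M)" .
    hence gint: "integrable lborel g" using fin'[OF t] g0 by (intro integrableI_bounded) auto
    have "ennreal (\<integral>w. (norm (It t w))\<^sup>2 \<partial>M) \<le> ennreal (\<integral>r. g r \<partial>lborel)"
      using ito_energy[OF It, of t] t nn_integral_eq_integral[OF gint] g0 ge sq_integrable_nn_integral[OF Isq[OF t]] by auto
    moreover have "0 \<le> (\<integral>r. g r \<partial>lborel)" using g0 by (intro integral_nonneg_AE) auto
    ultimately have "(\<integral>w. (norm (It t w))\<^sup>2 \<partial>M) \<le> (\<integral>r. g r \<partial>lborel)" by simp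
    with gint show ?thesis by (simp add: g_def[abs_def])
  qed
  have intE: "integrable lborel (\<lambda>r. \<integral>w. f w r \<partial>M)" by (rule P.integrable_snd[OF intf])
  have "(LINT s:{0..t}|lborel. (\<integral>w. 2 * (b s w \<bullet> X s w) + (norm (H s w))\<^sup>2 \<partial>M))
    = (\<integral>r. (\<integral>w. f w r \<partial>M) + indicator {0..t} r * (\<integral>w. (norm (H r w))\<^sup>2 \<partial>M) \<partial>lborel)"
    unfolding set_lebesgue_integral_def
  proof (rule Bochner_Integration.integral_cong[OF refl])
    fix r
    show "indicat_real {0..t} r *\<^sub>R (\<integral>w. 2 * (b r w \<bullet> X r w) + (norm (H r w))\<^sup>2 \<partial>M) =
      (\<integral>w. f w r \<partial>M) + indicator {0..t} r * (\<integral>w. (norm (H r w))\<^sup>2 \<partial>M)"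
    proof (cases "r \<in> {0..t}")
      case True
      hence r: "r \<in> {0..T}" using t by auto
      have "(\<integral>w. 2 * (b r w \<bullet> X r w) + (norm (H r w))\<^sup>2 \<partial>M) = 2 * (\<integral>w. b r w \<bullet> X r w \<partial>M) + (\<integral>w. (norm (H r w))\<^sup>2 \<partial>M)"
        using sq_integrable_inner[OF bsq[OF r] Xsq[OF r]] sq_integrable_norm[OF Hsq[OF r]] by simp
      thus ?thesis using True by (simp add: Ef)
    qed (simp add: Ef)
  qed
  also have "\<dots> = (\<integral>r. (\<integral>w. f w r \<partial>M) \<partial>lborel) + (\<integral>r. indicator {0..t} r * (\<integral>w. (norm (H r w))\<^sup>2 \<partial>M) \<partial>lborel)"
    using G by (intro Bochner_Integration.integral_add intE) auto
  finally show ?thesis using main G by linarith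
qed

end

section \<open>Discounted stability\<close>

text \<open>The weight is decreasing, so an integral inequality started at time \<open>0\<close> suffices for the
  discounted estimate; no inequality on subintervals is needed.\<close>

lemma discounted_integral_inequality:
  fixes v \<psi> :: "real \<Rightarrow> real"
  assumes int: "set_integrable lborel {0..\<tau>} \<psi>" "set_integrable lborel {0..\<tau>} v"
    and \<tau>: "0 \<le> \<tau>" and \<rho>: "0 \<le> \<rho>" and v\<tau>: "0 \<le> v \<tau>"
    and le: "\<And>t. t \<in> {0..\<tau>} \<Longrightarrow> v t \<le> v0 + (LINT s:{0..t}|lborel. \<psi> s)"
  shows "0 \<le> v0 + (LINT s:{0..\<tau>}|lborel. exp (- \<rho> * s) * (\<psi> s - \<rho> * v s))"
proof -
  define p where "p s = indicator {0..\<tau>} s * \<psi> s" for s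
  define w' where "w' s = indicator {0..\<tau>} s * v s" for s
  have p: "integrable lborel p" and w': "integrable lborel w'"
    using int by (simp_all add: set_integrable_def p_def[abs_def] w'_def[abs_def])
  have [measurable]: "p \<in> borel_measurable lborel" "w' \<in> borel_measurable lborel" using p w' by auto
  have expb: "exp (- \<rho> * s) * indicator {0..\<tau>} s \<le> 1" "0 \<le> exp (- \<rho> * s) * indicator {0..\<tau>} s" for s
    using \<rho> by (auto simp: indicator_def)
  have ip: "integrable lborel (\<lambda>s. exp (- \<rho> * s) * p s)"
  proof (rule Bochner_Integration.integrable_bound[OF p])
    show "AE s in lborel. norm (exp (- \<rho> * s) * p s) \<le> norm (p s)"
      using \<rho> by (intro AE_I2) (auto simp: p_def abs_mult indicator_def intro!: mult_left_le_one_le)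
  qed measurable
  have iw: "integrable lborel (\<lambda>s. exp (- \<rho> * s) * w' s)"
  proof (rule Bochner_Integration.integrable_bound[OF w'])
    show "AE s in lborel. norm (exp (- \<rho> * s) * w' s) \<le> norm (w' s)"
      using \<rho> by (intro AE_I2) (auto simp: w'_def abs_mult indicator_def intro!: mult_left_le_one_le)
  qed measurable
  \<comment> \<open>A kernel on the triangle \<open>s \<le> t\<close>. Integrating it in either
    order is integration by parts against the weight, for a \<open>\<psi>\<close> that is merely
    integrable.\<close>
  define k where "k t s = indicat_real {0..\<tau>} t * (if s \<le> t then \<rho> * exp (- \<rho> * t) * p s else 0)" for t s
  have km: "case_prod k \<in> borel_measurable (lborel \<Otimes>\<^sub>M lborel)" unfolding k_def by measurable
  have bnd: "integrable (lborel \<Otimes>\<^sub>M lborel) (\<lambda>(t, s). indicat_real {0..\<tau>} t * (\<rho> * \<bar>p s\<bar>))"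
  proof (rule lborel_pair.Fubini_integrable)
    have "(\<lambda>t. \<integral>s. norm (indicat_real {0..\<tau>} t * (\<rho> * \<bar>p s\<bar>)) \<partial>lborel) = (\<lambda>t. indicat_real {0..\<tau>} t *\<^sub>R (\<rho> * (\<integral>s. \<bar>p s\<bar> \<partial>lborel)))"
      using \<rho> by (simp add: abs_mult)
    moreover have "integrable lborel (\<lambda>t. indicat_real {0..\<tau>} t *\<^sub>R (\<rho> * (\<integral>s. \<bar>p s\<bar> \<partial>lborel)))"
      using \<tau> by (intro integrable_indicator) auto
    ultimately show "integrable lborel (\<lambda>t. \<integral>s. norm (case (t, s) of (t, s) \<Rightarrow> indicat_real {0..\<tau>} t * (\<rho> * \<bar>p s\<bar>)) \<partial>lborel)"
      by simp
  qed (use p in auto)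
  have ik: "integrable (lborel \<Otimes>\<^sub>M lborel) (case_prod k)"
  proof (rule Bochner_Integration.integrable_bound[OF bnd km], intro AE_I2)
    fix x :: "real \<times> real"
    obtain t s where x: "x = (t, s)" by (cases x)
    have "\<rho> * exp (- \<rho> * t) * \<bar>p s\<bar> \<le> \<rho> * 1 * \<bar>p s\<bar>" if "0 \<le> t"
      using that \<rho> by (intro mult_right_mono mult_left_mono) auto
    thus "norm (case_prod k x) \<le> norm (case x of (t, s) \<Rightarrow> indicat_real {0..\<tau>} t * (\<rho> * \<bar>p s\<bar>))"
      using \<rho> by (auto simp: x k_def abs_mult indicator_def)
  qed
  define U where "U t = (LINT s:{0..t}|lborel. \<psi> s)" for t
  have U: "U t = (\<integral>s. (if s \<le> t then p s else 0) \<partial>lborel)" if "t \<in> {0..\<tau>}" for t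
    unfolding U_def set_lebesgue_integral_def
    by (rule Bochner_Integration.integral_cong) (use that in \<open>auto simp: p_def indicator_def\<close>)
  have k1: "(\<integral>s. k t s \<partial>lborel) = indicator {0..\<tau>} t * (\<rho> * exp (- \<rho> * t) * U t)" for t
  proof (cases "t \<in> {0..\<tau>}")
    case True
    have "(\<integral>s. k t s \<partial>lborel) = (\<integral>s. \<rho> * exp (- \<rho> * t) * (if s \<le> t then p s else 0) \<partial>lborel)"
      by (rule Bochner_Integration.integral_cong) (use True in \<open>auto simp: k_def\<close>)
    thus ?thesis using True U[OF True] by simp
  qed (simp add: k_def)
  have ftc: "(\<integral>t. (\<rho> * exp (- \<rho> * t)) * indicator {a..\<tau>} t \<partial>lborel) = (- exp (- \<rho> * \<tau>)) - (- exp (- \<rho> * a))" if "a \<le> \<tau>" for a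
    by (rule integral_FTC_Icc_real[OF that]) (auto intro!: derivative_eq_intros continuous_intros)
  have k2: "(\<integral>t. k t s \<partial>lborel) = p s * (exp (- \<rho> * s) - exp (- \<rho> * \<tau>))" for s
  proof (cases "s \<in> {0..\<tau>}")
    case True
    have "(\<integral>t. k t s \<partial>lborel) = (\<integral>t. p s * ((\<rho> * exp (- \<rho> * t)) * indicator {s..\<tau>} t) \<partial>lborel)"
      by (rule Bochner_Integration.integral_cong) (use True in \<open>auto simp: k_def indicator_def\<close>)
    also have "\<dots> = p s * ((- exp (- \<rho> * \<tau>)) - (- exp (- \<rho> * s)))" using ftc[of s] True by simp
    finally show ?thesis by simp
  next
    case False
    hence "p s = 0" by (simp add: p_def)
    thus ?thesis by (simp add: k_def cong: if_cong)
  qed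
  have fub: "(\<integral>t. indicator {0..\<tau>} t * (\<rho> * exp (- \<rho> * t) * U t) \<partial>lborel) = (\<integral>s. p s * (exp (- \<rho> * s) - exp (- \<rho> * \<tau>)) \<partial>lborel)"
    using lborel_pair.Fubini_integral[OF ik] by (simp add: k1 k2)
  have iU: "integrable lborel (\<lambda>t. indicator {0..\<tau>} t * (\<rho> * exp (- \<rho> * t) * U t))"
    using lborel_pair.integrable_fst[OF ik] by (simp add: k1)
  have i0: "integrable lborel (\<lambda>t. v0 * ((\<rho> * exp (- \<rho> * t)) * indicator {0..\<tau>} t))"
  proof (cases "v0 = 0 \<or> \<rho> = 0")
    case False
    have "integrable lborel (\<lambda>t. indicator {0..\<tau>} t *\<^sub>R (\<rho> * exp (- \<rho> * t)))"
      by (rule borel_integrable_compact) (auto intro!: continuous_intros)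
    thus ?thesis by (simp add: mult.commute)
  qed auto
  have "(\<integral>t. \<rho> * (exp (- \<rho> * t) * w' t) \<partial>lborel) \<le>
     (\<integral>t. v0 * ((\<rho> * exp (- \<rho> * t)) * indicator {0..\<tau>} t) + indicator {0..\<tau>} t * (\<rho> * exp (- \<rho> * t) * U t) \<partial>lborel)"
  proof (rule integral_mono)
    fix t
    show "\<rho> * (exp (- \<rho> * t) * w' t) \<le> v0 * ((\<rho> * exp (- \<rho> * t)) * indicator {0..\<tau>} t) + indicator {0..\<tau>} t * (\<rho> * exp (- \<rho> * t) * U t)"
    proof (cases "t \<in> {0..\<tau>}")
      case True
      have "(\<rho> * exp (- \<rho> * t)) * v t \<le> (\<rho> * exp (- \<rho> * t)) * (v0 + U t)"
        using le[OF True] \<rho> by (intro mult_left_mono) (auto simp: U_def)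
      thus ?thesis using True by (simp add: w'_def algebra_simps)
    qed (simp add: w'_def)
  qed (use iw i0 iU in \<open>auto intro!: Bochner_Integration.integrable_add\<close>)
  also have "\<dots> = v0 * (1 - exp (- \<rho> * \<tau>)) + (\<integral>s. p s * (exp (- \<rho> * s) - exp (- \<rho> * \<tau>)) \<partial>lborel)"
    using ftc[OF \<tau>] fub by (subst Bochner_Integration.integral_add[OF i0 iU]) simp
  finally have A: "\<rho> * (\<integral>t. exp (- \<rho> * t) * w' t \<partial>lborel) \<le> v0 * (1 - exp (- \<rho> * \<tau>)) + (\<integral>s. p s * (exp (- \<rho> * s) - exp (- \<rho> * \<tau>)) \<partial>lborel)"
    by simp
  have B: "(\<integral>s. p s * (exp (- \<rho> * s) - exp (- \<rho> * \<tau>)) \<partial>lborel) = (\<integral>s. exp (- \<rho> * s) * p s \<partial>lborel) - exp (- \<rho> * \<tau>) * (\<integral>s. p s \<partial>lborel)"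
    using ip p by (simp add: right_diff_distrib mult.commute)
  have Up: "U \<tau> = (\<integral>s. p s \<partial>lborel)" by (simp add: U_def set_lebesgue_integral_def p_def)
  \<comment> \<open>The boundary term at \<open>\<tau>\<close> has a favourable sign and is dropped:
    it is at least the discounted \<open>v \<tau>\<close>, which is nonnegative.\<close>
  have "0 \<le> exp (- \<rho> * \<tau>) * (v0 + U \<tau>)" using le[of \<tau>] v\<tau> \<tau> by (simp add: U_def)
  moreover have "(LINT s:{0..\<tau>}|lborel. exp (- \<rho> * s) * (\<psi> s - \<rho> * v s))
     = (\<integral>s. exp (- \<rho> * s) * p s \<partial>lborel) - \<rho> * (\<integral>s. exp (- \<rho> * s) * w' s \<partial>lborel)"
  proof -
    have "(LINT s:{0..\<tau>}|lborel. exp (- \<rho> * s) * (\<psi> s - \<rho> * v s)) = (\<integral>s. exp (- \<rho> * s) * p s - \<rho> * (exp (- \<rho> * s) * w' s) \<partial>lborel)"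
      unfolding set_lebesgue_integral_def
      by (rule Bochner_Integration.integral_cong) (auto simp: p_def w'_def indicator_def algebra_simps)
    thus ?thesis using ip iw by simp
  qed
  ultimately show ?thesis using A B Up by (simp add: algebra_simps)
qed

lemma two_inner_le: "2 * (x \<bullet> y) \<le> e * (norm x)\<^sup>2 + (norm y)\<^sup>2 / e" if "0 < e"
proof -
  have "0 \<le> (norm (e *\<^sub>R x - y))\<^sup>2" by simp
  also have "\<dots> = e * (e * (norm x)\<^sup>2 - 2 * (x \<bullet> y)) + (norm y)\<^sup>2"
    unfolding power2_norm_eq_inner by (simp add: inner_diff_left inner_diff_right inner_commute algebra_simps)
  finally have "e * (2 * (x \<bullet> y) - e * (norm x)\<^sup>2) \<le> (norm y)\<^sup>2" by (simp add: algebra_simps)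
  thus ?thesis using that by (simp add: field_simps)
qed

text \<open>The offsets \<open>p\<close> and \<open>q\<close> are absorbed by half of the
  dissipation. The two cross terms are split by Young's inequality with parameters
  \<open>1 / (4 * s\<^sup>2)\<close> and \<open>1 / (4 * h\<^sup>2)\<close>, each using up a quarter
  of \<open>|x|^2\<close>; the last term \<open>s\<close> of \<open>\<kappa>\<close> covers
  \<open>q \<bullet> (S *v q)\<close>.\<close>

lemma lyapunov_drift_bound:
  fixes S G H :: "real^'n^'n"
  assumes S: "pos_semidef S"
    and lyap: "\<And>v. 2 * ((S *v v) \<bullet> (G *v v)) + (H *v v) \<bullet> (S *v (H *v v)) \<le> - (norm v)\<^sup>2"
  obtains \<kappa> where "0 \<le> \<kappa>" "\<And>x p q. 2 * ((S *v x) \<bullet> (G *v x + p)) + (H *v x + q) \<bullet> (S *v (H *v x + q))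
     \<le> - (norm x)\<^sup>2 / 2 + \<kappa> * ((norm p)\<^sup>2 + (norm q)\<^sup>2)"
proof -
  obtain s where s: "s > 0" "\<And>x. norm (S *v x) \<le> s * norm x"
    using linear_bounded_pos[OF matrix_vector_mul_linear[of S]] by metis
  obtain h where h: "h > 0" "\<And>x. norm (S *v (H *v x)) \<le> h * norm x"
    using linear_bounded_pos[OF linear_compose[OF matrix_vector_mul_linear[of H] matrix_vector_mul_linear[of S]]] by (auto simp: o_def)
  define \<kappa> where "\<kappa> = 4 * s\<^sup>2 + 4 * h\<^sup>2 + s"
  have k0: "0 \<le> \<kappa>" using s h by (simp add: \<kappa>_def)
  have sym: "transpose S = S" using S by (simp add: pos_semidef_def)
  have "2 * ((S *v x) \<bullet> (G *v x + p)) + (H *v x + q) \<bullet> (S *v (H *v x + q)) \<le> - (norm x)\<^sup>2 / 2 + \<kappa> * ((norm p)\<^sup>2 + (norm q)\<^sup>2)" for x p q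
  proof -
    have sq: "(norm (S *v x))\<^sup>2 \<le> s\<^sup>2 * (norm x)\<^sup>2" "(norm (S *v (H *v x)))\<^sup>2 \<le> h\<^sup>2 * (norm x)\<^sup>2"
      using power_mono[OF s(2)[of x], of 2] power_mono[OF h(2)[of x], of 2] by (simp_all add: power_mult_distrib)
    have p: "2 * ((S *v x) \<bullet> p) \<le> (norm x)\<^sup>2 / 4 + 4 * s\<^sup>2 * (norm p)\<^sup>2"
    proof -
      have "1 / (4 * s\<^sup>2) * (norm (S *v x))\<^sup>2 \<le> (norm x)\<^sup>2 / 4" using sq(1) s(1) by (simp add: field_simps)
      moreover have "(norm p)\<^sup>2 / (1 / (4 * s\<^sup>2)) = 4 * s\<^sup>2 * (norm p)\<^sup>2" by simp
      moreover have "0 < 1 / (4 * s\<^sup>2)" using s(1) by simp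
      ultimately show ?thesis using two_inner_le[of "1 / (4 * s\<^sup>2)" "S *v x" p] by linarith
    qed
    have q: "2 * ((S *v (H *v x)) \<bullet> q) \<le> (norm x)\<^sup>2 / 4 + 4 * h\<^sup>2 * (norm q)\<^sup>2"
    proof -
      have "1 / (4 * h\<^sup>2) * (norm (S *v (H *v x)))\<^sup>2 \<le> (norm x)\<^sup>2 / 4" using sq(2) h(1) by (simp add: field_simps)
      moreover have "(norm q)\<^sup>2 / (1 / (4 * h\<^sup>2)) = 4 * h\<^sup>2 * (norm q)\<^sup>2" by simp
      moreover have "0 < 1 / (4 * h\<^sup>2)" using h(1) by simp
      ultimately show ?thesis using two_inner_le[of "1 / (4 * h\<^sup>2)" "S *v (H *v x)" q] by linarith
    qed
    have "q \<bullet> (S *v q) \<le> norm q * norm (S *v q)" by (rule norm_cauchy_schwarz)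
    also have "\<dots> \<le> norm q * (s * norm q)" by (intro mult_left_mono s) simp
    finally have qq: "q \<bullet> (S *v q) \<le> s * (norm q)\<^sup>2" by (simp add: power2_eq_square mult_ac)
    have "2 * ((S *v x) \<bullet> (G *v x + p)) + (H *v x + q) \<bullet> (S *v (H *v x + q))
      = (2 * ((S *v x) \<bullet> (G *v x)) + (H *v x) \<bullet> (S *v (H *v x))) + 2 * ((S *v x) \<bullet> p) + 2 * ((S *v (H *v x)) \<bullet> q) + q \<bullet> (S *v q)"
      using sym_inner[OF sym, of "H *v x" q]
      by (simp add: matrix_vector_right_distrib inner_add_left inner_add_right inner_commute algebra_simps)
    also have "\<dots> \<le> - (norm x)\<^sup>2 + ((norm x)\<^sup>2 / 4 + 4 * s\<^sup>2 * (norm p)\<^sup>2) + ((norm x)\<^sup>2 / 4 + 4 * h\<^sup>2 * (norm q)\<^sup>2) + s * (norm q)\<^sup>2"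
      using lyap[of x] p q qq by linarith
    also have "\<dots> = - (norm x)\<^sup>2 / 2 + (4 * s\<^sup>2 * (norm p)\<^sup>2 + (4 * h\<^sup>2 + s) * (norm q)\<^sup>2)" by (simp add: algebra_simps)
    also have "\<dots> \<le> - (norm x)\<^sup>2 / 2 + (\<kappa> * (norm p)\<^sup>2 + \<kappa> * (norm q)\<^sup>2)"
      using s h by (intro add_left_mono add_mono mult_right_mono) (auto simp: \<kappa>_def)
    finally show ?thesis by (simp add: distrib_left)
  qed
  with that k0 show thesis by blast
qed

context brownian_basis
begin

lemma progressive_joint_Ici:
  fixes H :: "real \<Rightarrow> 'a \<Rightarrow> 'b::euclidean_space"
  assumes "progressive F H"
  shows "(\<lambda>x. indicator {0..} (snd x) *\<^sub>R H (snd x) (fst x)) \<in> borel_measurable (M \<Otimes>\<^sub>M lborel)"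
proof (rule borel_measurable_LIMSEQ_metric[where f = "\<lambda>n x. indicator {0..real n} (snd x) *\<^sub>R H (snd x) (fst x)"])
  show "(\<lambda>x. indicat_real {0..real n} (snd x) *\<^sub>R H (snd x) (fst x)) \<in> borel_measurable (M \<Otimes>\<^sub>M lborel)" for n
    by (rule progressive_joint[OF assms]) simp
  fix x :: "'a \<times> real"
  obtain n0 where n0: "snd x \<le> real n0" using real_arch_simple by blast
  have "eventually (\<lambda>n. indicat_real {0..real n} (snd x) *\<^sub>R H (snd x) (fst x) = indicator {0..} (snd x) *\<^sub>R H (snd x) (fst x)) sequentially"
    unfolding eventually_sequentially
    by (intro exI[of _ n0] allI impI) (use n0 in \<open>auto simp: indicator_def\<close>)
  thus "(\<lambda>n. indicat_real {0..real n} (snd x) *\<^sub>R H (snd x) (fst x)) \<longlonglongrightarrow> indicator {0..} (snd x) *\<^sub>R H (snd x) (fst x)"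
    by (rule tendsto_eventually)
qed

end

text \<open>The linear growth condition for the transformed process has to be stated in terms of
  \<open>T *v x\<close>; the lower bound \<open>B0\<close> on \<open>T\<close> is what recovers
  \<open>x\<close> from it.\<close>

lemma affine_norm_sq_bound:
  fixes T G :: "real^'n^'n"
  assumes B0: "B0 > 0" "\<And>x. B0 * norm x \<le> norm (T *v x)"
  shows "\<exists>c\<ge>1. \<forall>x p. norm p \<le> \<gamma> \<longrightarrow> (norm (T *v (G *v x + p)))\<^sup>2 \<le> c * (1 + (norm (T *v x))\<^sup>2)"
proof -
  obtain t where t: "t > 0" "\<And>x. norm (T *v x) \<le> t * norm x"
    using linear_bounded_pos[OF matrix_vector_mul_linear[of T]] by metis
  obtain g where g: "g > 0" "\<And>x. norm (G *v x) \<le> g * norm x"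
    using linear_bounded_pos[OF matrix_vector_mul_linear[of G]] by metis
  define c where "c = 1 + t\<^sup>2 * (2 * g\<^sup>2 / B0\<^sup>2 + 2 * \<gamma>\<^sup>2)"
  have "(norm (T *v (G *v x + p)))\<^sup>2 \<le> c * (1 + (norm (T *v x))\<^sup>2)" if p: "norm p \<le> \<gamma>" for x p
  proof -
    have "(norm (T *v (G *v x + p)))\<^sup>2 \<le> t\<^sup>2 * (norm (G *v x + p))\<^sup>2"
      using power_mono[OF t(2)[of "G *v x + p"], of 2] by (simp add: power_mult_distrib)
    also have "(norm (G *v x + p))\<^sup>2 \<le> 2 * (norm (G *v x))\<^sup>2 + 2 * (norm p)\<^sup>2" by (rule norm_add_sq_le)
    also have "(norm (G *v x))\<^sup>2 \<le> g\<^sup>2 * (norm x)\<^sup>2"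
      using power_mono[OF g(2)[of x], of 2] by (simp add: power_mult_distrib)
    also have "(norm p)\<^sup>2 \<le> \<gamma>\<^sup>2" using p by (intro power_mono) auto
    also have "(norm x)\<^sup>2 \<le> (norm (T *v x))\<^sup>2 / B0\<^sup>2"
      using power_mono[OF B0(2)[of x], of 2] B0(1) by (simp add: power_mult_distrib pos_le_divide_eq mult.commute)
    finally have "(norm (T *v (G *v x + p)))\<^sup>2 \<le> t\<^sup>2 * (2 * (g\<^sup>2 * ((norm (T *v x))\<^sup>2 / B0\<^sup>2)) + 2 * \<gamma>\<^sup>2)"
      by (simp add: mult_left_mono)
    also have "\<dots> = t\<^sup>2 * (2 * g\<^sup>2 / B0\<^sup>2) * (norm (T *v x))\<^sup>2 + t\<^sup>2 * (2 * \<gamma>\<^sup>2)" by (simp add: algebra_simps)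
    also have "\<dots> \<le> c * (norm (T *v x))\<^sup>2 + c * 1"
      unfolding c_def by (intro add_mono mult_right_mono) (auto simp: distrib_left intro: add_increasing add_increasing2)
    finally show ?thesis by (simp add: algebra_simps)
  qed
  moreover have "c \<ge> 1" by (simp add: c_def)
  ultimately show ?thesis by blast
qed

context brownian_basis
begin

lemma progressive_affine:
  fixes X :: "real \<Rightarrow> 'a \<Rightarrow> real^'n" and G :: "real^'n^'m"
  assumes prog: "progressive F X" and p: "continuous_on {0..} p"
    and b: "\<And>t w. 0 \<le> t \<Longrightarrow> b t w = G *v X t w + p t"
  shows "progressive F b"
  unfolding progressive_def
proof (intro allI impI)
  fix t :: real assume t: "0 \<le> t"
  let ?R = "restrict_space borel {0..t} \<Otimes>\<^sub>M F t"
  have X: "case_prod X \<in> borel_measurable ?R" using prog t by (simp add: progressive_def)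
  have [measurable]: "(*v) G \<in> borel_measurable borel"
    by (intro borel_measurable_continuous_onI linear_continuous_on) (simp add: matrix_vector_mul_bounded_linear)
  have "p \<in> borel_measurable (restrict_space borel {0..t})"
    by (rule borel_measurable_continuous_on_restrict) (rule continuous_on_subset[OF p], auto)
  hence "(\<lambda>x. p (fst x)) \<in> borel_measurable ?R" by measurable
  moreover have "(\<lambda>x. G *v case_prod X x) \<in> borel_measurable ?R" using X by measurable
  ultimately have "(\<lambda>x. G *v case_prod X x + p (fst x)) \<in> borel_measurable ?R" by (intro borel_measurable_add)
  thus "case_prod b \<in> borel_measurable ?R"
    by (rule measurable_cong[THEN iffD1, rotated]) (auto simp: space_pair_measure space_restrict_space b)
qed

lemma discounted_cost_eq:
  fixes X :: "real \<Rightarrow> 'a \<Rightarrow> 'b::euclidean_space"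
  assumes prog: "progressive F X"
  shows "discounted_cost M \<rho> (\<lambda>t w. (norm (X t w))\<^sup>2)
    = (\<integral>\<^sup>+ t\<in>{0..}. ennreal (exp (- \<rho> * t)) * (\<integral>\<^sup>+ w. ennreal ((norm (X t w))\<^sup>2) \<partial>M) \<partial>lborel)"
proof -
  interpret P: pair_sigma_finite M lborel ..
  define xx where "xx w t = indicator {0..} t *\<^sub>R X t w" for w t
  have [measurable]: "case_prod xx \<in> borel_measurable (M \<Otimes>\<^sub>M lborel)"
    using progressive_joint_Ici[OF prog] by (simp add: xx_def case_prod_beta')
  have "discounted_cost M \<rho> (\<lambda>t w. (norm (X t w))\<^sup>2) = (\<integral>\<^sup>+ w. (\<integral>\<^sup>+ t. ennreal (exp (- \<rho> * t)) * ennreal ((norm (xx w t))\<^sup>2) \<partial>lborel) \<partial>M)"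
    unfolding discounted_cost_def by (intro nn_integral_cong) (auto simp: xx_def indicator_def ennreal_mult)
  also have "\<dots> = (\<integral>\<^sup>+ t. (\<integral>\<^sup>+ w. ennreal (exp (- \<rho> * t)) * ennreal ((norm (xx w t))\<^sup>2) \<partial>M) \<partial>lborel)"
    by (rule P.Fubini'[symmetric]) measurable
  also have "\<dots> = (\<integral>\<^sup>+ t. ennreal (exp (- \<rho> * t)) * (\<integral>\<^sup>+ w. ennreal ((norm (xx w t))\<^sup>2) \<partial>M) \<partial>lborel)"
    by (intro nn_integral_cong nn_integral_cmult) measurable
  also have "\<dots> = (\<integral>\<^sup>+ t\<in>{0..}. ennreal (exp (- \<rho> * t)) * (\<integral>\<^sup>+ w. ennreal ((norm (X t w))\<^sup>2) \<partial>M) \<partial>lborel)"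
    by (intro nn_integral_cong) (auto simp: xx_def indicator_def)
  finally show ?thesis .
qed

lemma discounted_cost_affine:
  fixes X :: "real \<Rightarrow> 'a \<Rightarrow> 'b::euclidean_space"
  assumes prog: "progressive F X" and fin: "discounted_cost M \<rho> (\<lambda>t w. (norm (X t w))\<^sup>2) < \<infinity>"
    and \<phi>: "continuous_on {0..} \<phi>" "\<And>t. 0 \<le> \<phi> t" "(\<integral>\<^sup>+ t\<in>{0..}. ennreal (exp (- \<rho> * t) * \<phi> t) \<partial>lborel) < \<infinity>"
    and k: "0 \<le> k" and g: "\<And>t w. 0 \<le> t \<Longrightarrow> g t w \<le> k * ((norm (X t w))\<^sup>2 + \<phi> t)"
  shows "discounted_cost M \<rho> g < \<infinity>"
proof -
  interpret P: pair_sigma_finite M lborel ..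
  define xx where "xx w t = indicator {0..} t *\<^sub>R X t w" for w t
  have xm[measurable]: "case_prod xx \<in> borel_measurable (M \<Otimes>\<^sub>M lborel)"
    using progressive_joint_Ici[OF prog] by (simp add: xx_def case_prod_beta')
  define f where "f t = indicator {0..} t *\<^sub>R \<phi> t" for t
  have [measurable]: "f \<in> borel_measurable lborel"
    unfolding f_def using borel_measurable_continuous_on_indicator[OF _ \<phi>(1)] by simp
  have "discounted_cost M \<rho> g \<le> (\<integral>\<^sup>+ w. (\<integral>\<^sup>+ t. ennreal k * (ennreal (exp (- \<rho> * t) * (norm (xx w t))\<^sup>2) + ennreal (exp (- \<rho> * t) * f t)) \<partial>lborel) \<partial>M)"
    unfolding discounted_cost_def
  proof (intro nn_integral_mono)
    fix w t
    show "ennreal (exp (- \<rho> * t) * g t w) * indicator {0..} t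
       \<le> ennreal k * (ennreal (exp (- \<rho> * t) * (norm (xx w t))\<^sup>2) + ennreal (exp (- \<rho> * t) * f t))"
    proof (cases "0 \<le> t")
      case True
      have "exp (- \<rho> * t) * g t w \<le> k * (exp (- \<rho> * t) * (norm (X t w))\<^sup>2 + exp (- \<rho> * t) * \<phi> t)"
        using mult_left_mono[OF g[OF True], of "exp (- \<rho> * t)"] by (simp add: algebra_simps)
      hence "ennreal (exp (- \<rho> * t) * g t w) \<le> ennreal (k * (exp (- \<rho> * t) * (norm (X t w))\<^sup>2 + exp (- \<rho> * t) * \<phi> t))"
        by (rule ennreal_leI)
      also have "\<dots> = ennreal k * (ennreal (exp (- \<rho> * t) * (norm (X t w))\<^sup>2) + ennreal (exp (- \<rho> * t) * \<phi> t))"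
        using k \<phi>(2) by (subst ennreal_mult) (auto simp: ennreal_plus)
      finally show ?thesis using True by (simp add: xx_def f_def)
    qed simp
  qed
  also have "\<dots> = (\<integral>\<^sup>+ w. ennreal k * ((\<integral>\<^sup>+ t. ennreal (exp (- \<rho> * t) * (norm (xx w t))\<^sup>2) \<partial>lborel) + (\<integral>\<^sup>+ t. ennreal (exp (- \<rho> * t) * f t) \<partial>lborel)) \<partial>M)"
  proof (rule nn_integral_cong)
    fix w assume w': "w \<in> space M"
    have [measurable]: "xx w \<in> borel_measurable lborel" using w' by measurable
    show "(\<integral>\<^sup>+ t. ennreal k * (ennreal (exp (- \<rho> * t) * (norm (xx w t))\<^sup>2) + ennreal (exp (- \<rho> * t) * f t)) \<partial>lborel) =
      ennreal k * ((\<integral>\<^sup>+ t. ennreal (exp (- \<rho> * t) * (norm (xx w t))\<^sup>2) \<partial>lborel) + (\<integral>\<^sup>+ t. ennreal (exp (- \<rho> * t) * f t) \<partial>lborel))"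
      by (subst nn_integral_cmult, measurable, subst nn_integral_add) auto
  qed
  also have "\<dots> = ennreal k * ((\<integral>\<^sup>+ w. (\<integral>\<^sup>+ t. ennreal (exp (- \<rho> * t) * (norm (xx w t))\<^sup>2) \<partial>lborel) \<partial>M) + (\<integral>\<^sup>+ t. ennreal (exp (- \<rho> * t) * f t) \<partial>lborel))"
    by (subst nn_integral_cmult, measurable, subst nn_integral_add) (auto simp: emeasure_space_1)
  also have "(\<integral>\<^sup>+ w. (\<integral>\<^sup>+ t. ennreal (exp (- \<rho> * t) * (norm (xx w t))\<^sup>2) \<partial>lborel) \<partial>M) = discounted_cost M \<rho> (\<lambda>t w. (norm (X t w))\<^sup>2)"
    unfolding discounted_cost_def by (intro nn_integral_cong) (auto simp: xx_def indicator_def)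
  also have "(\<integral>\<^sup>+ t. ennreal (exp (- \<rho> * t) * f t) \<partial>lborel) = (\<integral>\<^sup>+ t\<in>{0..}. ennreal (exp (- \<rho> * t) * \<phi> t) \<partial>lborel)"
    by (intro nn_integral_cong) (auto simp: f_def indicator_def)
  also have "ennreal k * (discounted_cost M \<rho> (\<lambda>t w. (norm (X t w))\<^sup>2) + \<dots>) < \<infinity>"
    using fin \<phi>(3) by (simp add: ennreal_mult_less_top)
  finally show ?thesis .
qed

text \<open>The moment inequality is applied to \<open>y = sqrt S X\<close>, whose squared norm is
  the Lyapunov function. Its drift loses at least \<open>|X|^2 / 2\<close>, up to the offsets, so
  the discounted second moment of \<open>X\<close> is bounded by the initial value and the
  discounted energy of \<open>p\<close> and \<open>q\<close>.\<close>

lemma discounted_stability: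
  fixes X :: "real \<Rightarrow> 'a \<Rightarrow> real^'n" and G H S :: "real^'n^'n"
  assumes diff: "has_ito_differential M F W X b h" and \<rho>: "0 \<le> \<rho>"
    and b: "\<And>t w. 0 \<le> t \<Longrightarrow> b t w = (G + (\<rho> / 2) *\<^sub>R mat 1) *v X t w + p t"
    and h: "\<And>t w. 0 \<le> t \<Longrightarrow> h t w = H *v X t w + q t"
    and X0: "(\<integral>\<^sup>+ w. ennreal ((norm (X 0 w))\<^sup>2) \<partial>M) < \<infinity>"
    and cp: "continuous_on {0..} p" and cq: "continuous_on {0..} q"
    and fin: "(\<integral>\<^sup>+ t\<in>{0..}. ennreal (exp (- \<rho> * t) * ((norm (p t))\<^sup>2 + (norm (q t))\<^sup>2)) \<partial>lborel) < \<infinity>"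
    and S: "pos_semidef S"
    and lyap: "\<And>v. 2 * ((S *v v) \<bullet> (G *v v)) + (H *v v) \<bullet> (S *v (H *v v)) \<le> - (norm v)\<^sup>2"
  shows "discounted_cost M \<rho> (\<lambda>t w. (norm (X t w))\<^sup>2) < \<infinity>"
proof -
  have prog: "progressive F X" and cont: "AE w in M. continuous_on {0..} (\<lambda>t. X t w)"
    using diff by (auto simp: has_ito_differential_def)
  have progb: "progressive F b" by (rule progressive_affine[OF prog cp b])
  have progh: "progressive F h" by (rule progressive_affine[OF prog cq h])
  have contb: "AE w in M. continuous_on {0..} (\<lambda>t. b t w)" using cont
  proof eventually_elim
    case (elim w)
    have "continuous_on {0..} (\<lambda>t. (G + (\<rho> / 2) *\<^sub>R mat 1) *v X t w + p t)"
      by (intro continuous_intros cp bounded_linear.continuous_on[OF matrix_vector_mul_bounded_linear elim])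
    thus ?case by (rule continuous_on_cong[THEN iffD1, rotated -1]) (auto simp: b)
  qed
  define T where "T = matrix_sqrt S"
  note T = matrix_sqrt[OF S, folded T_def]
  have TT: "(T *v u) \<bullet> (T *v v) = u \<bullet> (S *v v)" for u v
    using sym_inner[OF T(3), of u "T *v v"] T(2) by (simp add: matrix_vector_mul_assoc)
  \<comment> \<open>The Lyapunov inequality itself excludes a kernel: if \<open>S *v v = 0\<close>,
    its left side is nonnegative and its right side is \<open>- |v|^2\<close>.\<close>
  have injT: "v = 0" if "T *v v = 0" for v
  proof -
    have "S *v v = 0" using that T(2) by (metis matrix_vector_mul_assoc matrix_vector_mult_0_right)
    moreover have "0 \<le> (H *v v) \<bullet> (S *v (H *v v))" using S by (simp add: pos_semidef_def)
    moreover have "2 * ((S *v v) \<bullet> (G *v v)) = 0" using \<open>S *v v = 0\<close> by simp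
    ultimately have "(norm v)\<^sup>2 \<le> 0" using lyap[of v] by linarith
    thus ?thesis by simp
  qed
  hence "inj ((*v) T)" using linear_injective_0[OF matrix_vector_mul_linear] by blast
  then obtain B0 where B0: "B0 > 0" "\<And>x. B0 * norm x \<le> norm (T *v x)"
    using linear_inj_bounded_below_pos[OF matrix_vector_mul_linear, of T] by metis
  define y where "y t w = T *v X t w" for t w
  have diffy: "has_ito_differential M F W y (\<lambda>t w. T *v b t w) (\<lambda>t w. T *v h t w)"
    unfolding y_def by (rule ito_differential_linear[OF diff matrix_vector_mul_linear])
  have X0sq: "sq_integrable M (X 0)"
    by (rule sq_integrableI_nn[OF measurable_F_M[OF progressive_adapted[OF prog order_refl]] X0])
  have y0sq: "sq_integrable M (y 0)"
    unfolding y_def by (rule sq_integrable_linear[OF matrix_vector_mul_linear X0sq])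
  have y0: "(\<integral>\<^sup>+ w. ennreal ((norm (y 0 w))\<^sup>2) \<partial>M) < \<infinity>" unfolding sq_integrable_nn_integral[OF y0sq] by simp
  obtain \<kappa> where \<kappa>: "0 \<le> \<kappa>" "\<And>x p q. 2 * ((S *v x) \<bullet> (G *v x + p)) + (H *v x + q) \<bullet> (S *v (H *v x + q))
     \<le> - (norm x)\<^sup>2 / 2 + \<kappa> * ((norm p)\<^sup>2 + (norm q)\<^sup>2)"
    using lyapunov_drift_bound[OF S lyap] by blast
  define v where "v t = (\<integral>w. (norm (y t w))\<^sup>2 \<partial>M)" for t
  define m where "m t = (\<integral>w. (norm (X t w))\<^sup>2 \<partial>M)" for t
  define \<psi> where "\<psi> t = (\<integral>w. 2 * ((T *v b t w) \<bullet> y t w) + (norm (T *v h t w))\<^sup>2 \<partial>M)" for t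
  define \<pi> where "\<pi> t = (norm (p t))\<^sup>2 + (norm (q t))\<^sup>2" for t
  obtain P0 where P0: "(\<integral>\<^sup>+ t\<in>{0..}. ennreal (exp (- \<rho> * t) * \<pi> t) \<partial>lborel) = ennreal P0" "0 \<le> P0"
    using fin unfolding \<pi>_def by (cases "\<integral>\<^sup>+ t\<in>{0..}. ennreal (exp (- \<rho> * t) * ((norm (p t))\<^sup>2 + (norm (q t))\<^sup>2)) \<partial>lborel") auto
  have \<pi>0: "0 \<le> \<pi> t" for t by (simp add: \<pi>_def)
  \<comment> \<open>The growth constants used inside depend on \<open>\<tau>\<close>, but only to
    secure integrability; the resulting bound does not, which is what permits the limit
    \<open>\<tau> \<rightarrow> \<infinity>\<close>.\<close>
  have horizon: "(\<forall>t\<in>{0..\<tau>}. sq_integrable M (X t)) \<and>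
     (\<integral>\<^sup>+ t\<in>{0..\<tau>}. ennreal (exp (- \<rho> * t) * m t) \<partial>lborel) \<le> ennreal (2 * v 0 + 2 * \<kappa> * P0)" if \<tau>: "0 \<le> \<tau>" for \<tau>
  proof -
    have "compact (p ` {0..\<tau>})" "compact (q ` {0..\<tau>})"
      by (auto intro!: compact_continuous_image continuous_on_subset[OF cp] continuous_on_subset[OF cq])
    from this[THEN compact_imp_bounded] obtain \<gamma> \<gamma>' where pq: "\<forall>t\<in>{0..\<tau>}. norm (p t) \<le> \<gamma>" "\<forall>t\<in>{0..\<tau>}. norm (q t) \<le> \<gamma>'"
      by (auto simp: bounded_iff)
    obtain c1 where c1: "c1 \<ge> 1" "\<forall>x p. norm p \<le> \<gamma> \<longrightarrow> (norm (T *v ((G + (\<rho> / 2) *\<^sub>R mat 1) *v x + p)))\<^sup>2 \<le> c1 * (1 + (norm (T *v x))\<^sup>2)"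
      using affine_norm_sq_bound[OF B0] by blast
    obtain c2 where c2: "c2 \<ge> 1" "\<forall>x p. norm p \<le> \<gamma>' \<longrightarrow> (norm (T *v (H *v x + p)))\<^sup>2 \<le> c2 * (1 + (norm (T *v x))\<^sup>2)"
      using affine_norm_sq_bound[OF B0] by blast
    define c where "c = max c1 c2"
    have c: "1 \<le> c" using c1(1) by (simp add: c_def)
    have bc: "(norm (T *v b t w))\<^sup>2 \<le> c * (1 + (norm (y t w))\<^sup>2)" if "t \<in> {0..\<tau>}" for t w
    proof -
      have "(norm (T *v b t w))\<^sup>2 \<le> c1 * (1 + (norm (y t w))\<^sup>2)" using c1(2) pq(1) that by (simp add: b y_def)
      also have "\<dots> \<le> c * (1 + (norm (y t w))\<^sup>2)" by (intro mult_right_mono) (auto simp: c_def)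
      finally show ?thesis .
    qed
    have hc: "(norm (T *v h t w))\<^sup>2 \<le> c * (1 + (norm (y t w))\<^sup>2)" if "t \<in> {0..\<tau>}" for t w
    proof -
      have "(norm (T *v h t w))\<^sup>2 \<le> c2 * (1 + (norm (y t w))\<^sup>2)" using c2(2) pq(2) that by (simp add: h y_def)
      also have "\<dots> \<le> c * (1 + (norm (y t w))\<^sup>2)" by (intro mult_right_mono) (auto simp: c_def)
      finally show ?thesis .
    qed
    have progTb: "progressive F (\<lambda>t w. T *v b t w)" by (rule progressive_linear[OF progb matrix_vector_mul_linear])
    have contTb: "AE w in M. continuous_on {0..} (\<lambda>t. T *v b t w)" using contb
      by eventually_elim (rule bounded_linear.continuous_on[OF matrix_vector_mul_bounded_linear])
    obtain C where C: "\<forall>t\<in>{0..\<tau>}. (\<integral>\<^sup>+ w. ennreal ((norm (y t w))\<^sup>2) \<partial>M) \<le> ennreal C"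
      using second_moment_bound[OF diffy \<tau> c bc hc y0] by blast
    have mX: "X t \<in> borel_measurable M" "b t \<in> borel_measurable M" "h t \<in> borel_measurable M" if "0 \<le> t" for t
      using that progressive_adapted[OF prog] progressive_adapted[OF progb] progressive_adapted[OF progh] by (auto dest: measurable_F_M)
    have my: "y t \<in> borel_measurable M" if "0 \<le> t" for t
      using measurable_F_M[OF progressive_adapted[OF progressive_linear[OF prog matrix_vector_mul_linear] that]] by (simp add: y_def[abs_def])
    have ysq: "sq_integrable M (y t)" if "t \<in> {0..\<tau>}" for t
    proof (rule sq_integrableI_nn)
      have "(\<integral>\<^sup>+ w. ennreal ((norm (y t w))\<^sup>2) \<partial>M) \<le> ennreal C" using C that by blast
      also have "\<dots> < \<infinity>" by simp
      finally show "(\<integral>\<^sup>+ w. ennreal ((norm (y t w))\<^sup>2) \<partial>M) < \<infinity>" .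
    qed (use my that in auto)
    have Xy: "(norm (X t w))\<^sup>2 \<le> 1 / B0\<^sup>2 * (norm (y t w))\<^sup>2" for t w
      using power_mono[OF B0(2)[of "X t w"], of 2] B0(1) by (simp add: y_def power_mult_distrib pos_le_divide_eq mult.commute)
    have Xsq: "sq_integrable M (X t)" if t: "t \<in> {0..\<tau>}" for t
      by (rule sq_integrable_bound[OF mX(1) integrable_mult_right[OF sq_integrable_norm[OF ysq[OF t]]] Xy]) (use t in auto)
    have Tbsq: "sq_integrable M (\<lambda>w. T *v b t w)" and Thsq: "sq_integrable M (\<lambda>w. T *v h t w)" if t: "t \<in> {0..\<tau>}" for t
      using sq_integrable_norm[OF ysq[OF t]] bc[OF t] hc[OF t] t mX[of t]
      by (auto intro!: sq_integrable_bound[where g = "\<lambda>w. c * (1 + (norm (y t w))\<^sup>2)"]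
        measurable_compose[OF _ borel_measurable_continuous_onI[OF linear_continuous_on[OF matrix_vector_mul_bounded_linear]]])
    have v0: "0 \<le> v t" and m0: "0 \<le> m t" for t by (auto simp: v_def m_def)
    have vC: "v t \<le> \<bar>C\<bar>" if t: "t \<in> {0..\<tau>}" for t
    proof -
      have "ennreal (v t) = (\<integral>\<^sup>+ w. ennreal ((norm (y t w))\<^sup>2) \<partial>M)"
        unfolding v_def by (rule sq_integrable_nn_integral[OF ysq[OF t], symmetric])
      also have "\<dots> \<le> ennreal C" using C t by blast
      also have "\<dots> \<le> ennreal \<bar>C\<bar>" by (rule ennreal_leI) simp
      finally show ?thesis by (subst (asm) ennreal_le_iff) auto
    qed
    define xx where "xx w t = indicator {0..\<tau>} t *\<^sub>R X t w" for w t
    define bb where "bb w t = indicator {0..\<tau>} t *\<^sub>R b t w" for w t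
    define hh where "hh w t = indicator {0..\<tau>} t *\<^sub>R h t w" for w t
    have [measurable]: "(\<lambda>x. xx (snd x) (fst x)) \<in> borel_measurable (lborel \<Otimes>\<^sub>M M)"
      "(\<lambda>x. bb (snd x) (fst x)) \<in> borel_measurable (lborel \<Otimes>\<^sub>M M)" "(\<lambda>x. hh (snd x) (fst x)) \<in> borel_measurable (lborel \<Otimes>\<^sub>M M)"
      using measurable_compose[OF measurable_pair_swap' progressive_joint[OF prog \<tau>]]
        measurable_compose[OF measurable_pair_swap' progressive_joint[OF progb \<tau>]]
        measurable_compose[OF measurable_pair_swap' progressive_joint[OF progh \<tau>]]
      by (simp_all add: xx_def bb_def hh_def case_prod_beta')
    have [measurable]: "(*v) T \<in> borel_measurable borel"
      by (rule borel_measurable_continuous_onI[OF linear_continuous_on[OF matrix_vector_mul_bounded_linear]])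
    have meas_v: "(\<lambda>t. indicator {0..\<tau>} t *\<^sub>R v t) \<in> borel_measurable lborel"
    proof -
      have "(\<lambda>t. \<integral>w. (norm (T *v xx w t))\<^sup>2 \<partial>M) \<in> borel_measurable lborel"
        by (intro borel_measurable_lebesgue_integral) (simp add: case_prod_beta')
      moreover have "(\<integral>w. (norm (T *v xx w t))\<^sup>2 \<partial>M) = indicator {0..\<tau>} t *\<^sub>R v t" for t
        by (auto simp: xx_def v_def y_def indicator_def)
      ultimately show ?thesis by simp
    qed
    have meas_m: "(\<lambda>t. indicator {0..\<tau>} t *\<^sub>R m t) \<in> borel_measurable lborel"
    proof -
      have "(\<lambda>t. \<integral>w. (norm (xx w t))\<^sup>2 \<partial>M) \<in> borel_measurable lborel"
        by (intro borel_measurable_lebesgue_integral) (simp add: case_prod_beta')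
      moreover have "(\<integral>w. (norm (xx w t))\<^sup>2 \<partial>M) = indicator {0..\<tau>} t *\<^sub>R m t" for t
        by (auto simp: xx_def m_def indicator_def)
      ultimately show ?thesis by simp
    qed
    have meas_\<psi>: "(\<lambda>t. indicator {0..\<tau>} t *\<^sub>R \<psi> t) \<in> borel_measurable lborel"
    proof -
      have "(\<lambda>t. \<integral>w. 2 * ((T *v bb w t) \<bullet> (T *v xx w t)) + (norm (T *v hh w t))\<^sup>2 \<partial>M) \<in> borel_measurable lborel"
        by (intro borel_measurable_lebesgue_integral) (simp add: case_prod_beta')
      moreover have "(\<integral>w. 2 * ((T *v bb w t) \<bullet> (T *v xx w t)) + (norm (T *v hh w t))\<^sup>2 \<partial>M) = indicator {0..\<tau>} t *\<^sub>R \<psi> t" for t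
        by (auto simp: xx_def bb_def hh_def \<psi>_def y_def indicator_def)
      ultimately show ?thesis by simp
    qed
    have bnd_int: "set_integrable lborel {0..\<tau>} f"
      if "(\<lambda>t. indicator {0..\<tau>} t *\<^sub>R f t) \<in> borel_measurable lborel" "\<And>t. t \<in> {0..\<tau>} \<Longrightarrow> \<bar>f t\<bar> \<le> B" for f :: "real \<Rightarrow> real" and B
      unfolding set_integrable_def
    proof (rule Bochner_Integration.integrable_bound[of lborel "\<lambda>t. indicator {0..\<tau>} t *\<^sub>R B"])
      show "integrable lborel (\<lambda>t. indicat_real {0..\<tau>} t *\<^sub>R B)" using \<tau> by (intro integrable_indicator) auto
      show "AE t in lborel. norm (indicator {0..\<tau>} t *\<^sub>R f t) \<le> norm (indicat_real {0..\<tau>} t *\<^sub>R B)"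
        using that(2) by (intro AE_I2) (auto simp: indicator_def intro: order_trans[OF _ abs_ge_self])
    qed (rule that)
    have iv: "set_integrable lborel {0..\<tau>} v" by (rule bnd_int[OF meas_v, of "\<bar>C\<bar>"]) (use v0 vC in auto)
    have mv: "m t \<le> 1 / B0\<^sup>2 * v t" if t: "t \<in> {0..\<tau>}" for t
    proof -
      have "m t \<le> (\<integral>w. 1 / B0\<^sup>2 * (norm (y t w))\<^sup>2 \<partial>M)" unfolding m_def
        by (intro integral_mono sq_integrable_norm[OF Xsq[OF t]] integrable_mult_right sq_integrable_norm[OF ysq[OF t]] Xy)
      thus ?thesis by (simp add: v_def)
    qed
    have im: "set_integrable lborel {0..\<tau>} m"
    proof (rule bnd_int[OF meas_m, of "1 / B0\<^sup>2 * \<bar>C\<bar>"])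
      fix t assume t: "t \<in> {0..\<tau>}"
      have "1 / B0\<^sup>2 * v t \<le> 1 / B0\<^sup>2 * \<bar>C\<bar>" using vC[OF t] by (intro mult_left_mono) auto
      thus "\<bar>m t\<bar> \<le> 1 / B0\<^sup>2 * \<bar>C\<bar>" using mv[OF t] m0[of t] by linarith
    qed
    have i\<psi>int: "integrable M (\<lambda>w. 2 * ((T *v b t w) \<bullet> y t w) + (norm (T *v h t w))\<^sup>2)" if t: "t \<in> {0..\<tau>}" for t
      by (intro Bochner_Integration.integrable_add integrable_mult_right sq_integrable_inner Tbsq ysq sq_integrable_norm[OF Thsq] t)
    have i\<psi>: "set_integrable lborel {0..\<tau>} \<psi>"
    proof (rule bnd_int[OF meas_\<psi>])
      fix t assume t: "t \<in> {0..\<tau>}"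
      have "\<bar>\<psi> t\<bar> \<le> (\<integral>w. \<bar>2 * ((T *v b t w) \<bullet> y t w) + (norm (T *v h t w))\<^sup>2\<bar> \<partial>M)"
        unfolding \<psi>_def by (rule integral_abs_bound)
      also have "\<dots> \<le> (\<integral>w. 3 * c + (3 * c + 2) * (norm (y t w))\<^sup>2 \<partial>M)"
      proof (rule integral_mono)
        show "integrable M (\<lambda>w. \<bar>2 * ((T *v b t w) \<bullet> y t w) + (norm (T *v h t w))\<^sup>2\<bar>)"
          by (rule Bochner_Integration.integrable_abs[OF i\<psi>int[OF t]])
        show "integrable M (\<lambda>w. 3 * c + (3 * c + 2) * (norm (y t w))\<^sup>2)" using sq_integrable_norm[OF ysq[OF t]] by simp
        fix w
        show "\<bar>2 * ((T *v b t w) \<bullet> y t w) + (norm (T *v h t w))\<^sup>2\<bar> \<le> 3 * c + (3 * c + 2) * (norm (y t w))\<^sup>2"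
        proof -
          define k where "k = c * (1 + (norm (y t w))\<^sup>2)"
          have k: "3 * c + (3 * c + 2) * (norm (y t w))\<^sup>2 = 3 * k + 2 * (norm (y t w))\<^sup>2"
            by (simp add: k_def algebra_simps)
          have "0 \<le> (norm (T *v h t w))\<^sup>2" by (rule zero_le_power2)
          thus ?thesis unfolding k
            using abs_inner_le_sq[of "T *v b t w" "y t w"] bc[OF t, of w, folded k_def] hc[OF t, of w, folded k_def] by linarith
        qed
      qed
      also have "\<dots> = 3 * c + (3 * c + 2) * v t" using sq_integrable_norm[OF ysq[OF t]] by (simp add: v_def prob_space)
      also have "\<dots> \<le> 3 * c + (3 * c + 2) * \<bar>C\<bar>" using vC[OF t] c by (intro add_left_mono mult_left_mono) auto
      finally show "\<bar>\<psi> t\<bar> \<le> 3 * c + (3 * c + 2) * \<bar>C\<bar>" .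
    qed
    have ineq: "0 \<le> v 0 + (LINT s:{0..\<tau>}|lborel. exp (- \<rho> * s) * (\<psi> s - \<rho> * v s))"
      by (rule discounted_integral_inequality[OF i\<psi> iv \<tau> \<rho> v0])
        (unfold v_def \<psi>_def, rule moment_inequality[OF diffy \<tau> c bc hc y0 progTb contTb])
    have drift: "\<psi> t - \<rho> * v t \<le> - m t / 2 + \<kappa> * \<pi> t" if t: "t \<in> {0..\<tau>}" for t
    proof -
      have "\<psi> t - \<rho> * v t = (\<integral>w. 2 * ((T *v b t w) \<bullet> y t w) + (norm (T *v h t w))\<^sup>2 - \<rho> * (norm (y t w))\<^sup>2 \<partial>M)"
        unfolding \<psi>_def v_def using i\<psi>int[OF t] sq_integrable_norm[OF ysq[OF t]] by simp
      also have "\<dots> \<le> (\<integral>w. - (norm (X t w))\<^sup>2 / 2 + \<kappa> * \<pi> t \<partial>M)"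
      proof (rule integral_mono)
        show "integrable M (\<lambda>w. 2 * ((T *v b t w) \<bullet> y t w) + (norm (T *v h t w))\<^sup>2 - \<rho> * (norm (y t w))\<^sup>2)"
          using i\<psi>int[OF t] sq_integrable_norm[OF ysq[OF t]] by simp
        show "integrable M (\<lambda>w. - (norm (X t w))\<^sup>2 / 2 + \<kappa> * \<pi> t)" using sq_integrable_norm[OF Xsq[OF t]] by simp
        fix w
        \<comment> \<open>The shift \<open>\<rho> / 2\<close> in the drift produces
          \<open>\<rho> * |y|^2\<close>, which the discount cancels; what remains is the
          undiscounted expression for \<open>G\<close> and \<open>H\<close>.\<close>
        have "2 * ((T *v b t w) \<bullet> y t w) + (norm (T *v h t w))\<^sup>2 - \<rho> * (norm (y t w))\<^sup>2
          = 2 * ((S *v X t w) \<bullet> (G *v X t w + p t)) + (H *v X t w + q t) \<bullet> (S *v (H *v X t w + q t))"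
          using t unfolding y_def power2_norm_eq_inner TT
          by (simp add: b h matrix_vector_mult_add_rdistrib inner_add_left inner_add_right inner_commute algebra_simps
              flip: scaleR_matrix_vector_assoc)
        thus "2 * ((T *v b t w) \<bullet> y t w) + (norm (T *v h t w))\<^sup>2 - \<rho> * (norm (y t w))\<^sup>2 \<le> - (norm (X t w))\<^sup>2 / 2 + \<kappa> * \<pi> t"
          using \<kappa>(2)[of "X t w" "p t" "q t"] by (simp add: \<pi>_def)
      qed
      also have "\<dots> = - m t / 2 + \<kappa> * \<pi> t" using sq_integrable_norm[OF Xsq[OF t]] by (simp add: m_def prob_space)
      finally show ?thesis .
    qed
    have expint: "set_integrable lborel {0..\<tau>} (\<lambda>s. exp (- \<rho> * s) * f s)" if "set_integrable lborel {0..\<tau>} f" for f :: "real \<Rightarrow> real"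
      unfolding set_integrable_def
    proof (rule Bochner_Integration.integrable_bound)
      show i: "integrable lborel (\<lambda>s. indicator {0..\<tau>} s *\<^sub>R f s)" using that by (simp add: set_integrable_def)
      show "(\<lambda>s. indicator {0..\<tau>} s *\<^sub>R (exp (- \<rho> * s) * f s)) \<in> borel_measurable lborel"
      proof -
        have "(\<lambda>s. exp (- \<rho> * s) * (indicator {0..\<tau>} s *\<^sub>R f s)) \<in> borel_measurable lborel"
          using borel_measurable_integrable[OF i] by (intro borel_measurable_times) auto
        thus ?thesis by (simp add: mult.left_commute)
      qed
      show "AE s in lborel. norm (indicator {0..\<tau>} s *\<^sub>R (exp (- \<rho> * s) * f s)) \<le> norm (indicator {0..\<tau>} s *\<^sub>R f s)"
        using \<rho> by (intro AE_I2) (auto simp: abs_mult indicator_def intro!: mult_left_le_one_le)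
    qed
    have i\<pi>: "set_integrable lborel {0..\<tau>} \<pi>" unfolding \<pi>_def set_integrable_def
      by (rule borel_integrable_compact) (auto intro!: continuous_intros continuous_on_subset[OF cp] continuous_on_subset[OF cq])
    have "(LINT s:{0..\<tau>}|lborel. exp (- \<rho> * s) * (\<psi> s - \<rho> * v s)) \<le> (LINT s:{0..\<tau>}|lborel. \<kappa> * (exp (- \<rho> * s) * \<pi> s) - (1/2) * (exp (- \<rho> * s) * m s))"
    proof (rule set_integral_mono)
      show "set_integrable lborel {0..\<tau>} (\<lambda>s. exp (- \<rho> * s) * (\<psi> s - \<rho> * v s))" by (intro expint set_integral_diff i\<psi> iv set_integrable_mult_right)
      show "set_integrable lborel {0..\<tau>} (\<lambda>s. \<kappa> * (exp (- \<rho> * s) * \<pi> s) - (1/2) * (exp (- \<rho> * s) * m s))"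
        by (intro set_integral_diff set_integrable_mult_right expint i\<pi> im)
      fix s assume s: "s \<in> {0..\<tau>}"
      show "exp (- \<rho> * s) * (\<psi> s - \<rho> * v s) \<le> \<kappa> * (exp (- \<rho> * s) * \<pi> s) - (1/2) * (exp (- \<rho> * s) * m s)"
        using mult_left_mono[OF drift[OF s], of "exp (- \<rho> * s)"] by (simp add: algebra_simps)
    qed
    also have "\<dots> = \<kappa> * (LINT s:{0..\<tau>}|lborel. exp (- \<rho> * s) * \<pi> s) - (1/2) * (LINT s:{0..\<tau>}|lborel. exp (- \<rho> * s) * m s)"
    proof -
      have "set_integrable lborel {0..\<tau>} (\<lambda>s. \<kappa> * (exp (- \<rho> * s) * \<pi> s))"
        "set_integrable lborel {0..\<tau>} (\<lambda>s. (1/2) * (exp (- \<rho> * s) * m s))"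
        by (intro set_integrable_mult_right expint i\<pi> im)+
      thus ?thesis by (subst set_integral_diff(2)) (simp_all only: set_integral_mult_right)
    qed
    finally have "(LINT s:{0..\<tau>}|lborel. exp (- \<rho> * s) * m s) \<le> 2 * v 0 + 2 * \<kappa> * (LINT s:{0..\<tau>}|lborel. exp (- \<rho> * s) * \<pi> s)"
      using ineq by simp
    moreover have nn: "(\<integral>\<^sup>+ s\<in>{0..\<tau>}. ennreal (exp (- \<rho> * s) * f s) \<partial>lborel) = ennreal (LINT s:{0..\<tau>}|lborel. exp (- \<rho> * s) * f s)"
      if "set_integrable lborel {0..\<tau>} f" "\<And>s. 0 \<le> f s" for f :: "real \<Rightarrow> real"
    proof -
      have "(\<integral>\<^sup>+ s\<in>{0..\<tau>}. ennreal (exp (- \<rho> * s) * f s) \<partial>lborel) = (\<integral>\<^sup>+ s. ennreal (indicator {0..\<tau>} s *\<^sub>R (exp (- \<rho> * s) * f s)) \<partial>lborel)"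
        by (intro nn_integral_cong) (auto simp: indicator_def)
      also have "\<dots> = ennreal (LINT s:{0..\<tau>}|lborel. exp (- \<rho> * s) * f s)" unfolding set_lebesgue_integral_def
        using expint[OF that(1)] that(2) by (intro nn_integral_eq_integral) (auto simp: set_integrable_def)
      finally show ?thesis .
    qed
    moreover have "(LINT s:{0..\<tau>}|lborel. exp (- \<rho> * s) * \<pi> s) \<le> P0"
    proof -
      have "ennreal (LINT s:{0..\<tau>}|lborel. exp (- \<rho> * s) * \<pi> s) \<le> ennreal P0"
        unfolding nn[OF i\<pi> \<pi>0, symmetric] P0(1)[symmetric]
        by (intro nn_integral_mono mult_left_mono) (auto simp: indicator_def)
      thus ?thesis using P0(2) by simp
    qed
    ultimately have "(LINT s:{0..\<tau>}|lborel. exp (- \<rho> * s) * m s) \<le> 2 * v 0 + 2 * \<kappa> * P0"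
      using \<kappa>(1) by (smt (verit) mult_left_mono mult_nonneg_nonneg)
    thus ?thesis unfolding nn[OF im m0] using Xsq by (auto intro: ennreal_leI)
  qed
  have "discounted_cost M \<rho> (\<lambda>t w. (norm (X t w))\<^sup>2) = (\<integral>\<^sup>+ t\<in>{0..}. ennreal (exp (- \<rho> * t) * m t) \<partial>lborel)"
    unfolding discounted_cost_eq[OF prog]
  proof (rule nn_integral_cong)
    fix t
    show "ennreal (exp (- \<rho> * t)) * (\<integral>\<^sup>+ w. ennreal ((norm (X t w))\<^sup>2) \<partial>M) * indicator {0..} t = ennreal (exp (- \<rho> * t) * m t) * indicator {0..} t"
      using horizon[of t] sq_integrable_nn_integral[of "X t"] by (cases "0 \<le> t") (auto simp: m_def ennreal_mult)
  qed
  also have "\<dots> = (\<integral>\<^sup>+ t. (SUP n. ennreal (exp (- \<rho> * t) * m t) * indicator {0..real n} t) \<partial>lborel)"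
  proof (rule nn_integral_cong)
    fix t :: real
    obtain n where n: "t \<le> real n" using real_arch_simple by blast
    show "ennreal (exp (- \<rho> * t) * m t) * indicator {0..} t = (SUP n. ennreal (exp (- \<rho> * t) * m t) * indicator {0..real n} t)"
    proof (rule antisym)
      show "ennreal (exp (- \<rho> * t) * m t) * indicator {0..} t \<le> (SUP n. ennreal (exp (- \<rho> * t) * m t) * indicator {0..real n} t)"
        by (rule SUP_upper2[of n]) (use n in \<open>auto simp: indicator_def\<close>)
    qed (rule SUP_least, auto simp: indicator_def)
  qed
  also have "\<dots> = (SUP n. \<integral>\<^sup>+ t\<in>{0..real n}. ennreal (exp (- \<rho> * t) * m t) \<partial>lborel)"
  proof (rule nn_integral_monotone_convergence_SUP)
    show "incseq (\<lambda>n t. ennreal (exp (- \<rho> * t) * m t) * indicator {0..real n} t)"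
      unfolding incseq_def le_fun_def by (auto simp: indicator_def)
    fix n :: nat
    define xx where "xx w t = indicator {0..real n} t *\<^sub>R X t w" for w t
    have "(\<lambda>x. xx (snd x) (fst x)) \<in> borel_measurable (lborel \<Otimes>\<^sub>M M)"
      using measurable_compose[OF measurable_pair_swap' progressive_joint[OF prog, of "real n"]] by (simp add: xx_def case_prod_beta')
    hence "(\<lambda>t. \<integral>w. (norm (xx w t))\<^sup>2 \<partial>M) \<in> borel_measurable lborel"
      by (intro borel_measurable_lebesgue_integral) (simp add: case_prod_beta')
    hence "(\<lambda>t. ennreal (exp (- \<rho> * t) * (\<integral>w. (norm (xx w t))\<^sup>2 \<partial>M))) \<in> borel_measurable lborel" by measurable
    moreover have "ennreal (exp (- \<rho> * t) * (\<integral>w. (norm (xx w t))\<^sup>2 \<partial>M)) = ennreal (exp (- \<rho> * t) * m t) * indicator {0..real n} t" for t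
      by (auto simp: xx_def m_def indicator_def)
    ultimately show "(\<lambda>t. ennreal (exp (- \<rho> * t) * m t) * indicator {0..real n} t) \<in> borel_measurable lborel" by (simp only:)
  qed
  also have "\<dots> \<le> ennreal (2 * v 0 + 2 * \<kappa> * P0)" by (rule SUP_least) (use horizon in auto)
  also have "\<dots> < \<infinity>" by simp
  finally show ?thesis .
qed

end

section \<open>The Euler scheme for linear equations\<close>

lemma discrete_gronwall:
  fixes u :: "nat \<Rightarrow> real"
  assumes u: "\<And>j. j \<le> n \<Longrightarrow> u j \<le> a + b * (\<Sum>i<j. u i)" and b: "0 \<le> b" and j: "j \<le> n"
  shows "u j \<le> a * (1 + b) ^ j"
  using j
proof (induction j rule: less_induct)
  case (less j)
  have geo: "b * (\<Sum>i<k. a * (1 + b) ^ i) = a * (1 + b) ^ k - a" for k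
    by (induction k) (simp_all add: algebra_simps)
  have "u j \<le> a + b * (\<Sum>i<j. u i)" using u less.prems by blast
  also have "\<dots> \<le> a + b * (\<Sum>i<j. a * (1 + b) ^ i)"
    using less b by (intro add_left_mono mult_left_mono sum_mono) auto
  also have "\<dots> = a * (1 + b) ^ j" by (simp add: geo)
  finally show ?case .
qed

lemma one_plus_power_le_exp: "0 \<le> b \<Longrightarrow> (1 + b) ^ j \<le> exp (b * real j)" for b :: real
  by (metis add.commute add_nonneg_nonneg exp_ge_add_one_self exp_of_nat_mult mult.commute power_mono zero_le_one)

lemma norm_sum_sq_le:
  fixes x :: "nat \<Rightarrow> 'b::real_normed_vector"
  shows "(norm (\<Sum>i<k. x i))\<^sup>2 \<le> real k * (\<Sum>i<k. (norm (x i))\<^sup>2)"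
proof -
  have "(norm (\<Sum>i<k. x i))\<^sup>2 \<le> (\<Sum>i<k. 1 * norm (x i))\<^sup>2" by (intro power_mono) (auto intro: norm_sum)
  also have "\<dots> \<le> (\<Sum>i<k. 1\<^sup>2) * (\<Sum>i<k. (norm (x i))\<^sup>2)" by (rule Cauchy_Schwarz_ineq_sum)
  finally show ?thesis by simp
qed

locale euler_scheme = brownian_basis M F W for M :: "'a measure" and F W +
  fixes A C :: "real^'n^'n" and \<zeta> :: "real^'n"
begin

text \<open>Dyadic grids are nested, so consecutive levels of the scheme can be compared on the
  finer one. The index is unbounded: no horizon enters the scheme itself.\<close>

definition grid :: "nat \<Rightarrow> nat \<Rightarrow> real" where "grid m j = real j / 2 ^ m"

primrec euler :: "nat \<Rightarrow> nat \<Rightarrow> 'a \<Rightarrow> real^'n" where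
  "euler m 0 = (\<lambda>w. \<zeta>)"
| "euler m (Suc j) = (\<lambda>w. euler m j w + (1 / 2 ^ m) *\<^sub>R (A *v euler m j w)
     + (W (grid m (Suc j)) w - W (grid m j) w) *\<^sub>R (C *v euler m j w))"

lemma grid_simps: "grid m 0 = 0" "0 \<le> grid m j" "grid m j \<le> grid m (Suc j)" "grid m (Suc j) - grid m j = 1 / 2 ^ m"
  by (auto simp: grid_def divide_right_mono simp flip: diff_divide_distrib)

lemma grid_mono: "i \<le> j \<Longrightarrow> grid m i \<le> grid m j"
  by (simp add: grid_def divide_right_mono)

lemma grid_double: "grid (Suc m) (2 * j) = grid m j"
  by (simp add: grid_def)

lemma grid_half_le: "grid m (j div 2) \<le> grid (Suc m) j"
  using grid_mono[of "2 * (j div 2)" j "Suc m"] by (simp add: grid_double)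

lemma sq_integrable_matrix: "sq_integrable M f \<Longrightarrow> sq_integrable M (\<lambda>w. B *v f w)" for B :: "real^'k^'l"
  by (rule sq_integrable_linear[OF matrix_vector_mul_linear])

lemma measurable_matrix: "f \<in> borel_measurable N \<Longrightarrow> (\<lambda>w. B *v f w) \<in> borel_measurable N" for B :: "real^'k^'l"
  by (rule measurable_compose[OF _ borel_measurable_continuous_onI[OF linear_continuous_on[OF matrix_vector_mul_bounded_linear]]])

lemma euler_measurable: "euler m j \<in> borel_measurable (F (grid m j))"
  and euler_sq_integrable: "sq_integrable M (euler m j)"
proof (induction j)
  case 0
  show "euler m 0 \<in> borel_measurable (F (grid m 0))" by simp
  show "sq_integrable M (euler m 0)" by (simp add: sq_integrable_def)
next
  case (Suc j)
  have e: "euler m j \<in> borel_measurable (F (grid m (Suc j)))" by (rule measurable_F_mono[OF grid_simps(3) Suc(1)])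
  show "euler m (Suc j) \<in> borel_measurable (F (grid m (Suc j)))"
    unfolding euler.simps
    by (intro borel_measurable_add borel_measurable_scaleR measurable_matrix e W_increment_measurable grid_simps) simp
  show "sq_integrable M (euler m (Suc j))" unfolding euler.simps
    by (intro sq_integrable_add sq_integrable_scaleR sq_integrable_matrix Suc sq_integrable_increment(1)
        measurable_matrix grid_simps)
qed

text \<open>The scheme of level \<open>m\<close> read on the grid of level \<open>Suc m\<close>,
  with its value held over both halves of a coarse cell.\<close>

definition coarse :: "nat \<Rightarrow> nat \<Rightarrow> 'a \<Rightarrow> real^'n" where
  "coarse m j = euler m (j div 2)"

definition level_diff :: "nat \<Rightarrow> nat \<Rightarrow> 'a \<Rightarrow> real^'n" where
  "level_diff m j w = euler (Suc m) j w - coarse m j w"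

lemma coarse_measurable: "coarse m j \<in> borel_measurable (F (grid (Suc m) j))"
  unfolding coarse_def by (rule measurable_F_mono[OF grid_half_le euler_measurable])

lemma level_diff_measurable: "level_diff m j \<in> borel_measurable (F (grid (Suc m) j))"
  unfolding level_diff_def by (intro borel_measurable_diff euler_measurable coarse_measurable)

lemma level_diff_sq_integrable: "sq_integrable M (level_diff m j)"
  unfolding level_diff_def coarse_def by (intro sq_integrable_diff euler_sq_integrable)

text \<open>The integrals of \<open>A f\<close> in time and of \<open>C f\<close> against the noise
  up to grid point \<open>k\<close>, with \<open>f\<close> constant on cells. An Euler scheme is a
  fixed point of it, up to the initial value.\<close>

definition partial :: "(nat \<Rightarrow> 'a \<Rightarrow> real^'n) \<Rightarrow> nat \<Rightarrow> nat \<Rightarrow> 'a \<Rightarrow> real^'n" where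
  "partial f m k w = (\<Sum>j<k. (1 / 2 ^ m) *\<^sub>R (A *v f j w)) + elementary_integral W k (grid m) (\<lambda>j w. C *v f j w) w"

lemma partial_Suc: "partial f m (Suc k) w = partial f m k w + (1 / 2 ^ m) *\<^sub>R (A *v f k w)
    + (W (grid m (Suc k)) w - W (grid m k) w) *\<^sub>R (C *v f k w)"
  by (simp add: partial_def elementary_integral_def)

lemma euler_partial: "euler m k w = \<zeta> + partial (euler m) m k w"
  by (induction k) (simp_all add: partial_Suc, simp add: partial_def elementary_integral_def)

lemma coarse_partial: "\<zeta> + partial (coarse m) (Suc m) (2 * i) w = euler m i w"
proof (induction i)
  case 0 show ?case by (simp add: partial_def elementary_integral_def)
next
  case (Suc i)
  have c: "coarse m (2 * i) = euler m i" "coarse m (Suc (2 * i)) = euler m i" by (simp_all add: coarse_def)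
  have g: "grid (Suc m) (2 * i) = grid m i" "grid (Suc m) (Suc (Suc (2 * i))) = grid m (Suc i)"
    using grid_double[of m i] grid_double[of m "Suc i"] by simp_all
  have "\<zeta> + partial (coarse m) (Suc m) (2 * Suc i) w =
     (\<zeta> + partial (coarse m) (Suc m) (2 * i) w) + ((1 / 2 ^ Suc m) *\<^sub>R (A *v euler m i w) + (1 / 2 ^ Suc m) *\<^sub>R (A *v euler m i w))
     + ((W (grid (Suc m) (Suc (2 * i))) w - W (grid m i) w) *\<^sub>R (C *v euler m i w)
       + (W (grid m (Suc i)) w - W (grid (Suc m) (Suc (2 * i))) w) *\<^sub>R (C *v euler m i w))"
  proof -
    have "2 * Suc i = Suc (Suc (2 * i))" by simp
    thus ?thesis by (simp only: partial_Suc c g add.assoc add.left_commute add.commute)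
  qed
  also have "(1 / 2 ^ Suc m) *\<^sub>R (A *v euler m i w) + (1 / 2 ^ Suc m) *\<^sub>R (A *v euler m i w) = (1 / 2 ^ m) *\<^sub>R (A *v euler m i w)"
    by (simp flip: scaleR_add_left add: field_simps)
  also have "(W (grid (Suc m) (Suc (2 * i))) w - W (grid m i) w) *\<^sub>R (C *v euler m i w)
       + (W (grid m (Suc i)) w - W (grid (Suc m) (Suc (2 * i))) w) *\<^sub>R (C *v euler m i w)
     = (W (grid m (Suc i)) w - W (grid m i) w) *\<^sub>R (C *v euler m i w)"
    by (simp flip: scaleR_add_left)
  finally show ?case using Suc.IH by simp
qed

text \<open>At even indices the integrated coarse scheme returns to itself. At odd ones it has
  advanced by half a coarse cell while \<open>coarse\<close> still holds the old value, and this
  half-step is the only consistency error.\<close>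

lemma coarse_remainder:
  "\<zeta> + partial (coarse m) (Suc m) j w - coarse m j w = (if even j then 0 else (1 / 2 ^ Suc m) *\<^sub>R (A *v coarse m j w)
    + (W (grid (Suc m) j) w - W (grid m (j div 2)) w) *\<^sub>R (C *v coarse m j w))"
proof (cases "even j")
  case True
  then obtain i where "j = 2 * i" by (rule evenE)
  thus ?thesis using coarse_partial[of m i w] by (simp add: coarse_def)
next
  case False
  then obtain i where j: "j = 2 * i + 1" by (rule oddE)
  have c: "coarse m (2 * i) = euler m i" "coarse m j = euler m i" "j div 2 = i" by (simp_all add: coarse_def j)
  have "partial (coarse m) (Suc m) j w = partial (coarse m) (Suc m) (2 * i) w + (1 / 2 ^ Suc m) *\<^sub>R (A *v euler m i w)
    + (W (grid (Suc m) j) w - W (grid m i) w) *\<^sub>R (C *v euler m i w)"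
    using partial_Suc[of "coarse m" "Suc m" "2 * i" w] by (simp add: j c grid_double del: power_Suc)
  thus ?thesis using False coarse_partial[of m i w] c by (simp add: algebra_simps del: power_Suc)
qed

lemma partial_diff: "partial (level_diff m) (Suc m) j w = partial (euler (Suc m)) (Suc m) j w - partial (coarse m) (Suc m) j w"
  by (induction j) (simp_all add: partial_Suc level_diff_def matrix_vector_mult_diff_distrib scaleR_diff_right algebra_simps,
    simp add: partial_def elementary_integral_def)

text \<open>The recursion for the difference of two levels, with the half-step as forcing;
  Gronwall's inequality is applied to it.\<close>

lemma level_diff_partial:
  "level_diff m j w = partial (level_diff m) (Suc m) j w + (\<zeta> + partial (coarse m) (Suc m) j w - coarse m j w)"
  using euler_partial[of "Suc m" j w] by (simp add: partial_diff level_diff_def)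

section \<open>Moment bounds for the scheme, uniform over levels\<close>

lemma step_data_grid:
  fixes B :: "real^'n^'n"
  assumes "\<And>j. f j \<in> borel_measurable (F (grid m j))" "\<And>j. sq_integrable M (f j)"
  shows "step_data k (grid m) (\<lambda>j w. B *v f j w)"
  unfolding step_data_def using assms by (auto simp: grid_simps sq_integrable_matrix measurable_matrix)

lemma matrix_moment_le:
  fixes B :: "real^'n^'n"
  assumes B: "\<And>x. norm (B *v x) \<le> b * norm x" and f: "sq_integrable M f"
  shows "(\<integral>w. (norm (B *v f w))\<^sup>2 \<partial>M) \<le> b\<^sup>2 * (\<integral>w. (norm (f w))\<^sup>2 \<partial>M)"
proof -
  have "(\<integral>w. (norm (B *v f w))\<^sup>2 \<partial>M) \<le> (\<integral>w. b\<^sup>2 * (norm (f w))\<^sup>2 \<partial>M)"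
  proof (rule integral_mono)
    show "(norm (B *v f w))\<^sup>2 \<le> b\<^sup>2 * (norm (f w))\<^sup>2" for w
      using power_mono[OF B[of "f w"], of 2] by (simp add: power_mult_distrib)
  qed (use sq_integrable_norm[OF sq_integrable_matrix[OF f]] sq_integrable_norm[OF f] in auto)
  thus ?thesis by simp
qed

text \<open>The noise part obeys the isometry. The drift part is a sum over cells of total length at
  most \<open>T\<close>, and Cauchy-Schwarz costs the factor \<open>T\<close>; the factor 2 comes
  from adding the two.\<close>

lemma partial_moment:
  assumes a: "\<And>x. norm (A *v x) \<le> a * norm x" and c: "\<And>x. norm (C *v x) \<le> c * norm x"
    and f: "\<And>j. f j \<in> borel_measurable (F (grid m j))" "\<And>j. sq_integrable M (f j)"
    and T: "grid m k \<le> T"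
  shows "sq_integrable M (partial f m k)"
    "(\<integral>w. (norm (partial f m k w))\<^sup>2 \<partial>M) \<le> 2 * (a\<^sup>2 * T + c\<^sup>2) * (1 / 2 ^ m) * (\<Sum>j<k. \<integral>w. (norm (f j w))\<^sup>2 \<partial>M)"
proof -
  define \<delta> :: real where "\<delta> = 1 / 2 ^ m"
  have d: "0 < \<delta>" by (simp add: \<delta>_def)
  define D where "D w = (\<Sum>j<k. \<delta> *\<^sub>R (A *v f j w))" for w
  define N where "N = elementary_integral W k (grid m) (\<lambda>j w. C *v f j w)"
  have eq: "partial f m k = (\<lambda>w. D w + N w)" by (simp add: fun_eq_iff partial_def D_def N_def \<delta>_def)
  note iso = step_isometry[OF step_data_grid[OF f, of k C]]
  have Dsq: "sq_integrable M D" unfolding D_def by (intro sq_integrable_sum sq_integrable_scaleR sq_integrable_matrix f)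
  have Nsq: "sq_integrable M N" using iso by (simp add: N_def)
  show sq: "sq_integrable M (partial f m k)" unfolding eq by (rule sq_integrable_add[OF Dsq Nsq])
  have EN: "(\<integral>w. (norm (N w))\<^sup>2 \<partial>M) \<le> c\<^sup>2 * \<delta> * (\<Sum>j<k. \<integral>w. (norm (f j w))\<^sup>2 \<partial>M)"
  proof -
    have "(\<integral>w. (norm (N w))\<^sup>2 \<partial>M) = (\<Sum>j<k. \<delta> * (\<integral>w. (norm (C *v f j w))\<^sup>2 \<partial>M))"
      using iso by (simp add: N_def grid_simps \<delta>_def)
    also have "\<dots> \<le> (\<Sum>j<k. \<delta> * (c\<^sup>2 * (\<integral>w. (norm (f j w))\<^sup>2 \<partial>M)))"
      using d by (intro sum_mono mult_left_mono matrix_moment_le[OF c f(2)]) auto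
    finally show ?thesis by (simp add: sum_distrib_left mult_ac)
  qed
  have ED: "(\<integral>w. (norm (D w))\<^sup>2 \<partial>M) \<le> a\<^sup>2 * T * \<delta> * (\<Sum>j<k. \<integral>w. (norm (f j w))\<^sup>2 \<partial>M)"
  proof -
    have "(\<integral>w. (norm (D w))\<^sup>2 \<partial>M) \<le> (\<integral>w. real k * (\<Sum>j<k. \<delta>\<^sup>2 * (norm (A *v f j w))\<^sup>2) \<partial>M)"
    proof (rule integral_mono[OF sq_integrable_norm[OF Dsq]])
      show "integrable M (\<lambda>w. real k * (\<Sum>j<k. \<delta>\<^sup>2 * (norm (A *v f j w))\<^sup>2))"
        by (intro integrable_mult_right Bochner_Integration.integrable_sum sq_integrable_norm[OF sq_integrable_matrix[OF f(2)]])
      show "(norm (D w))\<^sup>2 \<le> real k * (\<Sum>j<k. \<delta>\<^sup>2 * (norm (A *v f j w))\<^sup>2)" for w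
        using norm_sum_sq_le[of "\<lambda>j. \<delta> *\<^sub>R (A *v f j w)" k] by (simp add: D_def power_mult_distrib)
    qed
    also have "\<dots> = real k * (\<Sum>j<k. \<delta>\<^sup>2 * (\<integral>w. (norm (A *v f j w))\<^sup>2 \<partial>M))"
    proof -
      have "integrable M (\<lambda>w. \<delta>\<^sup>2 * (norm (A *v f j w))\<^sup>2)" for j
        by (intro integrable_mult_right sq_integrable_norm[OF sq_integrable_matrix[OF f(2)]])
      thus ?thesis by (simp add: Bochner_Integration.integral_sum)
    qed
    also have "\<dots> \<le> real k * (\<Sum>j<k. \<delta>\<^sup>2 * (a\<^sup>2 * (\<integral>w. (norm (f j w))\<^sup>2 \<partial>M)))"
      by (intro mult_left_mono sum_mono matrix_moment_le[OF a f(2)]) auto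
    also have "\<dots> = (real k * \<delta>) * (a\<^sup>2 * \<delta> * (\<Sum>j<k. \<integral>w. (norm (f j w))\<^sup>2 \<partial>M))"
      by (simp add: sum_distrib_left power2_eq_square mult_ac)
    also have "\<dots> \<le> T * (a\<^sup>2 * \<delta> * (\<Sum>j<k. \<integral>w. (norm (f j w))\<^sup>2 \<partial>M))"
      using T d by (intro mult_right_mono mult_nonneg_nonneg sum_nonneg) (auto simp: grid_def \<delta>_def)
    finally show ?thesis by (simp add: mult_ac)
  qed
  have "(\<integral>w. (norm (D w + N w))\<^sup>2 \<partial>M) \<le> (\<integral>w. 2 * (norm (D w))\<^sup>2 + 2 * (norm (N w))\<^sup>2 \<partial>M)"
    using sq_integrable_norm[OF sq] sq_integrable_norm[OF Dsq] sq_integrable_norm[OF Nsq]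
    by (intro integral_mono norm_add_sq_le) (auto simp: eq)
  also have "\<dots> = 2 * (\<integral>w. (norm (D w))\<^sup>2 \<partial>M) + 2 * (\<integral>w. (norm (N w))\<^sup>2 \<partial>M)"
    using sq_integrable_norm[OF Dsq] sq_integrable_norm[OF Nsq] by simp
  also have "\<dots> \<le> 2 * (a\<^sup>2 * T * \<delta> * (\<Sum>j<k. \<integral>w. (norm (f j w))\<^sup>2 \<partial>M)) + 2 * (c\<^sup>2 * \<delta> * (\<Sum>j<k. \<integral>w. (norm (f j w))\<^sup>2 \<partial>M))"
    using ED EN by simp
  finally show "(\<integral>w. (norm (partial f m k w))\<^sup>2 \<partial>M) \<le> 2 * (a\<^sup>2 * T + c\<^sup>2) * (1 / 2 ^ m) * (\<Sum>j<k. \<integral>w. (norm (f j w))\<^sup>2 \<partial>M)"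
    unfolding eq by (simp add: \<delta>_def algebra_simps)
qed

lemma moment_add_le:
  assumes "sq_integrable M f" "sq_integrable M g"
  shows "(\<integral>w. (norm (f w + g w))\<^sup>2 \<partial>M) \<le> 2 * (\<integral>w. (norm (f w))\<^sup>2 \<partial>M) + 2 * (\<integral>w. (norm (g w))\<^sup>2 \<partial>M)"
proof -
  have "(\<integral>w. (norm (f w + g w))\<^sup>2 \<partial>M) \<le> (\<integral>w. 2 * (norm (f w))\<^sup>2 + 2 * (norm (g w))\<^sup>2 \<partial>M)"
    using assms sq_integrable_norm[OF sq_integrable_add[OF assms]]
    by (intro integral_mono norm_add_sq_le) (auto simp: sq_integrable_norm)
  also have "\<dots> = 2 * (\<integral>w. (norm (f w))\<^sup>2 \<partial>M) + 2 * (\<integral>w. (norm (g w))\<^sup>2 \<partial>M)"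
    using assms by (simp add: sq_integrable_norm)
  finally show ?thesis .
qed

text \<open>Within the horizon the number of steps times the step size is at most \<open>T\<close>,
  so the product of growth factors is bounded by \<open>exp (b * T)\<close> at every level.\<close>

lemma gronwall_grid:
  assumes u: "\<And>j. grid m j \<le> T \<Longrightarrow> u j \<le> a + b * (1 / 2 ^ m) * (\<Sum>i<j. u i)"
    and ab: "0 \<le> a" "0 \<le> b" and j: "grid m j \<le> T"
  shows "u j \<le> a * exp (b * T)"
proof -
  have "u j \<le> a * (1 + b * (1 / 2 ^ m)) ^ j"
  proof (rule discrete_gronwall[where n = j])
    show "u i \<le> a + b * (1 / 2 ^ m) * (\<Sum>i<i. u i)" if "i \<le> j" for i
      using u[of i] grid_mono[OF that, of m] j by linarith
  qed (use ab in auto)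
  also have "\<dots> \<le> a * exp (b * (1 / 2 ^ m) * real j)" using ab by (intro mult_left_mono one_plus_power_le_exp) auto
  also have "\<dots> \<le> a * exp (b * T)"
    using j ab mult_left_mono[of "grid m j" T b] by (intro mult_left_mono) (auto simp: grid_def)
  finally show ?thesis .
qed

lemma euler_moment: "\<exists>K\<ge>0. \<forall>m j. grid m j \<le> T \<longrightarrow> (\<integral>w. (norm (euler m j w))\<^sup>2 \<partial>M) \<le> K"
proof -
  obtain a where a: "a > 0" "\<And>x. norm (A *v x) \<le> a * norm x"
    using linear_bounded_pos[OF matrix_vector_mul_linear[of A]] by metis
  obtain c where c: "c > 0" "\<And>x. norm (C *v x) \<le> c * norm x"
    using linear_bounded_pos[OF matrix_vector_mul_linear[of C]] by metis
  define b where "b = 2 * (2 * (a\<^sup>2 * \<bar>T\<bar> + c\<^sup>2))"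
  have b: "0 \<le> b" by (simp add: b_def)
  define K where "K = 2 * (norm \<zeta>)\<^sup>2 * exp (b * \<bar>T\<bar>)"
  have "(\<integral>w. (norm (euler m j w))\<^sup>2 \<partial>M) \<le> K" if "grid m j \<le> T" for m j
    unfolding K_def
  proof (rule gronwall_grid[where m = m and j = j and u = "\<lambda>j. \<integral>w. (norm (euler m j w))\<^sup>2 \<partial>M"])
    fix j assume j: "grid m j \<le> \<bar>T\<bar>"
    note pm = partial_moment[OF a(2) c(2) euler_measurable euler_sq_integrable j]
    have "(\<integral>w. (norm (euler m j w))\<^sup>2 \<partial>M) = (\<integral>w. (norm (\<zeta> + partial (euler m) m j w))\<^sup>2 \<partial>M)"
      by (simp only: euler_partial[symmetric])
    also have "\<dots> \<le> 2 * (\<integral>w. (norm \<zeta>)\<^sup>2 \<partial>M) + 2 * (\<integral>w. (norm (partial (euler m) m j w))\<^sup>2 \<partial>M)"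
      by (rule moment_add_le[OF _ pm(1)]) (simp add: sq_integrable_def)
    also have "\<dots> \<le> 2 * (norm \<zeta>)\<^sup>2 + b * (1 / 2 ^ m) * (\<Sum>i<j. \<integral>w. (norm (euler m i w))\<^sup>2 \<partial>M)"
    proof -
      have "2 * (2 * (a\<^sup>2 * \<bar>T\<bar> + c\<^sup>2) * (1 / 2 ^ m) * (\<Sum>i<j. \<integral>w. (norm (euler m i w))\<^sup>2 \<partial>M))
        = b * (1 / 2 ^ m) * (\<Sum>i<j. \<integral>w. (norm (euler m i w))\<^sup>2 \<partial>M)" by (simp add: b_def)
      moreover have "(\<integral>w. (norm \<zeta>)\<^sup>2 \<partial>M) = (norm \<zeta>)\<^sup>2" by (simp add: prob_space)
      ultimately show ?thesis using pm(2) by linarith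
    qed
    finally show "(\<integral>w. (norm (euler m j w))\<^sup>2 \<partial>M) \<le> 2 * (norm \<zeta>)\<^sup>2 + b * (1 / 2 ^ m) * (\<Sum>i<j. \<integral>w. (norm (euler m i w))\<^sup>2 \<partial>M)" .
  qed (use that b in auto)
  moreover have "0 \<le> K" by (simp add: K_def)
  ultimately show ?thesis by blast
qed

text \<open>The half-step has second moment of order one fine cell, since the noise over it has that
  variance. Gronwall's inequality preserves the order, so consecutive levels are close in mean
  square at a geometric rate.\<close>

lemma level_diff_moment: "\<exists>K\<ge>0. \<forall>m j. grid (Suc m) j \<le> T \<longrightarrow> (\<integral>w. (norm (level_diff m j w))\<^sup>2 \<partial>M) \<le> K * (1/2) ^ m"
proof -
  obtain a where a: "a > 0" "\<And>x. norm (A *v x) \<le> a * norm x"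
    using linear_bounded_pos[OF matrix_vector_mul_linear[of A]] by metis
  obtain c where c: "c > 0" "\<And>x. norm (C *v x) \<le> c * norm x"
    using linear_bounded_pos[OF matrix_vector_mul_linear[of C]] by metis
  obtain E where E: "E \<ge> 0" "\<And>m j. grid m j \<le> T \<Longrightarrow> (\<integral>w. (norm (euler m j w))\<^sup>2 \<partial>M) \<le> E"
    using euler_moment[of T] by blast
  define b where "b = 2 * (2 * (a\<^sup>2 * \<bar>T\<bar> + c\<^sup>2))"
  have b: "0 \<le> b" by (simp add: b_def)
  define k where "k = 2 * (2 * (a\<^sup>2 * E) + 2 * (c\<^sup>2 * E))"
  have k: "0 \<le> k" using E by (simp add: k_def)
  have "(\<integral>w. (norm (level_diff m j w))\<^sup>2 \<partial>M) \<le> (k * exp (b * \<bar>T\<bar>)) * (1/2) ^ m" if jT: "grid (Suc m) j \<le> T" for m j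
  proof -
    have "(\<integral>w. (norm (level_diff m j w))\<^sup>2 \<partial>M) \<le> (k * (1/2) ^ m) * exp (b * T)"
    proof (rule gronwall_grid[where m = "Suc m" and j = j and u = "\<lambda>j. \<integral>w. (norm (level_diff m j w))\<^sup>2 \<partial>M"])
      fix j assume j: "grid (Suc m) j \<le> T"
      hence T: "T = \<bar>T\<bar>" using grid_simps(2)[of "Suc m" j] by linarith
      note pm = partial_moment[OF a(2) c(2) level_diff_measurable level_diff_sq_integrable j]
      define R where "R w = \<zeta> + partial (coarse m) (Suc m) j w - coarse m j w" for w
      have cm: "(\<integral>w. (norm (coarse m j w))\<^sup>2 \<partial>M) \<le> E"
        unfolding coarse_def using E(2)[of m "j div 2"] grid_half_le[of m j] j by simp
      have csq: "sq_integrable M (coarse m j)" unfolding coarse_def by (rule euler_sq_integrable)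
      have R: "sq_integrable M R \<and> (\<integral>w. (norm (R w))\<^sup>2 \<partial>M) \<le> (k / 2) * (1/2) ^ m"
      proof (cases "even j")
        case True
        hence "R = (\<lambda>_. 0)" by (simp add: R_def coarse_remainder fun_eq_iff)
        thus ?thesis using k by (simp add: sq_integrable_zero)
      next
        case False
        \<comment> \<open>The width of a fine cell. As it is at most 1, the drift part, of order
          \<open>\<delta>\<close> squared, is absorbed into the order \<open>\<delta>\<close> of the
          noise part.\<close>
        define \<delta> :: real where "\<delta> = 1 / 2 ^ Suc m"
        have d: "0 < \<delta>" "\<delta> \<le> 1" "\<delta> \<le> (1/2) ^ m" by (simp_all add: \<delta>_def power_one_over field_simps one_le_power del: power_Suc)
        define D where "D w = \<delta> *\<^sub>R (A *v coarse m j w)" for w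
        define N where "N w = (W (grid (Suc m) j) w - W (grid m (j div 2)) w) *\<^sub>R (C *v coarse m j w)" for w
        have Rdn: "R = (\<lambda>w. D w + N w)" using False by (simp add: R_def coarse_remainder fun_eq_iff D_def N_def \<delta>_def del: power_Suc)
        have Dsq: "sq_integrable M D" unfolding D_def by (intro sq_integrable_scaleR sq_integrable_matrix csq)
        have gl: "grid (Suc m) j - grid m (j div 2) = \<delta>"
        proof -
          obtain i where "j = Suc (2 * i)" using False by (metis oddE Suc_eq_plus1)
          thus ?thesis using grid_simps(4)[of "Suc m" "2 * i"] by (simp add: grid_double \<delta>_def)
        qed
        note inc = sq_integrable_increment[OF grid_simps(2) grid_half_le, of "\<lambda>w. C *v coarse m j w" m j]
        have cmeas: "(\<lambda>w. C *v coarse m j w) \<in> borel_measurable (F (grid m (j div 2)))"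
          unfolding coarse_def by (intro measurable_matrix euler_measurable)
        have Nsq: "sq_integrable M N" unfolding N_def using inc(1)[OF cmeas sq_integrable_matrix[OF csq]] .
        have "(\<integral>w. (norm (N w))\<^sup>2 \<partial>M) = \<delta> * (\<integral>w. (norm (C *v coarse m j w))\<^sup>2 \<partial>M)"
          unfolding N_def using inc(2)[OF cmeas sq_integrable_matrix[OF csq]] gl by simp
        also have "\<dots> \<le> \<delta> * (c\<^sup>2 * E)"
          using d cm by (intro mult_left_mono order_trans[OF matrix_moment_le[OF c(2) csq]]) auto
        finally have EN: "(\<integral>w. (norm (N w))\<^sup>2 \<partial>M) \<le> \<delta> * (c\<^sup>2 * E)" .
        have "(\<integral>w. (norm (D w))\<^sup>2 \<partial>M) = \<delta>\<^sup>2 * (\<integral>w. (norm (A *v coarse m j w))\<^sup>2 \<partial>M)"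
          by (simp add: D_def power_mult_distrib)
        also have "\<dots> \<le> \<delta>\<^sup>2 * (a\<^sup>2 * E)"
          using cm by (intro mult_left_mono order_trans[OF matrix_moment_le[OF a(2) csq]]) auto
        also have "\<dots> \<le> \<delta> * (a\<^sup>2 * E)" using d E by (intro mult_right_mono) (auto simp: power2_eq_square)
        finally have ED: "(\<integral>w. (norm (D w))\<^sup>2 \<partial>M) \<le> \<delta> * (a\<^sup>2 * E)" .
        have "(\<integral>w. (norm (R w))\<^sup>2 \<partial>M) \<le> 2 * (\<delta> * (a\<^sup>2 * E)) + 2 * (\<delta> * (c\<^sup>2 * E))"
          unfolding Rdn using moment_add_le[OF Dsq Nsq] ED EN by linarith
        also have "\<dots> = k / 2 * \<delta>" by (simp add: k_def algebra_simps)
        also have "\<dots> \<le> k / 2 * (1/2) ^ m" using d k by (intro mult_left_mono) auto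
        finally show ?thesis unfolding Rdn using sq_integrable_add[OF Dsq Nsq] by simp
      qed
      have "(\<integral>w. (norm (level_diff m j w))\<^sup>2 \<partial>M) = (\<integral>w. (norm (partial (level_diff m) (Suc m) j w + R w))\<^sup>2 \<partial>M)"
        unfolding R_def by (simp only: level_diff_partial[symmetric])
      also have "\<dots> \<le> 2 * (\<integral>w. (norm (partial (level_diff m) (Suc m) j w))\<^sup>2 \<partial>M) + 2 * (\<integral>w. (norm (R w))\<^sup>2 \<partial>M)"
        using moment_add_le[OF pm(1)] R by blast
      also have "\<dots> \<le> b * (1 / 2 ^ Suc m) * (\<Sum>i<j. \<integral>w. (norm (level_diff m i w))\<^sup>2 \<partial>M) + k * (1/2) ^ m"
      proof -
        have "2 * (2 * (a\<^sup>2 * T + c\<^sup>2) * (1 / 2 ^ Suc m) * (\<Sum>i<j. \<integral>w. (norm (level_diff m i w))\<^sup>2 \<partial>M))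
          = b * (1 / 2 ^ Suc m) * (\<Sum>i<j. \<integral>w. (norm (level_diff m i w))\<^sup>2 \<partial>M)"
          by (simp only: b_def T[symmetric] mult.assoc)
        thus ?thesis using pm(2) R by linarith
      qed
      finally show "(\<integral>w. (norm (level_diff m j w))\<^sup>2 \<partial>M) \<le> k * (1/2) ^ m + b * (1 / 2 ^ Suc m) * (\<Sum>i<j. \<integral>w. (norm (level_diff m i w))\<^sup>2 \<partial>M)"
        by simp
    qed (use k b jT in auto)
    also have "\<dots> \<le> (k * (1/2) ^ m) * exp (b * \<bar>T\<bar>)" using k b by (intro mult_left_mono) (auto intro!: mult_left_mono)
    finally show ?thesis by (simp add: mult_ac)
  qed
  moreover have "0 \<le> k * exp (b * \<bar>T\<bar>)" using k by simp
  ultimately show ?thesis by blast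
qed

text \<open>The integral up to \<open>t\<close> of a step function with value \<open>f j\<close> on
  cell \<open>j\<close> against the integrator \<open>w'\<close>. Taking \<open>w'\<close> to be
  time or a Brownian path gives drift and noise; clipping the endpoints at \<open>t\<close> makes it
  continuous in \<open>t\<close>, and \<open>T\<close> is a horizon.\<close>

definition clipped :: "nat \<Rightarrow> nat \<Rightarrow> (nat \<Rightarrow> real^'n) \<Rightarrow> (real \<Rightarrow> real) \<Rightarrow> real \<Rightarrow> real^'n" where
  "clipped m T f w' t = (\<Sum>j<T * 2 ^ m. (w' (min t (grid m (Suc j))) - w' (min t (grid m j))) *\<^sub>R f j)"

lemma clipped_double: "clipped m T f w' t = clipped (Suc m) T (\<lambda>j. f (j div 2)) w' t"
proof -
  have "(\<Sum>j<n. (w' (min t (grid m (Suc j))) - w' (min t (grid m j))) *\<^sub>R f j)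
      = (\<Sum>j<2 * n. (w' (min t (grid (Suc m) (Suc j))) - w' (min t (grid (Suc m) j))) *\<^sub>R f (j div 2))" for n
  proof (induction n)
    case (Suc n)
    have g: "grid (Suc m) (2 * n) = grid m n" "grid (Suc m) (Suc (Suc (2 * n))) = grid m (Suc n)"
      using grid_double[of m n] grid_double[of m "Suc n"] by simp_all
    have n2: "2 * Suc n = Suc (Suc (2 * n))" by simp
    show ?case unfolding n2 sum.lessThan_Suc Suc.IH g
      by (simp add: algebra_simps)
  qed simp
  from this[of "T * 2 ^ m"] show ?thesis by (simp add: clipped_def mult_ac)
qed

lemma clipped_refine: "clipped m T f w' t = clipped (m + k) T (\<lambda>j. f (j div 2 ^ k)) w' t"
proof (induction k)
  case (Suc k)
  have "(\<lambda>j. f (j div 2 div 2 ^ k)) = (\<lambda>j. f (j div 2 ^ Suc k))" by (simp add: div_mult2_eq)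
  thus ?case using Suc.IH clipped_double[of "m + k" T "\<lambda>j. f (j div 2 ^ k)" w' t] by simp
qed simp

lemma clipped_grid:
  assumes "i \<le> T * 2 ^ m"
  shows "clipped m T f w' (grid m i) = (\<Sum>j<i. (w' (grid m (Suc j)) - w' (grid m j)) *\<^sub>R f j)"
proof -
  have "clipped m T f w' (grid m i) = (\<Sum>j<T * 2 ^ m. if j < i then (w' (grid m (Suc j)) - w' (grid m j)) *\<^sub>R f j else 0)"
    unfolding clipped_def
  proof (intro sum.cong refl)
    fix j
    have "j < i \<Longrightarrow> min (grid m i) (grid m (Suc j)) = grid m (Suc j) \<and> min (grid m i) (grid m j) = grid m j"
      "\<not> j < i \<Longrightarrow> min (grid m i) (grid m (Suc j)) = grid m i \<and> min (grid m i) (grid m j) = grid m i"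
      using grid_mono[of "Suc j" i m] grid_mono[of j i m] grid_mono[of i j m] grid_mono[of i "Suc j" m]
      by (auto simp: min_def)
    thus "(w' (min (grid m i) (grid m (Suc j))) - w' (min (grid m i) (grid m j))) *\<^sub>R f j
       = (if j < i then (w' (grid m (Suc j)) - w' (grid m j)) *\<^sub>R f j else 0)" by simp
  qed
  also have "\<dots> = (\<Sum>j\<in>{..<T * 2 ^ m} \<inter> {j. j < i}. (w' (grid m (Suc j)) - w' (grid m j)) *\<^sub>R f j)"
    by (simp add: sum.inter_restrict)
  also have "{..<T * 2 ^ m} \<inter> {j. j < i} = {..<i}" using assms by auto
  finally show ?thesis .
qed

lemma clipped_diff: "clipped m T (\<lambda>j. f j - g j) w' t = clipped m T f w' t - clipped m T g w' t"
  by (simp add: clipped_def scaleR_diff_right sum_subtractf)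

lemma clipped_continuous:
  assumes "continuous_on {0..} w'"
  shows "continuous_on {0..} (clipped m T f w')"
proof -
  have "continuous_on {0..} (\<lambda>t. w' (min t (grid m j)))" for j
    by (rule continuous_on_compose2[OF assms]) (auto intro!: continuous_intros simp: grid_simps)
  thus ?thesis unfolding clipped_def[abs_def] by (intro continuous_intros) auto
qed

lemma clipped_drift_bound: "norm (clipped m T f (\<lambda>s. s) t) \<le> (1 / 2 ^ m) * (\<Sum>j<T * 2 ^ m. norm (f j))"
proof -
  have "norm (clipped m T f (\<lambda>s. s) t) \<le> (\<Sum>j<T * 2 ^ m. norm ((min t (grid m (Suc j)) - min t (grid m j)) *\<^sub>R f j))"
    unfolding clipped_def by (rule norm_sum)
  also have "\<dots> \<le> (\<Sum>j<T * 2 ^ m. (1 / 2 ^ m) * norm (f j))"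
  proof (rule sum_mono)
    fix j
    have "\<bar>min t (grid m (Suc j)) - min t (grid m j)\<bar> \<le> 1 / 2 ^ m"
      using grid_simps(3,4)[of m j] by (auto simp: min_def abs_le_iff)
    thus "norm ((min t (grid m (Suc j)) - min t (grid m j)) *\<^sub>R f j) \<le> (1 / 2 ^ m) * norm (f j)"
      by (simp only: norm_scaleR real_norm_def) (intro mult_right_mono, auto)
  qed
  finally show ?thesis by (simp add: sum_distrib_left)
qed

definition interp :: "nat \<Rightarrow> nat \<Rightarrow> real \<Rightarrow> 'a \<Rightarrow> real^'n" where
  "interp m T t w = \<zeta> + clipped m T (\<lambda>j. A *v euler m j w) (\<lambda>s. s) t + clipped m T (\<lambda>j. C *v euler m j w) (\<lambda>s. W s w) t"

lemma interp_grid: "i \<le> T * 2 ^ m \<Longrightarrow> interp m T (grid m i) w = euler m i w"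
  using euler_partial[of m i w]
  by (simp only: interp_def clipped_grid partial_def elementary_integral_def grid_simps(4) add.assoc)

lemma interp_diff: "interp (Suc m) T t w - interp m T t w = clipped (Suc m) T (\<lambda>j. A *v level_diff m j w) (\<lambda>s. s) t
   + clipped (Suc m) T (\<lambda>j. C *v level_diff m j w) (\<lambda>s. W s w) t"
  unfolding interp_def clipped_double[of m T] level_diff_def coarse_def matrix_vector_mult_diff_distrib clipped_diff by simp

lemma interp_continuous: "continuous_on {0..} (\<lambda>t. W t w) \<Longrightarrow> continuous_on {0..} (\<lambda>t. interp m T t w)"
  unfolding interp_def by (intro continuous_intros clipped_continuous)

lemma grid_div_le: "grid m (j div 2 ^ k) \<le> grid (m + k) j"
proof -
  have "j div 2 ^ k * 2 ^ k \<le> j" by simp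
  hence "real (j div 2 ^ k * 2 ^ k) \<le> real j" by (simp only: of_nat_le_iff)
  hence "real (j div 2 ^ k) * 2 ^ k \<le> real j" by (simp only: of_nat_mult of_nat_numeral of_nat_power)
  thus ?thesis by (simp add: grid_def field_simps power_add)
qed

lemma grid_le_nat: "j \<le> T * 2 ^ m \<Longrightarrow> grid m j \<le> real T"
  using grid_mono[of j "T * 2 ^ m" m] by (simp add: grid_def)

text \<open>The supremum over continuous time is approached through dyadic points. On each
  refinement the integrand is the same step function, so the maximal inequality gives one bound for
  all \<open>k\<close>; the events increase with \<open>k\<close>, and continuity from below takes
  the limit.\<close>

lemma noise_maximal:
  assumes c: "\<And>x. norm (C *v x) \<le> c * norm x" and l: "l > 0"
    and K: "\<And>j. grid (Suc m) j \<le> real T \<Longrightarrow> (\<integral>w. (norm (level_diff m j w))\<^sup>2 \<partial>M) \<le> K"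
  defines "N \<equiv> \<lambda>t w. clipped (Suc m) T (\<lambda>j. C *v level_diff m j w) (\<lambda>s. W s w) t"
  shows "{w \<in> space M. \<exists>k. \<exists>i\<le>T * 2 ^ (Suc m + k). l < norm (N (grid (Suc m + k) i) w)} \<in> sets M \<and>
    measure M {w \<in> space M. \<exists>k. \<exists>i\<le>T * 2 ^ (Suc m + k). l < norm (N (grid (Suc m + k) i) w)} \<le> real T * c\<^sup>2 * K / l\<^sup>2"
proof -
  define E where "E k = {w \<in> space M. \<exists>i\<le>T * 2 ^ (Suc m + k). l < norm (N (grid (Suc m + k) i) w)}" for k
  define h where "h k j w = level_diff m (j div 2 ^ k) w" for k j w
  have N: "N (grid (Suc m + k) i) w = elementary_integral W i (grid (Suc m + k)) (\<lambda>j w. C *v h k j w) w"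
    if "i \<le> T * 2 ^ (Suc m + k)" for k i w
    unfolding N_def using clipped_refine[of "Suc m" T "\<lambda>j. C *v level_diff m j w" "\<lambda>s. W s w" "grid (Suc m + k) i" k]
      clipped_grid[OF that] by (simp add: elementary_integral_def h_def)
  have hm: "h k j \<in> borel_measurable (F (grid (Suc m + k) j))" "sq_integrable M (h k j)" for k j
    unfolding h_def by (rule measurable_F_mono[OF grid_div_le level_diff_measurable], rule level_diff_sq_integrable)
  have sd: "step_data i (grid (Suc m + k)) (\<lambda>j w. C *v h k j w)" for i k by (rule step_data_grid[OF hm])
  have Eeq: "E k = {w \<in> space M. \<exists>i\<le>T * 2 ^ (Suc m + k). l < norm (elementary_integral W i (grid (Suc m + k)) (\<lambda>j w. C *v h k j w) w)}" for k
    unfolding E_def using N[of _ k] by auto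
  have Em: "E k \<in> sets M" for k
  proof -
    have [measurable]: "elementary_integral W i (grid (Suc m + k)) (\<lambda>j w. C *v h k j w) \<in> borel_measurable M" for i
      using step_isometry[OF sd[of i k]] by (simp add: sq_integrable_def)
    show ?thesis unfolding Eeq by measurable
  qed
  have Eb: "measure M (E k) \<le> real T * c\<^sup>2 * K / l\<^sup>2" for k
  proof -
    let ?n = "T * 2 ^ (Suc m + k)"
    have "measure M (E k) \<le> (\<Sum>j<?n. (grid (Suc m + k) (Suc j) - grid (Suc m + k) j) * (\<integral>w. (norm (C *v h k j w))\<^sup>2 \<partial>M)) / l\<^sup>2"
      unfolding Eeq by (rule step_maximal_inequality[OF sd l])
    also have "\<dots> \<le> (\<Sum>j<?n. (1 / 2 ^ (Suc m + k)) * (c\<^sup>2 * K)) / l\<^sup>2"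
    proof (intro divide_right_mono sum_mono)
      fix j assume "j \<in> {..<?n}"
      hence "grid (Suc m + k) j \<le> real T" by (intro grid_le_nat) simp
      hence "(\<integral>w. (norm (h k j w))\<^sup>2 \<partial>M) \<le> K" unfolding h_def by (rule K[OF order_trans[OF grid_div_le]])
      hence "(\<integral>w. (norm (C *v h k j w))\<^sup>2 \<partial>M) \<le> c\<^sup>2 * K"
        by (intro order_trans[OF matrix_moment_le[OF c hm(2)]] mult_left_mono) auto
      thus "(grid (Suc m + k) (Suc j) - grid (Suc m + k) j) * (\<integral>w. (norm (C *v h k j w))\<^sup>2 \<partial>M) \<le> (1 / 2 ^ (Suc m + k)) * (c\<^sup>2 * K)"
        unfolding grid_simps by (intro mult_left_mono) auto
    qed simp
    also have "(\<Sum>j<?n. (1 / 2 ^ (Suc m + k)) * (c\<^sup>2 * K)) = real T * c\<^sup>2 * K" by (simp add: field_simps)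
    finally show ?thesis .
  qed
  have inc: "incseq E"
  proof (rule incseq_SucI, rule subsetI)
    fix k w assume "w \<in> E k"
    then obtain i where i: "w \<in> space M" "i \<le> T * 2 ^ (Suc m + k)" "l < norm (N (grid (Suc m + k) i) w)" by (auto simp: E_def)
    moreover have "grid (Suc m + Suc k) (2 * i) = grid (Suc m + k) i" using grid_double[of "Suc m + k" i] by simp
    moreover have "2 * i \<le> T * 2 ^ (Suc m + Suc k)" using i(2) by simp
    ultimately have "2 * i \<le> T * 2 ^ (Suc m + Suc k) \<and> l < norm (N (grid (Suc m + Suc k) (2 * i)) w)" by simp
    thus "w \<in> E (Suc k)" unfolding E_def using i(1) by blast
  qed
  have U: "{w \<in> space M. \<exists>k. \<exists>i\<le>T * 2 ^ (Suc m + k). l < norm (N (grid (Suc m + k) i) w)} = (\<Union>k. E k)"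
    unfolding E_def by blast
  have "(\<lambda>k. measure M (E k)) \<longlonglongrightarrow> measure M (\<Union>k. E k)"
    by (rule finite_Lim_measure_incseq) (use Em inc in auto)
  hence "measure M (\<Union>k. E k) \<le> real T * c\<^sup>2 * K / l\<^sup>2" by (rule LIMSEQ_le_const2) (use Eb in blast)
  thus ?thesis unfolding U using Em by auto
qed

text \<open>The sum does not depend on time and dominates the interpolated drift at all times at
  once, so Chebyshev's inequality replaces a maximal inequality.\<close>

lemma drift_maximal:
  assumes a: "0 \<le> a" and l: "l > 0" and K0: "0 \<le> K"
    and K: "\<And>j. grid (Suc m) j \<le> real T \<Longrightarrow> (\<integral>w. (norm (level_diff m j w))\<^sup>2 \<partial>M) \<le> K"
  shows "{w \<in> space M. l < (1 / 2 ^ Suc m) * (\<Sum>j<T * 2 ^ Suc m. a * norm (level_diff m j w))} \<in> sets M \<and>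
    measure M {w \<in> space M. l < (1 / 2 ^ Suc m) * (\<Sum>j<T * 2 ^ Suc m. a * norm (level_diff m j w))} \<le> (real T)\<^sup>2 * a\<^sup>2 * K / l\<^sup>2"
proof -
  define n where "n = T * 2 ^ Suc m"
  define \<delta> :: real where "\<delta> = 1 / 2 ^ Suc m"
  have nd: "real n * \<delta> = real T" by (simp add: n_def \<delta>_def)
  have d: "0 < \<delta>" by (simp add: \<delta>_def)
  define R where "R w = \<delta> * (\<Sum>j<n. a * norm (level_diff m j w))" for w
  have [measurable]: "level_diff m j \<in> borel_measurable M" for j using level_diff_sq_integrable by (simp add: sq_integrable_def)
  have [measurable]: "R \<in> borel_measurable M" unfolding R_def by measurable
  have R0: "0 \<le> R w" for w unfolding R_def using a d by (intro mult_nonneg_nonneg sum_nonneg) auto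
  have Rle: "(R w)\<^sup>2 \<le> \<delta>\<^sup>2 * (real n * (\<Sum>j<n. a\<^sup>2 * (norm (level_diff m j w))\<^sup>2))" for w
    unfolding R_def power_mult_distrib using norm_sum_sq_le[of "\<lambda>j. a * norm (level_diff m j w)" n]
    by (intro mult_left_mono) (auto simp: power_mult_distrib)
  have int: "integrable M (\<lambda>w. \<delta>\<^sup>2 * (real n * (\<Sum>j<n. a\<^sup>2 * (norm (level_diff m j w))\<^sup>2)))"
    by (intro integrable_mult_right Bochner_Integration.integrable_sum sq_integrable_norm level_diff_sq_integrable)
  have Rint: "integrable M (\<lambda>w. (R w)\<^sup>2)"
    by (rule Bochner_Integration.integrable_bound[OF int]) (use Rle in \<open>auto intro!: AE_I2 order_trans[OF _ abs_ge_self]\<close>)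
  have "(\<integral>w. (R w)\<^sup>2 \<partial>M) \<le> (\<integral>w. \<delta>\<^sup>2 * (real n * (\<Sum>j<n. a\<^sup>2 * (norm (level_diff m j w))\<^sup>2)) \<partial>M)"
    by (rule integral_mono[OF Rint int Rle])
  also have "\<dots> = \<delta>\<^sup>2 * (real n * (\<Sum>j<n. a\<^sup>2 * (\<integral>w. (norm (level_diff m j w))\<^sup>2 \<partial>M)))"
    using integrable_mult_right[OF sq_integrable_norm[OF level_diff_sq_integrable]] by (simp add: Bochner_Integration.integral_sum)
  also have "\<dots> \<le> \<delta>\<^sup>2 * (real n * (\<Sum>j<n. a\<^sup>2 * K))"
  proof (intro mult_left_mono sum_mono K)
    fix j assume "j \<in> {..<n}"
    thus "grid (Suc m) j \<le> real T" unfolding n_def by (intro grid_le_nat) simp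
  qed auto
  also have "\<dots> = (real n * \<delta>)\<^sup>2 * a\<^sup>2 * K" by (simp add: power2_eq_square)
  finally have ER: "(\<integral>w. (R w)\<^sup>2 \<partial>M) \<le> (real T)\<^sup>2 * a\<^sup>2 * K" unfolding nd .
  have sub: "{w \<in> space M. l < R w} \<subseteq> {w \<in> space M. l\<^sup>2 \<le> (R w)\<^sup>2}" using l by (auto intro: power_mono)
  have "measure M {w \<in> space M. l < R w} \<le> measure M {w \<in> space M. l\<^sup>2 \<le> (R w)\<^sup>2}"
    by (rule finite_measure_mono[OF sub]) measurable
  also have "\<dots> \<le> (\<integral>w. (R w)\<^sup>2 \<partial>M) / l\<^sup>2"
    using l by (intro integral_Markov_inequality_measure[OF Rint, where A = "{}"]) auto
  also have "\<dots> \<le> (real T)\<^sup>2 * a\<^sup>2 * K / l\<^sup>2" using ER by (intro divide_right_mono) auto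
  finally have "measure M {w \<in> space M. l < R w} \<le> (real T)\<^sup>2 * a\<^sup>2 * K / l\<^sup>2" .
  moreover have "{w \<in> space M. l < R w} \<in> sets M" by measurable
  ultimately show ?thesis unfolding R_def n_def \<delta>_def by simp
qed

section \<open>Uniform convergence of almost every path\<close>

definition last_index :: "nat \<Rightarrow> real \<Rightarrow> nat" where "last_index m t = nat \<lfloor>t * 2 ^ m\<rfloor>"

lemma last_index:
  assumes "0 \<le> t"
  shows "grid m (last_index m t) \<le> t" "t - grid m (last_index m t) \<le> 1 / 2 ^ m"
    "t \<le> real T \<Longrightarrow> last_index m t \<le> T * 2 ^ m"
proof -
  have r: "real (last_index m t) = of_int \<lfloor>t * 2 ^ m\<rfloor>" using assms by (simp add: last_index_def)
  have 1: "real (last_index m t) \<le> t * 2 ^ m" "t * 2 ^ m \<le> real (last_index m t) + 1" unfolding r by linarith+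
  show "grid m (last_index m t) \<le> t" using 1 by (simp add: grid_def pos_divide_le_eq)
  show "t - grid m (last_index m t) \<le> 1 / 2 ^ m" using divide_right_mono[of "t * 2 ^ m - real (last_index m t)" 1 "2 ^ m"] 1
    by (simp add: grid_def diff_divide_distrib)
  assume "t \<le> real T"
  hence "t * 2 ^ m \<le> real T * 2 ^ m" by (intro mult_right_mono) auto
  with 1(1) have "real (last_index m t) \<le> real T * 2 ^ m" by (rule order_trans)
  hence "real (last_index m t) \<le> real (T * 2 ^ m)" by simp
  thus "last_index m t \<le> T * 2 ^ m" by (simp only: of_nat_le_iff)
qed

lemma inverse_power_tendsto: "(\<lambda>m. 1 / 2 ^ m :: real) \<longlonglongrightarrow> 0"
  using LIMSEQ_realpow_zero[of "1/2 :: real"] by (simp add: power_one_over)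

lemma near_tendsto:
  assumes "\<And>m. \<bar>s m - t\<bar> \<le> 1 / 2 ^ m"
  shows "s \<longlonglongrightarrow> (t::real)"
  by (rule LIM_zero_cancel, rule Lim_null_comparison[OF always_eventually[OF allI] inverse_power_tendsto]) (use assms in simp)

lemma last_index_tendsto: "0 \<le> t \<Longrightarrow> (\<lambda>m. grid m (last_index m t)) \<longlonglongrightarrow> t"
  using last_index by (intro near_tendsto) (auto simp: abs_le_iff intro: order_trans)

lemma dyadic_bound:
  fixes g :: "real \<Rightarrow> 'b::real_normed_vector"
  assumes g: "continuous_on {0..} g" and B: "\<And>k i. i \<le> T * 2 ^ (m0 + k) \<Longrightarrow> norm (g (grid (m0 + k) i)) \<le> B"
    and t: "t \<in> {0..real T}"
  shows "norm (g t) \<le> B"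
proof -
  have t0: "0 \<le> t" using t by simp
  have "(\<lambda>k. grid (m0 + k) (last_index (m0 + k) t)) \<longlonglongrightarrow> t"
    using LIMSEQ_ignore_initial_segment[OF last_index_tendsto[OF t0], of m0] by (simp add: add.commute)
  hence "(\<lambda>k. g (grid (m0 + k) (last_index (m0 + k) t))) \<longlonglongrightarrow> g t"
    using g t0 grid_simps(2) by (auto simp: continuous_on_sequentially o_def)
  hence "(\<lambda>k. norm (g (grid (m0 + k) (last_index (m0 + k) t)))) \<longlonglongrightarrow> norm (g t)" by (rule tendsto_norm)
  thus ?thesis by (rule LIMSEQ_le_const2) (use B last_index(3)[OF t0] t in auto)
qed

text \<open>The limit is taken for every path, with the value of \<open>lim\<close> wherever it
  fails to exist, and uses only Euler values at grid times up to \<open>t\<close>. This keeps the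
  process adapted to a filtration that need not contain null sets. The definition mentions no
  horizon.\<close>

definition sol :: "real \<Rightarrow> 'a \<Rightarrow> real^'n" where
  "sol t w = lim (\<lambda>m. euler m (last_index m t) w)"

definition good_path :: "nat \<Rightarrow> 'a \<Rightarrow> bool" where
  "good_path T w \<longleftrightarrow> continuous_on {0..} (\<lambda>t. W t w) \<and> uniform_limit {0..real T} (\<lambda>m t. interp m T t w) (\<lambda>t. sol t w) sequentially"

lemma uniform_limit_at:
  fixes f :: "nat \<Rightarrow> real \<Rightarrow> 'b::metric_space"
  assumes u: "uniform_limit S f g sequentially" and g: "continuous_on S g"
    and s: "\<And>m. s m \<in> S" "s \<longlonglongrightarrow> t" "t \<in> S"
  shows "(\<lambda>m. f m (s m)) \<longlonglongrightarrow> g t"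
proof (rule tendstoI)
  fix e :: real assume e: "0 < e"
  have "eventually (\<lambda>m. \<forall>x\<in>S. dist (f m x) (g x) < e / 2) sequentially" by (rule uniform_limitD[OF u]) (use e in simp)
  moreover have "(\<lambda>m. g (s m)) \<longlonglongrightarrow> g t" using g s by (auto simp: continuous_on_sequentially o_def)
  hence "eventually (\<lambda>m. dist (g (s m)) (g t) < e / 2) sequentially" using e by (intro tendstoD) auto
  ultimately show "eventually (\<lambda>m. dist (f m (s m)) (g t) < e) sequentially"
  proof eventually_elim
    case (elim m)
    have "dist (f m (s m)) (g t) \<le> dist (f m (s m)) (g (s m)) + dist (g (s m)) (g t)" by (rule dist_triangle)
    thus ?case using elim s(1)[of m] by fastforce
  qed
qed

lemma uniform_limit_continuous:
  assumes W: "continuous_on {0..} (\<lambda>t. W t w)" and u: "uniform_limit {0..real T} (\<lambda>m t. interp m T t w) x sequentially"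
  shows "continuous_on {0..real T} x"
proof (rule uniform_limit_theorem[OF _ u])
  show "\<forall>\<^sub>F n in sequentially. continuous_on {0..real T} (\<lambda>t. interp n T t w)"
    by (intro always_eventually allI continuous_on_subset[OF interp_continuous[OF W]]) auto
qed simp

lemma sol_eq_uniform_limit:
  assumes W: "continuous_on {0..} (\<lambda>t. W t w)" and u: "uniform_limit {0..real T} (\<lambda>m t. interp m T t w) x sequentially"
    and t: "t \<in> {0..real T}"
  shows "sol t w = x t"
proof -
  have t0: "0 \<le> t" using t by simp
  have "(\<lambda>m. interp m T (grid m (last_index m t)) w) \<longlonglongrightarrow> x t"
    by (rule uniform_limit_at[OF u uniform_limit_continuous[OF W u] _ last_index_tendsto[OF t0] t])
       (use last_index(1)[OF t0] t grid_simps(2) in \<open>auto intro: order_trans\<close>)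
  moreover have "interp m T (grid m (last_index m t)) w = euler m (last_index m t) w" for m
    by (rule interp_grid) (use last_index(3)[OF t0, of T m] t in auto)
  ultimately show ?thesis unfolding sol_def by (intro limI) simp
qed

text \<open>Borel-Cantelli bounds the differences of consecutive interpolations by a summable
  sequence, eventually and uniformly in time; the Weierstrass test then yields uniform
  convergence.\<close>

lemma AE_good_path: "AE w in M. good_path T w"
proof -
  obtain a where a: "a > 0" "\<And>x. norm (A *v x) \<le> a * norm x"
    using linear_bounded_pos[OF matrix_vector_mul_linear[of A]] by metis
  obtain c where c: "c > 0" "\<And>x. norm (C *v x) \<le> c * norm x"
    using linear_bounded_pos[OF matrix_vector_mul_linear[of C]] by metis
  obtain K where K: "K \<ge> 0" "\<And>m j. grid (Suc m) j \<le> real T \<Longrightarrow> (\<integral>w. (norm (level_diff m j w))\<^sup>2 \<partial>M) \<le> K * (1/2) ^ m"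
    using level_diff_moment[of "real T"] by blast
  define N where "N m t w = clipped (Suc m) T (\<lambda>j. C *v level_diff m j w) (\<lambda>s. W s w) t" for m t w
  \<comment> \<open>Two demands meet here: \<open>l\<close> must be summable, and the Chebyshev
    bounds \<open>(1/2) ^ m / (l m)\<^sup>2 = (25/32) ^ m\<close> as well. Any ratio strictly
    between \<open>sqrt (1/2)\<close> and 1 would do.\<close>
  define l :: "nat \<Rightarrow> real" where "l m = (4/5) ^ m" for m
  have l: "l m > 0" for m by (simp add: l_def)
  define E1 where "E1 m = {w \<in> space M. \<exists>k. \<exists>i\<le>T * 2 ^ (Suc m + k). l m < norm (N m (grid (Suc m + k) i) w)}" for m
  define E2 where "E2 m = {w \<in> space M. l m < (1 / 2 ^ Suc m) * (\<Sum>j<T * 2 ^ Suc m. a * norm (level_diff m j w))}" for m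
  have E1: "E1 m \<in> sets M" "measure M (E1 m) \<le> real T * c\<^sup>2 * (K * (1/2) ^ m) / (l m)\<^sup>2" for m
    unfolding E1_def N_def by (rule noise_maximal[OF c(2) l K(2), THEN conjunct1], assumption,
      rule noise_maximal[OF c(2) l K(2), THEN conjunct2], assumption)
  have E2: "E2 m \<in> sets M" "measure M (E2 m) \<le> (real T)\<^sup>2 * a\<^sup>2 * (K * (1/2) ^ m) / (l m)\<^sup>2" for m
  proof -
    have "0 \<le> K * (1/2) ^ m" using K(1) by simp
    from drift_maximal[OF less_imp_le[OF a(1)] l this K(2)]
    show "E2 m \<in> sets M" "measure M (E2 m) \<le> (real T)\<^sup>2 * a\<^sup>2 * (K * (1/2) ^ m) / (l m)\<^sup>2"
      unfolding E2_def by blast+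
  qed
  have rate: "(1/2) ^ m / (l m)\<^sup>2 = (25/32) ^ m" for m
  proof -
    have "(l m)\<^sup>2 = (16/25) ^ m" by (simp add: l_def power2_eq_square flip: power_mult_distrib)
    thus ?thesis by (simp flip: power_divide)
  qed
  have summ: "summable (\<lambda>m. k * (K * (1/2) ^ m) / (l m)\<^sup>2)" for k
  proof -
    have "k * (K * (1/2) ^ m) / (l m)\<^sup>2 = k * K * (25/32) ^ m" for m using rate[of m] by (metis mult.assoc times_divide_eq_right)
    thus ?thesis by (simp add: summable_mult summable_geometric)
  qed
  have A1: "AE w in M. eventually (\<lambda>m. w \<in> space M - E1 m) sequentially"
  proof (rule borel_cantelli_AE1)
    show "summable (\<lambda>m. measure M (E1 m))"
      by (rule summable_comparison_test'[OF summ[of "real T * c\<^sup>2"], of 0]) (use E1 in auto)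
  qed (use E1 in \<open>simp_all add: less_top[symmetric]\<close>)
  have A2: "AE w in M. eventually (\<lambda>m. w \<in> space M - E2 m) sequentially"
  proof (rule borel_cantelli_AE1)
    show "summable (\<lambda>m. measure M (E2 m))"
      by (rule summable_comparison_test'[OF summ[of "(real T)\<^sup>2 * a\<^sup>2"], of 0]) (use E2 in auto)
  qed (use E2 in \<open>simp_all add: less_top[symmetric]\<close>)
  have A3: "AE w in M. continuous_on {0..} (\<lambda>t. W t w)" using bm by (simp add: brownian_motion_def)
  show ?thesis using A1 A2 A3
  proof eventually_elim
    case (elim w)
    have "eventually (\<lambda>m. \<forall>t\<in>{0..real T}. norm (interp (Suc m) T t w - interp m T t w) \<le> 2 * l m) sequentially"
      using elim(1,2)
    proof eventually_elim
      case (elim m)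
      hence w': "w \<in> space M" by simp
      have cN: "continuous_on {0..} (\<lambda>t. N m t w)" unfolding N_def by (rule clipped_continuous) fact
      have N: "norm (N m t w) \<le> l m" if "t \<in> {0..real T}" for t
        by (rule dyadic_bound[OF cN _ that, of "Suc m"]) (use elim(1) w' in \<open>auto simp: E1_def not_less\<close>)
      have D: "norm (clipped (Suc m) T (\<lambda>j. A *v level_diff m j w) (\<lambda>s. s) t) \<le> l m" for t
      proof -
        have "norm (clipped (Suc m) T (\<lambda>j. A *v level_diff m j w) (\<lambda>s. s) t) \<le> (1 / 2 ^ Suc m) * (\<Sum>j<T * 2 ^ Suc m. norm (A *v level_diff m j w))"
          by (rule clipped_drift_bound)
        also have "\<dots> \<le> (1 / 2 ^ Suc m) * (\<Sum>j<T * 2 ^ Suc m. a * norm (level_diff m j w))"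
          by (intro mult_left_mono sum_mono a(2)) auto
        also have "\<dots> \<le> l m" using elim(2) w' by (simp add: E2_def not_less)
        finally show ?thesis .
      qed
      show ?case
      proof
        fix t assume t: "t \<in> {0..real T}"
        show "norm (interp (Suc m) T t w - interp m T t w) \<le> 2 * l m"
          unfolding interp_diff using norm_triangle_ineq D[of t] N[OF t] unfolding N_def by (smt (verit))
      qed
    qed
    moreover have "summable (\<lambda>m. 2 * l m)" unfolding l_def by (intro summable_mult summable_geometric) simp
    ultimately have "uniform_limit {0..real T} (\<lambda>n t. \<Sum>i<n. interp (Suc i) T t w - interp i T t w)
      (\<lambda>t. suminf (\<lambda>i. interp (Suc i) T t w - interp i T t w)) sequentially"
      by (rule Weierstrass_m_test_ev)
    hence "uniform_limit {0..real T} (\<lambda>n t. interp 0 T t w + (\<Sum>i<n. interp (Suc i) T t w - interp i T t w))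
      (\<lambda>t. interp 0 T t w + suminf (\<lambda>i. interp (Suc i) T t w - interp i T t w)) sequentially"
      by (intro uniform_limit_add uniform_limit_const)
    moreover have "interp 0 T t w + (\<Sum>i<n. interp (Suc i) T t w - interp i T t w) = interp n T t w" for n t
      by (subst sum_lessThan_telescope) simp
    ultimately have u: "uniform_limit {0..real T} (\<lambda>n t. interp n T t w)
      (\<lambda>t. interp 0 T t w + suminf (\<lambda>i. interp (Suc i) T t w - interp i T t w)) sequentially" by simp
    have "uniform_limit {0..real T} (\<lambda>n t. interp n T t w) (\<lambda>t. sol t w) sequentially"
      by (rule uniform_limit_cong'[THEN iffD1, OF _ _ u]) (use sol_eq_uniform_limit[OF elim(3) u] in auto)
    thus ?case using elim(3) by (simp add: good_path_def)
  qed
qed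

end

section \<open>Existence of solutions of linear equations\<close>

lemma (in prob_space) AE_tendsto_imp_measure:
  fixes f :: "nat \<Rightarrow> 'a \<Rightarrow> ennreal"
  assumes [measurable]: "\<And>m. f m \<in> borel_measurable M" and conv: "AE w in M. (\<lambda>m. f m w) \<longlonglongrightarrow> 0" and e: "0 < e"
  shows "(\<lambda>m. measure M {w \<in> space M. e < f m w}) \<longlonglongrightarrow> 0"
proof -
  have "(\<lambda>m. \<integral>w. indicat_real {w \<in> space M. e < f m w} w \<partial>M) \<longlonglongrightarrow> (\<integral>w. 0 \<partial>M)"
  proof (rule integral_dominated_convergence[where w = "\<lambda>_. 1"])
    show "AE w in M. (\<lambda>m. indicat_real {w \<in> space M. e < f m w} w) \<longlonglongrightarrow> 0" using conv
    proof eventually_elim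
      case (elim w)
      have "eventually (\<lambda>m. indicat_real {w \<in> space M. e < f m w} w = 0) sequentially"
        using order_tendstoD(2)[OF elim e] by eventually_elim (auto simp: indicator_def)
      thus ?case by (rule tendsto_eventually)
    qed
  qed auto
  thus ?thesis by simp
qed

context euler_scheme
begin

lemma sol_0: "sol 0 w = \<zeta>"
  by (simp add: sol_def last_index_def)

lemma sol_progressive: "progressive F sol"
  unfolding progressive_def
proof (intro allI impI)
  fix t :: real assume t: "0 \<le> t"
  let ?R = "restrict_space borel {0..t} \<Otimes>\<^sub>M F t"
  have "(\<lambda>x. euler m (last_index m (fst x)) (snd x)) \<in> borel_measurable ?R" for m
  proof -
    \<comment> \<open>For a fixed index beyond \<open>t\<close> the Euler value is not known at time
      \<open>t\<close>, so it is replaced by 0. That case is never reached at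
      \<open>last_index\<close>, whose grid time is at most \<open>t\<close>.\<close>
    have "(\<lambda>x. (if grid m j \<le> t then euler m j (snd x) else 0)) \<in> borel_measurable ?R" for j
      by (cases "grid m j \<le> t") (auto intro: measurable_compose[OF measurable_snd measurable_F_mono[OF _ euler_measurable]])
    moreover have [measurable]: "fst \<in> borel_measurable ?R"
      by (rule measurable_compose[OF measurable_fst measurable_restrict_space1]) simp
    have "(\<lambda>x. last_index m (fst x)) \<in> measurable ?R (count_space UNIV)"
      unfolding last_index_def by measurable
    ultimately have "(\<lambda>x. (\<lambda>j x. if grid m j \<le> t then euler m j (snd x) else 0) (last_index m (fst x)) x) \<in> borel_measurable ?R"
      by (rule measurable_compose_countable)
    moreover have "grid m (last_index m (fst x)) \<le> t" if "x \<in> space ?R" for x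
      using that last_index(1)[of "fst x" m] by (auto simp: space_pair_measure space_restrict_space)
    ultimately show ?thesis by (subst (asm) measurable_cong[where g = "\<lambda>x. euler m (last_index m (fst x)) (snd x)"]) auto
  qed
  hence "(\<lambda>x. lim (\<lambda>m. euler m (last_index m (fst x)) (snd x))) \<in> borel_measurable ?R"
    by (rule borel_measurable_lim_metric)
  moreover have "case_prod sol = (\<lambda>x. lim (\<lambda>m. euler m (last_index m (fst x)) (snd x)))" by (simp add: fun_eq_iff sol_def)
  ultimately show "case_prod sol \<in> borel_measurable ?R" by simp
qed

lemma good_path_continuous: "good_path T w \<Longrightarrow> continuous_on {0..real T} (\<lambda>t. sol t w)"
  unfolding good_path_def using uniform_limit_continuous by blast

lemma AE_all_good_path: "AE w in M. \<forall>T. good_path T w"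
  using AE_good_path by (simp add: AE_all_countable)

lemma sol_continuous: "AE w in M. continuous_on {0..} (\<lambda>t. sol t w)"
  using AE_all_good_path
proof eventually_elim
  case (elim w)
  have "(\<lambda>n. sol (x n) w) \<longlonglongrightarrow> sol a w" if x: "\<And>n. 0 \<le> x n" "x \<longlonglongrightarrow> a" "0 \<le> a" for x a
  proof -
    obtain T where T: "a < real T" using reals_Archimedean2 by blast
    have "eventually (\<lambda>n. x n < real T) sequentially" by (rule order_tendstoD(2)[OF x(2) T])
    hence ev: "eventually (\<lambda>n. sol (min (x n) (real T)) w = sol (x n) w) sequentially" by eventually_elim simp
    have "(\<lambda>n. min (x n) (real T)) \<longlonglongrightarrow> a" using tendsto_min[OF x(2) tendsto_const[of "real T"]] T by (simp add: min_absorb1)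
    hence "(\<lambda>n. sol (min (x n) (real T)) w) \<longlonglongrightarrow> sol a w"
      using good_path_continuous[of T w] elim x T by (auto simp: continuous_on_sequentially o_def)
    thus ?thesis by (rule Lim_transform_eventually[OF _ ev])
  qed
  thus ?case by (auto simp: continuous_on_sequentially o_def)
qed

lemma interp_tendsto:
  assumes "good_path T w" "\<And>m. s m \<in> {0..real T}" "s \<longlonglongrightarrow> t" "t \<in> {0..real T}"
  shows "(\<lambda>m. interp m T (s m) w) \<longlonglongrightarrow> sol t w"
  by (rule uniform_limit_at[where f = "\<lambda>m t. interp m T t w", OF _ good_path_continuous[OF assms(1)] assms(2-4)])
     (use assms(1) in \<open>simp add: good_path_def\<close>)

text \<open>Uniform closeness to the continuous limit bounds the iterates on each good path. The
  bound depends on the path but not on the level, which serves dominated convergence and makes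
  truncation harmless.\<close>

lemma euler_eventually_bounded:
  assumes g: "good_path T w"
  obtains b where "0 < b" "eventually (\<lambda>m. \<forall>j\<le>T * 2 ^ m. norm (euler m j w) \<le> b) sequentially"
proof -
  have "compact ((\<lambda>t. sol t w) ` {0..real T})" by (rule compact_continuous_image[OF good_path_continuous[OF g] compact_Icc])
  then obtain b where b: "\<forall>t\<in>{0..real T}. norm (sol t w) \<le> b" by (auto simp: bounded_iff dest!: compact_imp_bounded)
  have "0 \<le> norm (sol 0 w)" "norm (sol 0 w) \<le> b" using b by auto
  hence b0: "0 < b + 1" by linarith
  have "eventually (\<lambda>m. \<forall>t\<in>{0..real T}. dist (interp m T t w) (sol t w) < 1) sequentially"
    by (rule uniform_limitD) (use g in \<open>auto simp: good_path_def\<close>)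
  hence "eventually (\<lambda>m. \<forall>j\<le>T * 2 ^ m. norm (euler m j w) \<le> b + 1) sequentially"
  proof eventually_elim
    case (elim m)
    show ?case
    proof (intro allI impI)
      fix j assume j: "j \<le> T * 2 ^ m"
      hence t: "grid m j \<in> {0..real T}" using grid_le_nat grid_simps(2) by simp
      have "norm (euler m j w - sol (grid m j) w) < 1" using elim[rule_format, OF t] interp_grid[OF j, of w] by (simp add: dist_norm)
      thus "norm (euler m j w) \<le> b + 1" using b t norm_triangle_sub[of "euler m j w" "sol (grid m j) w"] by fastforce
    qed
  qed
  thus thesis using that b0 by blast
qed

lemma process_at:
  assumes s: "0 < s" "s \<le> real T"
  obtains j where "j < T * 2 ^ m" "\<bar>grid m j - s\<bar> \<le> 1 / 2 ^ m"
    "\<And>\<xi> (w::'a). elementary_process (T * 2 ^ m) (grid m) \<xi> s w = (\<xi> j w :: real^'n)"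
proof -
  obtain j where j: "j < T * 2 ^ m" "grid m j < s" "s \<le> grid m (Suc j)"
    using partition_cover[of "grid m" s "T * 2 ^ m"] s by (auto simp: grid_simps) (auto simp: grid_def)
  have "\<bar>grid m j - s\<bar> \<le> 1 / 2 ^ m" using j grid_simps(4)[of m j] by linarith
  moreover have "elementary_process (T * 2 ^ m) (grid m) \<xi> s w = \<xi> j w" for \<xi> :: "nat \<Rightarrow> 'a \<Rightarrow> real^'n" and w
    by (rule elementary_process_eq) (use j grid_simps in auto)
  ultimately show thesis using that j(1) by blast
qed

lemma process_tendsto:
  fixes B :: "real^'n^'n"
  assumes g: "good_path T w" and s: "0 < s" "s \<le> real T"
  shows "(\<lambda>m. elementary_process (T * 2 ^ m) (grid m) (\<lambda>j w. B *v euler m j w) s w) \<longlonglongrightarrow> B *v sol s w"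
proof -
  have "\<exists>j<T * 2 ^ m. \<bar>grid m j - s\<bar> \<le> 1 / 2 ^ m \<and>
    elementary_process (T * 2 ^ m) (grid m) (\<lambda>j w. B *v euler m j w) s w = B *v euler m j w" for m
    using process_at[OF s, of m] by metis
  then obtain j where j: "\<And>m. j m < T * 2 ^ m" "\<And>m. \<bar>grid m (j m) - s\<bar> \<le> 1 / 2 ^ m"
    "\<And>m. elementary_process (T * 2 ^ m) (grid m) (\<lambda>j w. B *v euler m j w) s w = B *v euler m (j m) w" by metis
  have "(\<lambda>m. interp m T (grid m (j m)) w) \<longlonglongrightarrow> sol s w"
    by (rule interp_tendsto[OF g _ near_tendsto[OF j(2)]]) (use s grid_le_nat[OF less_imp_le[OF j(1)]] grid_simps(2) in auto)
  hence "(\<lambda>m. euler m (j m) w) \<longlonglongrightarrow> sol s w" using j(1) by (simp add: interp_grid less_imp_le)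
  hence "(\<lambda>m. B *v euler m (j m) w) \<longlonglongrightarrow> B *v sol s w"
    by (rule bounded_linear.tendsto[OF matrix_vector_mul_bounded_linear])
  thus ?thesis unfolding j(3) .
qed

lemma process_eventually_bounded:
  fixes B :: "real^'n^'n"
  assumes g: "good_path T w"
  obtains b where "0 < b" "eventually (\<lambda>m. \<forall>s. 0 < s \<and> s \<le> real T \<longrightarrow>
    norm (elementary_process (T * 2 ^ m) (grid m) (\<lambda>j w. B *v euler m j w) s w) \<le> b) sequentially"
proof -
  obtain b where b: "0 < b" "eventually (\<lambda>m. \<forall>j\<le>T * 2 ^ m. norm (euler m j w) \<le> b) sequentially"
    by (rule euler_eventually_bounded[OF g])
  obtain c where c: "c > 0" "\<And>x. norm (B *v x) \<le> c * norm x"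
    using linear_bounded_pos[OF matrix_vector_mul_linear[of B]] by metis
  have "eventually (\<lambda>m. \<forall>s. 0 < s \<and> s \<le> real T \<longrightarrow>
    norm (elementary_process (T * 2 ^ m) (grid m) (\<lambda>j w. B *v euler m j w) s w) \<le> c * b) sequentially"
    using b(2)
  proof eventually_elim
    case (elim m)
    show ?case
    proof (intro allI impI)
      fix s assume s: "0 < s \<and> s \<le> real T"
      obtain j where j: "j < T * 2 ^ m" "elementary_process (T * 2 ^ m) (grid m) (\<lambda>j w. B *v euler m j w) s w = B *v euler m j w"
        using process_at[OF s[THEN conjunct1] s[THEN conjunct2], of m] by metis
      show "norm (elementary_process (T * 2 ^ m) (grid m) (\<lambda>j w. B *v euler m j w) s w) \<le> c * b"
        unfolding j(2) using elim j(1) c(1) by (intro order_trans[OF c(2)] mult_left_mono) auto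
    qed
  qed
  thus thesis using that[of "c * b"] b c by simp
qed

text \<open>Cells are open on the left, so an elementary process vanishes at time 0; convergence of
  integrands is claimed off this point only.\<close>

lemma AE_endpoint: "AE s in lborel. s \<noteq> (0::real)"
  by (rule AE_lborel_singleton)

lemma LINT_elementary_process:
  fixes B :: "real^'n^'n"
  assumes t: "0 \<le> t"
  shows "(LINT s:{0..t}|lborel. elementary_process (T * 2 ^ m) (grid m) (\<lambda>j w. B *v euler m j w) s w)
    = clipped m T (\<lambda>j. B *v euler m j w) (\<lambda>s. s) t"
proof -
  have e: "indicat_real {0..t} s *\<^sub>R elementary_process (T * 2 ^ m) (grid m) (\<lambda>j w. B *v euler m j w) s w
    = (\<Sum>j<T * 2 ^ m. indicat_real {min t (grid m j)<..min t (grid m (Suc j))} s *\<^sub>R (B *v euler m j w))" for s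
    unfolding elementary_process_def scaleR_sum_right
  proof (intro sum.cong refl)
    fix j
    have "grid m j < s \<Longrightarrow> 0 \<le> s" using grid_simps(2)[of m j] by linarith
    hence "indicat_real {0..t} s * indicat_real {grid m j<..grid m (Suc j)} s
      = indicat_real {min t (grid m j)<..min t (grid m (Suc j))} s"
      by (auto simp: indicator_def min_def)
    thus "indicat_real {0..t} s *\<^sub>R indicat_real {grid m j<..grid m (Suc j)} s *\<^sub>R (B *v euler m j w)
      = indicat_real {min t (grid m j)<..min t (grid m (Suc j))} s *\<^sub>R (B *v euler m j w)"
      by simp
  qed
  have le: "min t (grid m j) \<le> min t (grid m (Suc j))" for j using grid_simps(3)[of m j] by auto
  have i: "integrable lborel (indicat_real {min t (grid m j)<..min t (grid m (Suc j))})" for j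
    using le[of j] by (intro integrable_real_indicator) (simp_all del: min_less_iff_conj)
  show ?thesis unfolding set_lebesgue_integral_def e clipped_def
    using le i by (subst Bochner_Integration.integral_sum) (auto intro!: sum.cong)
qed

lemma drift_tendsto:
  fixes B :: "real^'n^'n"
  assumes g: "good_path T w" and t: "0 \<le> t" "t \<le> real T" and w': "w \<in> space M"
  shows "(\<lambda>m. clipped m T (\<lambda>j. B *v euler m j w) (\<lambda>s. s) t) \<longlonglongrightarrow> (LINT s:{0..t}|lborel. B *v sol s w)"
proof -
  obtain b where b: "0 < b" "eventually (\<lambda>m. \<forall>s. 0 < s \<and> s \<le> real T \<longrightarrow>
    norm (elementary_process (T * 2 ^ m) (grid m) (\<lambda>j w. B *v euler m j w) s w) \<le> b) sequentially"
    by (rule process_eventually_bounded[OF g])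
  then obtain m0 where m0: "\<And>m s. m0 \<le> m \<Longrightarrow> 0 < s \<Longrightarrow> s \<le> real T \<Longrightarrow>
    norm (elementary_process (T * 2 ^ m) (grid m) (\<lambda>j w. B *v euler m j w) s w) \<le> b"
    by (auto simp: eventually_sequentially)
  let ?p = "\<lambda>m s. elementary_process (T * 2 ^ m) (grid m) (\<lambda>j w. B *v euler m j w) s w"
  have pB: "progressive F (\<lambda>s w. B *v sol s w)" by (rule progressive_affine[OF sol_progressive, of "\<lambda>_. 0"]) auto
  have "(\<lambda>m. LINT s:{0..t}|lborel. ?p (m + m0) s) \<longlonglongrightarrow> (LINT s:{0..t}|lborel. B *v sol s w)"
    unfolding set_lebesgue_integral_def
  proof (rule integral_dominated_convergence[where w = "\<lambda>s. b * indicator {0..t} s"])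
    show "(\<lambda>s. indicat_real {0..t} s *\<^sub>R (B *v sol s w)) \<in> borel_measurable lborel"
      by (rule progressive_path_measurable[OF pB t(1) w'])
    show "(\<lambda>s. indicat_real {0..t} s *\<^sub>R ?p (m + m0) s) \<in> borel_measurable lborel" for m
      by (rule elementary_process_measurable_s)
    show "integrable lborel (\<lambda>s. b * indicat_real {0..t} s)"
      using t(1) by (intro integrable_mult_right integrable_real_indicator) simp_all
    show "AE s in lborel. (\<lambda>m. indicat_real {0..t} s *\<^sub>R ?p (m + m0) s) \<longlonglongrightarrow> indicat_real {0..t} s *\<^sub>R (B *v sol s w)"
      using AE_endpoint
    proof eventually_elim
      case (elim s)
      show ?case
      proof (cases "s \<in> {0..t}")
        case True
        hence "0 < s" "s \<le> real T" using elim t by auto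
        from LIMSEQ_ignore_initial_segment[OF process_tendsto[OF g this, of B], of m0] show ?thesis by (intro tendsto_scaleR tendsto_const)
      qed simp
    qed
    show "AE s in lborel. norm (indicat_real {0..t} s *\<^sub>R ?p (m + m0) s) \<le> b * indicat_real {0..t} s" for m
      using AE_endpoint
    proof eventually_elim
      case (elim s)
      thus ?case using m0[of "m + m0" s] t by (auto simp: indicator_def)
    qed
  qed
  thus ?thesis unfolding LINT_elementary_process[OF t(1)] by (rule LIMSEQ_offset)
qed

text \<open>Elementary coefficients have to be bounded, which Euler values are not. The cut at level
  \<open>m\<close> is inactive on a good path for large \<open>m\<close>.\<close>

definition truncated :: "nat \<Rightarrow> nat \<Rightarrow> 'a \<Rightarrow> real^'n" where
  "truncated m j w = (if norm (euler m j w) \<le> real m then C *v euler m j w else 0)"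

lemma truncated_elementary: "elementary_data M F (real T) (T * 2 ^ m) (grid m) (truncated m)"
  unfolding elementary_data_def
proof (intro conjI allI impI)
  show "grid m (T * 2 ^ m) = real T" by (simp add: grid_def)
  fix j
  have [measurable]: "euler m j \<in> borel_measurable (F (grid m j))" "(\<lambda>w. C *v euler m j w) \<in> borel_measurable (F (grid m j))"
    using measurable_matrix euler_measurable by blast+
  show "truncated m j \<in> borel_measurable (F (grid m j))" unfolding truncated_def[abs_def] by measurable
  obtain c where c: "c > 0" "\<And>x. norm (C *v x) \<le> c * norm x"
    using linear_bounded_pos[OF matrix_vector_mul_linear[of C]] by metis
  have "norm (truncated m j w) \<le> c * real m" for w
    using order_trans[OF c(2)[of "euler m j w"] mult_left_mono[of "norm (euler m j w)" "real m" c]] c(1) by (auto simp: truncated_def)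
  thus "bounded (truncated m j ` space M)" by (auto simp: bounded_iff)
qed (auto simp: grid_simps)

lemma truncated_eventually:
  assumes g: "good_path T w"
  shows "eventually (\<lambda>m. \<forall>j\<le>T * 2 ^ m. truncated m j w = C *v euler m j w) sequentially"
proof -
  obtain b where b: "0 < b" "eventually (\<lambda>m. \<forall>j\<le>T * 2 ^ m. norm (euler m j w) \<le> b) sequentially"
    by (rule euler_eventually_bounded[OF g])
  have "eventually (\<lambda>m. b \<le> real m) sequentially"
    using filterlim_real_sequentially by (auto simp: filterlim_at_top)
  with b(2) show ?thesis by eventually_elim (force simp: truncated_def)
qed

text \<open>The integral is taken to be the residual of the equation, so the equation holds by
  construction. What has to be shown is that the residual is an Ito integral: the step integrals of
  the truncated Euler coefficients converge to it pathwise, and so do the integrands in energy, both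
  by dominated convergence.\<close>

lemma sol_ito:
  assumes t: "0 \<le> t" "t \<le> real T"
  shows "has_ito_integral M F W (\<lambda>s w. C *v sol s w) t (\<lambda>w. sol t w - \<zeta> - (LINT s:{0..t}|lborel. A *v sol s w))"
    (is "has_ito_integral M F W ?H t ?I")
proof -
  have pA: "progressive F (\<lambda>s w. A *v sol s w)" by (rule progressive_affine[OF sol_progressive, of "\<lambda>_. 0"]) auto
  have pH: "progressive F ?H" by (rule progressive_affine[OF sol_progressive, of "\<lambda>_. 0"]) auto
  have [measurable]: "sol t \<in> borel_measurable M" by (rule measurable_F_M[OF progressive_adapted[OF sol_progressive t(1)]])
  have [measurable]: "(\<lambda>w. LINT s:{0..t}|lborel. A *v sol s w) \<in> borel_measurable M"
    unfolding set_lebesgue_integral_def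
    by (rule lborel.borel_measurable_lebesgue_integral) (use progressive_joint[OF pA t(1)] in \<open>simp add: case_prod_beta\<close>)
  define k where "k m = T * 2 ^ m" for m :: nat
  define \<tau> where "\<tau> m j = min t (grid m j)" for m j
  define \<xi> where "\<xi> m = restricted t (grid m) (truncated m)" for m
  have ed: "elementary_data M F t (k m) (\<tau> m) (\<xi> m)" for m
    unfolding k_def \<tau>_def \<xi>_def by (rule restricted_elementary[OF truncated_elementary t])
  have process: "elementary_process (k m) (\<tau> m) (\<xi> m) s w = elementary_process (T * 2 ^ m) (grid m) (\<lambda>j w. C *v euler m j w) s w"
    if "s \<le> t" "\<forall>j\<le>T * 2 ^ m. truncated m j w = C *v euler m j w" for m s w
    unfolding k_def \<tau>_def[abs_def] \<xi>_def restricted_process[OF that(1)] using that(2)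
    by (simp add: elementary_process_def)
  have integral: "elementary_integral W (k m) (\<tau> m) (\<xi> m) w = interp m T t w - \<zeta> - clipped m T (\<lambda>j. A *v euler m j w) (\<lambda>s. s) t"
    if "\<forall>j\<le>T * 2 ^ m. truncated m j w = C *v euler m j w" for m w
  proof -
    have "elementary_integral W (k m) (\<tau> m) (\<xi> m) w = clipped m T (\<lambda>j. C *v euler m j w) (\<lambda>s. W s w) t"
      unfolding elementary_integral_def clipped_def k_def \<tau>_def \<xi>_def restricted_def
    proof (intro sum.cong refl)
      fix j assume j: "j \<in> {..<T * 2 ^ m}"
      have "\<not> grid m j < t \<Longrightarrow> min t (grid m (Suc j)) = t \<and> min t (grid m j) = t" using grid_simps(3)[of m j] by auto
      thus "(W (min t (grid m (Suc j))) w - W (min t (grid m j)) w) *\<^sub>R (if grid m j < t then truncated m j w else 0)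
        = (W (min t (grid m (Suc j))) w - W (min t (grid m j)) w) *\<^sub>R (C *v euler m j w)"
        using that j by auto
    qed
    thus ?thesis by (simp add: interp_def)
  qed
  have e1: "AE w in M. (\<lambda>m. energy t (\<lambda>s w. elementary_process (k m) (\<tau> m) (\<xi> m) s w - ?H s w) w) \<longlonglongrightarrow> 0"
    using AE_good_path[of T] AE_space
  proof eventually_elim
    case (elim w)
    note g = elim(1)
    let ?p = "\<lambda>m s. elementary_process (T * 2 ^ m) (grid m) (\<lambda>j w. C *v euler m j w) s w"
    obtain b where b: "0 < b" "eventually (\<lambda>m. \<forall>s. 0 < s \<and> s \<le> real T \<longrightarrow> norm (?p m s) \<le> b) sequentially"
      by (rule process_eventually_bounded[OF g])
    from eventually_conj[OF b(2) truncated_eventually[OF g]]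
    obtain m0 where m0: "\<And>m s. m0 \<le> m \<Longrightarrow> 0 < s \<Longrightarrow> s \<le> real T \<Longrightarrow> norm (?p m s) \<le> b"
      "\<And>m. m0 \<le> m \<Longrightarrow> \<forall>j\<le>T * 2 ^ m. truncated m j w = C *v euler m j w"
      by (auto simp: eventually_sequentially)
    have lim: "(\<lambda>m. ?p (m + m0) s) \<longlonglongrightarrow> ?H s w" if "0 < s" "s \<le> t" for s
      by (rule LIMSEQ_ignore_initial_segment[OF process_tendsto[OF g]]) (use that t in auto)
    have Hb: "norm (?H s w) \<le> b" if "0 < s" "s \<le> t" for s
      by (rule LIMSEQ_le_const2[OF tendsto_norm[OF lim[OF that]]]) (use m0(1) that t in auto)
    let ?f = "\<lambda>m s. ennreal ((norm (?p (m + m0) s - ?H s w))\<^sup>2) * indicator {0..t} s"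
    have en: "energy t (\<lambda>s w. elementary_process (k (m + m0)) (\<tau> (m + m0)) (\<xi> (m + m0)) s w - ?H s w) w = (\<integral>\<^sup>+ s. ?f m s \<partial>lborel)" for m
      unfolding energy_def
    proof (intro nn_integral_cong)
      fix s
      show "ennreal ((norm (elementary_process (k (m + m0)) (\<tau> (m + m0)) (\<xi> (m + m0)) s w - ?H s w))\<^sup>2) * indicator {0..t} s = ?f m s"
        using process[OF _ m0(2)[of "m + m0"], of s] by (cases "s \<in> {0..t}") auto
    qed
    have fm: "?f m \<in> borel_measurable lborel" for m
    proof -
      have "(\<lambda>s. ennreal ((norm (indicat_real {0..t} s *\<^sub>R ?p (m + m0) s - indicat_real {0..t} s *\<^sub>R ?H s w))\<^sup>2)) \<in> borel_measurable lborel"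
        using elementary_process_measurable_s[of t] progressive_path_measurable[OF pH t(1) elim(2)] by measurable
      moreover have "(\<lambda>s. ennreal ((norm (indicat_real {0..t} s *\<^sub>R ?p (m + m0) s - indicat_real {0..t} s *\<^sub>R ?H s w))\<^sup>2)) = ?f m"
        by (auto simp: fun_eq_iff indicator_def)
      ultimately show ?thesis by simp
    qed
    have "(\<lambda>m. \<integral>\<^sup>+ s. ?f m s \<partial>lborel) \<longlonglongrightarrow> (\<integral>\<^sup>+ s. 0 \<partial>(lborel :: real measure))"
    proof (rule nn_integral_dominated_convergence[where w = "\<lambda>s. ennreal ((2 * b)\<^sup>2) * indicator {0..t} s"])
      show "?f m \<in> borel_measurable lborel" for m by (rule fm)
      show "AE s in lborel. ?f m s \<le> ennreal ((2 * b)\<^sup>2) * indicator {0..t} s" for m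
        using AE_endpoint
      proof eventually_elim
        case (elim s)
        show ?case
        proof (cases "s \<in> {0..t}")
          case True
          hence s: "0 < s" "s \<le> t" "s \<le> real T" using elim t by auto
          have "norm (?p (m + m0) s - ?H s w) \<le> norm (?p (m + m0) s) + norm (?H s w)" by (rule norm_triangle_ineq4)
          hence "norm (?p (m + m0) s - ?H s w) \<le> 2 * b" using m0(1)[of "m + m0" s] Hb[OF s(1,2)] s by simp
          hence "(norm (?p (m + m0) s - ?H s w))\<^sup>2 \<le> (2 * b)\<^sup>2" by (rule power_mono) simp
          thus ?thesis using True by (simp add: ennreal_leI)
        qed simp
      qed
      have "(\<integral>\<^sup>+ s. ennreal ((2 * b)\<^sup>2) * indicator {0..t} s \<partial>lborel) = ennreal ((2 * b)\<^sup>2) * ennreal t"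
        using t(1) by (subst nn_integral_cmult_indicator) auto
      thus "(\<integral>\<^sup>+ s. ennreal ((2 * b)\<^sup>2) * indicator {0..t} s \<partial>lborel) < \<infinity>" by (simp add: ennreal_mult_less_top)
      show "AE s in lborel. (\<lambda>m. ?f m s) \<longlonglongrightarrow> 0"
        using AE_endpoint
      proof eventually_elim
        case (elim s)
        show ?case
        proof (cases "s \<in> {0..t}")
          case True
          hence s: "0 < s" "s \<le> t" using elim by auto
          have "(\<lambda>m. (norm (?p (m + m0) s - ?H s w))\<^sup>2) \<longlonglongrightarrow> (norm (?H s w - ?H s w))\<^sup>2"
            by (intro tendsto_power tendsto_norm tendsto_diff lim[OF s] tendsto_const)
          hence "(\<lambda>m. ennreal ((norm (?p (m + m0) s - ?H s w))\<^sup>2)) \<longlonglongrightarrow> ennreal 0" by (intro tendsto_ennrealI) simp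
          thus ?thesis using True by simp
        qed simp
      qed
    qed auto
    hence "(\<lambda>m. energy t (\<lambda>s w. elementary_process (k (m + m0)) (\<tau> (m + m0)) (\<xi> (m + m0)) s w - ?H s w) w) \<longlonglongrightarrow> 0"
      unfolding en by simp
    thus ?case by (rule LIMSEQ_offset)
  qed
  have e2: "AE w in M. (\<lambda>m. ennreal (norm (elementary_integral W (k m) (\<tau> m) (\<xi> m) w - ?I w))) \<longlonglongrightarrow> 0"
    using AE_good_path[of T] AE_space
  proof eventually_elim
    case (elim w)
    have "(\<lambda>m. interp m T t w - \<zeta> - clipped m T (\<lambda>j. A *v euler m j w) (\<lambda>s. s) t) \<longlonglongrightarrow> ?I w"
      by (intro tendsto_diff interp_tendsto[OF elim(1)] drift_tendsto[OF elim(1) t elim(2)] tendsto_const) (use t in auto)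
    moreover have "eventually (\<lambda>m. interp m T t w - \<zeta> - clipped m T (\<lambda>j. A *v euler m j w) (\<lambda>s. s) t
      = elementary_integral W (k m) (\<tau> m) (\<xi> m) w) sequentially"
      using truncated_eventually[OF elim(1)] by eventually_elim (simp add: integral)
    ultimately have "(\<lambda>m. elementary_integral W (k m) (\<tau> m) (\<xi> m) w) \<longlonglongrightarrow> ?I w"
      by (rule Lim_transform_eventually)
    hence "(\<lambda>m. norm (elementary_integral W (k m) (\<tau> m) (\<xi> m) w - ?I w)) \<longlonglongrightarrow> 0"
      by (intro tendsto_norm_zero LIM_zero)
    thus ?case using tendsto_ennrealI[of _ 0 sequentially] by simp
  qed
  have [measurable]: "elementary_integral W (k m) (\<tau> m) (\<xi> m) \<in> borel_measurable M" for m by (rule elementary_integral_measurable[OF ed])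
  have "(\<lambda>m. measure M {w \<in> space M. ennreal \<epsilon> < energy t (\<lambda>s w. elementary_process (k m) (\<tau> m) (\<xi> m) s w - ?H s w) w}) \<longlonglongrightarrow> 0" if "\<epsilon> > 0" for \<epsilon>
    by (rule AE_tendsto_imp_measure[OF _ e1])
       (use that energy_diff_measurable[OF progressive_joint[OF pH t(1)] elementary_process_joint[OF ed t(1)]] in auto)
  moreover have "(\<lambda>m. measure M {w \<in> space M. \<epsilon> < norm (elementary_integral W (k m) (\<tau> m) (\<xi> m) w - ?I w)}) \<longlonglongrightarrow> 0" if "\<epsilon> > 0" for \<epsilon>
  proof -
    have "(\<lambda>m. measure M {w \<in> space M. ennreal \<epsilon> < ennreal (norm (elementary_integral W (k m) (\<tau> m) (\<xi> m) w - ?I w))}) \<longlonglongrightarrow> 0"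
      by (rule AE_tendsto_imp_measure[OF _ e2]) (use that in \<open>simp_all add: measurable_compose[OF _ measurable_ennreal]\<close>)
    thus ?thesis using that by (simp add: ennreal_less_iff)
  qed
  moreover have "?I \<in> borel_measurable M" by measurable
  ultimately show ?thesis unfolding has_ito_integral_def energy_def using pH ed by blast
qed

theorem sol_linear_sde: "linear_sde_solution M F W A C sol"
  unfolding linear_sde_solution_def has_ito_differential_def
proof (intro conjI allI impI sol_progressive sol_continuous)
  fix t :: real assume t: "0 \<le> t"
  obtain T where T: "t \<le> real T" using real_arch_simple by blast
  have "AE w in M. set_integrable lborel {0..t} (\<lambda>s. A *v sol s w)" using sol_continuous
  proof eventually_elim
    case (elim w)
    show ?case
      by (intro borel_integrable_atLeastAtMost' bounded_linear.continuous_on[OF matrix_vector_mul_bounded_linear]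
          continuous_on_subset[OF elim]) auto
  qed
  thus "\<exists>I. has_ito_integral M F W (\<lambda>t w. C *v sol t w) t I \<and>
        (AE w in M. set_integrable lborel {0..t} (\<lambda>s. A *v sol s w) \<and>
           sol t w = sol 0 w + (LINT s:{0..t}|lborel. A *v sol s w) + I w)"
    by (intro exI[of _ "\<lambda>w. sol t w - \<zeta> - (LINT s:{0..t}|lborel. A *v sol s w)"] conjI sol_ito[OF t T]) (auto simp: sol_0)
qed

end

section \<open>Detectability\<close>

declare transpose_matrix_vector [simp del]

context euler_scheme
begin

lemma euler_subspace:
  assumes "subspace V" "\<And>x. x \<in> V \<Longrightarrow> A *v x \<in> V" "\<And>x. x \<in> V \<Longrightarrow> C *v x \<in> V" "\<zeta> \<in> V"
  shows "euler m j w \<in> V"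
  using assms by (induction j) (auto intro: subspace_add subspace_scale)

lemma euler_tendsto_sol:
  assumes g: "\<forall>T. good_path T w" and t: "0 \<le> t"
  shows "(\<lambda>m. euler m (last_index m t) w) \<longlonglongrightarrow> sol t w"
proof -
  obtain T where T: "t \<le> real T" using real_arch_simple by blast
  have "(\<lambda>m. interp m T (grid m (last_index m t)) w) \<longlonglongrightarrow> sol t w"
    by (rule interp_tendsto[OF _ _ last_index_tendsto[OF t]])
       (use g T t last_index(1)[OF t] grid_simps(2) in \<open>auto intro: order_trans\<close>)
  thus ?thesis using interp_grid[OF last_index(3)[OF t T]] by simp
qed

text \<open>Every Euler iterate stays in \<open>V\<close> on every path, and a subspace is closed,
  so the limit stays there too.\<close>

lemma sol_subspace:
  assumes "subspace V" "\<And>x. x \<in> V \<Longrightarrow> A *v x \<in> V" "\<And>x. x \<in> V \<Longrightarrow> C *v x \<in> V" "\<zeta> \<in> V"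
  shows "AE w in M. \<forall>t\<ge>0. sol t w \<in> V"
  using AE_all_good_path
proof eventually_elim
  case (elim w)
  show ?case
    using closed_sequentially[OF closed_subspace[OF assms(1)] _ euler_tendsto_sol[OF elim]] euler_subspace[OF assms] by blast
qed

section \<open>Mean square convergence at integer times\<close>

abbreviation endpoint :: "nat \<Rightarrow> nat \<Rightarrow> 'a \<Rightarrow> real^'n" where
  "endpoint T m \<equiv> euler m (T * 2 ^ m)"

lemma endpoint_diff: "endpoint T (Suc m) w - endpoint T m w = level_diff m (T * 2 ^ Suc m) w"
  by (simp add: level_diff_def coarse_def)

text \<open>Telescoping with the weighted inequality at \<open>e = 1/2\<close>, whose factors are
  3/2 and 3. The constant 12 reproduces itself: \<open>3/2 * 12 * 1/2 + 3 = 12\<close>.\<close>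

lemma endpoint_cauchy:
  "\<exists>K\<ge>0. \<forall>m k. (\<integral>w. (norm (endpoint T (m + k) w - endpoint T m w))\<^sup>2 \<partial>M) \<le> 12 * K * (1/2) ^ m"
proof -
  obtain K where K: "K \<ge> 0" "\<And>m j. grid (Suc m) j \<le> real T \<Longrightarrow> (\<integral>w. (norm (level_diff m j w))\<^sup>2 \<partial>M) \<le> K * (1/2) ^ m"
    using level_diff_moment[of "real T"] by blast
  have sq: "sq_integrable M (\<lambda>w. endpoint T m w - endpoint T k w)" for m k
    by (intro sq_integrable_diff euler_sq_integrable)
  note int = sq_integrable_norm[OF sq]
  have "(\<integral>w. (norm (endpoint T (m + k) w - endpoint T m w))\<^sup>2 \<partial>M) \<le> 12 * K * (1/2) ^ m" for m k
  proof (induction k arbitrary: m)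
    case 0 thus ?case using K(1) by simp
  next
    case (Suc k)
    have le: "(norm (endpoint T (m + Suc k) w - endpoint T m w))\<^sup>2
      \<le> 3/2 * (norm (endpoint T (Suc m + k) w - endpoint T (Suc m) w))\<^sup>2 + 3 * (norm (endpoint T (Suc m) w - endpoint T m w))\<^sup>2" for w
      using norm_sq_eps_le[of "1/2" "endpoint T (m + Suc k) w - endpoint T m w" "endpoint T (Suc m + k) w - endpoint T (Suc m) w"]
      by simp
    have "(\<integral>w. (norm (endpoint T (m + Suc k) w - endpoint T m w))\<^sup>2 \<partial>M)
      \<le> (\<integral>w. 3/2 * (norm (endpoint T (Suc m + k) w - endpoint T (Suc m) w))\<^sup>2 + 3 * (norm (endpoint T (Suc m) w - endpoint T m w))\<^sup>2 \<partial>M)"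
      by (intro integral_mono le Bochner_Integration.integrable_add integrable_mult_right int)
    also have "\<dots> = 3/2 * (\<integral>w. (norm (endpoint T (Suc m + k) w - endpoint T (Suc m) w))\<^sup>2 \<partial>M)
       + 3 * (\<integral>w. (norm (endpoint T (Suc m) w - endpoint T m w))\<^sup>2 \<partial>M)"
      by (subst Bochner_Integration.integral_add) (simp_all only: integrable_mult_right int integral_mult_right_zero)
    also have "\<dots> \<le> 3/2 * (12 * K * (1/2) ^ Suc m) + 3 * (K * (1/2) ^ m)"
      unfolding endpoint_diff by (intro add_mono mult_left_mono Suc.IH K(2) grid_le_nat) auto
    finally show ?case by simp
  qed
  thus ?thesis using K(1) by blast
qed

lemma endpoint_tendsto:
  assumes "\<forall>T. good_path T w"
  shows "(\<lambda>m. endpoint T m w) \<longlonglongrightarrow> sol (real T) w"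
proof -
  have "last_index m (real T) = T * 2 ^ m" for m
  proof -
    have "\<lfloor>real T * 2 ^ m\<rfloor> = int (T * 2 ^ m)" by (rule floor_unique) simp_all
    thus ?thesis by (simp only: last_index_def nat_int)
  qed
  thus ?thesis using euler_tendsto_sol[OF assms, of "real T"] by simp
qed

text \<open>Fatou's lemma, as \<open>k\<close> tends to infinity in the Cauchy estimate, turns
  pathwise convergence into mean square convergence.\<close>

lemma endpoint_L2:
  "(\<lambda>m. \<integral>\<^sup>+w. ennreal ((norm (sol (real T) w - endpoint T m w))\<^sup>2) \<partial>M) \<longlonglongrightarrow> 0"
proof -
  obtain K where K: "K \<ge> 0" "\<And>m k. (\<integral>w. (norm (endpoint T (m + k) w - endpoint T m w))\<^sup>2 \<partial>M) \<le> 12 * K * (1/2) ^ m"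
    using endpoint_cauchy by blast
  have sq: "sq_integrable M (\<lambda>w. endpoint T m w - endpoint T k w)" for m k
    by (intro sq_integrable_diff euler_sq_integrable)
  have [measurable]: "endpoint T m \<in> borel_measurable M" for m using euler_sq_integrable by (simp add: sq_integrable_def)
  have le: "(\<integral>\<^sup>+w. ennreal ((norm (sol (real T) w - endpoint T m w))\<^sup>2) \<partial>M) \<le> ennreal (12 * K * (1/2) ^ m)" for m
  proof -
    have "AE w in M. ennreal ((norm (sol (real T) w - endpoint T m w))\<^sup>2)
      = liminf (\<lambda>k. ennreal ((norm (endpoint T (m + k) w - endpoint T m w))\<^sup>2))"
      using AE_all_good_path
    proof eventually_elim
      case (elim w)
      have "(\<lambda>k. endpoint T (m + k) w) \<longlonglongrightarrow> sol (real T) w"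
        using LIMSEQ_ignore_initial_segment[OF endpoint_tendsto[OF elim, of T], of m] by (simp add: add.commute)
      hence "(\<lambda>k. ennreal ((norm (endpoint T (m + k) w - endpoint T m w))\<^sup>2)) \<longlonglongrightarrow> ennreal ((norm (sol (real T) w - endpoint T m w))\<^sup>2)"
        by (intro tendsto_ennrealI tendsto_power tendsto_norm tendsto_diff tendsto_const)
      thus ?case by (intro lim_imp_Liminf[symmetric]) simp_all
    qed
    hence "(\<integral>\<^sup>+w. ennreal ((norm (sol (real T) w - endpoint T m w))\<^sup>2) \<partial>M)
      = (\<integral>\<^sup>+w. liminf (\<lambda>k. ennreal ((norm (endpoint T (m + k) w - endpoint T m w))\<^sup>2)) \<partial>M)" by (rule nn_integral_cong_AE)
    also have "\<dots> \<le> liminf (\<lambda>k. \<integral>\<^sup>+w. ennreal ((norm (endpoint T (m + k) w - endpoint T m w))\<^sup>2) \<partial>M)"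
      by (rule nn_integral_liminf) measurable
    also have "\<dots> \<le> ennreal (12 * K * (1/2) ^ m)"
    proof (rule order_trans[OF Liminf_le_Limsup Limsup_bounded])
      show "\<forall>\<^sub>F k in sequentially. (\<integral>\<^sup>+w. ennreal ((norm (endpoint T (m + k) w - endpoint T m w))\<^sup>2) \<partial>M) \<le> ennreal (12 * K * (1/2) ^ m)"
        by (intro always_eventually allI) (subst nn_integral_eq_integral[OF sq_integrable_norm[OF sq]], auto intro!: ennreal_leI K(2))
    qed simp
    finally show ?thesis .
  qed
  have "(\<lambda>m. 12 * K * (1/2) ^ m) \<longlonglongrightarrow> 12 * K * 0" by (intro tendsto_mult tendsto_const LIMSEQ_realpow_zero) auto
  hence "(\<lambda>m. ennreal (12 * K * (1/2) ^ m)) \<longlonglongrightarrow> 0" using tendsto_ennrealI by fastforce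
  thus ?thesis by (rule tendsto_sandwich[OF _ _ tendsto_const, rotated -1]) (use le in auto)
qed

text \<open>Transfers decay of the solution to the Euler scheme, for which a lower bound on the
  covariance is available; a factor 2 does no harm there.\<close>

lemma endpoint_moment_le:
  "(\<integral>\<^sup>+w. ennreal ((norm (endpoint T m w))\<^sup>2) \<partial>M) \<le> 2 * (\<integral>\<^sup>+w. ennreal ((norm (sol (real T) w))\<^sup>2) \<partial>M)
    + 2 * (\<integral>\<^sup>+w. ennreal ((norm (sol (real T) w - endpoint T m w))\<^sup>2) \<partial>M)"
proof -
  have [measurable]: "endpoint T m \<in> borel_measurable M" "sol (real T) \<in> borel_measurable M"
    using euler_sq_integrable measurable_F_M[OF progressive_adapted[OF sol_progressive]] by (auto simp: sq_integrable_def)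
  have "ennreal ((norm (endpoint T m w))\<^sup>2) \<le> 2 * ennreal ((norm (sol (real T) w))\<^sup>2) + 2 * ennreal ((norm (sol (real T) w - endpoint T m w))\<^sup>2)" for w
  proof -
    have "(norm (endpoint T m w))\<^sup>2 \<le> 2 * (norm (sol (real T) w))\<^sup>2 + 2 * (norm (sol (real T) w - endpoint T m w))\<^sup>2"
      using norm_add_sq_le[of "sol (real T) w" "endpoint T m w - sol (real T) w"] by (simp add: norm_minus_commute)
    hence "ennreal ((norm (endpoint T m w))\<^sup>2) \<le> ennreal (2 * (norm (sol (real T) w))\<^sup>2 + 2 * (norm (sol (real T) w - endpoint T m w))\<^sup>2)"
      by (rule ennreal_leI)
    thus ?thesis by (simp add: ennreal_plus ennreal_mult)
  qed
  hence "(\<integral>\<^sup>+w. ennreal ((norm (endpoint T m w))\<^sup>2) \<partial>M)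
    \<le> (\<integral>\<^sup>+w. 2 * ennreal ((norm (sol (real T) w))\<^sup>2) + 2 * ennreal ((norm (sol (real T) w - endpoint T m w))\<^sup>2) \<partial>M)"
    by (intro nn_integral_mono)
  also have "\<dots> = 2 * (\<integral>\<^sup>+w. ennreal ((norm (sol (real T) w))\<^sup>2) \<partial>M)
    + 2 * (\<integral>\<^sup>+w. ennreal ((norm (sol (real T) w - endpoint T m w))\<^sup>2) \<partial>M)"
    by (subst nn_integral_add) (simp_all add: nn_integral_cmult)
  finally show ?thesis .
qed

text \<open>An exact identity: one Euler step is moved onto the test vector, which becomes
  \<open>v + \<delta> A^T v\<close> for the drift and \<open>C^T v\<close> for the noise, with no
  cross term by orthogonality of the increment.\<close>

lemma euler_quadratic:
  "(\<integral>w. (v \<bullet> euler m (Suc k) w)\<^sup>2 \<partial>M) = (\<integral>w. ((v + (1 / 2 ^ m) *\<^sub>R (transpose A *v v)) \<bullet> euler m k w)\<^sup>2 \<partial>M)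
    + (1 / 2 ^ m) * (\<integral>w. ((transpose C *v v) \<bullet> euler m k w)\<^sup>2 \<partial>M)"
proof -
  define u where "u = v + (1 / 2 ^ m) *\<^sub>R (transpose A *v v)"
  define Y where "Y w = u \<bullet> euler m k w" for w
  define X where "X w = (transpose C *v v) \<bullet> euler m k w" for w
  define Z where "Z w = (W (grid m (Suc k)) w - W (grid m k) w) *\<^sub>R X w" for w
  have meas: "Y \<in> borel_measurable (F (grid m k))" "X \<in> borel_measurable (F (grid m k))"
    unfolding Y_def[abs_def] X_def[abs_def] using euler_measurable by (intro borel_measurable_inner borel_measurable_const; simp)+
  have sq: "sq_integrable M Y" "sq_integrable M X"
    unfolding Y_def[abs_def] X_def[abs_def]
    by (rule sq_integrable_linear[OF bounded_linear.linear[OF bounded_linear_inner_right] euler_sq_integrable])+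
  note g = grid_simps(2,3)[of m k]
  note Z = sq_integrable_increment[OF g meas(2) sq(2), folded Z_def]
  have eq: "v \<bullet> euler m (Suc k) w = Y w + Z w" for w
    unfolding euler.simps Y_def Z_def X_def u_def
    using transpose_inner[of A "euler m k w" v] transpose_inner[of C "euler m k w" v]
    by (simp add: inner_add_left inner_add_right inner_commute)
  have int: "integrable M (\<lambda>w. (Y w)\<^sup>2)" "integrable M (\<lambda>w. (Z w)\<^sup>2)" "integrable M (\<lambda>w. Y w * Z w)"
    using sq_integrable_norm[OF sq(1)] sq_integrable_norm[OF Z(1)] sq_integrable_inner[OF sq(1) Z(1)] by simp_all
  have "(\<integral>w. (v \<bullet> euler m (Suc k) w)\<^sup>2 \<partial>M) = (\<integral>w. (Y w)\<^sup>2 + (Z w)\<^sup>2 + 2 * (Y w * Z w) \<partial>M)"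
    unfolding eq by (simp add: power2_sum mult.assoc)
  also have "\<dots> = (\<integral>w. (Y w)\<^sup>2 \<partial>M) + (\<integral>w. (Z w)\<^sup>2 \<partial>M) + 2 * (\<integral>w. Y w * Z w \<partial>M)"
    using int by simp
  also have "(\<integral>w. Y w * Z w \<partial>M) = 0"
    using orthogonal_increment[OF g meas(2) sq(2) meas(1) sq(1)] by (simp add: Z_def)
  also have "(\<integral>w. (Z w)\<^sup>2 \<partial>M) = (1 / 2 ^ m) * (\<integral>w. (X w)\<^sup>2 \<partial>M)"
    using Z(2) by (simp add: grid_simps(4))
  finally show ?thesis by (simp add: Y_def X_def u_def)
qed

lemma euler_quadratic_sum: "(\<integral>w. (norm (euler m k w))\<^sup>2 \<partial>M) = (\<Sum>i\<in>UNIV. \<integral>w. (axis i 1 \<bullet> euler m k w)\<^sup>2 \<partial>M)"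
proof -
  have "integrable M (\<lambda>w. (axis i 1 \<bullet> euler m k w)\<^sup>2)" for i
    using sq_integrable_norm[OF sq_integrable_linear[OF bounded_linear.linear[OF bounded_linear_inner_right[of "axis i 1"]] euler_sq_integrable[of m k]]]
    by simp
  moreover have "(norm x)\<^sup>2 = (\<Sum>i\<in>UNIV. (axis i 1 \<bullet> x)\<^sup>2)" for x :: "real^'n"
    unfolding inner_axis' power2_norm_eq_inner by (simp add: inner_vec_def power2_eq_square)
  ultimately show ?thesis by (simp add: Bochner_Integration.integral_sum)
qed

end

text \<open>The columns of the root are initial states whose outer products sum to \<open>X\<close>,
  so solving from each of them simulates the matrix evolution started at \<open>X\<close> with
  deterministic initial values.\<close>

lemma sqrt_columns:
  fixes X :: "real^'n^'n"
  assumes X: "pos_semidef X"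
  shows "(\<Sum>j\<in>UNIV. (v \<bullet> column j (matrix_sqrt X))\<^sup>2) = v \<bullet> (X *v v)"
proof -
  have "column j (matrix_sqrt X) = matrix_sqrt X $ j" for j
    using sym_entry[OF matrix_sqrt(3)[OF X]] by (simp add: column_def vec_eq_iff)
  hence h: "v \<bullet> column j (matrix_sqrt X) = (matrix_sqrt X *v v) $ j" for j
    by (simp add: matrix_vector_mul_component inner_commute)
  show ?thesis unfolding h matrix_sqrt(4)[OF X, symmetric] power2_norm_eq_inner by (simp add: inner_vec_def power2_eq_square)
qed

text \<open>One Euler step takes the covariance \<open>X\<close> to
  \<open>X + \<delta> * lyap A C X + \<delta>^2 * A X A^T\<close>. The middle term is
  \<open>\<delta> * a * X\<close> and the last is semidefinite, so the covariance does not
  decrease.\<close>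

lemma psd_lyapunov_step:
  fixes X A C :: "real^'n^'n"
  assumes X: "pos_semidef X" and a: "0 \<le> a" and L: "lyap A C X = a *\<^sub>R X" and d: "0 \<le> \<delta>"
  shows "v \<bullet> (X *v v) \<le> (v + \<delta> *\<^sub>R (transpose A *v v)) \<bullet> (X *v (v + \<delta> *\<^sub>R (transpose A *v v)))
    + \<delta> * ((transpose C *v v) \<bullet> (X *v (transpose C *v v)))"
proof -
  have sX: "transpose X = X" and pX: "\<And>v. 0 \<le> v \<bullet> (X *v v)" using X by (auto simp: pos_semidef_def)
  let ?w = "transpose A *v v"
  have "v \<bullet> (lyap A C X *v v) = 2 * (?w \<bullet> (X *v v)) + (transpose C *v v) \<bullet> (X *v (transpose C *v v))"
    unfolding lyap_def
    using transpose_inner[of A "X *v v" v] transpose_inner[of C "X *v (transpose C *v v)" v] sym_inner[OF sX, of v ?w]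
    by (simp add: matrix_vector_mult_add_rdistrib inner_add_right matrix_vector_mul_assoc[symmetric] inner_commute)
  moreover have "v \<bullet> (lyap A C X *v v) \<ge> 0"
    using mult_nonneg_nonneg[OF a pX[of v]] unfolding L by (simp add: scaleR_matrix_vector_assoc[symmetric])
  moreover have "(v + \<delta> *\<^sub>R ?w) \<bullet> (X *v (v + \<delta> *\<^sub>R ?w)) = v \<bullet> (X *v v) + 2 * \<delta> * (?w \<bullet> (X *v v)) + \<delta>\<^sup>2 * (?w \<bullet> (X *v ?w))"
    using sym_inner[OF sX, of v ?w]
    by (simp add: matrix_vector_right_distrib matrix_vector_mult_scaleR inner_add_left inner_add_right inner_commute power2_eq_square algebra_simps)
  moreover have "0 \<le> \<delta>\<^sup>2 * (?w \<bullet> (X *v ?w))" using pX by simp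
  moreover have "0 \<le> \<delta> * (2 * (?w \<bullet> (X *v v)) + (transpose C *v v) \<bullet> (X *v (transpose C *v v)))"
    using calculation(1,2) d by simp
  ultimately show ?thesis by (simp add: algebra_simps)
qed

text \<open>Induction with \<open>v\<close> arbitrary, since each step changes the test vector. The
  bound is free of \<open>m\<close> and \<open>k\<close>.\<close>

lemma (in brownian_basis) euler_quadratic_ge:
  fixes X A C :: "real^'n^'n"
  assumes X: "pos_semidef X" and a: "0 \<le> a" and L: "lyap A C X = a *\<^sub>R X"
  shows "v \<bullet> (X *v v) \<le> (\<Sum>j\<in>UNIV. \<integral>w. (v \<bullet> euler_scheme.euler W A C (column j (matrix_sqrt X)) m k w)\<^sup>2 \<partial>M)"
proof (induction k arbitrary: v)
  case 0
  interpret E: euler_scheme M F W A C \<zeta> for \<zeta> ..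
  show ?case using sqrt_columns[OF X, of v] by (simp add: prob_space)
next
  case (Suc k)
  interpret E: euler_scheme M F W A C \<zeta> for \<zeta> ..
  have "v \<bullet> (X *v v) \<le> (v + (1 / 2 ^ m) *\<^sub>R (transpose A *v v)) \<bullet> (X *v (v + (1 / 2 ^ m) *\<^sub>R (transpose A *v v)))
    + (1 / 2 ^ m) * ((transpose C *v v) \<bullet> (X *v (transpose C *v v)))"
    by (rule psd_lyapunov_step[OF X a L]) simp
  also have "\<dots> \<le> (\<Sum>j\<in>UNIV. \<integral>w. ((v + (1 / 2 ^ m) *\<^sub>R (transpose A *v v)) \<bullet> euler_scheme.euler W A C (column j (matrix_sqrt X)) m k w)\<^sup>2 \<partial>M)
    + (1 / 2 ^ m) * (\<Sum>j\<in>UNIV. \<integral>w. ((transpose C *v v) \<bullet> euler_scheme.euler W A C (column j (matrix_sqrt X)) m k w)\<^sup>2 \<partial>M)"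
    by (intro add_mono mult_left_mono Suc.IH) simp
  finally show ?case by (simp only: E.euler_quadratic sum.distrib sum_distrib_left)
qed

text \<open>If all columns decayed, letting the level tend to infinity and then the time would force
  the positive trace of \<open>X\<close> down to 0. Which column persists is left open.\<close>

lemma (in brownian_basis) persistent_column:
  fixes X A C :: "real^'n^'n"
  assumes X: "pos_semidef X" "X \<noteq> 0" and a: "0 \<le> a" and L: "lyap A C X = a *\<^sub>R X"
  shows "\<exists>j. \<not> ((\<lambda>t. \<integral>\<^sup>+ w. ennreal ((norm (euler_scheme.sol W A C (column j (matrix_sqrt X)) t w))\<^sup>2) \<partial>M) \<longlongrightarrow> 0) at_top"
proof (rule ccontr)
  interpret E: euler_scheme M F W A C \<zeta> for \<zeta> ..
  let ?z = "\<lambda>j. column j (matrix_sqrt X)"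
  let ?S = "\<lambda>j T. \<integral>\<^sup>+ w. ennreal ((norm (E.sol (?z j) T w))\<^sup>2) \<partial>M"
  let ?D = "\<lambda>j T m. \<integral>\<^sup>+w. ennreal ((norm (E.sol (?z j) (real T) w - E.euler (?z j) m (T * 2 ^ m) w))\<^sup>2) \<partial>M"
  assume "\<not> (\<exists>j. \<not> (?S j \<longlongrightarrow> 0) at_top)"
  hence "(?S j \<longlongrightarrow> 0) at_top" for j by blast
  hence lim: "(\<lambda>T. ?S j (real T)) \<longlonglongrightarrow> 0" for j by (rule filterlim_compose) (rule filterlim_real_sequentially)
  have pos: "0 < X \<bullet> mat 1" using trace_psd_nonneg[OF X(1)] psd_trace_zero[OF X(1)] X(2) by fastforce
  have ge: "X \<bullet> mat 1 \<le> (\<Sum>j\<in>UNIV. \<integral>w. (norm (E.euler (?z j) m k w))\<^sup>2 \<partial>M)" for m k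
    unfolding inner_mat_1 E.euler_quadratic_sum by (subst sum.swap) (intro sum_mono euler_quadratic_ge[OF X(1) a L])
  have le: "ennreal (X \<bullet> mat 1) \<le> (\<Sum>j\<in>UNIV. 2 * ?S j (real T) + 2 * ?D j T m)" for T m
  proof -
    have "ennreal (X \<bullet> mat 1) \<le> ennreal (\<Sum>j\<in>UNIV. \<integral>w. (norm (E.euler (?z j) m (T * 2 ^ m) w))\<^sup>2 \<partial>M)"
      by (rule ennreal_leI[OF ge])
    also have "\<dots> = (\<Sum>j\<in>UNIV. \<integral>\<^sup>+w. ennreal ((norm (E.euler (?z j) m (T * 2 ^ m) w))\<^sup>2) \<partial>M)"
      by (simp add: nn_integral_eq_integral[OF sq_integrable_norm[OF E.euler_sq_integrable]] sum_ennreal)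
    also have "\<dots> \<le> (\<Sum>j\<in>UNIV. 2 * ?S j (real T) + 2 * ?D j T m)" by (intro sum_mono E.endpoint_moment_le)
    finally show ?thesis .
  qed
  have "ennreal (X \<bullet> mat 1) \<le> (\<Sum>j\<in>UNIV. 2 * ?S j (real T) + 2 * 0)" for T
  proof -
    have "(\<lambda>m. \<Sum>j\<in>UNIV. 2 * ?S j (real T) + 2 * ?D j T m) \<longlonglongrightarrow> (\<Sum>j\<in>UNIV. 2 * ?S j (real T) + 2 * 0)"
      by (intro tendsto_sum tendsto_add tendsto_const ennreal_tendsto_cmult E.endpoint_L2) auto
    thus ?thesis by (rule LIMSEQ_le_const) (use le in blast)
  qed
  moreover have "(\<lambda>T. \<Sum>j\<in>UNIV. 2 * ?S j (real T) + 2 * 0) \<longlonglongrightarrow> (\<Sum>j\<in>(UNIV::'n set). 2 * 0 + 2 * 0)"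
    by (intro tendsto_sum tendsto_add ennreal_tendsto_cmult lim) auto
  ultimately have "ennreal (X \<bullet> mat 1) \<le> (\<Sum>j\<in>(UNIV::'n set). 2 * 0 + 2 * 0)" by (intro LIMSEQ_le_const) auto
  thus False using pos by simp
qed

text \<open>The eigenvector \<open>X\<close> lives on the orthogonal complement of its kernel, which is an invariant
  subspace; the solutions starting there stay there, and are not seen through \<open>Q\<close>.\<close>

lemma (in brownian_basis) detectable_no_mode:
  fixes X A C Q :: "real^'n^'n"
  assumes det: "exactly_detectable M F W A C (matrix_sqrt Q)" and Q: "pos_semidef Q"
    and X: "pos_semidef X" "X \<noteq> 0" and a: "0 \<le> a" and L: "lyap A C X = a *\<^sub>R X" and QX: "Q ** X = 0"
  shows False
proof -
  have sX: "transpose X = X" using X by (auto simp: pos_semidef_def)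
  have sQ: "transpose Q = Q" using Q by (auto simp: pos_semidef_def)
  define V where "V = {x. \<forall>w'. X *v w' = 0 \<longrightarrow> w' \<bullet> x = 0}"
  have V: "subspace V" unfolding V_def subspace_def by (simp add: inner_add_right)
  \<comment> \<open>At a kernel vector the form of \<open>lyap A C X\<close> reduces to its noise
    term, while the eigenvalue equation makes it 0. With that term gone, the equation applied to the
    same vector leaves only the drift term, which gives \<open>kerA\<close>.\<close>
  have kerC: "X *v (transpose C *v w') = 0" if w': "X *v w' = 0" for w'
  proof -
    have "(transpose C *v w') \<bullet> (X *v (transpose C *v w')) = w' \<bullet> (lyap A C X *v w')"
      unfolding lyap_def using w' transpose_inner[of C "X *v (transpose C *v w')" w'] sym_inner[OF sX, of w' "transpose A *v w'"]
      by (simp add: matrix_vector_mult_add_rdistrib inner_add_right matrix_vector_mul_assoc[symmetric] inner_commute)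
    thus ?thesis using w' psd_zero_iff[OF X(1)] unfolding L by (simp add: scaleR_matrix_vector_assoc[symmetric])
  qed
  have kerA: "X *v (transpose A *v w') = 0" if w': "X *v w' = 0" for w'
  proof -
    have "X *v (transpose A *v w') = lyap A C X *v w'"
      unfolding lyap_def using w' kerC[OF w'] by (simp add: matrix_vector_mult_add_rdistrib matrix_vector_mul_assoc[symmetric])
    thus ?thesis using w' unfolding L by (simp add: scaleR_matrix_vector_assoc[symmetric])
  qed
  have inv: "B *v x \<in> V" if x: "x \<in> V" and B: "\<And>w'. X *v w' = 0 \<Longrightarrow> X *v (transpose B *v w') = 0" for B x
    unfolding V_def
  proof (intro CollectI allI impI)
    fix w' assume "X *v w' = 0"
    hence "(transpose B *v w') \<bullet> x = 0" using x B by (simp add: V_def)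
    thus "w' \<bullet> (B *v x) = 0" using transpose_inner[of B x w'] by (simp add: inner_commute)
  qed
  note VA = inv[OF _ kerA] and VC = inv[OF _ kerC]
  obtain j where j: "\<not> ((\<lambda>t. \<integral>\<^sup>+ w. ennreal ((norm (euler_scheme.sol W A C (column j (matrix_sqrt X)) t w))\<^sup>2) \<partial>M) \<longlongrightarrow> 0) at_top"
    using persistent_column[OF X a L] by blast
  define \<zeta> where "\<zeta> = column j (matrix_sqrt X)"
  have "\<zeta> \<in> V" unfolding V_def
  proof (intro CollectI allI impI)
    fix w' assume "X *v w' = 0"
    hence "(\<Sum>j\<in>UNIV. (w' \<bullet> column j (matrix_sqrt X))\<^sup>2) = 0" using sqrt_columns[OF X(1), of w'] by simp
    thus "w' \<bullet> \<zeta> = 0" by (simp add: sum_nonneg_eq_0_iff \<zeta>_def)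
  qed
  interpret E: euler_scheme M F W A C \<zeta> ..
  \<comment> \<open>Transposing \<open>Q ** X = 0\<close> gives \<open>X ** Q = 0\<close>, so
    \<open>Q *v (Q *v x)\<close> lies in the kernel of \<open>X\<close> and is orthogonal to
    \<open>x\<close>; hence \<open>|Q x|^2 = 0\<close>.\<close>
  have out: "matrix_sqrt Q *v x = 0" if "x \<in> V" for x
  proof -
    have "X *v (Q *v (Q *v x)) = transpose (Q ** X) *v (Q *v x)" by (simp add: matrix_transpose_mul sX sQ matrix_vector_mul_assoc matrix_mul_assoc)
    also have "\<dots> = 0" by (simp add: QX transpose_def zero_vec_def[symmetric] vec_eq_iff matrix_vector_mult_def)
    finally have "(Q *v (Q *v x)) \<bullet> x = 0" using that by (simp add: V_def)
    hence "(Q *v x) \<bullet> (Q *v x) = 0" using sym_inner[OF sQ, of "Q *v x" x] by simp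
    hence "x \<bullet> (Q *v x) = 0" by simp
    thus ?thesis using matrix_sqrt(4)[OF Q, of x] by simp
  qed
  have AEV: "AE w in M. \<forall>t\<ge>0. E.sol t w \<in> V" by (rule E.sol_subspace[OF V VA VC \<open>\<zeta> \<in> V\<close>])
  have "((\<lambda>t. \<integral>\<^sup>+ w. ennreal ((norm (E.sol t w))\<^sup>2) \<partial>M) \<longlongrightarrow> 0) at_top"
  proof (rule det[unfolded exactly_detectable_def, rule_format], intro conjI allI impI ballI)
    show "linear_sde_solution M F W A C E.sol" by (rule E.sol_linear_sde)
    show "AE w in M. E.sol 0 w = \<zeta>" by (simp add: E.sol_0)
    fix T t :: real assume t: "t \<in> {0..T}"
    show "AE w in M. matrix_sqrt Q *v E.sol t w = 0" using AEV by eventually_elim (use t in \<open>auto intro: out\<close>)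
  qed
  thus False using j by (simp add: \<zeta>_def)
qed

section \<open>The closed loop\<close>

lemma matrix_vector_mult_minus_left: "(- Y) *v x = - (Y *v x)" for Y :: "real^'n^'m"
  by (simp add: vec_eq_iff matrix_vector_mult_def sum_negf)

lemma matrix_vector_mult_minus_right: "Y *v (- x) = - (Y *v x)" for Y :: "real^'n^'m"
  by (simp add: vec_eq_iff matrix_vector_mult_def sum_negf)

lemma matrix_inv_right: "invertible Y \<Longrightarrow> Y ** matrix_inv Y = mat 1" for Y :: "real^'n^'n"
  unfolding invertible_def matrix_inv_def by (rule someI2_ex) auto

text \<open>Completing the square: \<open>w' = K *v v\<close> solves
  \<open>U *v w' = - (Z *v v)\<close>, and this turns the Riccati equation into a Lyapunov equation
  for the closed loop with right-hand side \<open>- (Q + K^T R K)\<close>.\<close>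

lemma feedback_lyapunov:
  fixes A C Q P :: "real^'n^'n" and B D :: "real^'r^'n" and R :: "real^'r^'r"
  assumes R: "pos_def R" and P: "pos_semidef P" and ric: "riccati_solution \<rho> A B C D Q R P"
    and K: "K = - (matrix_inv (ctrl_weight R D P) ** cross_term B C D P)"
  shows "2 * ((P *v v) \<bullet> ((A - (\<rho> / 2) *\<^sub>R mat 1 + B ** K) *v v)) + ((C + D ** K) *v v) \<bullet> (P *v ((C + D ** K) *v v))
    = - (v \<bullet> (Q *v v) + (K *v v) \<bullet> (R *v (K *v v)))"
proof -
  define U where "U = ctrl_weight R D P"
  define Z where "Z = cross_term B C D P"
  define w' where "w' = K *v v"
  have sP: "transpose P = P" and pP: "\<And>v. 0 \<le> v \<bullet> (P *v v)" using P by (auto simp: pos_semidef_def)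
  have Uq: "x \<bullet> (U *v y) = x \<bullet> (R *v y) + (D *v x) \<bullet> (P *v (D *v y))" for x y
    unfolding U_def ctrl_weight_def using transpose_inner[of D x "P *v (D *v y)"]
    by (simp add: matrix_vector_mult_add_rdistrib inner_add_right matrix_vector_mul_assoc[symmetric])
  \<comment> \<open>\<open>R\<close> is positive definite and \<open>P\<close> semidefinite, so
    \<open>U\<close> has trivial kernel and \<open>matrix_inv\<close> is a true inverse.\<close>
  have "x = 0" if "U *v x = 0" for x
    using Uq[of x x] that R pP[of "D *v x"] unfolding pos_def_def by (smt (verit) inner_zero_right)
  hence "invertible U" using matrix_left_invertible_ker[of U] invertible_left_inverse by blast
  hence "U ** matrix_inv U = mat 1" by (simp add: matrix_inv_right)
  have Uw: "U *v w' = - (Z *v v)"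
  proof -
    have "U *v w' = - ((U ** matrix_inv U) *v (Z *v v))" unfolding w'_def K
      by (simp add: U_def Z_def matrix_vector_mul_assoc matrix_mul_assoc matrix_vector_mult_minus_left matrix_vector_mult_minus_right)
    thus ?thesis using \<open>U ** matrix_inv U = mat 1\<close> by simp
  qed
  have iw: "matrix_inv U *v (Z *v v) = - w'" unfolding w'_def K by (simp add: U_def Z_def matrix_vector_mul_assoc matrix_vector_mult_minus_left)
  have Zq: "w' \<bullet> (Z *v v) = (B *v w') \<bullet> (P *v v) + (D *v w') \<bullet> (P *v (C *v v))"
    unfolding Z_def cross_term_def using transpose_inner[of B w' "P *v v"] transpose_inner[of D w' "P *v (C *v v)"]
    by (simp add: matrix_vector_mult_add_rdistrib inner_add_right matrix_vector_mul_assoc[symmetric])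
  have "v \<bullet> ((\<rho> *\<^sub>R P) *v v) = v \<bullet> ((transpose A ** P + P ** A + transpose C ** P ** C + Q - transpose Z ** matrix_inv U ** Z) *v v)"
    using ric by (simp add: riccati_solution_def U_def Z_def)
  also have "\<dots> = v \<bullet> (transpose A *v (P *v v)) + v \<bullet> (P *v (A *v v)) + v \<bullet> (transpose C *v (P *v (C *v v))) + v \<bullet> (Q *v v)
    - v \<bullet> (transpose Z *v (matrix_inv U *v (Z *v v)))"
    by (simp add: matrix_vector_mult_add_rdistrib matrix_vector_mult_diff_rdistrib inner_add_right inner_diff_right matrix_vector_mul_assoc[symmetric])
  also have "\<dots> = 2 * ((P *v v) \<bullet> (A *v v)) + (C *v v) \<bullet> (P *v (C *v v)) + v \<bullet> (Q *v v) + w' \<bullet> (Z *v v)"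
    unfolding transpose_inner[symmetric] iw using sym_inner[OF sP, of v "A *v v"] by (simp add: inner_commute)
  finally have ricq: "\<rho> * (v \<bullet> (P *v v)) = 2 * ((P *v v) \<bullet> (A *v v)) + (C *v v) \<bullet> (P *v (C *v v)) + v \<bullet> (Q *v v) + w' \<bullet> (Z *v v)"
    by (simp add: scaleR_matrix_vector_assoc[symmetric])
  have G: "(A - (\<rho> / 2) *\<^sub>R mat 1 + B ** K) *v v = A *v v - (\<rho> / 2) *\<^sub>R v + B *v w'"
    by (simp add: w'_def matrix_vector_mult_add_rdistrib matrix_vector_mult_diff_rdistrib scaleR_matrix_vector_assoc[symmetric] matrix_vector_mul_assoc[symmetric])
  have H: "(C + D ** K) *v v = C *v v + D *v w'"
    by (simp add: w'_def matrix_vector_mult_add_rdistrib matrix_vector_mul_assoc[symmetric])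
  have uw: "w' \<bullet> (R *v w') + (D *v w') \<bullet> (P *v (D *v w')) = - (w' \<bullet> (Z *v v))" using Uq[of w' w'] Uw by simp
  show ?thesis unfolding G H w'_def[symmetric]
    using ricq uw Zq sym_inner[OF sP, of "C *v v" "D *v w'"]
    by (simp add: inner_add_left inner_add_right inner_diff_right matrix_vector_right_distrib inner_commute algebra_simps)
qed

lemma mult_zero_columns:
  fixes B :: "real^'n^'m" and X :: "real^'n^'n"
  assumes X: "pos_semidef X" and "\<And>j. B *v column j (matrix_sqrt X) = 0"
  shows "B ** X = 0"
proof -
  have "B ** matrix_sqrt X = 0"
    using assms(2) by (simp add: vec_eq_iff matrix_matrix_mult_def matrix_vector_mult_def column_def)
  hence "B ** (matrix_sqrt X ** matrix_sqrt X) = 0" by (simp add: matrix_mul_assoc)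
  thus ?thesis by (simp add: matrix_sqrt(2)[OF X])
qed

text \<open>Since \<open>a\<close> and \<open>X \<bullet> P\<close> are nonnegative, so is
  \<open>a * (X \<bullet> P)\<close>; by adjointness it is also minus a sum of \<open>Q\<close>- and
  \<open>R\<close>-energies over the columns of \<open>matrix_sqrt X\<close>. All these energies
  therefore vanish.\<close>

lemma mode_unweighted:
  fixes G H P Q X :: "real^'n^'n" and K :: "real^'n^'r" and R :: "real^'r^'r"
  assumes R: "pos_def R" and Q: "pos_semidef Q" and P: "pos_semidef P"
    and L: "\<And>v. 2 * ((P *v v) \<bullet> (G *v v)) + (H *v v) \<bullet> (P *v (H *v v)) = - (v \<bullet> (Q *v v) + (K *v v) \<bullet> (R *v (K *v v)))"
    and X: "pos_semidef X" and a: "0 \<le> a" and X1: "lyap G H X = a *\<^sub>R X"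
  shows "Q ** X = 0" "K ** X = 0"
proof -
  let ?c = "\<lambda>j. column j (matrix_sqrt X)"
  let ?Y = "lyap (transpose G) (transpose H) P"
  have sP: "transpose P = P" using P by (simp add: pos_semidef_def)
  have pQ: "0 \<le> v \<bullet> (Q *v v)" for v using Q by (simp add: pos_semidef_def)
  have pR: "0 \<le> v \<bullet> (R *v v)" for v using R by (cases "v = 0") (auto simp: pos_def_def less_imp_le)
  have "0 \<le> a * (X \<bullet> P)" using X a P by (intro mult_nonneg_nonneg inner_psd_nonneg) (auto simp: pos_semidef_def)
  also have "a * (X \<bullet> P) = ?Y \<bullet> X" using lyap_adjoint[of G H X P] by (simp add: X1 inner_commute)
  also have "\<dots> = ?Y \<bullet> (matrix_sqrt X ** matrix_sqrt X)" by (simp add: matrix_sqrt(2)[OF X])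
  also have "\<dots> = (\<Sum>j\<in>UNIV. - (?c j \<bullet> (Q *v ?c j) + (K *v ?c j) \<bullet> (R *v (K *v ?c j))))"
    unfolding inner_square[OF matrix_sqrt(3)[OF X]] lyap_quadratic[OF sP] L ..
  finally have "(\<Sum>j\<in>UNIV. ?c j \<bullet> (Q *v ?c j) + (K *v ?c j) \<bullet> (R *v (K *v ?c j))) = 0"
    using pQ pR by (intro antisym sum_nonneg add_nonneg_nonneg) (simp_all only: sum_negf neg_0_le_iff_le)
  hence z: "?c j \<bullet> (Q *v ?c j) + (K *v ?c j) \<bullet> (R *v (K *v ?c j)) = 0" for j
    using pQ pR by (subst (asm) sum_nonneg_eq_0_iff) auto
  have "?c j \<bullet> (Q *v ?c j) = 0" "(K *v ?c j) \<bullet> (R *v (K *v ?c j)) = 0" for j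
    using z[of j] pQ[of "?c j"] pR[of "K *v ?c j"] by linarith+
  hence "Q *v ?c j = 0" "K *v ?c j = 0" for j
    using psd_zero_iff[OF Q] R unfolding pos_def_def by (blast, metis less_irrefl)
  thus "Q ** X = 0" "K ** X = 0" using mult_zero_columns[OF X] by blast+
qed

text \<open>By symmetry \<open>K ** X = 0\<close> also gives \<open>X ** transpose K = 0\<close>,
  and every term containing the feedback has one of these as a factor. The mode is thus inherited by
  the uncontrolled pair.\<close>

lemma lyap_feedback:
  fixes A C X :: "real^'n^'n" and B D :: "real^'r^'n"
  assumes sX: "transpose X = X" and KX: "K ** X = 0"
  shows "lyap (A + B ** K) (C + D ** K) X = lyap A C X"
proof -
  have z: "(Y ** K) ** X = 0" for Y :: "real^'r^'n" using KX by (simp add: matrix_mul_assoc[symmetric])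
  have "X ** transpose (Y ** K) = transpose ((Y ** K) ** X)" for Y :: "real^'r^'n" by (simp add: matrix_transpose_mul sX)
  hence zt: "X ** transpose (Y ** K) = 0" for Y :: "real^'r^'n" unfolding z by (simp add: transpose_def vec_eq_iff)
  have "C ** X ** transpose (D ** K) = 0" using zt[of D] by (simp add: matrix_mul_assoc[symmetric])
  moreover have "transpose (Y + Z) = transpose Y + transpose Z" for Y Z :: "real^'n^'n" by (simp add: transpose_def vec_eq_iff)
  ultimately show ?thesis by (simp add: lyap_def matrix_matrix_mult_add_left matrix_add_ldistrib z zt)
qed

lemma weighted_integral_finite:
  assumes s: "s \<in> C_half_rho \<rho>" and c: "0 \<le> c" and le: "\<And>t. 0 \<le> t \<Longrightarrow> \<psi> t \<le> c * (norm (s t))\<^sup>2"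
  shows "(\<integral>\<^sup>+ t\<in>{0..}. ennreal (exp (- \<rho> * t) * \<psi> t) \<partial>lborel) < \<infinity>"
proof -
  let ?g = "\<lambda>t. exp (- \<rho> * t) * (norm (s t))\<^sup>2"
  have "continuous_on {0..} ?g" using s by (auto simp: C_half_rho_def intro!: continuous_intros)
  hence "(\<lambda>t. indicat_real {0..} t *\<^sub>R ?g t) \<in> borel_measurable borel" by (intro borel_measurable_continuous_on_indicator) auto
  hence m: "(\<lambda>t. ennreal (indicat_real {0..} t * ?g t)) \<in> borel_measurable lborel" by simp
  have eq: "ennreal (?g t) * indicator {0..} t = ennreal (indicat_real {0..} t * ?g t)" for t by (simp add: indicator_def)
  have "(\<integral>\<^sup>+ t\<in>{0..}. ennreal (exp (- \<rho> * t) * \<psi> t) \<partial>lborel) \<le> (\<integral>\<^sup>+ t. ennreal c * ennreal (indicat_real {0..} t * ?g t) \<partial>lborel)"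
  proof (intro nn_integral_mono)
    fix t :: real
    show "ennreal (exp (- \<rho> * t) * \<psi> t) * indicator {0..} t \<le> ennreal c * ennreal (indicat_real {0..} t * ?g t)"
    proof (cases "0 \<le> t")
      case True
      have "exp (- \<rho> * t) * \<psi> t \<le> c * ?g t" using mult_left_mono[OF le[OF True], of "exp (- \<rho> * t)"] by (simp add: mult_ac)
      thus ?thesis using True c by (simp add: ennreal_mult[symmetric] ennreal_leI)
    qed simp
  qed
  also have "\<dots> = ennreal c * (\<integral>\<^sup>+ t\<in>{0..}. ennreal (?g t) \<partial>lborel)" unfolding eq by (rule nn_integral_cmult[OF m])
  also have "\<dots> < \<infinity>" using s by (simp add: C_half_rho_def ennreal_mult_less_top)
  finally show ?thesis .
qed

lemma (in brownian_basis) closed_loop_cost_finite: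
  fixes A C Q P :: "real^'n^'n" and B D :: "real^'r^'n" and R :: "real^'r^'r"
    and X :: "real \<Rightarrow> 'a \<Rightarrow> real^'n" and u :: "real \<Rightarrow> 'a \<Rightarrow> real^'r"
  assumes \<rho>: "0 \<le> \<rho>" and R: "pos_def R" and Q: "pos_semidef Q" and P: "pos_semidef P"
    and ric: "riccati_solution \<rho> A B C D Q R P"
    and det: "exactly_detectable M F W (A - (\<rho> / 2) *\<^sub>R mat 1) C (matrix_sqrt Q)"
    and s: "s \<in> C_half_rho \<rho>"
    and u: "\<And>t w. 0 \<le> t \<Longrightarrow> u t w = - (matrix_inv (ctrl_weight R D P) *v (cross_term B C D P *v X t w + transpose B *v s t))"
    and sde: "controlled_sde_solution M F W A B C D X u"
    and X0: "(\<integral>\<^sup>+ w. ennreal ((norm (X 0 w))\<^sup>2) \<partial>M) < \<infinity>"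
  shows "discounted_cost M \<rho> (\<lambda>t w. (norm (X t w))\<^sup>2 + (norm (u t w))\<^sup>2) < \<infinity>"
proof -
  define K where "K = - (matrix_inv (ctrl_weight R D P) ** cross_term B C D P)"
  define J where "J = - (matrix_inv (ctrl_weight R D P) ** transpose B)"
  define G where "G = A - (\<rho> / 2) *\<^sub>R mat 1 + B ** K"
  define H where "H = C + D ** K"
  have u': "u t w = K *v X t w + J *v s t" if "0 \<le> t" for t w
    unfolding u[OF that] K_def J_def
    by (simp add: matrix_vector_mult_minus_left matrix_vector_right_distrib matrix_vector_mul_assoc)
  note L = feedback_lyapunov[OF R P ric K_def, folded G_def H_def]
  have "\<not> (\<exists>Y a. pos_semidef Y \<and> Y \<noteq> 0 \<and> a \<ge> 0 \<and> lyap G H Y = a *\<^sub>R Y)"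
  proof clarify
    fix Y a assume Y: "pos_semidef Y" "Y \<noteq> 0" "0 \<le> a" "lyap G H Y = a *\<^sub>R Y"
    note z = mode_unweighted[OF R Q P L Y(1,3,4)]
    have "lyap (A - (\<rho> / 2) *\<^sub>R mat 1) C Y = a *\<^sub>R Y"
      using lyap_feedback[OF _ z(2), of "A - (\<rho> / 2) *\<^sub>R mat 1" B C D] Y(1,4) by (simp add: pos_semidef_def G_def H_def)
    thus False by (rule detectable_no_mode[OF det Q Y(1-3) _ z(1)])
  qed
  then obtain S where S: "pos_semidef S" "\<And>v. 2 * ((S *v v) \<bullet> (G *v v)) + (H *v v) \<bullet> (S *v (H *v v)) \<le> - (norm v)\<^sup>2"
    using lyapunov_alternative[of G H] by blast
  have cs: "continuous_on {0..} s" using s by (simp add: C_half_rho_def)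
  have cv: "continuous_on {0..} (\<lambda>t. Y *v f t)" if "continuous_on {0..} f" for Y :: "real^'k^'l" and f :: "real \<Rightarrow> real^'k"
    by (rule bounded_linear.continuous_on[OF matrix_vector_mul_bounded_linear that])
  have bnd: "\<exists>c\<ge>0. \<forall>x. (norm (Y *v x))\<^sup>2 \<le> c * (norm x)\<^sup>2" for Y :: "real^'k^'l"
  proof -
    obtain c where "c > 0" "\<And>x. norm (Y *v x) \<le> c * norm x"
      using linear_bounded_pos[OF matrix_vector_mul_linear[of Y]] by metis
    hence "(norm (Y *v x))\<^sup>2 \<le> c\<^sup>2 * (norm x)\<^sup>2" for x
      using power_mono[of "norm (Y *v x)" "c * norm x" 2] by (simp add: power_mult_distrib)
    thus ?thesis by (intro exI[of _ "c\<^sup>2"]) auto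
  qed
  obtain b1 where b1: "b1 \<ge> 0" "\<And>x. (norm ((B ** J) *v x))\<^sup>2 \<le> b1 * (norm x)\<^sup>2" using bnd by blast
  obtain b2 where b2: "b2 \<ge> 0" "\<And>x. (norm ((D ** J) *v x))\<^sup>2 \<le> b2 * (norm x)\<^sup>2" using bnd by blast
  obtain k where k: "k \<ge> 0" "\<And>x. (norm (K *v x))\<^sup>2 \<le> k * (norm x)\<^sup>2" using bnd by blast
  obtain l where l: "l \<ge> 0" "\<And>x. (norm (J *v x))\<^sup>2 \<le> l * (norm x)\<^sup>2" using bnd by blast
  have fin: "discounted_cost M \<rho> (\<lambda>t w. (norm (X t w))\<^sup>2) < \<infinity>"
  proof (rule discounted_stability[OF sde[unfolded controlled_sde_solution_def] \<rho> _ _ X0 _ _ _ S])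
    \<comment> \<open>\<open>G\<close> carries the shift by \<open>- \<rho> / 2\<close> and is
      unshifted here; the part of the control driven by \<open>s\<close> becomes the deterministic
      offset.\<close>
    show "A *v X t w + B *v u t w = (G + (\<rho> / 2) *\<^sub>R mat 1) *v X t w + (B ** J) *v s t" if "0 \<le> t" for t w
      by (simp add: u'[OF that] G_def matrix_vector_mult_add_rdistrib matrix_vector_right_distrib matrix_vector_mul_assoc)
    show "C *v X t w + D *v u t w = H *v X t w + (D ** J) *v s t" if "0 \<le> t" for t w
      by (simp add: u'[OF that] H_def matrix_vector_mult_add_rdistrib matrix_vector_right_distrib matrix_vector_mul_assoc)
    show "(\<integral>\<^sup>+ t\<in>{0..}. ennreal (exp (- \<rho> * t) * ((norm ((B ** J) *v s t))\<^sup>2 + (norm ((D ** J) *v s t))\<^sup>2)) \<partial>lborel) < \<infinity>"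
      by (rule weighted_integral_finite[OF s, of "b1 + b2"]) (use b1 b2 in \<open>auto simp: distrib_right intro: add_mono\<close>)
  qed (intro cv cs)+
  have prog: "progressive F X" using sde by (simp add: controlled_sde_solution_def has_ito_differential_def)
  show ?thesis
  proof (rule discounted_cost_affine[OF prog fin, of "\<lambda>t. (norm (s t))\<^sup>2" "1 + 2 * k + 2 * l"])
    show "continuous_on {0..} (\<lambda>t. (norm (s t))\<^sup>2)" by (intro continuous_intros cs)
    show "(\<integral>\<^sup>+ t\<in>{0..}. ennreal (exp (- \<rho> * t) * (norm (s t))\<^sup>2) \<partial>lborel) < \<infinity>" using s by (simp add: C_half_rho_def)
    fix t w assume t: "0 \<le> (t::real)"
    have "(norm (u t w))\<^sup>2 \<le> 2 * (k * (norm (X t w))\<^sup>2) + 2 * (l * (norm (s t))\<^sup>2)"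
      unfolding u'[OF t] using norm_add_sq_le[of "K *v X t w" "J *v s t"] k(2)[of "X t w"] l(2)[of "s t"] by linarith
    moreover have "0 \<le> k * (norm (s t))\<^sup>2" "0 \<le> l * (norm (X t w))\<^sup>2" using k l by auto
    moreover have "(1 + 2 * k + 2 * l) * ((norm (X t w))\<^sup>2 + (norm (s t))\<^sup>2) = (norm (X t w))\<^sup>2 + (norm (s t))\<^sup>2
      + 2 * (k * (norm (X t w))\<^sup>2) + 2 * (k * (norm (s t))\<^sup>2) + 2 * (l * (norm (X t w))\<^sup>2) + 2 * (l * (norm (s t))\<^sup>2)"
      by (simp add: algebra_simps)
    ultimately show "(norm (X t w))\<^sup>2 + (norm (u t w))\<^sup>2 \<le> (1 + 2 * k + 2 * l) * ((norm (X t w))\<^sup>2 + (norm (s t))\<^sup>2)"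
      using zero_le_power2[of "norm (s t)"] by linarith
  qed (use k l in auto)
qed

theorem theorem3p4:
  fixes M :: "'a measure" and \<F> :: "real \<Rightarrow> 'a measure"
    and W :: "nat \<Rightarrow> real \<Rightarrow> 'a \<Rightarrow> real"
    and x0 :: "nat \<Rightarrow> 'a \<Rightarrow> real^'n"
    and \<Theta> :: "(real^'d) set" and \<theta> :: "nat \<Rightarrow> real^'d" and F :: "real^'d \<Rightarrow> real"
    and A :: "real^'d \<Rightarrow> real^'n^'n" and B D :: "real^'r^'n" and C Q :: "real^'n^'n"
    and R :: "real^'r^'r" and \<rho> :: real
    and P :: "real^'d \<Rightarrow> real^'n^'n"
    and xbar0 :: "real^'n" and xbar :: "real \<Rightarrow> real^'n"
    and x\<theta> s :: "real^'d \<Rightarrow> real \<Rightarrow> real^'n"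
    and xhat :: "nat \<Rightarrow> real \<Rightarrow> 'a \<Rightarrow> real^'n" and uhat :: "nat \<Rightarrow> real \<Rightarrow> 'a \<Rightarrow> real^'r"
    and N :: nat
  assumes basis: "stoch_basis M \<F>"
    and brownian: "\<And>i. i \<ge> 1 \<Longrightarrow> brownian_motion M \<F> (W i)"
    and brownian_indep: "prob_space.indep_vars M (\<lambda>_. Pi\<^sub>M {0..} (\<lambda>_. borel))
          (\<lambda>i \<omega>. \<lambda>t\<in>{0..}. W i t \<omega>) {1..}"
    and discount: "\<rho> \<ge> 0"
    and weights: "transpose Q = Q" "transpose R = R"
    and parameters: "\<And>i. i \<ge> 1 \<Longrightarrow> \<theta> i \<in> \<Theta>"
    and A1_indep: "prob_space.indep_vars M (\<lambda>_. borel) x0 {1..}"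
    and A1_mean: "\<And>i. i \<ge> 1 \<Longrightarrow> integrable M (x0 i) \<and> integral\<^sup>L M (x0 i) = xbar0"
    and A1_moment: "\<exists>c\<^sub>0. \<forall>N'\<ge>1.
          Max ((\<lambda>i. \<integral>\<^sup>+ \<omega>. ennreal ((norm (x0 i \<omega>))\<^sup>2) \<partial>M) ` {1..N'}) < ennreal c\<^sub>0"
    and A1_noise: "prob_space.indep_set M
          (sets (vimage_algebra (space M) (\<lambda>\<omega>. \<lambda>i\<in>{1..}. x0 i \<omega>) (Pi\<^sub>M {1..} (\<lambda>_. borel))))
          (sets (vimage_algebra (space M) (\<lambda>\<omega>. \<lambda>i\<in>{1..}. \<lambda>t\<in>{0..}. W i t \<omega>)
             (Pi\<^sub>M {1..} (\<lambda>_. Pi\<^sub>M {0..} (\<lambda>_. borel)))))"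
    and A2_compact: "compact \<Theta>"
    and A2_continuous: "continuous_on \<Theta> A"
    and A2_df: "distribution_function F"
    and A2_weak: "\<And>\<psi> :: real^'d \<Rightarrow> real. continuous_on \<Theta> \<psi> \<Longrightarrow> bounded (\<psi> ` \<Theta>) \<Longrightarrow>
          (\<lambda>N'. LINT y:\<Theta>|df_measure (empirical_df \<theta> N'). \<psi> y)
            \<longlonglongrightarrow> (LINT y:\<Theta>|df_measure F. \<psi> y)"
    and A3: "\<And>i. i \<ge> 1 \<Longrightarrow> rho_stabilizable M \<F> (W i) \<rho> (A (\<theta> i)) B C D"
    and A4_weights: "pos_def R" "pos_semidef Q"
    and A4_detectable: "\<And>i. i \<ge> 1 \<Longrightarrow>
          exactly_detectable M \<F> (W i) (A (\<theta> i) - (\<rho> / 2) *\<^sub>R mat 1) C (matrix_sqrt Q)"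
    and riccati: "\<And>\<theta>. \<theta> \<in> \<Theta> \<Longrightarrow> pos_semidef (P \<theta>) \<and> riccati_solution \<rho> (A \<theta>) B C D Q R (P \<theta>)"
    and A5: "consistency_solution \<Theta> F \<rho> A B C D Q R P xbar0 xbar x\<theta> s"
    and N: "N \<ge> 1"
    and control: "\<And>i t \<omega>. i \<in> {1..N} \<Longrightarrow> t \<ge> 0 \<Longrightarrow> uhat i t \<omega> =
          - (matrix_inv (ctrl_weight R D (P (\<theta> i))) *v
              (cross_term B C D (P (\<theta> i)) *v xhat i t \<omega> + transpose B *v s (\<theta> i) t))"
    and closed_loop: "\<And>i. i \<in> {1..N} \<Longrightarrow>
          controlled_sde_solution M \<F> (W i) (A (\<theta> i)) B C D (xhat i) (uhat i)"
    and initial: "\<And>i. i \<in> {1..N} \<Longrightarrow> AE \<omega> in M. xhat i 0 \<omega> = x0 i \<omega>"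
  shows "Max ((\<lambda>i. discounted_cost M \<rho>
            (\<lambda>t \<omega>. (norm (xhat i t \<omega>))\<^sup>2 + (norm (uhat i t \<omega>))\<^sup>2)) ` {1..N}) < \<infinity>"
proof -
  \<comment> \<open>Each agent's equation involves only its own Brownian motion, adapted to the
    common filtration, so the estimate for one agent applies with \<open>W i\<close>. The maximum is
    over a finite nonempty set.\<close>
  have cost: "discounted_cost M \<rho> (\<lambda>t \<omega>. (norm (xhat i t \<omega>))\<^sup>2 + (norm (uhat i t \<omega>))\<^sup>2) < \<infinity>" if i: "i \<in> {1..N}" for i
  proof -
    have i1: "1 \<le> i" using i by simp
    interpret prob_space M using basis by (simp add: stoch_basis_def)
    interpret brownian_basis M \<F> "W i" by unfold_locales (use basis brownian[OF i1] in auto)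
    obtain c\<^sub>0 where "Max ((\<lambda>i. \<integral>\<^sup>+ \<omega>. ennreal ((norm (x0 i \<omega>))\<^sup>2) \<partial>M) ` {1..N}) < ennreal c\<^sub>0"
      using A1_moment N by blast
    hence "(\<integral>\<^sup>+ \<omega>. ennreal ((norm (x0 i \<omega>))\<^sup>2) \<partial>M) < ennreal c\<^sub>0" using i by (subst (asm) Max_less_iff) auto
    moreover have "(\<integral>\<^sup>+ \<omega>. ennreal ((norm (xhat i 0 \<omega>))\<^sup>2) \<partial>M) = (\<integral>\<^sup>+ \<omega>. ennreal ((norm (x0 i \<omega>))\<^sup>2) \<partial>M)"
      by (rule nn_integral_cong_AE) (use initial[OF i] in \<open>eventually_elim, simp\<close>)
    ultimately have X0: "(\<integral>\<^sup>+ \<omega>. ennreal ((norm (xhat i 0 \<omega>))\<^sup>2) \<partial>M) < \<infinity>" by (simp add: less_trans[OF _ ennreal_less_top])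
    have s: "s (\<theta> i) \<in> C_half_rho \<rho>" using A5 parameters[OF i1] by (simp add: consistency_solution_def)
    note r = riccati[OF parameters[OF i1]]
    show ?thesis
      by (rule closed_loop_cost_finite[OF discount A4_weights conjunct1[OF r] conjunct2[OF r] A4_detectable[OF i1] s
            control[OF i] closed_loop[OF i] X0])
  qed
  have "finite {1..N}" "{1..N} \<noteq> {}" using N by auto
  thus ?thesis using cost by (subst Max_less_iff) auto
qed

end
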